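(* Let $\Omega \subset \mathbb{R}^n$ be open and bounded with smooth boundary, let $\nu$ be its outward unit normal, and let $\Gamma_+ := \{ x \in \partial \Omega : x\cdot \nu >0 \}$. Let $\mathfrak{U} := \mathbb{R}^m \times \Omega$, and fix $R>0$ such that $\Omega \subseteq \{ r<R \}$. Let $\varepsilon, a, b >0$ be constants such that \[ a \geqslant (m+n)^2, \qquad a \gg R, \qquad \varepsilon \ll_{m,n} b \ll R^{-1}. \] Fix $\sigma >0$ and define $\omega := \mathcal{O}_\sigma (\Gamma_+) \cap \Omega$, where $\mathcal{O}_\sigma(\Gamma_+) := \{ y \in \mathbb{R}^n : |y-x|< \sigma \text{ for some } x \in \Gamma_+ \}$. Then there exists $C>0$ such that for any $z \in C^2(\mathfrak{U})\cap C^1(\bar{\mathfrak{U}})$ satisfying $z|_{\partial\mathfrak{U} \cap \mathfrak{D}} = 0$, we have \begin{align*} C\varepsilon \int_{\mathfrak{U} \cap \mathfrak{D}} \zeta_{a,b;\varepsilon}\, r^{-1}\big(|u\partial_u z |^2 + |v\partial_v z |^2 + f g^{ab}\nabla^{\omega_x}_a z\, \nabla^{\omega_x}_b z - f g^{CD} \nabla^{\omega_t}_C z\, \nabla^{\omega_t}_D z \big) + Cba^2\int_{\mathfrak{U} \cap \mathfrak{D}}\zeta_{a,b;\varepsilon} f^{-\frac{1}{2}} z^2 \\ \leqslant \frac{1}{a} \int_{\mathfrak{U}\cap \mathfrak{D}} \zeta_{a,b;\varepsilon} f |\square z|^2 + a^2 R^3 \int_{( \mathbb{R}^m \times \omega )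 \cap \mathfrak{D}} \zeta_{a,b;\varepsilon} f^{-2} |\nabla_t z|^2 + a^4 R^4 \int_{( \mathbb{R}^m \times \omega ) \cap \mathfrak{D}} \zeta_{a,b;\varepsilon} f^{-3} z^2, \end{align*} where \[ \zeta_{ a, b; \varepsilon } := \left\{ \frac{ f }{ ( 1 + \varepsilon u ) ( 1 - \varepsilon v ) } \cdot \exp \left[ \frac{ 2 b f^\frac{1}{2} }{ ( 1 - \varepsilon u )^\frac{1}{2} ( 1 + \varepsilon v )^\frac{1}{2} } \right] \right\}^{2a}. \]
   Context: Fix $m,n\in\mathbb{N}$. On $\mathbb{R}^{m+n}$ with Cartesian coordinates $t=(t_1,\dots,t_m)$, $x=(x_1,\dots,x_n)$, let $g=-dt_1^2-\dots-dt_m^2+dx_1^2+\dots+dx_n^2$, $\nabla$ its Levi-Civita connection and $\square=g^{\alpha\beta}\nabla_{\alpha\beta}$. Let $r=|x|$, $\tau=|t|$, $u=\frac12(\tau-r)$, $v=\frac12(\tau+r)$, $f=-uv=\frac14(|x|^2-|t|^2)$, and $\mathfrak{D}=\{f>0\}$ (exterior of the null cone centred at the origin). In polar coordinates $(u,v,\omega_x,\omega_t)$, $\omega_x\in\mathbb{S}^{n-1}$, $\omega_t\in\mathbb{S}^{m-1}$, $g=-4\,du\,dv+r^2\mathring\gamma_{\mathbb{S}^{n-1}}-\tau^2\mathring\gamma_{\mathbb{S}^{m-1}}$. Indices $a,b$ denote spatial angular components and $C,D$ temporal angular components; $\nabla^{\omega_x}_a$ denotes derivatives (w.r.t. $g$)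 in the spatial angular directions and $\nabla^{\omega_t}_C$ in the temporal angular directions; $\nabla_t z=(\partial_{t_1}z,\dots,\partial_{t_m}z)$. *)

theory Defs
  imports "HOL-Analysis.Analysis"
begin

definition dder :: "('a::real_normed_vector \<Rightarrow> real) \<Rightarrow> 'a \<Rightarrow> 'a \<Rightarrow> real" where
  "dder f h p = frechet_derivative f (at p) h"

fun Ck :: "nat \<Rightarrow> 'a::real_normed_vector set \<Rightarrow> ('a \<Rightarrow> real) \<Rightarrow> bool" where
  "Ck 0 S f = continuous_on S f"
| "Ck (Suc k) S f = ((\<forall>x\<in>S. f differentiable (at x)) \<and> (\<forall>h. Ck k S (dder f h)))"

definition smooth_on :: "'a::real_normed_vector set \<Rightarrow> ('a \<Rightarrow> real) \<Rightarrow> bool" where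
  "smooth_on S f = (\<forall>k. Ck k S f)"

definition C1_closure :: "'a::real_normed_vector set \<Rightarrow> ('a \<Rightarrow> real) \<Rightarrow> bool" where
  "C1_closure S f = (continuous_on (closure S) f \<and>
     (\<forall>h. \<exists>g. continuous_on (closure S) g \<and> (\<forall>p\<in>S. g p = dder f h p)))"

definition grad :: "(real^'n \<Rightarrow> real) \<Rightarrow> real^'n \<Rightarrow> real^'n" where
  "grad \<phi> y = (\<chi> j. dder \<phi> (axis j 1) y)"

definition local_defining :: "(real^'n) set \<Rightarrow> real^'n \<Rightarrow> (real^'n) set \<Rightarrow> (real^'n \<Rightarrow> real) \<Rightarrow> bool" where
  "local_defining \<Omega> x U \<phi> = (open U \<and> x \<in> U \<and> smooth_on U \<phi> \<and>
      (\<forall>y\<in>U. grad \<phi> y \<noteq> 0) \<and> \<Omega> \<inter> U = {y\<in>U. \<phi> y < 0})"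

definition smooth_boundary :: "(real^'n) set \<Rightarrow> bool" where
  "smooth_boundary \<Omega> = (\<forall>x\<in>frontier \<Omega>. \<exists>U \<phi>. local_defining \<Omega> x U \<phi>)"

text \<open>Outward unit normal (independent of the choice of defining function).\<close>
definition outward_normal :: "(real^'n) set \<Rightarrow> real^'n \<Rightarrow> real^'n" where
  "outward_normal \<Omega> x = (SOME \<nu>. \<exists>U \<phi>. local_defining \<Omega> x U \<phi> \<and> \<nu> = sgn (grad \<phi> x))"

definition Gamma_plus :: "(real^'n) set \<Rightarrow> (real^'n) set" where
  "Gamma_plus \<Omega> = {x \<in> frontier \<Omega>. x \<bullet> outward_normal \<Omega> x > 0}"

definition nbhd :: "real \<Rightarrow> (real^'n) set \<Rightarrow> (real^'n) set" where
  "nbhd \<sigma> A = {y. \<exists>x\<in>A. dist y x < \<sigma>}"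

definition rr :: "(real^'m) \<times> (real^'n) \<Rightarrow> real" where "rr p = norm (snd p)"
definition tau :: "(real^'m) \<times> (real^'n) \<Rightarrow> real" where "tau p = norm (fst p)"
definition uu :: "(real^'m) \<times> (real^'n) \<Rightarrow> real" where "uu p = (tau p - rr p) / 2"
definition vv :: "(real^'m) \<times> (real^'n) \<Rightarrow> real" where "vv p = (tau p + rr p) / 2"
definition ff :: "(real^'m) \<times> (real^'n) \<Rightarrow> real" where "ff p = - uu p * vv p"

definition DD :: "((real^'m) \<times> (real^'n)) set" where "DD = {p. ff p > 0}"

definition zeta :: "real \<Rightarrow> real \<Rightarrow> real \<Rightarrow> (real^'m) \<times> (real^'n) \<Rightarrow> real" where
  "zeta a b \<epsilon> p = (ff p / ((1 + \<epsilon> * uu p) * (1 - \<epsilon> * vv p))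
      * exp (2 * b * sqrt (ff p) / (sqrt (1 - \<epsilon> * uu p) * sqrt (1 + \<epsilon> * vv p)))) powr (2 * a)"

definition dt :: "((real^'m) \<times> (real^'n) \<Rightarrow> real) \<Rightarrow> 'm \<Rightarrow> (real^'m) \<times> (real^'n) \<Rightarrow> real" where
  "dt z i p = dder z (axis i 1, 0) p"
definition dx :: "((real^'m) \<times> (real^'n) \<Rightarrow> real) \<Rightarrow> 'n \<Rightarrow> (real^'m) \<times> (real^'n) \<Rightarrow> real" where
  "dx z j p = dder z (0, axis j 1) p"

definition gradt_sq :: "((real^'m) \<times> (real^'n) \<Rightarrow> real) \<Rightarrow> (real^'m) \<times> (real^'n) \<Rightarrow> real" where
  "gradt_sq z p = (\<Sum>i\<in>UNIV. (dt z i p)\<^sup>2)"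
definition gradx_sq :: "((real^'m) \<times> (real^'n) \<Rightarrow> real) \<Rightarrow> (real^'m) \<times> (real^'n) \<Rightarrow> real" where
  "gradx_sq z p = (\<Sum>j\<in>UNIV. (dx z j p)\<^sup>2)"

definition dtau :: "((real^'m) \<times> (real^'n) \<Rightarrow> real) \<Rightarrow> (real^'m) \<times> (real^'n) \<Rightarrow> real" where
  "dtau z p = dder z (sgn (fst p), 0) p"
definition dr :: "((real^'m) \<times> (real^'n) \<Rightarrow> real) \<Rightarrow> (real^'m) \<times> (real^'n) \<Rightarrow> real" where
  "dr z p = dder z (0, sgn (snd p)) p"

text \<open>Since tau = u + v and r = v - u: partial_u = partial_tau - partial_r, partial_v = partial_tau + partial_r.\<close>
definition du :: "((real^'m) \<times> (real^'n) \<Rightarrow> real) \<Rightarrow> (real^'m) \<times> (real^'n) \<Rightarrow> real" where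
  "du z p = dtau z p - dr z p"
definition dv :: "((real^'m) \<times> (real^'n) \<Rightarrow> real) \<Rightarrow> (real^'m) \<times> (real^'n) \<Rightarrow> real" where
  "dv z p = dtau z p + dr z p"

text \<open>g^{ab} nabla_a z nabla_b z (spatial angular part) = |nabla_x z|^2 - (partial_r z)^2.\<close>
definition ang_x :: "((real^'m) \<times> (real^'n) \<Rightarrow> real) \<Rightarrow> (real^'m) \<times> (real^'n) \<Rightarrow> real" where
  "ang_x z p = gradx_sq z p - (dr z p)\<^sup>2"

text \<open>g^{CD} nabla_C z nabla_D z (temporal angular part) = -(|nabla_t z|^2 - (partial_tau z)^2),
  as g restricted to the temporal spheres is -tau^2 times the round metric.\<close>
definition ang_t :: "((real^'m) \<times> (real^'n) \<Rightarrow> real) \<Rightarrow> (real^'m) \<times> (real^'n) \<Rightarrow> real" where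
  "ang_t z p = - (gradt_sq z p - (dtau z p)\<^sup>2)"

definition box :: "((real^'m) \<times> (real^'n) \<Rightarrow> real) \<Rightarrow> (real^'m) \<times> (real^'n) \<Rightarrow> real" where
  "box z p = - (\<Sum>i\<in>UNIV. dder (dt z i) (axis i 1, 0) p) + (\<Sum>j\<in>UNIV. dder (dx z j) (0, axis j 1) p)"

end

theory Submission
  imports Defs
begin

text \<open>
  The constant \<open>C\<close> may depend on everything except \<open>z\<close>, so the weight may be replaced by any weight
  comparable to \<open>f powr (2 * a)\<close>. We use \<open>(f / k) powr (2 * a)\<close> with \<open>k = 1 - e * r\<close> and \<open>e\<close> small: the
  gradient of \<open>f / k\<close> is proportional to \<open>Y = k \<nabla>f - f \<nabla>k\<close>, and the symmetrised covariant derivative of \<open>Y\<close> is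
  exactly \<open>k / 2\<close> times the metric plus \<open>e f / r\<close> times the metric of the spatial spheres. The multiplier method for
  \<open>\<psi> = (f / k) powr a * z\<close> with multiplier \<open>Y \<psi> + q \<psi>\<close>, together with a Hardy inequality along \<open>Y\<close>, therefore
  gives a pointwise inequality whose only boundary term is \<open>(x \<bullet> \<nu>) |\<partial>\<^sub>\<nu> \<psi>|\<^sup>2\<close> up to a positive factor. A spatial cutoff
  vanishing on \<open>\<Gamma>\<^sub>+\<close> removes the part of the boundary where this term has the wrong sign; the error it produces is
  supported in \<open>\<omega>\<close> and is controlled by a Caccioppoli inequality, in which the equation trades spatial for time derivatives.
  Boundary contributions are read off as limits of interior cutoffs, so that only integration by parts
  for compactly supported fields is needed.
\<close>

section \<open>Continuously differentiable maps and integration by parts\<close>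

text \<open>For e = 0 the field \<open>YY e\<close> is half the position field; its symmetrised
  derivative is a pure multiple of the metric, and once the coefficient q compensates it no control
  of the gradient survives. For e > 0 there remains e f / r times the spatial angular square minus
  half the Lorentzian square of the gradient. This form is positive except in the direction of
  \<open>YY e\<close>, and there conjugation with the weight supplies a square with coefficient 2 a
  / (k f). The price is error terms with a factor e and sizes up to a^2, so e is small in terms of a
  and R. The second obstacle is regularity: z is C2 only inside the cylinder, and the currents J are
  merely continuous up to its boundary, so div J need not be integrable there. Integrals are
  therefore taken in [0, \<infinity>], a nonnegative F is added that makes F + div J nonnegative,
  and Fatou's lemma removes the cutoffs. On the null cone no boundary condition is available; there
  the currents are O(f^2), which is enough to kill the flux through f = 0.\<close>

definition C1_deriv :: "'a::real_normed_vector set \<Rightarrow> ('a \<Rightarrow> 'b::real_normed_vector) \<Rightarrow> ('a \<Rightarrow> 'a \<Rightarrow> 'b) \<Rightarrow> bool" where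
  "C1_deriv S F F' \<longleftrightarrow> (\<forall>p\<in>S. (F has_derivative F' p) (at p)) \<and> (\<forall>v. continuous_on S (\<lambda>p. F' p v))"

lemma C1_derivI:
  "\<lbrakk>\<And>p. p \<in> S \<Longrightarrow> (F has_derivative F' p) (at p); \<And>v. continuous_on S (\<lambda>p. F' p v)\<rbrakk> \<Longrightarrow> C1_deriv S F F'"
  by (simp add: C1_deriv_def)

lemma C1_deriv_has_derivative: "C1_deriv S F F' \<Longrightarrow> p \<in> S \<Longrightarrow> (F has_derivative F' p) (at p)"
  by (simp add: C1_deriv_def)

lemma C1_deriv_linear: "C1_deriv S F F' \<Longrightarrow> p \<in> S \<Longrightarrow> linear (F' p)"
  using C1_deriv_has_derivative has_derivative_linear by blast

lemma C1_deriv_continuous_deriv: "C1_deriv S F F' \<Longrightarrow> continuous_on S (\<lambda>p. F' p v)"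
  by (simp add: C1_deriv_def)

lemma C1_deriv_continuous_on: "C1_deriv S F F' \<Longrightarrow> continuous_on S F"
  unfolding C1_deriv_def
  by (meson continuous_at_imp_continuous_on has_derivative_continuous)

lemma C1_deriv_subset: "C1_deriv S F F' \<Longrightarrow> T \<subseteq> S \<Longrightarrow> C1_deriv T F F'"
  unfolding C1_deriv_def by (meson continuous_on_subset subset_iff)

lemma C1_deriv_eq:
  "C1_deriv S F F' \<Longrightarrow> (\<And>p v. p \<in> S \<Longrightarrow> F' p v = G' p v) \<Longrightarrow> C1_deriv S F G'"
proof -
  assume 1: "C1_deriv S F F'" and 2: "\<And>p v. p \<in> S \<Longrightarrow> F' p v = G' p v"
  have "F' p = G' p" if "p \<in> S" for p using 2 that by blast
  moreover have "continuous_on S (\<lambda>p. G' p v)" for v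
    by (rule continuous_on_eq[OF C1_deriv_continuous_deriv[OF 1]]) (use 2 in auto)
  ultimately show "C1_deriv S F G'" using 1 by (auto simp: C1_deriv_def)
qed

lemma C1_deriv_cong:
  assumes "C1_deriv S F F'" "open S" "\<And>p. p \<in> S \<Longrightarrow> F p = G p" "\<And>p v. p \<in> S \<Longrightarrow> F' p v = G' p v"
  shows "C1_deriv S G G'"
proof -
  have "C1_deriv S F G'" using C1_deriv_eq assms(1,4) by blast
  then show ?thesis
    unfolding C1_deriv_def using has_derivative_transform_within_open[OF _ assms(2)] assms(3) by blast
qed

lemma C1_deriv_const: "C1_deriv S (\<lambda>p. c) (\<lambda>p v. 0)"
  by (auto intro!: C1_derivI)

lemma C1_deriv_bounded_linear: "bounded_linear L \<Longrightarrow> C1_deriv S L (\<lambda>p. L)"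
  by (auto intro!: C1_derivI bounded_linear_imp_has_derivative)

lemma C1_deriv_linear_compose:
  assumes "bounded_linear L" "C1_deriv S F F'"
  shows "C1_deriv S (\<lambda>p. L (F p)) (\<lambda>p v. L (F' p v))"
  using assms unfolding C1_deriv_def
  by (auto intro: bounded_linear.has_derivative bounded_linear.continuous_on)

lemma C1_deriv_add:
  "C1_deriv S F F' \<Longrightarrow> C1_deriv S G G' \<Longrightarrow> C1_deriv S (\<lambda>p. F p + G p) (\<lambda>p v. F' p v + G' p v)"
  unfolding C1_deriv_def by (auto intro!: has_derivative_add continuous_on_add)

lemma C1_deriv_diff:
  "C1_deriv S F F' \<Longrightarrow> C1_deriv S G G' \<Longrightarrow> C1_deriv S (\<lambda>p. F p - G p) (\<lambda>p v. F' p v - G' p v)"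
  unfolding C1_deriv_def by (auto intro!: has_derivative_diff continuous_on_diff)

lemma C1_deriv_scaleR:
  assumes "C1_deriv S s s'" "C1_deriv S F F'"
  shows "C1_deriv S (\<lambda>p. s p *\<^sub>R F p) (\<lambda>p v. s p *\<^sub>R F' p v + s' p v *\<^sub>R F p)"
  using assms C1_deriv_continuous_on[OF assms(1)] C1_deriv_continuous_on[OF assms(2)]
  unfolding C1_deriv_def by (auto intro!: has_derivative_scaleR continuous_intros)

lemma C1_deriv_mult:
  fixes s u :: "'a::real_normed_vector \<Rightarrow> real"
  shows "C1_deriv S s s' \<Longrightarrow> C1_deriv S u u' \<Longrightarrow> C1_deriv S (\<lambda>p. s p * u p) (\<lambda>p v. s p * u' p v + s' p v * u p)"
  using C1_deriv_scaleR[of S s s' u u'] by simp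

lemma C1_deriv_inner:
  assumes "C1_deriv S F F'" "C1_deriv S G G'"
  shows "C1_deriv S (\<lambda>p. F p \<bullet> G p) (\<lambda>p v. F p \<bullet> G' p v + F' p v \<bullet> G p)"
  using assms C1_deriv_continuous_on[OF assms(1)] C1_deriv_continuous_on[OF assms(2)]
  unfolding C1_deriv_def by (auto intro!: has_derivative_inner continuous_intros)

lemma C1_deriv_compose_real:
  fixes s :: "'a::real_normed_vector \<Rightarrow> real" and h :: "real \<Rightarrow> real"
  assumes "C1_deriv S s s'" "\<And>p. p \<in> S \<Longrightarrow> (h has_real_derivative h' (s p)) (at (s p))"
    and "continuous_on (s ` S) h'"
  shows "C1_deriv S (\<lambda>p. h (s p)) (\<lambda>p v. h' (s p) * s' p v)"
proof (rule C1_derivI)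
  fix p assume "p \<in> S"
  then show "((\<lambda>p. h (s p)) has_derivative (\<lambda>v. h' (s p) * s' p v)) (at p)"
    using has_derivative_compose[OF C1_deriv_has_derivative[OF assms(1)], of p h "\<lambda>t. h' (s p) * t"] assms(2)
    by (simp add: has_field_derivative_def)
next
  fix v
  have "continuous_on S (\<lambda>p. h' (s p))"
    using continuous_on_compose[OF C1_deriv_continuous_on[OF assms(1)] assms(3)] by (simp add: o_def)
  then show "continuous_on S (\<lambda>p. h' (s p) * s' p v)"
    using assms(1) by (auto simp: C1_deriv_def intro!: continuous_intros)
qed

lemma C1_deriv_inverse:
  fixes s :: "'a::real_normed_vector \<Rightarrow> real"
  assumes "C1_deriv S s s'" "\<And>p. p \<in> S \<Longrightarrow> s p \<noteq> 0"
  shows "C1_deriv S (\<lambda>p. 1 / s p) (\<lambda>p v. - s' p v / (s p)\<^sup>2)"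
proof -
  have "C1_deriv S (\<lambda>p. (\<lambda>x. 1 / x) (s p)) (\<lambda>p v. (\<lambda>x. - 1 / x\<^sup>2) (s p) * s' p v)"
    using assms by (intro C1_deriv_compose_real)
      (auto intro!: continuous_intros derivative_eq_intros simp: power2_eq_square)
  then show ?thesis by (rule C1_deriv_eq) simp
qed

lemma C1_deriv_prod:
  fixes h :: "'i \<Rightarrow> 'a::real_normed_vector \<Rightarrow> real"
  assumes "\<And>i. i \<in> A \<Longrightarrow> C1_deriv S (h i) (h' i)"
  shows "C1_deriv S (\<lambda>p. \<Prod>i\<in>A. h i p) (\<lambda>p v. \<Sum>i\<in>A. h' i p v * (\<Prod>j\<in>A - {i}. h j p))"
  using assms C1_deriv_continuous_on[OF assms]
  unfolding C1_deriv_def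
  by (auto intro!: has_derivative_prod continuous_on_sum continuous_on_mult continuous_on_prod)

lemma C1_deriv_line:
  assumes C1: "C1_deriv S F F'" and S: "c + s *\<^sub>R b \<in> S"
  shows "((\<lambda>s. F (c + s *\<^sub>R b)) has_derivative (\<lambda>h. h *\<^sub>R F' (c + s *\<^sub>R b) b)) (at s)"
proof -
  have "((\<lambda>s. c + s *\<^sub>R b) has_derivative (\<lambda>h. h *\<^sub>R b)) (at s)"
    by (auto intro!: derivative_eq_intros)
  from has_derivative_compose[OF this C1_deriv_has_derivative[OF C1 S]]
  have "((\<lambda>s. F (c + s *\<^sub>R b)) has_derivative (\<lambda>h. F' (c + s *\<^sub>R b) (h *\<^sub>R b))) (at s)" .
  moreover have "F' (c + s *\<^sub>R b) (h *\<^sub>R b) = h *\<^sub>R F' (c + s *\<^sub>R b) b" for h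
    using C1_deriv_linear[OF C1 S] by (simp add: linear_cmul)
  ultimately show ?thesis by simp
qed

lemma C1_deriv_line_real:
  fixes F :: "'a::real_normed_vector \<Rightarrow> real"
  assumes "C1_deriv S F F'" and "c + s *\<^sub>R b \<in> S"
  shows "((\<lambda>s. F (c + s *\<^sub>R b)) has_real_derivative F' (c + s *\<^sub>R b) b) (at s)"
  by (rule has_derivative_imp_has_field_derivative[OF C1_deriv_line[OF assms]]) simp

lemma C1_deriv_local_zero:
  assumes "C1_deriv S F F'" "open T" "p \<in> T" "p \<in> S" "\<And>q. q \<in> T \<Longrightarrow> F q = 0"
  shows "F' p v = 0"
proof -
  have "(F has_derivative (\<lambda>v. 0)) (at p)"
    by (rule has_derivative_transform_within_open[OF _ assms(2,3), of "\<lambda>_. 0"]) (use assms in auto)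
  then show ?thesis
    using C1_deriv_has_derivative[OF assms(1,4)] has_derivative_unique by metis
qed

lemma C1_deriv_Un:
  assumes "C1_deriv S F F'" "C1_deriv T F F'" "open S" "open T"
  shows "C1_deriv (S \<union> T) F F'"
  using assms unfolding C1_deriv_def by (auto intro: continuous_on_open_Un)

text \<open>The open sets S and the complement of K cover the space, and on their overlap both F and
  its derivative vanish, so the two local descriptions fit together. Fields supported in a compact
  part of S thereby become fields on the whole space.\<close>

lemma C1_deriv_extend:
  assumes "C1_deriv S F F'" "open S" "closed K" "K \<subseteq> S" "\<And>p. p \<in> S - K \<Longrightarrow> F p = 0"
  shows "C1_deriv UNIV (\<lambda>p. if p \<in> S then F p else 0) (\<lambda>p v. if p \<in> S then F' p v else 0)"
    (is "C1_deriv _ ?F ?F'")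
proof -
  have zero: "F' p v = 0" if "p \<in> S - K" for p v
    using C1_deriv_local_zero[OF assms(1), of "S - K" p v] assms that by auto
  have 1: "C1_deriv S ?F ?F'" by (rule C1_deriv_cong[OF assms(1,2)]) auto
  have 2: "C1_deriv (-K) ?F ?F'"
    by (rule C1_deriv_cong[OF C1_deriv_const[of "-K" 0]]) (use assms(3,5) zero in auto)
  have U: "S \<union> (-K) = UNIV" using assms(4) by auto
  show ?thesis using C1_deriv_Un[OF 1 2] assms(2,3) by (simp add: U open_Compl)
qed

section \<open>Divergence as a trace, and its vanishing integral for compactly supported
  fields\<close>

definition trace_of :: "('a::euclidean_space \<Rightarrow> 'a) \<Rightarrow> real" where
  "trace_of L = (\<Sum>b\<in>Basis. L b \<bullet> b)"

lemma trace_of_add: "trace_of (\<lambda>v. A v + B v) = trace_of A + trace_of B"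
  by (simp add: trace_of_def inner_add_left sum.distrib)

lemma trace_of_diff: "trace_of (\<lambda>v. A v - B v) = trace_of A - trace_of B"
  by (simp add: trace_of_def inner_diff_left sum_subtractf)

lemma trace_of_scaleR: "trace_of (\<lambda>v. c *\<^sub>R A v) = c * trace_of A"
  by (simp add: trace_of_def sum_distrib_left)

text \<open>The derivative of a product s J contains the rank-one map v \<mapsto> s'(v) J. Its trace
  s'(J) is the second term of the product rule for the divergence.\<close>

lemma trace_of_rank_one:
  fixes l :: "'a::euclidean_space \<Rightarrow> real"
  assumes "linear l"
  shows "trace_of (\<lambda>v. l v *\<^sub>R c) = l c"
proof -
  have "l c = l (\<Sum>b\<in>Basis. (c \<bullet> b) *\<^sub>R b)" by (simp add: euclidean_representation)
  also have "\<dots> = (\<Sum>b\<in>Basis. (c \<bullet> b) * l b)"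
    using assms by (simp add: linear_sum linear_cmul)
  finally show ?thesis by (simp add: trace_of_def mult.commute)
qed

lemma trace_of_inner: "trace_of (\<lambda>v. (a \<bullet> v) *\<^sub>R c) = a \<bullet> c"
  by (rule trace_of_rank_one) (simp add: linear_iff inner_add_right)

lemma trace_of_id: "trace_of (\<lambda>v::'a::euclidean_space. v) = DIM('a)"
  by (simp add: trace_of_def inner_Basis)

text \<open>The difference quotients of g along b have integral zero by translation invariance of
  Lebesgue measure. They converge pointwise to the derivative under a bounded majorant of bounded
  support, so dominated convergence applies. This is the only source of integration by parts in the
  development.\<close>

lemma integral_directional_derivative_zero:
  fixes g :: "'a::euclidean_space \<Rightarrow> real"
  assumes C1: "C1_deriv UNIV g g'" and K: "compact K" and z: "\<And>p. p \<notin> K \<Longrightarrow> g p = 0"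
  shows "integrable lborel (\<lambda>p. g' p b)" "(\<integral>p. g' p b \<partial>lborel) = 0"
proof -
  have gc: "continuous_on UNIV g" and g'c: "continuous_on UNIV (\<lambda>p. g' p b)"
    using C1 C1_deriv_continuous_on C1_deriv_continuous_deriv by auto
  have z': "g' p b = 0" if "p \<notin> K" for p
    using C1_deriv_local_zero[OF C1, of "-K" p b] z that compact_imp_closed[OF K] by (auto simp: open_Compl)
  obtain M where M: "\<And>p. p \<in> K \<Longrightarrow> \<bar>g' p b\<bar> \<le> M"
    using compact_imp_bounded[OF compact_continuous_image[OF continuous_on_subset[OF g'c] K]]
    by (auto simp: bounded_iff)
  define M' where "M' = max M 0"
  have M': "\<bar>g' p b\<bar> \<le> M'" for p
    using M z' by (cases "p \<in> K") (auto simp: M'_def le_max_iff_disj)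
  obtain B where B: "\<And>p. p \<in> K \<Longrightarrow> norm p \<le> B"
    using compact_imp_bounded[OF K] by (auto simp: bounded_iff)
  have line: "((\<lambda>s. g (p + s *\<^sub>R b)) has_real_derivative g' (p + s *\<^sub>R b) b) (at s)" for p s
    by (rule C1_deriv_line_real[OF C1]) simp
  define s where "s n p = (g (p + (1 / real (Suc n)) *\<^sub>R b) - g p) * real (Suc n)" for n p
  \<comment> \<open>On the ball the mean value theorem bounds the quotient by the supremum of the
    derivative. Outside it both p and the shifted point miss K, because the shift has length at most
    \<open>norm b\<close>.\<close>
  have s_bound: "norm (s n p) \<le> M' * indicator (cball 0 (B + norm b)) p" for n p
  proof (cases "p \<in> cball 0 (B + norm b)")
    case True
    obtain \<xi> where "g (p + (1 / real (Suc n)) *\<^sub>R b) - g (p + 0 *\<^sub>R b)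
        = (1 / real (Suc n) - 0) * g' (p + \<xi> *\<^sub>R b) b"
      using MVT2[of 0 "1 / real (Suc n)", OF _ line[of p]] by auto
    then have "s n p = g' (p + \<xi> *\<^sub>R b) b" by (simp add: s_def)
    then show ?thesis using True M' by simp
  next
    case False
    have "norm p - norm b \<le> norm (p + (1 / real (Suc n)) *\<^sub>R b)"
    proof -
      have "norm ((1 / real (Suc n)) *\<^sub>R b) \<le> norm b"
        by (simp add: mult_left_le_one_le divide_le_eq mult_le_cancel_left1)
      then show ?thesis using norm_diff_ineq[of p "(1 / real (Suc n)) *\<^sub>R b"] by linarith
    qed
    then have "p \<notin> K" "p + (1 / real (Suc n)) *\<^sub>R b \<notin> K"
      using False B[of p] B[of "p + (1 / real (Suc n)) *\<^sub>R b"] norm_ge_zero[of b]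
      by (auto simp: not_le simp del: norm_ge_zero)
    then show ?thesis using z by (simp add: s_def M'_def)
  qed
  have s_meas: "s n \<in> borel_measurable lborel" for n
    unfolding s_def
    by (simp, intro borel_measurable_continuous_onI continuous_intros continuous_on_compose2[OF gc]) auto
  have s_lim: "(\<lambda>n. s n p) \<longlonglongrightarrow> g' p b" for p
  proof -
    have "((\<lambda>h. (g (p + h *\<^sub>R b) - g p) / h) \<longlongrightarrow> g' p b) (at 0)"
      using line[of p 0] by (simp add: DERIV_def)
    moreover have "filterlim (\<lambda>n. 1 / real (Suc n)) (at 0) sequentially"
      unfolding filterlim_at using LIMSEQ_inverse_real_of_nat by (simp add: inverse_eq_divide)
    ultimately have "((\<lambda>n. (g (p + (1 / real (Suc n)) *\<^sub>R b) - g p) / (1 / real (Suc n))) \<longlongrightarrow> g' p b) sequentially"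
      by (rule filterlim_compose)
    then show ?thesis by (simp add: s_def)
  qed
  have meas: "(\<lambda>p. g' p b) \<in> borel_measurable lborel"
    using g'c by (simp add: borel_measurable_continuous_onI)
  have dom: "integrable lborel (\<lambda>p. M' * indicator (cball 0 (B + norm b)) (p::'a))"
    using emeasure_bounded_finite[of "cball (0::'a) (B + norm b)"] by simp
  have int: "integrable lborel (\<lambda>p. g' p b)"
    by (rule integrable_dominated_convergence[where s=s, OF meas s_meas dom])
      (use s_lim s_bound in auto)
  have lim: "(\<lambda>n. \<integral>p. s n p \<partial>lborel) \<longlonglongrightarrow> (\<integral>p. g' p b \<partial>lborel)"
    by (rule integral_dominated_convergence[where s=s, OF meas s_meas dom])
      (use s_lim s_bound in auto)
  obtain Mg where Mg: "\<And>p. p \<in> K \<Longrightarrow> \<bar>g p\<bar> \<le> Mg"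
    using compact_imp_bounded[OF compact_continuous_image[OF continuous_on_subset[OF gc] K]]
    by (auto simp: bounded_iff)
  have gint: "integrable lborel g"
  proof (rule Bochner_Integration.integrable_bound[where f="\<lambda>p. Mg * indicator K p"])
    show "integrable lborel (\<lambda>p. Mg * indicator K p)"
      using emeasure_bounded_finite[OF compact_imp_bounded[OF K]] borel_compact[OF K] by simp
    show "AE p in lborel. norm (g p) \<le> norm (Mg * indicator K p)"
    proof (rule AE_I2)
      fix p show "norm (g p) \<le> norm (Mg * indicator K p)"
        using Mg[of p] z[of p] by (cases "p \<in> K") auto
    qed
  qed (use gc in \<open>simp add: borel_measurable_continuous_onI\<close>)
  have shift: "integrable lborel (\<lambda>p. g (c + p)) \<and> (\<integral>p. g (c + p) \<partial>lborel) = (\<integral>p. g p \<partial>lborel)" for c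
  proof -
    have d: "distr lborel borel ((+) c) = lborel" by (rule lborel_distr_plus)
    have "g \<in> borel_measurable borel" using gc by (simp add: borel_measurable_continuous_onI)
    then show ?thesis
      using integral_distr[of "(+) c" lborel borel g] integrable_distr_eq[of "(+) c" lborel borel g] gint
      by (simp add: d)
  qed
  have "(\<integral>p. s n p \<partial>lborel) = 0" for n
  proof -
    have "(\<integral>p. g (p + (1 / real (Suc n)) *\<^sub>R b) - g p \<partial>lborel) = 0"
      using shift[of "(1 / real (Suc n)) *\<^sub>R b"] gint by (simp add: add.commute)
    then show ?thesis by (simp add: s_def)
  qed
  with lim have "(\<integral>p. g' p b \<partial>lborel) = 0"
    by (simp add: LIMSEQ_const_iff)
  with int show "integrable lborel (\<lambda>p. g' p b)" "(\<integral>p. g' p b \<partial>lborel) = 0" by auto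
qed

text \<open>The component of F along each basis vector b, extended by zero, is differentiated in the
  direction b; the trace is the sum of these derivatives.\<close>

lemma integral_divergence_zero:
  fixes F :: "'a::euclidean_space \<Rightarrow> 'a"
  assumes "C1_deriv S F F'" "open S" "compact K" "K \<subseteq> S" "\<And>p. p \<in> S - K \<Longrightarrow> F p = 0"
  shows "integrable lborel (\<lambda>p. if p \<in> S then trace_of (F' p) else 0)"
    "(\<integral>p. (if p \<in> S then trace_of (F' p) else 0) \<partial>lborel) = 0"
proof -
  have C1: "C1_deriv UNIV (\<lambda>p. (if p \<in> S then F p else 0) \<bullet> b) (\<lambda>p v. (if p \<in> S then F' p v else 0) \<bullet> b)" for b
    by (rule C1_deriv_linear_compose[OF bounded_linear_inner_left
        C1_deriv_extend[OF assms(1,2) compact_imp_closed[OF assms(3)] assms(4,5)]])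
  have eq: "(if p \<in> S then trace_of (F' p) else 0) = (\<Sum>b\<in>Basis. (if p \<in> S then F' p b else 0) \<bullet> b)" for p
    by (simp add: trace_of_def)
  have *: "integrable lborel (\<lambda>p. (if p \<in> S then F' p b else 0) \<bullet> b)"
       "(\<integral>p. (if p \<in> S then F' p b else 0) \<bullet> b \<partial>lborel) = 0" for b
    using integral_directional_derivative_zero[OF C1[of b] assms(3), of b] assms(5) by fastforce+
  show "integrable lborel (\<lambda>p. if p \<in> S then trace_of (F' p) else 0)"
    "(\<integral>p. (if p \<in> S then trace_of (F' p) else 0) \<partial>lborel) = 0"
    unfolding eq using * by (auto simp: Bochner_Integration.integral_sum)
qed

lemma integral_gradient_zero:
  fixes s :: "'a::euclidean_space \<Rightarrow> real"
  assumes "C1_deriv S s s'" "open S" "compact K" "K \<subseteq> S" "\<And>p. p \<in> S - K \<Longrightarrow> s p = 0"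
  shows "integrable lborel (\<lambda>p. if p \<in> S then s' p h else 0)"
    "(\<integral>p. (if p \<in> S then s' p h else 0) \<partial>lborel) = 0"
  using integral_directional_derivative_zero[OF C1_deriv_extend[OF assms(1,2) compact_imp_closed[OF assms(3)] assms(4,5)] assms(3), of h]
    assms(5) by fastforce+

text \<open>The second difference of z over the parallelogram spanned by s u and s v is symmetric in
  u and v. Two mean value theorems, taken in either order, express it as s^2 times a second
  derivative at a nearby point, and continuity of H at p excludes different values there.\<close>

lemma second_derivative_symmetric:
  fixes z :: "'a::euclidean_space \<Rightarrow> real"
  assumes S: "open S" "p \<in> S"
    and z: "C1_deriv S z (\<lambda>p v. G p \<bullet> v)" and G: "C1_deriv S G H"
  shows "H p u \<bullet> v = H p v \<bullet> u"
proof -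
  obtain e where e: "e > 0" "ball p e \<subseteq> S" using S openE by blast
  define d where "d = e / (norm u + norm v + 1)"
  have d: "d > 0" using e by (simp add: d_def add_nonneg_pos)
  have dn: "d * (norm u + norm v) < e"
  proof -
    have "d * (norm u + norm v) < d * (norm u + norm v + 1)" using d by simp
    also have "\<dots> = e"
    proof -
      have "norm u + norm v + 1 \<noteq> 0" using norm_ge_zero[of u] norm_ge_zero[of v] by linarith
      then show ?thesis unfolding d_def by simp
    qed
    finally show ?thesis .
  qed
  have in_S: "p + \<sigma> *\<^sub>R u + \<rho> *\<^sub>R v \<in> S" if "0 \<le> \<sigma>" "\<sigma> < d" "0 \<le> \<rho>" "\<rho> < d" for \<sigma> \<rho> u' v'
  proof -
    have "norm (\<sigma> *\<^sub>R u + \<rho> *\<^sub>R v) \<le> \<sigma> * norm u + \<rho> * norm v"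
      using norm_triangle_ineq[of "\<sigma> *\<^sub>R u" "\<rho> *\<^sub>R v"] that by simp
    also have "\<dots> \<le> d * norm u + d * norm v" using that by (intro add_mono mult_right_mono) auto
    also have "\<dots> < e" using dn by (simp add: algebra_simps)
    finally have "dist (p + (\<sigma> *\<^sub>R u + \<rho> *\<^sub>R v)) p < e" by (simp add: dist_norm)
    then have "p + (\<sigma> *\<^sub>R u + \<rho> *\<^sub>R v) \<in> ball p e" by (simp add: dist_commute)
    then show ?thesis using e(2) by (auto simp: add.assoc)
  qed
  \<comment> \<open>The vectors are quantified afresh, so that the fact serves for (u, v) and, with
    the roles exchanged, for (v, u).\<close>
  have key: "\<exists>\<theta> \<theta>'. 0 < \<theta> \<and> \<theta> < s \<and> 0 < \<theta>' \<and> \<theta>' < s \<and>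
     z (p + s *\<^sub>R u + s *\<^sub>R v) - z (p + s *\<^sub>R u) - (z (p + s *\<^sub>R v) - z p)
       = s * s * (H (p + \<theta> *\<^sub>R u + \<theta>' *\<^sub>R v) v \<bullet> u)"
    if s: "0 < s" "s < d"
      and in_S: "\<And>\<sigma> \<rho>. \<lbrakk>0 \<le> \<sigma>; \<sigma> < d; 0 \<le> \<rho>; \<rho> < d\<rbrakk> \<Longrightarrow> p + \<sigma> *\<^sub>R u + \<rho> *\<^sub>R v \<in> S" for s u v
  proof -
    have "((\<lambda>\<sigma>. z (p + \<sigma> *\<^sub>R u + s *\<^sub>R v) - z (p + \<sigma> *\<^sub>R u)) has_real_derivative
        (G (p + \<sigma> *\<^sub>R u + s *\<^sub>R v) \<bullet> u - G (p + \<sigma> *\<^sub>R u) \<bullet> u)) (at \<sigma>)"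
      if "0 \<le> \<sigma>" "\<sigma> \<le> s" for \<sigma>
    proof -
      have "p + \<sigma> *\<^sub>R u \<in> S" "p + \<sigma> *\<^sub>R u + s *\<^sub>R v \<in> S"
        using in_S[of \<sigma> s] in_S[of \<sigma> 0] that s by auto
      then show ?thesis
        using DERIV_diff[OF C1_deriv_line_real[OF z, of "p + s *\<^sub>R v" \<sigma> u] C1_deriv_line_real[OF z, of p \<sigma> u]]
        by (simp add: add.commute add.left_commute)
    qed
    from MVT2[OF s(1) this] obtain \<theta> where \<theta>: "0 < \<theta>" "\<theta> < s"
      "z (p + s *\<^sub>R u + s *\<^sub>R v) - z (p + s *\<^sub>R u) - (z (p + s *\<^sub>R v) - z p)
        = s * (G (p + \<theta> *\<^sub>R u + s *\<^sub>R v) \<bullet> u - G (p + \<theta> *\<^sub>R u) \<bullet> u)" by auto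
    have "((\<lambda>\<rho>. G (p + \<theta> *\<^sub>R u + \<rho> *\<^sub>R v) \<bullet> u) has_real_derivative H (p + \<theta> *\<^sub>R u + \<rho> *\<^sub>R v) v \<bullet> u) (at \<rho>)"
      if "0 \<le> \<rho>" "\<rho> \<le> s" for \<rho>
    proof -
      have i: "p + \<theta> *\<^sub>R u + \<rho> *\<^sub>R v \<in> S" using in_S[of \<theta> \<rho>] that \<theta> s by auto
      show ?thesis
        by (rule has_derivative_imp_has_field_derivative[OF has_derivative_inner_left[OF C1_deriv_line[OF G i]]]) simp
    qed
    from MVT2[OF s(1) this] obtain \<theta>' where "0 < \<theta>'" "\<theta>' < s"
      "G (p + \<theta> *\<^sub>R u + s *\<^sub>R v) \<bullet> u - G (p + \<theta> *\<^sub>R u) \<bullet> u = s * (H (p + \<theta> *\<^sub>R u + \<theta>' *\<^sub>R v) v \<bullet> u)" by auto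
    with \<theta> show ?thesis by (metis mult.assoc)
  qed
  show ?thesis
  proof (rule ccontr)
    assume ne: "H p u \<bullet> v \<noteq> H p v \<bullet> u"
    define \<kappa> where "\<kappa> = \<bar>H p u \<bullet> v - H p v \<bullet> u\<bar> / 2"
    have \<kappa>: "\<kappa> > 0" using ne by (simp add: \<kappa>_def)
    have c: "continuous (at p) (\<lambda>p. H p x \<bullet> y)" for x y
      using C1_deriv_continuous_deriv[OF G, of x] S
      by (auto simp: continuous_on_eq_continuous_at intro!: continuous_intros)
    obtain d1 where d1: "d1 > 0" "\<And>q. dist q p < d1 \<Longrightarrow> \<bar>H q u \<bullet> v - H p u \<bullet> v\<bar> < \<kappa>"
      using c[of u v] \<kappa> unfolding continuous_at_eps_delta dist_real_def by blast
    obtain d2 where d2: "d2 > 0" "\<And>q. dist q p < d2 \<Longrightarrow> \<bar>H q v \<bullet> u - H p v \<bullet> u\<bar> < \<kappa>"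
      using c[of v u] \<kappa> unfolding continuous_at_eps_delta dist_real_def by blast
    define n where "n = norm u + norm v + 1"
    have n: "n > 0" unfolding n_def using norm_ge_zero[of u] norm_ge_zero[of v] by linarith
    \<comment> \<open>The intermediate points produced by \<open>key\<close> lie within s * n of p,
      hence inside both continuity neighbourhoods.\<close>
    define s where "s = min (d / 2) (min (d1 / n) (d2 / n))"
    have s: "0 < s" "s < d" "s * n \<le> d1" "s * n \<le> d2"
      using d d1 d2 n by (auto simp: s_def min_def field_simps)
    obtain \<theta> \<theta>' where 1: "0 < \<theta>" "\<theta> < s" "0 < \<theta>'" "\<theta>' < s"
     "z (p + s *\<^sub>R u + s *\<^sub>R v) - z (p + s *\<^sub>R u) - (z (p + s *\<^sub>R v) - z p)
       = s * s * (H (p + \<theta> *\<^sub>R u + \<theta>' *\<^sub>R v) v \<bullet> u)"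
      using key[OF s(1,2) in_S] by blast
    have "p + \<sigma> *\<^sub>R v + \<rho> *\<^sub>R u \<in> S" if "0 \<le> \<sigma>" "\<sigma> < d" "0 \<le> \<rho>" "\<rho> < d" for \<sigma> \<rho>
      using in_S[of \<rho> \<sigma>] that by (simp add: add.assoc add.commute[of "\<rho> *\<^sub>R u"])
    from key[OF s(1,2) this] obtain \<eta> \<eta>' where 2: "0 < \<eta>" "\<eta> < s" "0 < \<eta>'" "\<eta>' < s"
     "z (p + s *\<^sub>R v + s *\<^sub>R u) - z (p + s *\<^sub>R v) - (z (p + s *\<^sub>R u) - z p)
       = s * s * (H (p + \<eta> *\<^sub>R v + \<eta>' *\<^sub>R u) u \<bullet> v)" by blast
    have eq: "H (p + \<theta> *\<^sub>R u + \<theta>' *\<^sub>R v) v \<bullet> u = H (p + \<eta> *\<^sub>R v + \<eta>' *\<^sub>R u) u \<bullet> v"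
    proof -
      have "s * s * (H (p + \<theta> *\<^sub>R u + \<theta>' *\<^sub>R v) v \<bullet> u) = s * s * (H (p + \<eta> *\<^sub>R v + \<eta>' *\<^sub>R u) u \<bullet> v)"
        using 1(5) 2(5) by (simp add: algebra_simps)
      then show ?thesis using s(1) by simp
    qed
    have small: "norm (\<sigma> *\<^sub>R u + \<rho> *\<^sub>R v) < s * n" if "0 < \<sigma>" "\<sigma> < s" "0 < \<rho>" "\<rho> < s" for \<sigma> \<rho>
    proof -
      have "norm (\<sigma> *\<^sub>R u + \<rho> *\<^sub>R v) \<le> \<sigma> * norm u + \<rho> * norm v"
        using norm_triangle_ineq[of "\<sigma> *\<^sub>R u" "\<rho> *\<^sub>R v"] that by simp
      also have "\<dots> \<le> s * norm u + s * norm v" using that by (intro add_mono mult_right_mono) auto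
      also have "\<dots> < s * n" using s(1) by (simp add: n_def algebra_simps)
      finally show ?thesis .
    qed
    have "dist (p + \<theta> *\<^sub>R u + \<theta>' *\<^sub>R v) p < d2"
      using small[of \<theta> \<theta>'] 1 s(4) by (simp add: dist_norm add.assoc)
    moreover have "dist (p + \<eta> *\<^sub>R v + \<eta>' *\<^sub>R u) p < d1"
      using small[of \<eta>' \<eta>] 2 s(3) by (simp add: dist_norm add.assoc add.commute[of "\<eta> *\<^sub>R v"])
    ultimately have "\<bar>H (p + \<theta> *\<^sub>R u + \<theta>' *\<^sub>R v) v \<bullet> u - H p v \<bullet> u\<bar> < \<kappa>"
      "\<bar>H (p + \<eta> *\<^sub>R v + \<eta>' *\<^sub>R u) u \<bullet> v - H p u \<bullet> v\<bar> < \<kappa>"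
      using d1 d2 by auto
    moreover have "\<bar>H p u \<bullet> v - H p v \<bullet> u\<bar>
        \<le> \<bar>H (p + \<theta> *\<^sub>R u + \<theta>' *\<^sub>R v) v \<bullet> u - H p v \<bullet> u\<bar>
          + \<bar>H (p + \<eta> *\<^sub>R v + \<eta>' *\<^sub>R u) u \<bullet> v - H p u \<bullet> v\<bar>"
      unfolding eq by linarith
    ultimately show False unfolding \<kappa>_def by (simp add: field_simps)
  qed
qed

section \<open>Cutoff functions on the line\<close>

definition pos_sq :: "real \<Rightarrow> real" where "pos_sq s = (max 0 s)\<^sup>2"

lemma pos_sq_has_derivative: "(pos_sq has_real_derivative 2 * max 0 s) (at s)"
proof -
  consider "s < 0" | "s > 0" | "s = 0" by linarith
  then show ?thesis
  proof cases
    case 1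
    have "((\<lambda>_. 0) has_real_derivative 2 * max 0 s) (at s)" using 1 by simp
    then show ?thesis
      by (rule has_field_derivative_transform_within_open[where S="{..<0}"]) (use 1 in \<open>auto simp: pos_sq_def\<close>)
  next
    case 2
    have "((\<lambda>s. s\<^sup>2) has_real_derivative 2 * max 0 s) (at s)" using 2 by (auto intro!: derivative_eq_intros)
    then show ?thesis
      by (rule has_field_derivative_transform_within_open[where S="{0<..}"]) (use 2 in \<open>auto simp: pos_sq_def\<close>)
  next
    case 3
    have "((\<lambda>h. pos_sq h / h) \<longlongrightarrow> 0) (at 0)"
    proof (rule Lim_null_comparison)
      show "\<forall>\<^sub>F h in at 0. norm (pos_sq h / h) \<le> \<bar>h\<bar>"
        by (auto simp: pos_sq_def eventually_at_filter max_def power2_eq_square)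
      show "((\<lambda>h::real. \<bar>h\<bar>) \<longlongrightarrow> 0) (at 0)" by (intro tendsto_rabs_zero tendsto_ident_at)
    qed
    then show ?thesis using 3 by (simp add: DERIV_def pos_sq_def)
  qed
qed

text \<open>A step of class C1 between 0 for arguments up to 1 and 1 for arguments from 2 on. The
  integrations by parts differentiate cutoffs once, so a quotient of squared positive parts takes
  the place of a smooth step.\<close>

definition cutoff :: "real \<Rightarrow> real" where
  "cutoff s = pos_sq (s - 1) / (pos_sq (s - 1) + pos_sq (2 - s))"

definition cutoff' :: "real \<Rightarrow> real" where
  "cutoff' s = (2 * max 0 (s - 1) * pos_sq (2 - s) + pos_sq (s - 1) * (2 * max 0 (2 - s)))
     / (pos_sq (s - 1) + pos_sq (2 - s))\<^sup>2"

lemma cutoff_denominator_pos: "pos_sq (s - 1) + pos_sq (2 - s) > 0"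
proof (cases "s > 1")
  case True
  then show ?thesis by (simp add: pos_sq_def add_pos_nonneg)
next
  case False
  then show ?thesis by (simp add: pos_sq_def add_nonneg_pos)
qed

lemma cutoff_has_derivative: "(cutoff has_real_derivative cutoff' s) (at s)"
proof -
  have 1: "((\<lambda>s. pos_sq (s - 1)) has_real_derivative 2 * max 0 (s - 1)) (at s)"
    by (rule DERIV_cong[OF DERIV_chain2[OF pos_sq_has_derivative DERIV_diff[OF DERIV_ident DERIV_const]]]) simp
  have 2: "((\<lambda>s. pos_sq (2 - s)) has_real_derivative - (2 * max 0 (2 - s))) (at s)"
    by (rule DERIV_cong[OF DERIV_chain2[OF pos_sq_has_derivative DERIV_diff[OF DERIV_const DERIV_ident]]]) simp
  have "(cutoff has_real_derivative
    (2 * max 0 (s - 1) * (pos_sq (s - 1) + pos_sq (2 - s)) - pos_sq (s - 1) * (2 * max 0 (s - 1) + - (2 * max 0 (2 - s))))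
     / ((pos_sq (s - 1) + pos_sq (2 - s)) * (pos_sq (s - 1) + pos_sq (2 - s)))) (at s)"
    unfolding cutoff_def[abs_def]
    by (rule DERIV_divide[OF 1 DERIV_add[OF 1 2]]) (use cutoff_denominator_pos[of s] in simp)
  then show ?thesis by (simp add: cutoff'_def power2_eq_square algebra_simps)
qed

lemma continuous_on_cutoff': "continuous_on A cutoff'"
proof -
  have "pos_sq (s - 1) + pos_sq (2 - s) \<noteq> 0" for s using cutoff_denominator_pos[of s] by simp
  moreover have "continuous_on A (\<lambda>s. pos_sq (c + d * s))" for c d
    unfolding pos_sq_def by (intro continuous_intros)
  from this[of "-1" 1] this[of 2 "-1"]
  have "continuous_on A (\<lambda>s. pos_sq (s - 1))" "continuous_on A (\<lambda>s. pos_sq (2 - s))" by simp_all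
  ultimately show ?thesis unfolding cutoff'_def[abs_def] by (intro continuous_intros) auto
qed

lemma cutoff_nonneg: "0 \<le> cutoff s" and cutoff_le_1: "cutoff s \<le> 1"
  using cutoff_denominator_pos[of s] by (auto simp: cutoff_def pos_sq_def divide_le_eq)

lemma cutoff_eq_0: "s \<le> 1 \<Longrightarrow> cutoff s = 0" and cutoff_eq_1: "2 \<le> s \<Longrightarrow> cutoff s = 1"
  by (auto simp: cutoff_def pos_sq_def)

lemma cutoff'_nonneg: "0 \<le> cutoff' s"
  by (simp add: cutoff'_def pos_sq_def)

lemma cutoff'_eq_0: "s \<le> 1 \<or> 2 \<le> s \<Longrightarrow> cutoff' s = 0"
  by (auto simp: cutoff'_def pos_sq_def)

lemma cutoff'_bounded: obtains M where "M > 0" "\<And>s. cutoff' s \<le> M"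
proof -
  obtain M where M: "\<forall>s\<in>{1..2}. \<bar>cutoff' s\<bar> \<le> M"
    using compact_imp_bounded[OF compact_continuous_image[OF continuous_on_cutoff'[of "{1..2}"]]]
    by (auto simp: bounded_iff)
  have "cutoff' s \<le> max M 1" for s
  proof (cases "s \<in> {1..2}")
    case True
    then have "\<bar>cutoff' s\<bar> \<le> M" using M by blast
    then show ?thesis by linarith
  next
    case False
    then show ?thesis using cutoff'_eq_0[of s] by auto
  qed
  then show ?thesis using that[of "max M 1"] by simp
qed

lemma C1_deriv_cutoff:
  assumes "C1_deriv S s s'"
  shows "C1_deriv S (\<lambda>p. cutoff (s p)) (\<lambda>p v. cutoff' (s p) * s' p v)"
  by (rule C1_deriv_compose_real[OF assms cutoff_has_derivative continuous_on_cutoff'])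

section \<open>Interior cutoffs at a smooth boundary\<close>

lemma borel_measurable_on_open:
  fixes g :: "'a::euclidean_space \<Rightarrow> real"
  assumes "open S" "continuous_on S g"
  shows "(\<lambda>p. if p \<in> S then g p else 0) \<in> borel_measurable borel"
  using assms by (intro borel_measurable_continuous_on_if) auto

lemma borel_measurable_indicator_on_open:
  fixes g :: "'a::euclidean_space \<Rightarrow> real"
  assumes "open S" "continuous_on S g"
  shows "(\<lambda>p. ennreal (g p) * indicator S p) \<in> borel_measurable lborel"
proof -
  have "(\<lambda>p. ennreal (g p) * indicator S p) = (\<lambda>p. ennreal (if p \<in> S then g p else 0))"
    by (auto simp: indicator_def)
  then show ?thesis using borel_measurable_on_open[OF assms] by simp
qed

lemma integrable_compact_support_on_open:
  fixes g :: "'a::euclidean_space \<Rightarrow> real"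
  assumes S: "open S" "continuous_on S g" and K: "compact K" "K \<subseteq> S" and z: "\<And>p. p \<in> S - K \<Longrightarrow> g p = 0"
  shows "integrable lborel (\<lambda>p. if p \<in> S then g p else 0)"
proof -
  obtain M where M: "\<forall>p\<in>K. \<bar>g p\<bar> \<le> M"
    using compact_imp_bounded[OF compact_continuous_image[OF continuous_on_subset[OF S(2) K(2)] K(1)]]
    by (auto simp: bounded_iff)
  show ?thesis
  proof (rule Bochner_Integration.integrable_bound[where f="\<lambda>p. M * indicator K p"])
    show "integrable lborel (\<lambda>p. M * indicator K p)"
      using emeasure_bounded_finite[OF compact_imp_bounded[OF K(1)]] borel_compact[OF K(1)] by simp
    show "AE p in lborel. norm (if p \<in> S then g p else 0) \<le> norm (M * indicator K p)"
    proof (rule AE_I2)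
      fix p show "norm (if p \<in> S then g p else 0) \<le> norm (M * indicator K p)"
      proof (cases "p \<in> K")
        case True
        then have "\<bar>g p\<bar> \<le> M" using M by blast
        then show ?thesis using True by auto
      next
        case False
        then show ?thesis using z[of p] by auto
      qed
    qed
  qed (use borel_measurable_on_open[OF S] in simp)
qed

text \<open>The squared distance keeps the function C1 at the centre. With t = |p - c|^2 / \<rho>^2
  the argument 3 - t is at least 2 for t <= 1 and at most 1 for t >= 2.\<close>

definition bump :: "'a::euclidean_space \<Rightarrow> real \<Rightarrow> 'a \<Rightarrow> real" where
  "bump c \<rho> p = cutoff (3 - ((p - c) \<bullet> (p - c)) / \<rho>\<^sup>2)"

definition bump' :: "'a::euclidean_space \<Rightarrow> real \<Rightarrow> 'a \<Rightarrow> 'a \<Rightarrow> real" where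
  "bump' c \<rho> p v = cutoff' (3 - ((p - c) \<bullet> (p - c)) / \<rho>\<^sup>2) * (- 2 * ((p - c) \<bullet> v) / \<rho>\<^sup>2)"

lemma C1_deriv_dist_sq: "C1_deriv S (\<lambda>p. (p - c) \<bullet> (p - c)) (\<lambda>p v. 2 * ((p - c) \<bullet> v))"
  by (rule C1_deriv_eq[OF C1_deriv_inner[OF
        C1_deriv_diff[OF C1_deriv_bounded_linear[OF bounded_linear_ident] C1_deriv_const]
        C1_deriv_diff[OF C1_deriv_bounded_linear[OF bounded_linear_ident] C1_deriv_const]]])
    (simp add: inner_commute)

lemma C1_deriv_bump: "C1_deriv S (bump c \<rho>) (bump' c \<rho>)"
proof -
  have "C1_deriv S (\<lambda>p. 3 - (1 / \<rho>\<^sup>2) * ((p - c) \<bullet> (p - c)))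
     (\<lambda>p v. 0 - ((1 / \<rho>\<^sup>2) * (2 * ((p - c) \<bullet> v)) + 0 * ((p - c) \<bullet> (p - c))))"
    by (intro C1_deriv_diff C1_deriv_const C1_deriv_mult C1_deriv_dist_sq)
  from C1_deriv_cutoff[OF this] show ?thesis
    unfolding bump_def[abs_def] bump'_def[abs_def] by simp
qed

lemma bump_nonneg: "0 \<le> bump c \<rho> p" and bump_le_1: "bump c \<rho> p \<le> 1"
  by (auto simp: bump_def cutoff_nonneg cutoff_le_1)

lemma bump_eq_1:
  assumes "\<rho> > 0" "dist p c \<le> \<rho>" shows "bump c \<rho> p = 1"
proof -
  have "(p - c) \<bullet> (p - c) \<le> \<rho>\<^sup>2" using assms
    by (simp add: dist_norm power2_norm_eq_inner[symmetric] power_mono)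
  then show ?thesis unfolding bump_def using assms(1) by (intro cutoff_eq_1) (simp add: field_simps)
qed

lemma
  assumes "\<rho> > 0" "2 * \<rho> \<le> dist p c"
  shows bump_eq_0: "bump c \<rho> p = 0" and bump'_eq_0: "bump' c \<rho> p v = 0"
proof -
  have "(2 * \<rho>)\<^sup>2 \<le> (dist p c)\<^sup>2" using assms by (intro power_mono) auto
  then have "4 * \<rho>\<^sup>2 \<le> (p - c) \<bullet> (p - c)" 
    by (simp add: dist_norm power2_norm_eq_inner power_mult_distrib)
  then have 1: "3 - ((p - c) \<bullet> (p - c)) / \<rho>\<^sup>2 \<le> 1"
  proof -
    have "2 * \<rho>\<^sup>2 \<le> (p - c) \<bullet> (p - c)"
      using \<open>4 * \<rho>\<^sup>2 \<le> (p - c) \<bullet> (p - c)\<close> zero_le_power2[of \<rho>] by linarith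
    then show ?thesis using assms(1) by (simp add: field_simps)
  qed
  show "bump c \<rho> p = 0" unfolding bump_def by (rule cutoff_eq_0[OF 1])
  show "bump' c \<rho> p v = 0" unfolding bump'_def using cutoff'_eq_0 1 by simp
qed

text \<open>With k_j a cutoff in - N_j \<Phi>, the function h_j = 1 - \<beta> (1 - k_j) is 1 far
  from p0 and vanishes near the boundary inside the ball. Differentiation along Q gives two terms.
  In one the factor \<beta> is differentiated, and it tends to 0 in L1 because k_j tends to 1. The
  other is a layer l_j times \<open>Q p \<bullet> G p\<close>; l_j has bounded mass and lives where
  \<Phi> >= -2 / N_j, where \<open>Q p \<bullet> G p\<close> is nearly nonpositive. Hence - h_j' Q
  has an upper bound of arbitrarily small integral, although h_j' itself blows up.\<close>

lemma boundary_patch: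
  fixes Q :: "'a::euclidean_space \<Rightarrow> 'a"
  assumes S: "open S" and Qc: "continuous_on (closure S) Q"
    and V: "open V" "p0 \<in> V"
    and \<Phi>: "C1_deriv V \<Phi> (\<lambda>p v. G p \<bullet> v)" and G0: "G p0 \<noteq> 0"
    and SV: "S \<inter> V = {p\<in>V. \<Phi> p < 0}"
    and sign: "\<And>p. p \<in> V \<Longrightarrow> p \<in> frontier S \<Longrightarrow> Q p \<bullet> G p \<le> 0"
  obtains \<rho> h h' where "\<rho> > 0"
    "\<And>j::nat. C1_deriv S (h j) (h' j)"
    "\<And>j p. p \<in> S \<Longrightarrow> 0 \<le> h j p \<and> h j p \<le> (1::real)"
    "\<And>p. p \<in> S \<Longrightarrow> \<forall>\<^sub>F j in sequentially. h j p = 1"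
    "\<And>j p. p \<in> ball p0 \<rho> \<Longrightarrow> p \<in> frontier S \<Longrightarrow> \<exists>T. open T \<and> p \<in> T \<and> (\<forall>q\<in>T \<inter> S. h j q = 0)"
    "\<And>e. e > 0 \<Longrightarrow> \<forall>\<^sub>F j in sequentially. \<exists>A. (\<forall>p\<in>S. - h' j p (Q p) \<le> A p) \<and> (\<forall>p. 0 \<le> A p)
        \<and> A \<in> borel_measurable borel \<and> (\<integral>\<^sup>+p\<in>S. ennreal (A p) \<partial>lborel) \<le> ennreal e"
proof -
  have Gc: "continuous_on V G"
    unfolding continuous_on_componentwise[of V G] using C1_deriv_continuous_deriv[OF \<Phi>] by blast
  have \<Phi>c: "continuous_on V \<Phi>" by (rule C1_deriv_continuous_on[OF \<Phi>])
  \<comment> \<open>Continuity keeps \<open>G p \<bullet> G p0\<close> above c near p0, so the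
    constant field \<open>G p0\<close> is uniformly transversal to the level sets of \<Phi>; it will
    serve as test direction.\<close>
  define c where "c = (G p0 \<bullet> G p0) / 2"
  have c: "c > 0" using G0 by (simp add: c_def)
  have "open (V \<inter> (\<lambda>p. G p \<bullet> G p0) -` {c<..})"
    by (intro continuous_open_preimage continuous_intros Gc V)
  moreover have "p0 \<in> V \<inter> (\<lambda>p. G p \<bullet> G p0) -` {c<..}" using V c G0 by (simp add: c_def)
  ultimately obtain \<rho>1 where \<rho>1: "\<rho>1 > 0" "cball p0 \<rho>1 \<subseteq> V \<inter> (\<lambda>p. G p \<bullet> G p0) -` {c<..}"
    using open_contains_cball by blast
  define \<rho> where "\<rho> = \<rho>1 / 2"
  have \<rho>: "\<rho> > 0" using \<rho>1 by (simp add: \<rho>_def)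
  define B where "B = cball p0 (2 * \<rho>)"
  have B: "B \<subseteq> V" "\<And>p. p \<in> B \<Longrightarrow> G p \<bullet> G p0 \<ge> c" "compact B" "p \<in> B \<longleftrightarrow> dist p p0 \<le> 2 * \<rho>" for p
    using \<rho>1 by (auto simp: \<rho>_def B_def dist_commute subset_iff less_imp_le)
  define \<beta> where "\<beta> = bump p0 \<rho>"
  define \<beta>' where "\<beta>' = bump' p0 \<rho>"
  have \<beta>C: "C1_deriv T \<beta> \<beta>'" for T unfolding \<beta>_def \<beta>'_def by (rule C1_deriv_bump)
  have \<beta>01: "0 \<le> \<beta> p" "\<beta> p \<le> 1" for p by (auto simp: \<beta>_def bump_nonneg bump_le_1)
  have \<beta>0: "\<beta> p = 0" "\<beta>' p v = 0" if "p \<notin> B" for p v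
    using that B(4)[of p] \<rho> by (auto simp: \<beta>_def \<beta>'_def bump_eq_0 bump'_eq_0)
  define N where "N j = real (Suc j)" for j
  have N: "N j > 0" for j by (simp add: N_def)
  define k where "k j p = cutoff (- N j * \<Phi> p)" for j p
  define k' where "k' j p v = - N j * cutoff' (- N j * \<Phi> p) * (G p \<bullet> v)" for j p v
  have kC: "C1_deriv V (k j) (k' j)" for j
  proof -
    have "C1_deriv V (\<lambda>p. - N j * \<Phi> p) (\<lambda>p v. - N j * (G p \<bullet> v) + 0 * \<Phi> p)"
      by (intro C1_deriv_mult C1_deriv_const \<Phi>)
    from C1_deriv_cutoff[OF this] show ?thesis
      unfolding k_def[abs_def] k'_def[abs_def] by (simp add: algebra_simps)
  qed
  have k01: "0 \<le> k j p" "k j p \<le> 1" for j p by (auto simp: k_def cutoff_nonneg cutoff_le_1)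
  define h where "h j p = 1 - \<beta> p * (1 - k j p)" for j p
  \<comment> \<open>Outside V nothing is known about \<Phi>. There \<beta> vanishes and h is
    constantly 1, so the derivative is set to 0 by cases.\<close>
  define h' where "h' j p v = (if p \<in> V then - (\<beta> p * (0 - k' j p v) + \<beta>' p v * (1 - k j p)) else 0)" for j p v
  have hC: "C1_deriv S (h j) (h' j)" for j
  proof -
    have "C1_deriv V (h j) (\<lambda>p v. 0 - (\<beta> p * (0 - k' j p v) + \<beta>' p v * (1 - k j p)))"
      unfolding h_def[abs_def] by (intro C1_deriv_diff C1_deriv_const C1_deriv_mult \<beta>C kC)
    then have 1: "C1_deriv V (h j) (h' j)"
      by (rule C1_deriv_eq) (simp add: h'_def)
    have 2: "C1_deriv (-B) (h j) (h' j)"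
      by (rule C1_deriv_cong[OF C1_deriv_const[of _ 1]])
        (use B(3) \<beta>0 in \<open>auto simp: h_def h'_def compact_imp_closed open_Compl\<close>)
    have "C1_deriv (V \<union> - B) (h j) (h' j)"
      by (rule C1_deriv_Un[OF 1 2 V(1)]) (use B(3) in \<open>simp add: compact_imp_closed open_Compl\<close>)
    then show ?thesis by (rule C1_deriv_subset) (use B(1) in auto)
  qed
  have h01: "0 \<le> h j p \<and> h j p \<le> 1" for j p
  proof -
    have "\<beta> p * (1 - k j p) \<le> 1 * 1" using \<beta>01 k01 by (intro mult_mono) auto
    moreover have "0 \<le> \<beta> p * (1 - k j p)" using \<beta>01 k01 by simp
    ultimately show ?thesis by (simp add: h_def)
  qed
  have k_ev: "\<forall>\<^sub>F j in sequentially. k j p = 1" if "p \<in> S" "p \<in> V" for p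
  proof -
    have neg: "\<Phi> p < 0" using that SV by blast
    obtain j0 where j0: "real j0 > 2 / (- \<Phi> p)" using reals_Archimedean2 by blast
    have "k j p = 1" if "j \<ge> j0" for j
    proof -
      have "2 / (- \<Phi> p) < N j" using j0 that by (simp add: N_def)
      then have "2 \<le> - N j * \<Phi> p" using neg by (simp add: field_simps)
      then show ?thesis unfolding k_def by (rule cutoff_eq_1)
    qed
    then show ?thesis by (auto simp: eventually_sequentially)
  qed
  have h_ev: "\<forall>\<^sub>F j in sequentially. h j p = 1" if "p \<in> S" for p
  proof (cases "p \<in> V")
    case True
    show ?thesis by (rule eventually_mono[OF k_ev[OF that True]]) (simp add: h_def)
  next
    case False
    then show ?thesis using \<beta>0(1)[of p] B(1) by (auto simp: h_def)
  qed
  have h_nb: "\<exists>T. open T \<and> p \<in> T \<and> (\<forall>q\<in>T \<inter> S. h j q = 0)" if "p \<in> ball p0 \<rho>" "p \<in> frontier S" for j p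
  proof -
    have "p \<notin> S" using that(2) S by (simp add: frontier_def interior_open)
    moreover have pV: "p \<in> V" using that(1) B(1) B(4)[of p] \<rho> by (auto simp: dist_commute)
    ultimately have "\<Phi> p \<ge> 0" using SV by force
    \<comment> \<open>A boundary point has \<Phi> >= 0, so \<Phi> > -1 / N_j persists in a
      neighbourhood; there the argument of the cutoff is below 1 and k_j is still 0.\<close>
    define T where "T = ball p0 \<rho> \<inter> (V \<inter> \<Phi> -` {- 1 / N j<..})"
    have "open T" unfolding T_def
      by (intro open_Int open_ball continuous_open_preimage \<Phi>c V open_greaterThan)
    moreover have "- 1 / N j < 0" using N by simp
    then have "- 1 / N j < \<Phi> p" using \<open>\<Phi> p \<ge> 0\<close> by linarith
    then have "p \<in> T" unfolding T_def using that pV by auto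
    moreover have "h j q = 0" if "q \<in> T" for q
    proof -
      have "\<beta> q = 1" using that \<rho> unfolding \<beta>_def T_def by (intro bump_eq_1) (auto simp: dist_commute)
      moreover have "- 1 / N j < \<Phi> q" using that by (auto simp: T_def)
      then have "- N j * \<Phi> q \<le> 1" using N[of j] by (simp add: field_simps)
      then have "k j q = 0" unfolding k_def by (rule cutoff_eq_0)
      ultimately show ?thesis by (simp add: h_def)
    qed
    ultimately show ?thesis by blast
  qed
  define l where "l j p = \<beta> p * (N j * cutoff' (- N j * \<Phi> p))" for j p
  have l0: "0 \<le> l j p" for j p unfolding l_def using \<beta>01 N[of j] cutoff'_nonneg by (simp add: less_imp_le)
  have SVo: "open (S \<inter> V)" using S V by auto
  have lc: "continuous_on V (l j)" for j
    unfolding l_def[abs_def]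
    by (intro continuous_intros continuous_on_compose2[OF continuous_on_cutoff'[of UNIV]] \<Phi>c
        C1_deriv_continuous_on[OF \<beta>C]) auto
  \<comment> \<open>Testing the cutoff against a constant vector field bounds the mass of the layer uniformly.\<close>
  obtain M where M: "M \<ge> 0" "\<And>j. integrable lborel (\<lambda>p. if p \<in> S \<inter> V then l j p else 0)"
    "\<And>j. (\<integral>p. (if p \<in> S \<inter> V then l j p else 0) \<partial>lborel) \<le> M"
  proof -
    have \<beta>'c: "continuous_on UNIV (\<lambda>p. \<bar>\<beta>' p (G p0)\<bar>)"
      by (intro continuous_intros C1_deriv_continuous_deriv[OF \<beta>C])
    have \<beta>'i: "integrable lborel (\<lambda>p. if p \<in> UNIV then \<bar>\<beta>' p (G p0)\<bar> else 0)"
      by (rule integrable_compact_support_on_open[OF open_UNIV \<beta>'c B(3)]) (use \<beta>0 in auto)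
    define M where "M = (\<integral>p. \<bar>\<beta>' p (G p0)\<bar> \<partial>lborel) / c"
    have "integrable lborel (\<lambda>p. if p \<in> S \<inter> V then l j p else 0)
      \<and> (\<integral>p. (if p \<in> S \<inter> V then l j p else 0) \<partial>lborel) \<le> M" for j
    proof -
      \<comment> \<open>A compact subset of S outside which \<beta> k_j and its layer vanish, since
        k_j is 0 for \<Phi> > -1 / N_j.\<close>
      define Kj where "Kj = B \<inter> \<Phi> -` {.. - 1 / N j}"
      have "closed Kj" unfolding Kj_def
        by (intro continuous_closed_preimage continuous_on_subset[OF \<Phi>c B(1)] compact_imp_closed[OF B(3)] closed_atMost)
      moreover have "Kj = B \<inter> Kj" by (auto simp: Kj_def)
      ultimately have Kj: "compact Kj" using B(3) compact_Int_closed by metis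
      have "- 1 / N j < 0" using N by simp
      then have "\<Phi> p < 0" if "p \<in> Kj" for p
        using that unfolding Kj_def by (auto simp del: minus_divide_left divide_minus_left)
      then have KS: "Kj \<subseteq> S \<inter> V" unfolding SV using B(1) by (auto simp: Kj_def)
      have kz: "k j p = 0" "cutoff' (- N j * \<Phi> p) = 0" if "p \<notin> Kj" "p \<in> B" for p
      proof -
        have "- 1 / N j < \<Phi> p" using that by (auto simp: Kj_def)
        then have "- N j * \<Phi> p \<le> 1" using N[of j] by (simp add: field_simps)
        then show "k j p = 0" "cutoff' (- N j * \<Phi> p) = 0"
          using cutoff_eq_0 cutoff'_eq_0 by (auto simp: k_def)
      qed
      have C: "C1_deriv (S \<inter> V) (\<lambda>p. \<beta> p * k j p) (\<lambda>p v. \<beta> p * k' j p v + \<beta>' p v * k j p)"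
        by (rule C1_deriv_subset[OF C1_deriv_mult[OF \<beta>C kC]]) auto
      have Z: "\<And>p. p \<in> S \<inter> V - Kj \<Longrightarrow> \<beta> p * k j p = 0"
        using kz(1) \<beta>0(1) by (metis DiffD2 mult_zero_left mult_zero_right)
      have Zl: "l j p = 0" if "p \<notin> Kj" for p
        using kz(2)[of p] \<beta>0(1)[of p] that by (cases "p \<in> B") (simp_all add: l_def)
      have lcS: "continuous_on (S \<inter> V) (l j)" by (rule continuous_on_subset[OF lc]) simp
      note I = integral_gradient_zero[OF C SVo Kj KS Z, of "G p0"]
      have li: "integrable lborel (\<lambda>p. if p \<in> S \<inter> V then l j p else 0)"
        by (rule integrable_compact_support_on_open[OF SVo lcS Kj KS]) (use Zl in auto)
      have gi: "integrable lborel (\<lambda>p. if p \<in> S \<inter> V then l j p * (G p \<bullet> G p0) else 0)"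
        by (rule integrable_compact_support_on_open[OF SVo _ Kj KS])
          (use Zl in \<open>auto intro!: continuous_intros lcS continuous_on_subset[OF Gc]\<close>)
      have bi: "integrable lborel (\<lambda>p. if p \<in> S \<inter> V then \<beta>' p (G p0) * k j p else 0)"
      proof (rule integrable_compact_support_on_open[OF SVo _ Kj KS])
        show "continuous_on (S \<inter> V) (\<lambda>p. \<beta>' p (G p0) * k j p)"
          by (intro continuous_intros C1_deriv_continuous_deriv[OF \<beta>C]
             continuous_on_subset[OF C1_deriv_continuous_on[OF kC]]) simp
        show "\<beta>' p (G p0) * k j p = 0" if "p \<in> S \<inter> V - Kj" for p
          using kz(1)[of p] \<beta>0(2)[of p] that by (cases "p \<in> B") auto
      qed
      \<comment> \<open>The derivative of \<beta> k_j in the direction \<open>G p0\<close>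
        integrates to zero, so its two product-rule terms have opposite integrals.\<close>
      have "(\<integral>p. (if p \<in> S \<inter> V then l j p * (G p \<bullet> G p0) else 0) \<partial>lborel)
          = (\<integral>p. (if p \<in> S \<inter> V then \<beta>' p (G p0) * k j p else 0) \<partial>lborel)"
      proof -
        have "(\<integral>p. (if p \<in> S \<inter> V then \<beta>' p (G p0) * k j p else 0)
           - (if p \<in> S \<inter> V then l j p * (G p \<bullet> G p0) else 0) \<partial>lborel) = 0"
          by (rule trans[OF Bochner_Integration.integral_cong I(2)]) (auto simp: l_def k'_def algebra_simps)
        then show ?thesis using gi bi by simp
      qed
      also have "\<dots> \<le> (\<integral>p. \<bar>\<beta>' p (G p0)\<bar> \<partial>lborel)"
      proof (rule integral_mono[OF bi])
        show "integrable lborel (\<lambda>p. \<bar>\<beta>' p (G p0)\<bar>)" using \<beta>'i by simp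
        fix p
        have "\<beta>' p (G p0) * k j p \<le> \<bar>\<beta>' p (G p0)\<bar> * 1"
          using k01[of j p] by (intro mult_mono) auto
        then show "(if p \<in> S \<inter> V then \<beta>' p (G p0) * k j p else 0) \<le> \<bar>\<beta>' p (G p0)\<bar>" by auto
      qed
      finally have 1: "(\<integral>p. (if p \<in> S \<inter> V then l j p * (G p \<bullet> G p0) else 0) \<partial>lborel) \<le> (\<integral>p. \<bar>\<beta>' p (G p0)\<bar> \<partial>lborel)" .
      have "(\<integral>p. c * (if p \<in> S \<inter> V then l j p else 0) \<partial>lborel)
         \<le> (\<integral>p. (if p \<in> S \<inter> V then l j p * (G p \<bullet> G p0) else 0) \<partial>lborel)"
      proof (rule integral_mono)
        fix p
        show "c * (if p \<in> S \<inter> V then l j p else 0) \<le> (if p \<in> S \<inter> V then l j p * (G p \<bullet> G p0) else 0)"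
        proof (cases "p \<in> B")
          case True
          then have "l j p * c \<le> l j p * (G p \<bullet> G p0)" using B(2) l0 by (intro mult_left_mono) auto
          then show ?thesis by (simp add: mult.commute)
        next
          case False
          then show ?thesis using \<beta>0 by (simp add: l_def)
        qed
      qed (use li gi in auto)
      then have "c * (\<integral>p. (if p \<in> S \<inter> V then l j p else 0) \<partial>lborel) \<le> (\<integral>p. \<bar>\<beta>' p (G p0)\<bar> \<partial>lborel)"
        using 1 by simp
      then have "(\<integral>p. (if p \<in> S \<inter> V then l j p else 0) \<partial>lborel) \<le> M"
        using c by (simp add: M_def field_simps)
      with li show ?thesis by blast
    qed
    moreover have "M \<ge> 0" unfolding M_def using c by simp
    ultimately show ?thesis using that by blast
  qed
  have layer: "\<forall>\<^sub>F j in sequentially. \<exists>A. (\<forall>p\<in>S. - h' j p (Q p) \<le> A p) \<and> (\<forall>p. 0 \<le> A p)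
        \<and> A \<in> borel_measurable borel \<and> (\<integral>\<^sup>+p\<in>S. ennreal (A p) \<partial>lborel) \<le> ennreal e" if e: "e > 0" for e
  proof -
    \<comment> \<open>Half of e is reserved for the term with the differentiated \<beta>, the other
      half for e1 times the mass bound M.\<close>
    define e1 where "e1 = e / (2 * (M + 1))"
    have e1: "e1 > 0" using e M(1) by (simp add: e1_def)
    define a where "a j p = (if p \<in> S \<inter> V then \<bar>\<beta>' p (Q p)\<bar> * (1 - k j p) else 0)" for j p
    have Qc': "continuous_on (S \<inter> V) Q" using closure_subset by (intro continuous_on_subset[OF Qc]) auto
    have \<beta>'Q: "continuous_on (closure S) (\<lambda>p. \<beta>' p (Q p))"
      unfolding \<beta>'_def bump'_def
      by (intro continuous_intros continuous_on_compose2[OF continuous_on_cutoff'[of UNIV]] Qc) (use \<rho> in auto)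
    have am: "a j \<in> borel_measurable lborel" for j
    proof -
      have "S \<inter> V \<subseteq> closure S" using closure_subset by auto
      then have "continuous_on (S \<inter> V) (\<lambda>p. \<bar>\<beta>' p (Q p)\<bar> * (1 - k j p))"
        by (intro continuous_intros continuous_on_subset[OF \<beta>'Q]
            continuous_on_subset[OF C1_deriv_continuous_on[OF kC]]) auto
      from borel_measurable_on_open[OF SVo this] show ?thesis unfolding a_def by simp
    qed
    have "compact (B \<inter> closure S)" using B(3) by (simp add: compact_Int_closed)
    from compact_imp_bounded[OF compact_continuous_image[OF continuous_on_subset[OF \<beta>'Q] this]]
    obtain L' where L': "\<forall>p\<in>B \<inter> closure S. \<bar>\<beta>' p (Q p)\<bar> \<le> L'" by (auto simp: bounded_iff)
    define L where "L = max L' 0"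
    have L0: "L \<ge> 0" by (simp add: L_def)
    have L: "\<bar>\<beta>' p (Q p)\<bar> \<le> L" if "p \<in> B \<inter> closure S" for p
      using L' that unfolding L_def by (meson max.cobounded1 order_trans)
    have a_le: "norm (a j p) \<le> L * indicator B p" for j p
    proof (cases "p \<in> S \<inter> V \<inter> B")
      case True
      then have "\<bar>\<beta>' p (Q p)\<bar> \<le> L" using L[of p] closure_subset[of S] by blast
      moreover have "\<bar>\<beta>' p (Q p)\<bar> * (1 - k j p) \<le> \<bar>\<beta>' p (Q p)\<bar>"
        using k01[of j p] by (intro mult_left_le) auto
      ultimately show ?thesis using True k01[of j p] by (auto simp: a_def abs_mult)
    next
      case False
      then show ?thesis using \<beta>0 L0 by (auto simp: a_def indicator_def)
    qed
    have a_lim: "(\<lambda>j. a j p) \<longlonglongrightarrow> 0" for p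
    proof (cases "p \<in> S \<inter> V")
      case True
      then have "\<forall>\<^sub>F j in sequentially. k j p = 1" using k_ev by blast
      then have "\<forall>\<^sub>F j in sequentially. a j p = 0" by eventually_elim (simp add: a_def)
      then show ?thesis by (rule tendsto_eventually)
    next
      case False
      then have "(\<lambda>j. a j p) = (\<lambda>_. 0)" by (auto simp: a_def)
      then show ?thesis by simp
    qed
    have domi: "integrable lborel (\<lambda>p. L * indicator B p)"
      using emeasure_bounded_finite[OF compact_imp_bounded[OF B(3)]] borel_compact[OF B(3)] by simp
    have ai: "integrable lborel (a j)" for j
      by (rule Bochner_Integration.integrable_bound[OF domi am]) (use a_le L0 in \<open>auto simp: abs_mult\<close>)
    have "(\<lambda>j. \<integral>p. a j p \<partial>lborel) \<longlonglongrightarrow> (\<integral>p. 0 \<partial>(lborel::'a measure))"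
      by (rule integral_dominated_convergence[OF _ am domi]) (use a_lim a_le in auto)
    then have "\<forall>\<^sub>F j in sequentially. (\<integral>p. a j p \<partial>lborel) < e / 2"
      using e by (intro order_tendstoD) auto
    moreover have "\<forall>\<^sub>F j in sequentially. \<forall>p\<in>S \<inter> B. \<Phi> p \<ge> - 2 / N j \<longrightarrow> Q p \<bullet> G p \<le> e1"
    proof -
      \<comment> \<open>The points where \<open>Q p \<bullet> G p\<close> is not small. By the sign
        condition C misses the boundary, so \<Phi> has a negative maximum on C, and for large j the
        layer \<Phi> >= -2 / N_j does not meet C.\<close>
      define C where "C = B \<inter> closure S \<inter> (\<lambda>p. Q p \<bullet> G p) -` {e1..}"
      have "closed C" unfolding C_def
        by (intro continuous_closed_preimage continuous_intros continuous_on_subset[OF Gc] continuous_on_subset[OF Qc])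
          (use B in \<open>auto simp: compact_imp_closed\<close>)
      moreover have "C = B \<inter> C" by (auto simp: C_def)
      ultimately have Cc: "compact C" using B(3) compact_Int_closed by metis
      have neg: "\<Phi> p < 0" if "p \<in> C" for p
      proof (rule ccontr)
        assume "\<not> \<Phi> p < 0"
        then have "p \<notin> S" "p \<in> V" using SV that B(1) by (auto simp: C_def)
        then have "p \<in> frontier S" using that S by (simp add: C_def frontier_def interior_open)
        then have "Q p \<bullet> G p \<le> 0" using sign \<open>p \<in> V\<close> by blast
        then show False using that e1 by (auto simp: C_def)
      qed
      show ?thesis
      proof (cases "C = {}")
        case True
        then have "\<forall>p\<in>S \<inter> B. Q p \<bullet> G p \<le> e1" using closure_subset by (fastforce simp: C_def)
        then show ?thesis by auto
      next
        case False
        obtain q where q: "q \<in> C" "\<forall>p\<in>C. \<Phi> p \<le> \<Phi> q"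
          using continuous_attains_sup[OF Cc False] continuous_on_subset[OF \<Phi>c] B(1)
          by (metis C_def Int_lower1 inf.coboundedI1 le_inf_iff)
        obtain j0 where j0: "real j0 > 2 / (- \<Phi> q)" using reals_Archimedean2 by blast
        have "Q p \<bullet> G p \<le> e1" if "j \<ge> j0" "p \<in> S \<inter> B" "\<Phi> p \<ge> - 2 / N j" for j p
        proof (rule ccontr)
          assume "\<not> Q p \<bullet> G p \<le> e1"
          then have "p \<in> C" using that closure_subset by (auto simp: C_def)
          then have "\<Phi> p \<le> \<Phi> q" using q by blast
          moreover have "2 / (- \<Phi> q) < N j" using j0 that by (simp add: N_def)
          then have "\<Phi> q < - 2 / N j" using neg[OF q(1)] N[of j] by (simp add: field_simps)
          ultimately show False using that by linarith
        qed
        then show ?thesis unfolding eventually_sequentially by blast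
      qed
    qed
    ultimately show ?thesis
    proof eventually_elim
      case (elim j)
      define A where "A p = a j p + e1 * (if p \<in> S \<inter> V then l j p else 0)" for p
      have A1: "- h' j p (Q p) \<le> A p" if "p \<in> S" for p
      proof (cases "p \<in> B")
        case True
        then have pV: "p \<in> V" using B(1) by auto
        have "l j p * (Q p \<bullet> G p) \<le> l j p * e1"
        proof (cases "\<Phi> p \<ge> - 2 / N j")
          case True
          then show ?thesis using elim(2) that \<open>p \<in> B\<close> l0 by (intro mult_left_mono) auto
        next
          case False
          then have "2 \<le> - N j * \<Phi> p" using N[of j] by (simp add: field_simps)
          then have "l j p = 0" using cutoff'_eq_0 by (simp add: l_def)
          then show ?thesis by simp
        qed
        moreover have "\<beta>' p (Q p) * (1 - k j p) \<le> \<bar>\<beta>' p (Q p)\<bar> * (1 - k j p)"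
          using k01[of j p] by (intro mult_right_mono) auto
        moreover have "- h' j p (Q p) = \<beta>' p (Q p) * (1 - k j p) + l j p * (Q p \<bullet> G p)"
          using pV by (simp add: h'_def k'_def l_def inner_commute)
        ultimately show ?thesis using pV that by (simp add: A_def a_def mult.commute)
      next
        case False
        have "0 \<le> A p" unfolding A_def a_def using l0 e1 k01 by (auto simp: less_imp_le)
        then show ?thesis using False \<beta>0 by (auto simp: h'_def)
      qed
      have A0: "0 \<le> A p" for p unfolding A_def a_def using l0 e1 k01 by (auto simp: less_imp_le)
      have Ai: "integrable lborel A" unfolding A_def[abs_def] using ai M(2) by auto
      have "(\<integral>\<^sup>+p\<in>S. ennreal (A p) \<partial>lborel) \<le> (\<integral>\<^sup>+p. ennreal (A p) \<partial>lborel)"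
        by (intro nn_integral_mono) (auto simp: indicator_def)
      also have "\<dots> = ennreal (\<integral>p. A p \<partial>lborel)"
        using nn_integral_eq_integral[OF Ai] A0 by auto
      also have "\<dots> \<le> ennreal e"
      proof (rule ennreal_leI)
        have "(\<integral>p. A p \<partial>lborel) = (\<integral>p. a j p \<partial>lborel) + e1 * (\<integral>p. (if p \<in> S \<inter> V then l j p else 0) \<partial>lborel)"
          unfolding A_def[abs_def] using ai[of j] M(2)[of j] by simp
        also have "\<dots> \<le> e / 2 + e1 * M" using elim(1) M(3)[of j] e1 by (intro add_mono mult_left_mono) auto
        also have "\<dots> \<le> e"
        proof -
          have "e1 * M \<le> e1 * (M + 1)" using e1 by simp
          also have "\<dots> = e / 2" using M(1) by (simp add: e1_def field_simps)
          finally show ?thesis by linarith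
        qed
        finally show "(\<integral>p. A p \<partial>lborel) \<le> e" .
      qed
      finally show ?case using A1 A0 Ai by (auto intro!: exI[of _ A] dest: borel_measurable_integrable)
    qed
  qed
  show ?thesis
    by (rule that[of \<rho> h h', OF \<rho> hC h01 h_ev h_nb layer])
qed

text \<open>Finitely many patches cover the compact set \<open>frontier S \<inter> K\<close>, and
  their cutoffs are multiplied. All factors lie in [0, 1] and the majorants are nonnegative, so the
  one-sided bounds simply add up in the derivative of the product.\<close>

lemma boundary_cutoffs:
  fixes Q :: "'a::euclidean_space \<Rightarrow> 'a"
  assumes S: "open S" and Qc: "continuous_on (closure S) Q" and K: "compact K"
    and bd: "\<And>p0. p0 \<in> frontier S \<inter> K \<Longrightarrow> \<exists>V \<Phi> G. open V \<and> p0 \<in> V \<and> C1_deriv V \<Phi> (\<lambda>p v. G p \<bullet> v)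
       \<and> G p0 \<noteq> 0 \<and> S \<inter> V = {p\<in>V. \<Phi> p < 0} \<and> (\<forall>p\<in>V \<inter> frontier S. Q p \<bullet> G p \<le> 0)"
  obtains H H' where
    "\<And>j::nat. C1_deriv S (H j) (H' j)"
    "\<And>j p. p \<in> S \<Longrightarrow> 0 \<le> H j p \<and> H j p \<le> (1::real)"
    "\<And>p. p \<in> S \<Longrightarrow> \<forall>\<^sub>F j in sequentially. H j p = 1"
    "\<And>j. \<exists>L. compact L \<and> L \<subseteq> S \<and> (\<forall>p\<in>S \<inter> K - L. H j p = 0)"
    "\<And>e. e > 0 \<Longrightarrow> \<forall>\<^sub>F j in sequentially. \<exists>A. (\<forall>p\<in>S. - H' j p (Q p) \<le> A p) \<and> (\<forall>p. 0 \<le> A p)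
        \<and> A \<in> borel_measurable borel \<and> (\<integral>\<^sup>+p\<in>S. ennreal (A p) \<partial>lborel) \<le> ennreal e"
proof -
  \<comment> \<open>One name for everything that \<open>boundary_patch\<close> provides, so that
    patches can be chosen simultaneously for all boundary points.\<close>
  define good where "good p0 \<rho> h h' \<longleftrightarrow> \<rho> > 0 \<and>
    (\<forall>j::nat. C1_deriv S (h j) (h' j)) \<and>
    (\<forall>j p. p \<in> S \<longrightarrow> 0 \<le> h j p \<and> h j p \<le> (1::real)) \<and>
    (\<forall>p. p \<in> S \<longrightarrow> (\<forall>\<^sub>F j in sequentially. h j p = 1)) \<and>
    (\<forall>j p. p \<in> ball p0 \<rho> \<longrightarrow> p \<in> frontier S \<longrightarrow> (\<exists>T. open T \<and> p \<in> T \<and> (\<forall>q\<in>T \<inter> S. h j q = 0))) \<and>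
    (\<forall>e>0. \<forall>\<^sub>F j in sequentially. \<exists>A. (\<forall>p\<in>S. - h' j p (Q p) \<le> A p) \<and> (\<forall>p. 0 \<le> A p)
        \<and> A \<in> borel_measurable borel \<and> (\<integral>\<^sup>+p\<in>S. ennreal (A p) \<partial>lborel) \<le> ennreal e)" for p0 \<rho> h h'
  have "\<exists>\<rho> h h'. good p0 \<rho> h h'" if p0: "p0 \<in> frontier S \<inter> K" for p0
  proof -
    from bd[OF p0] obtain V \<Phi> G where V: "open V" "p0 \<in> V" "C1_deriv V \<Phi> (\<lambda>p v. G p \<bullet> v)" "G p0 \<noteq> 0"
      "S \<inter> V = {p\<in>V. \<Phi> p < 0}" "\<forall>p\<in>V \<inter> frontier S. Q p \<bullet> G p \<le> 0" by blast
    have sg: "\<And>p. p \<in> V \<Longrightarrow> p \<in> frontier S \<Longrightarrow> Q p \<bullet> G p \<le> 0" using V(6) by blast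
    show ?thesis
    proof (rule boundary_patch[OF S Qc V(1-5) sg])
      fix \<rho> h h'
      assume b: "\<rho> > 0" "\<And>j::nat. C1_deriv S (h j) (h' j)"
        "\<And>j p. p \<in> S \<Longrightarrow> 0 \<le> h j p \<and> h j p \<le> (1::real)"
        "\<And>p. p \<in> S \<Longrightarrow> \<forall>\<^sub>F j in sequentially. h j p = 1"
        "\<And>j p. p \<in> ball p0 \<rho> \<Longrightarrow> p \<in> frontier S \<Longrightarrow> \<exists>T. open T \<and> p \<in> T \<and> (\<forall>q\<in>T \<inter> S. h j q = 0)"
        "\<And>e. e > 0 \<Longrightarrow> \<forall>\<^sub>F j in sequentially. \<exists>A. (\<forall>p\<in>S. - h' j p (Q p) \<le> A p) \<and> (\<forall>p. 0 \<le> A p)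
          \<and> A \<in> borel_measurable borel \<and> (\<integral>\<^sup>+p\<in>S. ennreal (A p) \<partial>lborel) \<le> ennreal e"
      have "good p0 \<rho> h h'" unfolding good_def
        by (rule conjI[OF b(1)], rule conjI, rule allI, rule b(2), rule conjI, intro allI impI, erule b(3),
            rule conjI, intro allI impI, erule b(4), rule conjI, intro allI impI, erule b(5), assumption,
            intro allI impI, erule b(6))
      then show "\<exists>\<rho> h h'. good p0 \<rho> h h'" by blast
    qed
  qed
  then obtain \<rho> h h' where good: "\<And>p0. p0 \<in> frontier S \<inter> K \<Longrightarrow> good p0 (\<rho> p0) (h p0) (h' p0)"
    by metis
  have "compact (frontier S \<inter> K)" using K by (simp add: closed_Int_compact)
  moreover have "frontier S \<inter> K \<subseteq> (\<Union>p0\<in>frontier S \<inter> K. ball p0 (\<rho> p0))"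
  proof
    fix p assume p: "p \<in> frontier S \<inter> K"
    have "\<rho> p > 0" using good[OF p] unfolding good_def by (rule conjunct1)
    then show "p \<in> (\<Union>p0\<in>frontier S \<inter> K. ball p0 (\<rho> p0))" using p centre_in_ball by blast
  qed
  ultimately obtain I where I: "I \<subseteq> frontier S \<inter> K" "finite I" "frontier S \<inter> K \<subseteq> (\<Union>p0\<in>I. ball p0 (\<rho> p0))"
    using compactE_image[of "frontier S \<inter> K" "frontier S \<inter> K" "\<lambda>p0. ball p0 (\<rho> p0)"] open_ball by metis
  have gI: "good i (\<rho> i) (h i) (h' i)" if "i \<in> I" for i using good I(1) that by blast
  have g1: "\<And>i j. i \<in> I \<Longrightarrow> C1_deriv S (h i j) (h' i j)"
    and g2: "\<And>i j p. i \<in> I \<Longrightarrow> p \<in> S \<Longrightarrow> 0 \<le> h i j p \<and> h i j p \<le> 1"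
    and g3: "\<And>i p. i \<in> I \<Longrightarrow> p \<in> S \<Longrightarrow> \<forall>\<^sub>F j in sequentially. h i j p = 1"
    and g4: "\<And>i j p. i \<in> I \<Longrightarrow> p \<in> ball i (\<rho> i) \<Longrightarrow> p \<in> frontier S \<Longrightarrow>
        \<exists>T. open T \<and> p \<in> T \<and> (\<forall>q\<in>T \<inter> S. h i j q = 0)"
    and g5: "\<And>i e. i \<in> I \<Longrightarrow> e > 0 \<Longrightarrow> \<forall>\<^sub>F j in sequentially. \<exists>A. (\<forall>p\<in>S. - h' i j p (Q p) \<le> A p) \<and> (\<forall>p. 0 \<le> A p)
        \<and> A \<in> borel_measurable borel \<and> (\<integral>\<^sup>+p\<in>S. ennreal (A p) \<partial>lborel) \<le> ennreal e"
    using gI[unfolded good_def, THEN conjunct2, THEN conjunct1]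
      gI[unfolded good_def, THEN conjunct2, THEN conjunct2, THEN conjunct1]
      gI[unfolded good_def, THEN conjunct2, THEN conjunct2, THEN conjunct2, THEN conjunct1]
      gI[unfolded good_def, THEN conjunct2, THEN conjunct2, THEN conjunct2, THEN conjunct2, THEN conjunct1]
      gI[unfolded good_def, THEN conjunct2, THEN conjunct2, THEN conjunct2, THEN conjunct2, THEN conjunct2]
    by simp_all
  define H where "H j p = (\<Prod>i\<in>I. h i j p)" for j p
  define H' where "H' j p v = (\<Sum>i\<in>I. h' i j p v * (\<Prod>l\<in>I - {i}. h l j p))" for j p v
  have HC: "C1_deriv S (H j) (H' j)" for j
    unfolding H_def[abs_def] H'_def[abs_def] by (rule C1_deriv_prod[OF g1])
  have H01: "0 \<le> H j p \<and> H j p \<le> 1" if "p \<in> S" for j p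
    unfolding H_def using g2 that by (auto intro!: prod_nonneg prod_le_1)
  have Hev: "\<forall>\<^sub>F j in sequentially. H j p = 1" if "p \<in> S" for p
  proof -
    have "\<forall>\<^sub>F j in sequentially. \<forall>i\<in>I. h i j p = 1"
      using I(2) g3 that by (simp add: eventually_ball_finite)
    then show ?thesis by eventually_elim (simp add: H_def)
  qed
  have HL: "\<exists>L. compact L \<and> L \<subseteq> S \<and> (\<forall>p\<in>S \<inter> K - L. H j p = 0)" for j
  proof -
    \<comment> \<open>Near each point of \<open>frontier S \<inter> K\<close> some factor vanishes
      on S, so the closure cannot reach the boundary: the part of the support of H_j in K is compact
      in S.\<close>
    define L where "L = closure {p\<in>S \<inter> K. H j p \<noteq> 0}"
    have LK: "L \<subseteq> K" unfolding L_def using K by (intro closure_minimal) (auto simp: compact_imp_closed)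
    then have "L = K \<inter> L" by auto
    then have "compact L" using K compact_Int_closed[of K L] by (simp add: L_def)
    moreover have "L \<subseteq> S"
    proof
      fix p assume p: "p \<in> L"
      show "p \<in> S"
      proof (rule ccontr)
        assume "p \<notin> S"
        moreover have "p \<in> closure S" 
          using p closure_mono[of "{p\<in>S \<inter> K. H j p \<noteq> 0}" S] unfolding L_def by auto
        ultimately have fr: "p \<in> frontier S \<inter> K" using p LK S by (auto simp: frontier_def interior_open)
        then obtain i where i: "i \<in> I" "p \<in> ball i (\<rho> i)" using I(3) by blast
        then obtain T where T: "open T" "p \<in> T" "\<forall>q\<in>T \<inter> S. h i j q = 0" using g4 fr by blast
        have "T \<inter> {p\<in>S \<inter> K. H j p \<noteq> 0} = {}"
          using T(3) i(1) I(2) by (auto simp: H_def)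
        then show False using p T(1,2) unfolding L_def by (meson closure_iff_nhds_not_empty disjoint_iff order_refl)
      qed
    qed
    moreover have "\<forall>p\<in>S \<inter> K - L. H j p = 0"
      using closure_subset[of "{p\<in>S \<inter> K. H j p \<noteq> 0}"] by (auto simp: L_def)
    ultimately show ?thesis by blast
  qed
  have HA: "\<forall>\<^sub>F j in sequentially. \<exists>A. (\<forall>p\<in>S. - H' j p (Q p) \<le> A p) \<and> (\<forall>p. 0 \<le> A p)
        \<and> A \<in> borel_measurable borel \<and> (\<integral>\<^sup>+p\<in>S. ennreal (A p) \<partial>lborel) \<le> ennreal e" if e: "e > 0" for e
  proof -
    define e1 where "e1 = e / (real (card I) + 1)"
    have e1: "e1 > 0" using e by (simp add: e1_def)
    have "\<forall>\<^sub>F j in sequentially. \<forall>i\<in>I. \<exists>A. (\<forall>p\<in>S. - h' i j p (Q p) \<le> A p) \<and> (\<forall>p. 0 \<le> A p)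
        \<and> A \<in> borel_measurable borel \<and> (\<integral>\<^sup>+p\<in>S. ennreal (A p) \<partial>lborel) \<le> ennreal e1"
      using I(2) g5[OF _ e1] by (simp add: eventually_ball_finite)
    then show ?thesis
    proof eventually_elim
      case (elim j)
      then obtain A where A: "\<And>i p. i \<in> I \<Longrightarrow> p \<in> S \<Longrightarrow> - h' i j p (Q p) \<le> A i p"
        "\<And>i p. i \<in> I \<Longrightarrow> 0 \<le> A i p" "\<And>i. i \<in> I \<Longrightarrow> A i \<in> borel_measurable borel"
        "\<And>i. i \<in> I \<Longrightarrow> (\<integral>\<^sup>+p\<in>S. ennreal (A i p) \<partial>lborel) \<le> ennreal e1"
        by metis
      define B where "B p = (\<Sum>i\<in>I. A i p)" for p
      have "- H' j p (Q p) \<le> B p" if p: "p \<in> S" for p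
      proof -
        have "- H' j p (Q p) = (\<Sum>i\<in>I. - h' i j p (Q p) * (\<Prod>l\<in>I - {i}. h l j p))"
          by (simp add: H'_def sum_negf)
        also have "\<dots> \<le> (\<Sum>i\<in>I. A i p)"
        proof (rule sum_mono)
          fix i assume i: "i \<in> I"
          have P: "0 \<le> (\<Prod>l\<in>I - {i}. h l j p)" "(\<Prod>l\<in>I - {i}. h l j p) \<le> 1"
            using g2 p by (auto intro!: prod_nonneg prod_le_1)
          have "- h' i j p (Q p) * (\<Prod>l\<in>I - {i}. h l j p) \<le> A i p * (\<Prod>l\<in>I - {i}. h l j p)"
            using A(1)[OF i p] P by (intro mult_right_mono)
          also have "\<dots> \<le> A i p" using P A(2)[OF i] by (simp add: mult_left_le)
          finally show "- h' i j p (Q p) * (\<Prod>l\<in>I - {i}. h l j p) \<le> A i p" .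
        qed
        finally show ?thesis by (simp add: B_def)
      qed
      moreover have "0 \<le> B p" for p unfolding B_def using A(2) by (intro sum_nonneg)
      moreover have "B \<in> borel_measurable borel" unfolding B_def[abs_def] using A(3) by simp
      moreover have "(\<integral>\<^sup>+p\<in>S. ennreal (B p) \<partial>lborel) \<le> ennreal e"
      proof -
        have [measurable]: "S \<in> sets borel" using S by simp
        have "(\<integral>\<^sup>+p\<in>S. ennreal (B p) \<partial>lborel) = (\<integral>\<^sup>+p. (\<Sum>i\<in>I. ennreal (A i p) * indicator S p) \<partial>lborel)"
          unfolding B_def using A(2) by (intro nn_integral_cong) (simp add: sum_distrib_right[symmetric] sum_nonneg)
        also have "\<dots> = (\<Sum>i\<in>I. \<integral>\<^sup>+p\<in>S. ennreal (A i p) \<partial>lborel)"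
          using A(3) by (intro nn_integral_sum) (auto intro!: borel_measurable_times_ennreal)
        also have "\<dots> \<le> (\<Sum>i\<in>I. ennreal e1)" using A(4) by (intro sum_mono)
        also have "\<dots> = ennreal (real (card I) * e1)"
          using e1 by (simp add: ennreal_mult' ennreal_of_nat_eq_real_of_nat)
        also have "\<dots> \<le> ennreal e"
          using e by (intro ennreal_leI) (simp add: e1_def field_simps)
        finally show ?thesis .
      qed
      ultimately show ?case by blast
    qed
  qed
  show ?thesis by (rule that[of H H', OF HC H01 Hev HL HA])
qed

section \<open>A divergence inequality\<close>

text \<open>Fatou's lemma for cutoffs that equal 1 at each given point after finitely many steps.
  The bound on the integrals may fail by an arbitrarily small e, as it does for the boundary
  layers.\<close>

lemma nn_integral_le_of_eventually:
  fixes u :: "nat \<Rightarrow> 'a \<Rightarrow> ennreal"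
  assumes m: "\<And>n. u n \<in> borel_measurable M"
    and ev: "\<And>p. \<forall>\<^sub>F n in sequentially. u n p = v p"
    and le: "\<And>e::real. e > 0 \<Longrightarrow> \<forall>\<^sub>F n in sequentially. (\<integral>\<^sup>+p. u n p \<partial>M) \<le> B + ennreal e"
  shows "(\<integral>\<^sup>+p. v p \<partial>M) \<le> B"
proof (rule ennreal_le_epsilon)
  fix e :: real assume e: "0 < e"
  have "liminf (\<lambda>n. u n p) = v p" for p
    using ev by (intro lim_imp_Liminf tendsto_eventually) auto
  then have "(\<integral>\<^sup>+p. v p \<partial>M) = (\<integral>\<^sup>+p. liminf (\<lambda>n. u n p) \<partial>M)" by simp
  also have "\<dots> \<le> liminf (\<lambda>n. \<integral>\<^sup>+p. u n p \<partial>M)" by (rule nn_integral_liminf[OF m])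
  also have "\<dots> \<le> limsup (\<lambda>n. \<integral>\<^sup>+p. u n p \<partial>M)" by (rule Liminf_le_Limsup) simp
  also have "\<dots> \<le> B + ennreal e" by (rule Limsup_bounded[OF le[OF e]])
  finally show "(\<integral>\<^sup>+p. v p \<partial>M) \<le> B + ennreal e" .
qed

text \<open>X may take both signs. Its positive part has the larger integral, and
  \<open>ennreal\<close> discards the negative values on the right.\<close>

lemma ennreal_integral_le_nn_integral:
  fixes X :: "'a \<Rightarrow> real"
  assumes "integrable M X"
  shows "ennreal (\<integral>p. X p \<partial>M) \<le> (\<integral>\<^sup>+p. ennreal (X p) \<partial>M)"
proof -
  have i: "integrable M (\<lambda>p. max 0 (X p))" using assms by auto
  have "ennreal (\<integral>p. X p \<partial>M) \<le> ennreal (\<integral>p. max 0 (X p) \<partial>M)"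
    by (intro ennreal_leI integral_mono assms i) auto
  also have "\<dots> = (\<integral>\<^sup>+p. ennreal (max 0 (X p)) \<partial>M)"
    using nn_integral_eq_integral[OF i] by simp
  also have "\<dots> = (\<integral>\<^sup>+p. ennreal (X p) \<partial>M)"
    by (intro nn_integral_cong) (auto simp: max_def ennreal_neg)
  finally show ?thesis .
qed

lemma C1_deriv_continuous_trace: "C1_deriv S J J' \<Longrightarrow> continuous_on S (\<lambda>p. trace_of (J' p))"
  unfolding trace_of_def by (intro continuous_intros C1_deriv_continuous_deriv)

text \<open>Only the sign of the normal component of the field on the boundary is needed, so no surface measure appears.\<close>

lemma divergence_inequality:
  fixes J :: "'a::euclidean_space \<Rightarrow> 'a"
  assumes S: "open S" and J: "C1_deriv S J J'"
    and g: "C1_deriv UNIV g g'" "\<And>p. 0 \<le> g p" and K: "compact K" and gK: "\<And>p. p \<notin> K \<Longrightarrow> g p = 0"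
    and Qc: "continuous_on (closure S) (\<lambda>p. g p *\<^sub>R J p)"
    and bd: "\<And>p0. p0 \<in> frontier S \<inter> K \<Longrightarrow> \<exists>V \<Phi> G. open V \<and> p0 \<in> V \<and> C1_deriv V \<Phi> (\<lambda>p v. G p \<bullet> v)
       \<and> G p0 \<noteq> 0 \<and> S \<inter> V = {p\<in>V. \<Phi> p < 0} \<and> (\<forall>p\<in>V \<inter> frontier S. (g p *\<^sub>R J p) \<bullet> G p \<le> 0)"
    and F: "continuous_on S F" "\<And>p. p \<in> S \<Longrightarrow> 0 \<le> F p" "\<And>p. p \<in> S \<Longrightarrow> 0 \<le> F p + trace_of (J' p)"
  shows "(\<integral>\<^sup>+p\<in>S. ennreal (g p * (F p + trace_of (J' p))) \<partial>lborel)
     \<le> (\<integral>\<^sup>+p\<in>S. ennreal (g p * F p) \<partial>lborel) + (\<integral>\<^sup>+p\<in>S. ennreal \<bar>g' p (J p)\<bar> \<partial>lborel)"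
proof -
  obtain H H' where H: "\<And>j::nat. C1_deriv S (H j) (H' j)"
    and H01: "\<And>j p. p \<in> S \<Longrightarrow> 0 \<le> H j p \<and> H j p \<le> (1::real)"
    and Hev: "\<And>p. p \<in> S \<Longrightarrow> \<forall>\<^sub>F j in sequentially. H j p = 1"
    and HL: "\<And>j. \<exists>L. compact L \<and> L \<subseteq> S \<and> (\<forall>p\<in>S \<inter> K - L. H j p = 0)"
    and HA: "\<And>e. e > 0 \<Longrightarrow> \<forall>\<^sub>F j in sequentially. \<exists>A. (\<forall>p\<in>S. - H' j p (g p *\<^sub>R J p) \<le> A p) \<and> (\<forall>p. 0 \<le> A p)
        \<and> A \<in> borel_measurable borel \<and> (\<integral>\<^sup>+p\<in>S. ennreal (A p) \<partial>lborel) \<le> ennreal e"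
    using boundary_cutoffs[OF S Qc K bd] by blast
  have gc: "continuous_on S g" using C1_deriv_continuous_on[OF g(1)] continuous_on_subset by blast
  have Hc: "continuous_on S (H j)" for j by (rule C1_deriv_continuous_on[OF H])
  have trc: "continuous_on S (\<lambda>p. trace_of (J' p))" by (rule C1_deriv_continuous_trace[OF J])
  have gJ: "continuous_on S (\<lambda>p. g' p (J p))"
  proof -
    have "g' p (J p) = (\<Sum>b\<in>Basis. (J p \<bullet> b) * g' p b)" for p
    proof -
      have "g' p (J p) = g' p (\<Sum>b\<in>Basis. (J p \<bullet> b) *\<^sub>R b)" by (simp add: euclidean_representation)
      also have "\<dots> = (\<Sum>b\<in>Basis. (J p \<bullet> b) * g' p b)"
        using C1_deriv_linear[OF g(1), of p] by (simp add: linear_sum linear_cmul)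
      finally show ?thesis .
    qed
    then show ?thesis
      using C1_deriv_continuous_on[OF J] C1_deriv_continuous_deriv[OF g(1)]
      by (auto intro!: continuous_intros intro: continuous_on_subset)
  qed
  have [measurable]: "S \<in> sets borel" using S by simp
  have m1: "(\<lambda>p. ennreal (g p * F p) * indicator S p) \<in> borel_measurable lborel"
    by (intro borel_measurable_indicator_on_open[OF S] continuous_intros gc F)
  have m2: "(\<lambda>p. ennreal \<bar>g' p (J p)\<bar> * indicator S p) \<in> borel_measurable lborel"
    by (intro borel_measurable_indicator_on_open[OF S] continuous_intros gJ)
  show ?thesis
  proof (rule nn_integral_le_of_eventually[where u="\<lambda>j p. ennreal (g p * H j p * (F p + trace_of (J' p))) * indicator S p"])
    show "(\<lambda>p. ennreal (g p * H j p * (F p + trace_of (J' p))) * indicator S p) \<in> borel_measurable lborel" for j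
      by (intro borel_measurable_indicator_on_open[OF S] continuous_intros gc Hc F trc)
    show "\<forall>\<^sub>F j in sequentially. ennreal (g p * H j p * (F p + trace_of (J' p))) * indicator S p
       = ennreal (g p * (F p + trace_of (J' p))) * indicator S p" for p
    proof (cases "p \<in> S")
      case True
      show ?thesis by (rule eventually_mono[OF Hev[OF True]]) simp
    qed simp
    fix e :: real assume e: "e > 0"
    show "\<forall>\<^sub>F j in sequentially. (\<integral>\<^sup>+p\<in>S. ennreal (g p * H j p * (F p + trace_of (J' p))) \<partial>lborel)
      \<le> (\<integral>\<^sup>+p\<in>S. ennreal (g p * F p) \<partial>lborel) + (\<integral>\<^sup>+p\<in>S. ennreal \<bar>g' p (J p)\<bar> \<partial>lborel) + ennreal e"
      using HA[OF e]
    proof eventually_elim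
      case (elim j)
      then obtain A where A: "\<And>p. p \<in> S \<Longrightarrow> - H' j p (g p *\<^sub>R J p) \<le> A p" "\<And>p. 0 \<le> A p"
        "A \<in> borel_measurable borel" "(\<integral>\<^sup>+p\<in>S. ennreal (A p) \<partial>lborel) \<le> ennreal e" by blast
      from HL[of j] obtain L where L: "compact L" "L \<subseteq> S" and L3: "\<forall>p\<in>S \<inter> K - L. H j p = 0" by auto
      \<comment> \<open>The field s J is supported in a compact part of S, so s div J + s'(J) has
        integral zero and s div J can be traded for - s'(J), which contains no second
        derivatives.\<close>
      define s where "s p = g p * H j p" for p
      define s' where "s' p v = g p * H' j p v + g' p v * H j p" for p v
      have sC: "C1_deriv S s s'" unfolding s_def[abs_def] s'_def[abs_def]
        by (rule C1_deriv_mult[OF C1_deriv_subset[OF g(1)] H]) simp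
      have s0: "s p = 0" if "p \<in> S - L" for p
        using L3 gK[of p] that by (cases "p \<in> K") (auto simp: s_def)
      define T' where "T' p v = s p *\<^sub>R J' p v + s' p v *\<^sub>R J p" for p v
      have TC: "C1_deriv S (\<lambda>p. s p *\<^sub>R J p) T'"
        unfolding T'_def[abs_def] by (rule C1_deriv_scaleR[OF sC J])
      have T: "trace_of (T' p) = s p * trace_of (J' p) + s' p (J p)" if "p \<in> S" for p
        unfolding T'_def
        by (simp add: trace_of_add trace_of_scaleR trace_of_rank_one[OF C1_deriv_linear[OF sC that]])
      have I: "integrable lborel (\<lambda>p. if p \<in> S then trace_of (T' p) else 0)"
        "(\<integral>p. (if p \<in> S then trace_of (T' p) else 0) \<partial>lborel) = 0"
        using integral_divergence_zero[OF TC S L(1,2)] s0 by auto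
      define P where "P p = (if p \<in> S then s p * (F p + trace_of (J' p)) else 0)" for p
      have Pi: "integrable lborel P" unfolding P_def
        by (rule integrable_compact_support_on_open[OF S _ L(1,2)])
          (use s0 in \<open>auto intro!: continuous_intros F trc C1_deriv_continuous_on[OF sC]\<close>)
      have P0: "0 \<le> P p" for p unfolding P_def s_def using F(3) g(2) H01 by auto
      define X where "X p = P p - (if p \<in> S then trace_of (T' p) else 0)" for p
      have Xi: "integrable lborel X" unfolding X_def[abs_def] using Pi I(1) by simp
      have "(\<integral>\<^sup>+p\<in>S. ennreal (g p * H j p * (F p + trace_of (J' p))) \<partial>lborel) = (\<integral>\<^sup>+p. ennreal (P p) \<partial>lborel)"
        by (intro nn_integral_cong) (auto simp: P_def s_def indicator_def)
      also have "\<dots> = ennreal (\<integral>p. P p \<partial>lborel)"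
        using nn_integral_eq_integral[OF Pi] P0 by simp
      also have "\<dots> = ennreal (\<integral>p. X p \<partial>lborel)"
        unfolding X_def[abs_def] using Pi I by simp
      also have "\<dots> \<le> (\<integral>\<^sup>+p. ennreal (X p) \<partial>lborel)" by (rule ennreal_integral_le_nn_integral[OF Xi])
      also have "\<dots> \<le> (\<integral>\<^sup>+p. (ennreal (g p * F p) * indicator S p + ennreal \<bar>g' p (J p)\<bar> * indicator S p)
           + ennreal (A p) * indicator S p \<partial>lborel)"
      proof (rule nn_integral_mono)
        fix p
        show "ennreal (X p) \<le> (ennreal (g p * F p) * indicator S p + ennreal \<bar>g' p (J p)\<bar> * indicator S p)
           + ennreal (A p) * indicator S p"
        proof (cases "p \<in> S")
          case True
          have "X p = s p * F p - s' p (J p)" using True by (simp add: X_def P_def T algebra_simps)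
          also have "\<dots> \<le> g p * F p + \<bar>g' p (J p)\<bar> + A p"
          proof -
            have 1: "s p * F p \<le> g p * F p"
              unfolding s_def using H01[OF True, of j] F(2)[OF True] g(2)[of p]
              by (intro mult_right_mono mult_left_le) auto
            \<comment> \<open>Linearity moves g into the argument of H_j', where the bound by A
              applies. That bound holds only from above, which is why the outcome is an
              inequality.\<close>
            have "H' j p (g p *\<^sub>R J p) = g p * H' j p (J p)"
              using C1_deriv_linear[OF H True] by (simp add: linear_cmul)
            then have 2: "- (g p * H' j p (J p)) \<le> A p" using A(1)[OF True] by simp
            have "\<bar>g' p (J p) * H j p\<bar> \<le> \<bar>g' p (J p)\<bar> * 1"
              unfolding abs_mult using H01[OF True, of j] by (intro mult_left_mono) auto
            then show ?thesis using 1 2 by (simp add: s'_def)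
          qed
          finally have "ennreal (X p) \<le> ennreal (g p * F p + \<bar>g' p (J p)\<bar> + A p)" by (rule ennreal_leI)
          then show ?thesis using True F(2)[OF True] g(2)[of p] A(2)[of p]
            by (simp add: ennreal_plus[symmetric] del: ennreal_plus)
        next
          case False
          then show ?thesis by (simp add: X_def P_def)
        qed
      qed
      also have "\<dots> = (\<integral>\<^sup>+p\<in>S. ennreal (g p * F p) \<partial>lborel) + (\<integral>\<^sup>+p\<in>S. ennreal \<bar>g' p (J p)\<bar> \<partial>lborel)
          + (\<integral>\<^sup>+p\<in>S. ennreal (A p) \<partial>lborel)"
      proof -
        have m3: "(\<lambda>p. ennreal (A p) * indicator S p) \<in> borel_measurable lborel" using A(3) by simp
        show ?thesis
          by (simp add: nn_integral_add[OF borel_measurable_add[OF m1 m2] m3] nn_integral_add[OF m1 m2])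
      qed
      also have "\<dots> \<le> (\<integral>\<^sup>+p\<in>S. ennreal (g p * F p) \<partial>lborel) + (\<integral>\<^sup>+p\<in>S. ennreal \<bar>g' p (J p)\<bar> \<partial>lborel) + ennreal e"
        by (intro add_left_mono A(4))
      finally show ?case .
    qed
  qed
qed

section \<open>The flat metric as a reflection, and Euclidean gradients\<close>

definition mink :: "'a::real_inner \<times> 'b::real_inner \<Rightarrow> 'a \<times> 'b" where
  "mink p = (- fst p, snd p)"

lemma mink_mink [simp]: "mink (mink p) = p"
  by (simp add: mink_def)

text \<open>Metric products are written as Euclidean inner products with \<open>mink\<close>; its
  symmetry replaces the raising and lowering of indices.\<close>

lemma inner_mink: "mink p \<bullet> q = p \<bullet> mink q"
  by (simp add: mink_def inner_prod_def)

lemma norm_mink [simp]: "norm (mink p) = norm p"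
  by (simp add: mink_def norm_prod_def)

lemma bounded_linear_mink: "bounded_linear mink"
  unfolding mink_def[abs_def]
  by (intro bounded_linear_Pair bounded_linear_minus bounded_linear_fst bounded_linear_snd)

lemma ff_eq: "ff p = (p \<bullet> mink p) / 4"
  by (simp add: ff_def uu_def vv_def tau_def rr_def mink_def inner_prod_def
      power2_norm_eq_inner[symmetric] power2_eq_square field_simps)

lemma C1_deriv_ff: "C1_deriv S ff (\<lambda>p v. (mink p \<bullet> v) / 2)"
proof -
  have "C1_deriv S (\<lambda>p. (1 / 4) * (p \<bullet> mink p)) (\<lambda>p v. (1 / 4) * (p \<bullet> mink v + v \<bullet> mink p) + 0 * (p \<bullet> mink p))"
    by (intro C1_deriv_mult C1_deriv_const C1_deriv_inner C1_deriv_bounded_linear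
        bounded_linear_ident bounded_linear_mink)
  then have "C1_deriv S ff (\<lambda>p v. (1 / 4) * (p \<bullet> mink v + v \<bullet> mink p) + 0 * (p \<bullet> mink p))"
    by (simp add: ff_eq[abs_def])
  then show ?thesis
  proof (rule C1_deriv_eq)
    fix p v :: "(real^'a) \<times> (real^'b)"
    have "v \<bullet> mink p = mink p \<bullet> v" "p \<bullet> mink v = mink p \<bullet> v"
      by (rule inner_commute, rule inner_mink[symmetric])
    then show "(1 / 4) * (p \<bullet> mink v + v \<bullet> mink p) + 0 * (p \<bullet> mink p) = (mink p \<bullet> v) / 2" by simp
  qed
qed

lemma continuous_on_ff: "continuous_on A ff"
  by (rule C1_deriv_continuous_on[OF C1_deriv_ff])

lemma open_DD: "open (DD :: ((real^'m) \<times> (real^'n)) set)"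
proof -
  have "open (UNIV \<inter> ff -` {0<..} :: ((real^'m) \<times> (real^'n)) set)"
    by (rule continuous_open_preimage[OF continuous_on_ff open_UNIV open_greaterThan])
  then show ?thesis by (simp add: DD_def vimage_def)
qed

lemma ff_pos_norm_less: "ff p > 0 \<Longrightarrow> norm (fst p) < norm (snd p)"
  using norm_lt[of "fst p" "snd p"] by (simp add: ff_eq mink_def inner_prod_def)

lemma norm_le_of_ff_pos:
  assumes "ff p > 0" shows "norm p \<le> 2 * norm (snd p)"
  using norm_Pair_le[of "fst p" "snd p"] ff_pos_norm_less[OF assms] by simp

text \<open>The differential of z as a vector with respect to the Euclidean product. The gradient
  for the metric is \<open>mink (egrad z p)\<close>.\<close>

definition egrad :: "('a::euclidean_space \<Rightarrow> real) \<Rightarrow> 'a \<Rightarrow> 'a" where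
  "egrad z p = (\<Sum>b\<in>Basis. dder z b p *\<^sub>R b)"

lemma egrad_inner:
  assumes "z differentiable (at p)"
  shows "(z has_derivative (\<lambda>v. egrad z p \<bullet> v)) (at p)" "dder z v p = egrad z p \<bullet> v"
proof -
  have d: "(z has_derivative frechet_derivative z (at p)) (at p)"
    using assms frechet_derivative_works by blast
  have "frechet_derivative z (at p) v = egrad z p \<bullet> v" for v
  proof -
    have l: "linear (frechet_derivative z (at p))" using d has_derivative_linear by blast
    have "frechet_derivative z (at p) v = frechet_derivative z (at p) (\<Sum>b\<in>Basis. (v \<bullet> b) *\<^sub>R b)"
      by (simp add: euclidean_representation)
    also have "\<dots> = (\<Sum>b\<in>Basis. (v \<bullet> b) * frechet_derivative z (at p) b)"
      using l by (simp add: linear_sum linear_cmul)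
    finally show ?thesis
      by (simp add: egrad_def dder_def inner_sum_left mult.commute inner_commute[of v])
  qed
  then have "frechet_derivative z (at p) = (\<lambda>v. egrad z p \<bullet> v)" by blast
  then show "(z has_derivative (\<lambda>v. egrad z p \<bullet> v)) (at p)" "dder z v p = egrad z p \<bullet> v"
    using d by (simp_all add: dder_def)
qed

lemma Ck_1_C1_deriv:
  assumes "Ck 1 S z"
  shows "C1_deriv S z (\<lambda>p v. egrad z p \<bullet> v)"
proof -
  have 1: "\<And>p. p \<in> S \<Longrightarrow> z differentiable (at p)" and 2: "\<And>h. continuous_on S (dder z h)"
    using assms by (auto simp: One_nat_def)
  show ?thesis
  proof (rule C1_derivI)
    show "continuous_on S (\<lambda>p. egrad z p \<bullet> v)" for v
      by (rule continuous_on_eq[OF 2[of v]]) (simp add: egrad_inner 1)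
  qed (simp add: egrad_inner 1)
qed

lemma grad_eq_egrad:
  assumes "\<phi> differentiable (at y)" shows "grad \<phi> y = egrad \<phi> y"
  unfolding vec_eq_iff grad_def by (simp add: egrad_inner(2)[OF assms] inner_axis)

text \<open>The value is nonnegative because the point is not in the open set \<Omega>, and
  nonpositive because points with \<phi> > 0 have a neighbourhood free of \<Omega>.\<close>

lemma local_defining_frontier_zero:
  assumes "local_defining \<Omega> x0 V \<phi>" "open \<Omega>" "y \<in> frontier \<Omega>" "y \<in> V"
  shows "\<phi> y = 0"
proof -
  have V: "open V" "\<Omega> \<inter> V = {y\<in>V. \<phi> y < 0}" and "smooth_on V \<phi>" using assms(1) by (auto simp: local_defining_def)
  then have "Ck 1 V \<phi>" by (simp add: smooth_on_def)
  then have c: "continuous_on V \<phi>" using C1_deriv_continuous_on[OF Ck_1_C1_deriv] by blast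
  have "y \<notin> \<Omega>" "y \<in> closure \<Omega>" using assms(2,3) by (auto simp: frontier_def interior_open)
  then have "\<phi> y \<ge> 0" using V(2) assms(4) by force
  moreover have "\<phi> y \<le> 0"
  proof (rule ccontr)
    assume "\<not> \<phi> y \<le> 0"
    then have "y \<in> V \<inter> \<phi> -` {0<..}" using assms(4) by auto
    moreover have "open (V \<inter> \<phi> -` {0<..})" by (rule continuous_open_preimage[OF c V(1) open_greaterThan])
    ultimately obtain x where "x \<in> \<Omega>" "x \<in> V \<inter> \<phi> -` {0<..}"
      using \<open>y \<in> closure \<Omega>\<close> closure_iff_nhds_not_empty by (metis disjoint_iff order_refl)
    then show False using V(2) by force
  qed
  ultimately show ?thesis by simp
qed

lemma frontier_cylinder: "frontier (UNIV \<times> \<Omega>) = UNIV \<times> frontier \<Omega>"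
  by (auto simp: frontier_def closure_Times interior_Times)

text \<open>The boundary of S also contains parts of the null cone, where no sign is known. The
  cutoff \<open>cutoff (N * ff p)\<close> causes an error of size N |p| |J|, which lives where f <=
  2 / N. Since |p| <= 2 R on S, the bound |J| <= C f^2 makes it O(1 / N), and S has finite
  volume.\<close>

lemma divergence_inequality_cone:
  fixes J :: "(real^'m) \<times> (real^'n) \<Rightarrow> (real^'m) \<times> (real^'n)"
  assumes \<Omega>: "open \<Omega>" "smooth_boundary \<Omega>" and R: "R > 0" "\<forall>x\<in>\<Omega>. norm x < R"
    and S: "S = (UNIV \<times> \<Omega>) \<inter> DD"
    and J: "C1_deriv S J J'" and Jc: "continuous_on (closure (UNIV \<times> \<Omega>) \<inter> DD) J"
    and JC: "\<And>p. p \<in> S \<Longrightarrow> norm (J p) \<le> C * (ff p)\<^sup>2"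
    and bd: "\<And>p V \<phi>. p \<in> frontier (UNIV \<times> \<Omega>) \<Longrightarrow> p \<in> DD \<Longrightarrow> local_defining \<Omega> (snd p) V \<phi> \<Longrightarrow> snd (J p) \<bullet> grad \<phi> (snd p) \<le> 0"
    and F: "continuous_on S F" "\<And>p. p \<in> S \<Longrightarrow> 0 \<le> F p" "\<And>p. p \<in> S \<Longrightarrow> 0 \<le> F p + trace_of (J' p)"
  shows "(\<integral>\<^sup>+p\<in>S. ennreal (F p + trace_of (J' p)) \<partial>lborel) \<le> (\<integral>\<^sup>+p\<in>S. ennreal (F p) \<partial>lborel)"
proof -
  have So: "open S" unfolding S using \<Omega>(1) open_DD by (intro open_Int open_Times) auto
  have SR: "norm (snd p) < R" "ff p > 0" "norm p \<le> 2 * R" if "p \<in> S" for p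
  proof -
    show 1: "norm (snd p) < R" "ff p > 0" using that R(2) by (auto simp: S DD_def)
    show "norm p \<le> 2 * R" using norm_le_of_ff_pos[OF 1(2)] 1(1) by simp
  qed
  obtain M where M: "M > 0" "\<And>s. cutoff' s \<le> M" using cutoff'_bounded by blast
  define N where "N n = real (Suc n)" for n
  have N: "N n > 0" for n by (simp add: N_def)
  \<comment> \<open>Equal to 1 on S and hence without effect on the integrals. Together with the
    cutoff in f it makes the support of \<open>g\<close> compact, since f > 0 bounds |p| by twice
    the spatial radius.\<close>
  define \<rho> where "\<rho> p = cutoff (3 - (1 / R\<^sup>2) * (snd p \<bullet> snd p))" for p :: "(real^'m) \<times> (real^'n)"
  define \<rho>' where "\<rho>' p v = cutoff' (3 - (1 / R\<^sup>2) * (snd p \<bullet> snd p)) * (0 - ((1 / R\<^sup>2) * (snd p \<bullet> snd v + snd v \<bullet> snd p) + 0 * (snd p \<bullet> snd p)))"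
    for p v :: "(real^'m) \<times> (real^'n)"
  have \<rho>C: "C1_deriv UNIV \<rho> \<rho>'"
    unfolding \<rho>_def[abs_def] \<rho>'_def[abs_def]
    by (intro C1_deriv_cutoff C1_deriv_diff C1_deriv_mult C1_deriv_const C1_deriv_inner
        C1_deriv_bounded_linear bounded_linear_snd)
  define \<eta> where "\<eta> n p = cutoff (N n * ff p)" for n and p :: "(real^'m) \<times> (real^'n)"
  define \<eta>' where "\<eta>' n p v = cutoff' (N n * ff p) * (N n * ((mink p \<bullet> v) / 2) + 0 * ff p)"
    for n and p v :: "(real^'m) \<times> (real^'n)"
  have \<eta>C: "C1_deriv UNIV (\<eta> n) (\<eta>' n)" for n
    unfolding \<eta>_def[abs_def] \<eta>'_def[abs_def]
    by (intro C1_deriv_cutoff C1_deriv_mult C1_deriv_const C1_deriv_ff)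
  define g where "g n p = \<eta> n p * \<rho> p" for n p
  define g' where "g' n p v = \<eta> n p * \<rho>' p v + \<eta>' n p v * \<rho> p" for n p v
  have gC: "C1_deriv UNIV (g n) (g' n)" for n
    unfolding g_def[abs_def] g'_def[abs_def] by (intro C1_deriv_mult \<eta>C \<rho>C)
  have g0: "0 \<le> g n p" and g1: "g n p \<le> 1" for n p
    unfolding g_def \<eta>_def \<rho>_def by (auto simp: cutoff_nonneg cutoff_le_1 intro!: mult_le_one)
  have \<rho>S: "\<rho> p = 1" "\<rho>' p v = 0" if "p \<in> S" for p v
  proof -
    have "(norm (snd p))\<^sup>2 \<le> R\<^sup>2" using SR(1)[OF that] by (intro power_mono) auto
    then have "2 \<le> 3 - (1 / R\<^sup>2) * (snd p \<bullet> snd p)"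
      using R(1) by (simp add: power2_norm_eq_inner)
    then show "\<rho> p = 1" "\<rho>' p v = 0" by (simp_all add: \<rho>_def \<rho>'_def cutoff_eq_1 cutoff'_eq_0)
  qed
  define K where "K n = cball 0 (4 * R) \<inter> (ff -` {1 / N n..} :: ((real^'m) \<times> (real^'n)) set)" for n
  have Kc: "compact (K n)" for n
  proof -
    have "closed (UNIV \<inter> ff -` {1 / N n..} :: ((real^'m) \<times> (real^'n)) set)"
      by (rule continuous_closed_preimage[OF continuous_on_ff]) auto
    then show ?thesis unfolding K_def by (intro compact_Int_closed) auto
  qed
  have gK: "g n p = 0" if "p \<notin> K n" for n p
  proof (cases "ff p \<ge> 1 / N n")
    case True
    have "1 / N n > 0" using N by simp
    then have fp: "ff p > 0" using True by linarith
    have "4 * R < norm p" using that True by (simp add: K_def)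
    then have "2 * R < norm (snd p)" using norm_le_of_ff_pos[OF fp] by linarith
    then have "(2 * R)\<^sup>2 < (norm (snd p))\<^sup>2" using R by (intro power_strict_mono) auto
    then have "4 * R\<^sup>2 < snd p \<bullet> snd p" by (simp add: power2_norm_eq_inner power_mult_distrib)
    then have "2 * R\<^sup>2 \<le> snd p \<bullet> snd p" using zero_le_power2[of R] by linarith
    then have "3 - (1 / R\<^sup>2) * (snd p \<bullet> snd p) \<le> 1" using R by (simp add: field_simps)
    then show ?thesis by (simp add: g_def \<rho>_def cutoff_eq_0)
  next
    case False
    then have "N n * ff p \<le> 1" using N[of n] by (simp add: field_simps)
    then show ?thesis by (simp add: g_def \<eta>_def cutoff_eq_0)
  qed
  have clS: "closure S \<subseteq> closure (UNIV \<times> \<Omega>)" unfolding S by (intro closure_mono) auto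
  have Qc: "continuous_on (closure S) (\<lambda>p. g n p *\<^sub>R J p)" for n
  proof -
    \<comment> \<open>Continuity is glued from two relatively open pieces of
      \<open>closure S\<close>: one inside \<open>DD\<close>, where J is continuous, and one where
      the cutoff vanishes. Nothing is known about J on the cone itself.\<close>
    define A where "A = closure S \<inter> DD"
    define B where "B = closure S \<inter> (ff -` {..< 1 / N n})"
    have "1 / N n > 0" using N by simp
    then have "ff p > 0 \<or> ff p < 1 / N n" for p :: "(real^'m) \<times> (real^'n)" by linarith
    then have AB: "A \<union> B = closure S" by (auto simp: A_def B_def DD_def)
    have "open (UNIV \<inter> ff -` {..< 1 / N n} :: ((real^'m) \<times> (real^'n)) set)"
      by (rule continuous_open_preimage[OF continuous_on_ff]) auto
    then have "openin (top_of_set (closure S)) B" unfolding B_def by (simp add: openin_open_Int)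
    then have "openin (top_of_set (A \<union> B)) B" by (simp only: AB)
    moreover have "openin (top_of_set (closure S)) A" unfolding A_def by (simp add: openin_open_Int open_DD)
    then have "openin (top_of_set (A \<union> B)) A" by (simp only: AB)
    moreover have "continuous_on A (\<lambda>p. g n p *\<^sub>R J p)" unfolding A_def
      by (intro continuous_intros continuous_on_subset[OF C1_deriv_continuous_on[OF gC]] continuous_on_subset[OF Jc])
        (use clS in auto)
    moreover have "continuous_on B (\<lambda>p. g n p *\<^sub>R J p)"
    proof (rule continuous_on_eq[of _ "\<lambda>_. 0"])
      show "0 = g n p *\<^sub>R J p" if "p \<in> B" for p
        using gK[of p n] that by (auto simp: B_def K_def)
    qed simp
    ultimately have "continuous_on (A \<union> B) (\<lambda>p. g n p *\<^sub>R J p)"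
      by (intro continuous_on_Un_local_open)
    then show ?thesis by (simp add: AB)
  qed
  have frS: "p \<in> frontier (UNIV \<times> \<Omega>)" if "p \<in> frontier S" "p \<in> DD" for p
  proof -
    have "p \<in> closure (UNIV \<times> \<Omega>)" "p \<notin> S" using that clS So by (auto simp: frontier_def interior_open)
    then have "p \<notin> UNIV \<times> \<Omega>" using that S by auto
    moreover have "open (UNIV \<times> \<Omega> :: ((real^'m) \<times> (real^'n)) set)" using \<Omega> by (intro open_Times) auto
    ultimately show ?thesis using \<open>p \<in> closure (UNIV \<times> \<Omega>)\<close> by (simp add: frontier_def interior_open)
  qed
  have Qbd: "\<exists>V \<Phi> G. open V \<and> p0 \<in> V \<and> C1_deriv V \<Phi> (\<lambda>p v. G p \<bullet> v)
       \<and> G p0 \<noteq> 0 \<and> S \<inter> V = {p\<in>V. \<Phi> p < 0} \<and> (\<forall>p\<in>V \<inter> frontier S. (g n p *\<^sub>R J p) \<bullet> G p \<le> 0)"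
    if p0: "p0 \<in> frontier S \<inter> K n" for p0 n
  proof -
    have "1 / N n > 0" using N by simp
    moreover have "1 / N n \<le> ff p0" using p0 by (simp add: K_def)
    ultimately have "ff p0 > 0" by linarith
    then have pD: "p0 \<in> DD" by (simp add: DD_def)
    have "snd p0 \<in> frontier \<Omega>" using frS[of p0] pD p0 by (simp add: frontier_cylinder mem_Times_iff)
    then obtain V \<phi> where V: "local_defining \<Omega> (snd p0) V \<phi>" using \<Omega>(2) unfolding smooth_boundary_def by blast
    then have V': "open V" "snd p0 \<in> V" "\<And>y. y \<in> V \<Longrightarrow> grad \<phi> y \<noteq> 0" "\<Omega> \<inter> V = {y\<in>V. \<phi> y < 0}" "Ck 1 V \<phi>"
      by (auto simp: local_defining_def smooth_on_def)
    have C: "C1_deriv V \<phi> (\<lambda>y v. grad \<phi> y \<bullet> v)"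
    proof (rule C1_deriv_eq[OF Ck_1_C1_deriv[OF V'(5)]])
      show "egrad \<phi> p \<bullet> v = grad \<phi> p \<bullet> v" if "p \<in> V" for p v
        using grad_eq_egrad[of \<phi> p] V'(5) that by (auto simp: One_nat_def)
    qed
    define V1 where "V1 = (UNIV \<times> V) \<inter> (DD :: ((real^'m) \<times> (real^'n)) set)"
    have "open V1" unfolding V1_def using V'(1) open_DD by (intro open_Int open_Times) auto
    moreover have "p0 \<in> V1" unfolding V1_def using pD V'(2) by (cases p0) auto
    moreover have "C1_deriv V1 (\<lambda>p. \<phi> (snd p)) (\<lambda>p v. (0, grad \<phi> (snd p)) \<bullet> v)"
    proof (rule C1_derivI)
      fix p assume p: "p \<in> V1"
      have "(snd has_derivative snd) (at p)" by (rule bounded_linear_imp_has_derivative[OF bounded_linear_snd])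
      from has_derivative_compose[OF this C1_deriv_has_derivative[OF C]] p
      have "((\<lambda>p. \<phi> (snd p)) has_derivative (\<lambda>v. grad \<phi> (snd p) \<bullet> snd v)) (at p)" by (auto simp: V1_def)
      then show "((\<lambda>p. \<phi> (snd p)) has_derivative (\<lambda>v. (0, grad \<phi> (snd p)) \<bullet> v)) (at p)"
        by (simp add: inner_prod_def)
    next
      fix v :: "(real^'m) \<times> (real^'n)"
      have "continuous_on V1 (\<lambda>p. grad \<phi> (snd p) \<bullet> snd v)"
        by (rule continuous_on_compose2[OF C1_deriv_continuous_deriv[OF C]])
          (auto intro!: continuous_intros simp: V1_def)
      then show "continuous_on V1 (\<lambda>p. (0, grad \<phi> (snd p)) \<bullet> v)" by (simp add: inner_prod_def)
    qed
    moreover have "(0, grad \<phi> (snd p0)) \<noteq> (0 :: (real^'m) \<times> (real^'n))"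
      using V'(2,3) by (simp add: zero_prod_def)
    moreover have "S \<inter> V1 = {p\<in>V1. \<phi> (snd p) < 0}" 
    proof -
      have "y \<in> \<Omega> \<longleftrightarrow> \<phi> y < 0" if "y \<in> V" for y using V'(4) that by blast
      then show ?thesis by (auto simp: S V1_def)
    qed
    moreover have "(g n p *\<^sub>R J p) \<bullet> (0, grad \<phi> (snd p)) \<le> 0" if p: "p \<in> V1 \<inter> frontier S" for p
    proof -
      have "local_defining \<Omega> (snd p) V \<phi>" using V p by (auto simp: local_defining_def V1_def)
      then have "snd (J p) \<bullet> grad \<phi> (snd p) \<le> 0" using bd[of p V \<phi>] frS[of p] p by (auto simp: V1_def)
      then show ?thesis using g0[of n p] by (simp add: inner_prod_def mult_nonneg_nonpos)
    qed
    ultimately show ?thesis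
      by (intro exI[of _ V1] exI[of _ "\<lambda>p. \<phi> (snd p)"] exI[of _ "\<lambda>p. (0, grad \<phi> (snd p))"]) blast
  qed
  define C1 where "C1 = M * R * (4 * \<bar>C\<bar>)"
  have g'J: "\<bar>g' n p (J p)\<bar> \<le> C1 / N n" if p: "p \<in> S" for n p
  proof -
    have eq: "g' n p (J p) = cutoff' (N n * ff p) * (N n * ((mink p \<bullet> J p) / 2))"
      using p by (simp add: g'_def \<rho>S \<eta>'_def)
    show ?thesis
    proof (cases "N n * ff p \<le> 2")
      case True
      have "\<bar>mink p \<bullet> J p\<bar> \<le> norm p * norm (J p)" using Cauchy_Schwarz_ineq2[of "mink p" "J p"] by simp
      also have "\<dots> \<le> (2 * R) * (\<bar>C\<bar> * (ff p)\<^sup>2)"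
      proof (intro mult_mono)
        show "norm (J p) \<le> \<bar>C\<bar> * (ff p)\<^sup>2"
          using JC[OF p] by (smt (verit) mult_right_mono zero_le_power2)
      qed (use SR[OF p] R in auto)
      also have "\<dots> \<le> (2 * R) * (\<bar>C\<bar> * (2 / N n)\<^sup>2)"
      proof -
        have "ff p \<le> 2 / N n" using True N[of n] by (simp add: field_simps)
        then have "(ff p)\<^sup>2 \<le> (2 / N n)\<^sup>2" using SR[OF p] by (intro power_mono) auto
        then show ?thesis using R by (intro mult_left_mono) auto
      qed
      finally have 1: "\<bar>mink p \<bullet> J p\<bar> \<le> (2 * R) * (\<bar>C\<bar> * (2 / N n)\<^sup>2)" .
      have "\<bar>g' n p (J p)\<bar> = cutoff' (N n * ff p) * (N n * (\<bar>mink p \<bullet> J p\<bar> / 2))"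
        unfolding eq using N[of n] cutoff'_nonneg by (simp add: abs_mult)
      also have "\<dots> \<le> M * (N n * (((2 * R) * (\<bar>C\<bar> * (2 / N n)\<^sup>2)) / 2))"
        using 1 M N[of n] cutoff'_nonneg by (intro mult_mono) auto
      also have "\<dots> = C1 / N n" using N[of n] by (simp add: C1_def power2_eq_square field_simps)
      finally show ?thesis .
    next
      case False
      then have "g' n p (J p) = 0" unfolding eq by (simp add: cutoff'_eq_0)
      then show ?thesis using N[of n] M R by (simp add: C1_def less_imp_le)
    qed
  qed
  have C10: "C1 \<ge> 0" using M R by (simp add: C1_def less_imp_le)
  have "bounded S" unfolding bounded_iff using SR(3) by blast
  then have "emeasure lborel S < \<infinity>" by (rule emeasure_bounded_finite)
  then obtain vol where vol: "emeasure lborel S = ennreal vol" "vol \<ge> 0"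
    by (cases "emeasure lborel S") auto
  have [measurable]: "S \<in> sets borel" using So by simp
  show ?thesis
  proof (rule nn_integral_le_of_eventually[where u="\<lambda>n p. ennreal (g n p * (F p + trace_of (J' p))) * indicator S p"])
    show "(\<lambda>p. ennreal (g n p * (F p + trace_of (J' p))) * indicator S p) \<in> borel_measurable lborel" for n
      by (intro borel_measurable_indicator_on_open[OF So] continuous_intros F C1_deriv_continuous_trace[OF J]
          continuous_on_subset[OF C1_deriv_continuous_on[OF gC]]) auto
    show "\<forall>\<^sub>F n in sequentially. ennreal (g n p * (F p + trace_of (J' p))) * indicator S p
       = ennreal (F p + trace_of (J' p)) * indicator S p" for p
    proof (cases "p \<in> S")
      case True
      obtain n0 where n0: "real n0 > 2 / ff p" using reals_Archimedean2 by blast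
      have "g n p = 1" if "n \<ge> n0" for n
      proof -
        have "2 / ff p < N n" using n0 that by (simp add: N_def)
        then have "2 \<le> N n * ff p" using SR(2)[OF True] by (simp add: field_simps)
        then show ?thesis using True by (simp add: g_def \<rho>S \<eta>_def cutoff_eq_1)
      qed
      then have "\<forall>\<^sub>F n in sequentially. g n p = 1" unfolding eventually_sequentially by blast
      then show ?thesis by eventually_elim simp
    qed simp
    fix e :: real assume e: "e > 0"
    obtain n0 where n0: "real n0 > C1 * vol / e" using reals_Archimedean2 by blast
    have "(\<integral>\<^sup>+p\<in>S. ennreal (g n p * (F p + trace_of (J' p))) \<partial>lborel) \<le> (\<integral>\<^sup>+p\<in>S. ennreal (F p) \<partial>lborel) + ennreal e"
      if n: "n \<ge> n0" for n
    proof -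
      have "(\<integral>\<^sup>+p\<in>S. ennreal (g n p * (F p + trace_of (J' p))) \<partial>lborel)
        \<le> (\<integral>\<^sup>+p\<in>S. ennreal (g n p * F p) \<partial>lborel) + (\<integral>\<^sup>+p\<in>S. ennreal \<bar>g' n p (J p)\<bar> \<partial>lborel)"
        by (rule divergence_inequality[OF So J gC g0 Kc gK Qc Qbd F])
      also have "\<dots> \<le> (\<integral>\<^sup>+p\<in>S. ennreal (F p) \<partial>lborel) + (\<integral>\<^sup>+p\<in>S. ennreal (C1 / N n) \<partial>lborel)"
      proof (intro add_mono nn_integral_mono)
        fix p
        show "ennreal (g n p * F p) * indicator S p \<le> ennreal (F p) * indicator S p"
          using F(2)[of p] g0[of n p] g1[of n p] by (auto simp: indicator_def intro!: ennreal_leI mult_left_le_one_le)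
        show "ennreal \<bar>g' n p (J p)\<bar> * indicator S p \<le> ennreal (C1 / N n) * indicator S p"
          using g'J[of p n] by (auto simp: indicator_def intro!: ennreal_leI)
      qed
      also have "(\<integral>\<^sup>+p\<in>S. ennreal (C1 / N n) \<partial>lborel) = ennreal (C1 / N n) * ennreal vol"
        by (subst nn_integral_cmult_indicator) (auto simp: vol)
      also have "\<dots> = ennreal (C1 / N n * vol)" 
        using C10 N[of n] vol(2) by (intro ennreal_mult[symmetric]) auto
      also have "\<dots> \<le> ennreal e"
      proof (rule ennreal_leI)
        have "C1 * vol / e < N n" using n0 n by (simp add: N_def)
        then show "C1 / N n * vol \<le> e" using e N[of n] by (simp add: field_simps)
      qed
      finally show ?thesis by simp
    qed
    then show "\<forall>\<^sub>F n in sequentially. (\<integral>\<^sup>+p\<in>S. ennreal (g n p * (F p + trace_of (J' p))) \<partial>lborel)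
      \<le> (\<integral>\<^sup>+p\<in>S. ennreal (F p) \<partial>lborel) + ennreal e" unfolding eventually_sequentially by blast
  qed
qed

section \<open>Boundary values and localization\<close>

text \<open>The ends of the segment may lie on the boundary, as the mean value theorem
  differentiates only in the open segment. The derivative is expressed through W, which can be
  compared with its value at a boundary point.\<close>

lemma segment_mean_value:
  fixes z :: "'a::euclidean_space \<Rightarrow> real"
  assumes S: "open S" and z: "C1_deriv S z (\<lambda>p v. G p \<bullet> v)" and zc: "continuous_on (closure S) z"
    and W: "\<And>p. p \<in> S \<Longrightarrow> W p = G p"
    and seg: "\<And>\<theta>. 0 < \<theta> \<Longrightarrow> \<theta> < 1 \<Longrightarrow> b + \<theta> *\<^sub>R w \<in> S"
    and ends: "b \<in> closure S" "b + w \<in> closure S"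
  obtains \<theta> where "0 < \<theta>" "\<theta> < 1" "z (b + w) - z b = W (b + \<theta> *\<^sub>R w) \<bullet> w"
proof -
  have in_cl: "b + \<theta> *\<^sub>R w \<in> closure S" if "\<theta> \<in> {0..1}" for \<theta>
  proof -
    have "\<theta> = 0 \<or> \<theta> = 1 \<or> (0 < \<theta> \<and> \<theta> < 1)" using that by auto
    then consider "\<theta> = 0" | "\<theta> = 1" | "0 < \<theta>" "\<theta> < 1" by blast
    then show ?thesis using ends seg closure_subset by cases auto
  qed
  have c: "continuous_on {0..1} (\<lambda>\<theta>. z (b + \<theta> *\<^sub>R w))"
    by (rule continuous_on_compose2[OF zc]) (auto intro!: continuous_intros in_cl)
  have d: "((\<lambda>\<theta>. z (b + \<theta> *\<^sub>R w)) has_real_derivative G (b + \<theta> *\<^sub>R w) \<bullet> w) (at \<theta>)" if "0 < \<theta>" "\<theta> < 1" for \<theta>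
    by (rule C1_deriv_line_real[OF z seg[OF that]])
  have "\<exists>l \<theta>. 0 < \<theta> \<and> \<theta> < 1 \<and> ((\<lambda>\<theta>. z (b + \<theta> *\<^sub>R w)) has_real_derivative l) (at \<theta>)
       \<and> z (b + 1 *\<^sub>R w) - z (b + 0 *\<^sub>R w) = (1 - 0) * l"
    by (rule MVT[OF _ c]) (use d real_differentiable_def in auto)
  then obtain l \<theta> where \<theta>: "0 < \<theta>" "\<theta> < 1" "((\<lambda>\<theta>. z (b + \<theta> *\<^sub>R w)) has_real_derivative l) (at \<theta>)"
     "z (b + w) - z b = l" by auto
  have "l = G (b + \<theta> *\<^sub>R w) \<bullet> w" using DERIV_unique[OF \<theta>(3) d[OF \<theta>(1,2)]] .
  then show ?thesis using that \<theta> W seg by metis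
qed

text \<open>Consider a path of three segments: from p0 inwards along - n, then parallel to h, then
  outwards along n until the boundary is met again. z vanishes at both ends. The normal pieces have
  length proportional to s \<delta> and change z by at most s c / 8 and s c / 4; the middle piece
  contributes \<open>s * (W p0 \<bullet> h)\<close> up to s c / 4. Hence s c <= 5 s c / 8, where c
  is the absolute value of \<open>W p0 \<bullet> h\<close>. No parametrisation of the boundary
  enters.\<close>

lemma tangential_derivative_zero:
  fixes z :: "'a::euclidean_space \<Rightarrow> real"
  assumes S: "open S" "p0 \<in> frontier S" and V: "open V" "p0 \<in> V"
    and \<Phi>: "(\<Phi> has_derivative (\<lambda>v. n \<bullet> v)) (at p0)" "\<Phi> p0 = 0" and n: "n \<noteq> 0"
    and SV: "S \<inter> V = {p\<in>V. \<Phi> p < 0}"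
    and z: "C1_deriv S z (\<lambda>p v. G p \<bullet> v)" and zc: "continuous_on (closure S) z"
    and W: "\<And>p. p \<in> S \<Longrightarrow> W p = G p" and Wc: "continuous_on (closure S) W"
    and z0: "\<And>p. p \<in> V \<Longrightarrow> p \<in> frontier S \<Longrightarrow> z p = 0"
    and h: "n \<bullet> h = 0"
  shows "W p0 \<bullet> h = 0"
proof (rule ccontr)
  assume ne: "W p0 \<bullet> h \<noteq> 0"
  define c where "c = \<bar>W p0 \<bullet> h\<bar>"
  have c: "c > 0" using ne by (simp add: c_def)
  define \<kappa> where "\<kappa> = c / (4 * (norm h + 1))"
  have h1: "norm h + 1 > 0" by (simp add: add_nonneg_pos)
  have \<kappa>: "\<kappa> > 0" using c h1 by (simp add: \<kappa>_def)
  have \<kappa>h: "\<kappa> * norm h \<le> c / 4"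
  proof -
    have "\<kappa> * norm h \<le> \<kappa> * (norm h + 1)" using \<kappa> by simp
    also have "\<dots> = c / 4" using h1 by (simp add: \<kappa>_def field_simps)
    finally show ?thesis .
  qed
  define M where "M = norm (W p0) + \<kappa>"
  have M: "M > 0" using \<kappa> by (simp add: M_def add_nonneg_pos)
  have nn: "norm n > 0" using n by simp
  \<comment> \<open>Ratio of normal to tangential displacement, so small that a normal step of size
    s \<delta> changes z by at most s c / 8 when the gradient is bounded by M.\<close>
  define \<delta> where "\<delta> = c / (8 * M * norm n)"
  have \<delta>: "\<delta> > 0" using c M nn by (simp add: \<delta>_def)
  have \<delta>M: "\<delta> * M * norm n = c / 8" using M nn by (simp add: \<delta>_def)
  have p0: "p0 \<in> closure S" "p0 \<notin> S" using S by (auto simp: frontier_def interior_open)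
  obtain e1 where e1: "e1 > 0" "ball p0 e1 \<subseteq> V" using V openE by blast
  obtain e2 where e2: "e2 > 0" "\<And>p. p \<in> closure S \<Longrightarrow> dist p p0 < e2 \<Longrightarrow> dist (W p) (W p0) < \<kappa>"
    using Wc \<kappa> p0(1) unfolding continuous_on_iff by blast
  \<comment> \<open>Tolerance for the linearisation of \<Phi> at p0. Within it the sign of \<Phi> at
    a displaced point is that of the normal parameter, as long as the tangential parameter does not
    exceed it in absolute value.\<close>
  define \<kappa>' where "\<kappa>' = \<delta> * (norm n)\<^sup>2 / (2 * (\<delta> * norm n + norm h + 1))"
  have dn: "\<delta> * norm n + norm h + 1 > 0" using \<delta> nn by (simp add: add_nonneg_pos)
  have \<kappa>': "\<kappa>' > 0" unfolding \<kappa>'_def using \<delta> nn dn by (intro divide_pos_pos mult_pos_pos) auto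
  have \<kappa>'2: "\<kappa>' * (\<delta> * norm n + norm h) < \<delta> * (norm n)\<^sup>2"
  proof -
    have "\<kappa>' * (\<delta> * norm n + norm h) \<le> \<kappa>' * (\<delta> * norm n + norm h + 1)" using \<kappa>' by simp
    also have "\<dots> = \<delta> * (norm n)\<^sup>2 / 2" using dn unfolding \<kappa>'_def by (simp add: field_simps)
    also have "\<dots> < \<delta> * (norm n)\<^sup>2" using \<delta> nn by simp
    finally show ?thesis .
  qed
  obtain e3 where e3: "e3 > 0" "\<And>v. norm v < e3 \<Longrightarrow> \<bar>\<Phi> (p0 + v) - n \<bullet> v\<bar> \<le> \<kappa>' * norm v"
  proof -
    have "\<exists>d>0. \<forall>y. norm (y - p0) < d \<longrightarrow> norm (\<Phi> y - \<Phi> p0 - n \<bullet> (y - p0)) \<le> \<kappa>' * norm (y - p0)"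
      using \<Phi>(1) \<kappa>' unfolding has_derivative_at_alt by blast
    then obtain d where d: "d > 0" "\<And>y. norm (y - p0) < d \<Longrightarrow> norm (\<Phi> y - \<Phi> p0 - n \<bullet> (y - p0)) \<le> \<kappa>' * norm (y - p0)"
      by blast
    show ?thesis using that[OF d(1)] d(2)[of "p0 + _"] \<Phi>(2) by simp
  qed
  define s where "s = min e1 (min e2 e3) / (2 * (\<delta> * norm n + norm h + 1))"
  have s: "s > 0" using e1 e2 e3 dn by (simp add: s_def)
  have s_le: "s * (\<delta> * norm n + norm h) < min e1 (min e2 e3)"
  proof -
    have "s * (\<delta> * norm n + norm h) \<le> s * (\<delta> * norm n + norm h + 1)" using s by simp
    also have "\<dots> = min e1 (min e2 e3) / 2" using dn unfolding s_def by (simp add: field_simps)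
    also have "\<dots> < min e1 (min e2 e3)"
    proof -
      have "min e1 (min e2 e3) > 0" using e1(1) e2(1) e3(1) by simp
      then show ?thesis by linarith
    qed
    finally show ?thesis .
  qed
  \<comment> \<open>Points of the path: \<alpha> is the tangential and \<beta> the normal parameter,
    negative \<beta> meaning inside S.\<close>
  define P where "P \<alpha> \<beta> = p0 + ((s * \<alpha>) *\<^sub>R h + (s * \<beta> * \<delta>) *\<^sub>R n)" for \<alpha> \<beta>
  have Pn: "norm ((s * \<alpha>) *\<^sub>R h + (s * \<beta> * \<delta>) *\<^sub>R n) \<le> s * (\<alpha> * norm h + \<bar>\<beta>\<bar> * (\<delta> * norm n))" if "\<alpha> \<ge> 0" for \<alpha> \<beta>
  proof -
    have "norm ((s * \<alpha>) *\<^sub>R h + (s * \<beta> * \<delta>) *\<^sub>R n) \<le> norm ((s * \<alpha>) *\<^sub>R h) + norm ((s * \<beta> * \<delta>) *\<^sub>R n)"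
      by (rule norm_triangle_ineq)
    also have "\<dots> = s * (\<alpha> * norm h + \<bar>\<beta>\<bar> * (\<delta> * norm n))"
      using s \<delta> that by (simp add: abs_mult algebra_simps)
    finally show ?thesis .
  qed
  have Psmall: "norm ((s * \<alpha>) *\<^sub>R h + (s * \<beta> * \<delta>) *\<^sub>R n) < min e1 (min e2 e3)"
    if "0 \<le> \<alpha>" "\<alpha> \<le> 1" "\<bar>\<beta>\<bar> \<le> 1" for \<alpha> \<beta>
  proof -
    have "\<alpha> * norm h + \<bar>\<beta>\<bar> * (\<delta> * norm n) \<le> 1 * norm h + 1 * (\<delta> * norm n)"
      using that \<delta> by (intro add_mono mult_right_mono) auto
    then have "s * (\<alpha> * norm h + \<bar>\<beta>\<bar> * (\<delta> * norm n)) \<le> s * (\<delta> * norm n + norm h)"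
      using s by (intro mult_left_mono) auto
    then show ?thesis using Pn[OF that(1), of \<beta>] s_le by linarith
  qed
  have PV: "P \<alpha> \<beta> \<in> V" "dist (P \<alpha> \<beta>) p0 < e2" if "0 \<le> \<alpha>" "\<alpha> \<le> 1" "\<bar>\<beta>\<bar> \<le> 1" for \<alpha> \<beta>
    using Psmall[OF that] e1(2) by (auto simp: P_def dist_norm subset_iff norm_minus_commute)
  have P\<Phi>: "\<bar>\<Phi> (P \<alpha> \<beta>) - s * \<beta> * \<delta> * (norm n)\<^sup>2\<bar> \<le> \<kappa>' * (s * (\<alpha> * norm h + \<bar>\<beta>\<bar> * (\<delta> * norm n)))"
    if "0 \<le> \<alpha>" "\<alpha> \<le> 1" "\<bar>\<beta>\<bar> \<le> 1" for \<alpha> \<beta>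
  proof -
    have "n \<bullet> ((s * \<alpha>) *\<^sub>R h + (s * \<beta> * \<delta>) *\<^sub>R n) = s * \<beta> * \<delta> * (norm n)\<^sup>2"
      by (simp add: inner_add_right h power2_norm_eq_inner)
    then have "\<bar>\<Phi> (P \<alpha> \<beta>) - s * \<beta> * \<delta> * (norm n)\<^sup>2\<bar> \<le> \<kappa>' * norm ((s * \<alpha>) *\<^sub>R h + (s * \<beta> * \<delta>) *\<^sub>R n)"
      using e3(2)[of "(s * \<alpha>) *\<^sub>R h + (s * \<beta> * \<delta>) *\<^sub>R n"] Psmall[OF that] by (simp add: P_def)
    also have "\<dots> \<le> \<kappa>' * (s * (\<alpha> * norm h + \<bar>\<beta>\<bar> * (\<delta> * norm n)))"
      using Pn[OF that(1)] \<kappa>' by (intro mult_left_mono) auto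
    finally show ?thesis .
  qed
  have key: "\<kappa>' * (s * (\<alpha> * norm h + \<bar>\<beta>\<bar> * (\<delta> * norm n))) < s * \<bar>\<beta>\<bar> * \<delta> * (norm n)\<^sup>2"
    if "0 \<le> \<alpha>" "\<alpha> \<le> \<bar>\<beta>\<bar>" "\<beta> \<noteq> 0" for \<alpha> \<beta>
  proof -
    have "\<alpha> * norm h + \<bar>\<beta>\<bar> * (\<delta> * norm n) \<le> \<bar>\<beta>\<bar> * norm h + \<bar>\<beta>\<bar> * (\<delta> * norm n)"
      using that by (intro add_mono mult_right_mono order_refl) auto
    also have "\<dots> = \<bar>\<beta>\<bar> * (\<delta> * norm n + norm h)" by (simp add: algebra_simps)
    finally have "\<kappa>' * (s * (\<alpha> * norm h + \<bar>\<beta>\<bar> * (\<delta> * norm n))) \<le> \<kappa>' * (s * (\<bar>\<beta>\<bar> * (\<delta> * norm n + norm h)))"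
      using \<kappa>' s by (intro mult_left_mono) auto
    also have "\<dots> = (s * \<bar>\<beta>\<bar>) * (\<kappa>' * (\<delta> * norm n + norm h))" by (simp add: algebra_simps)
    also have "\<dots> < (s * \<bar>\<beta>\<bar>) * (\<delta> * (norm n)\<^sup>2)" using \<kappa>'2 s that by (intro mult_strict_left_mono) auto
    finally show ?thesis by (simp add: algebra_simps)
  qed
  have PS: "P \<alpha> \<beta> \<in> S" if "0 \<le> \<alpha>" "\<alpha> \<le> 1" "\<alpha> \<le> - \<beta>" "- 1 \<le> \<beta>" "\<beta> < 0" for \<alpha> \<beta>
  proof -
    have "\<Phi> (P \<alpha> \<beta>) < 0" using P\<Phi>[of \<alpha> \<beta>] key[of \<alpha> \<beta>] that by simp
    then show ?thesis using PV(1)[of \<alpha> \<beta>] SV that by auto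
  qed
  have Pout: "P 1 1 \<notin> S"
  proof
    assume "P 1 1 \<in> S"
    then have "\<Phi> (P 1 1) < 0" using PV(1)[of 1 1] SV by auto
    then show False using P\<Phi>[of 1 1] key[of 1 1] by simp
  qed
  have Wle: "norm (W p) \<le> M" "\<bar>W p \<bullet> h - W p0 \<bullet> h\<bar> \<le> \<kappa> * norm h" if "p \<in> S" "dist p p0 < e2" for p
  proof -
    have d: "norm (W p - W p0) < \<kappa>" using e2(2)[of p] that closure_subset[of S] by (auto simp: dist_norm)
    then show "norm (W p) \<le> M" using norm_triangle_ineq2[of "W p" "W p0"] unfolding M_def by linarith
    have "\<bar>(W p - W p0) \<bullet> h\<bar> \<le> norm (W p - W p0) * norm h" by (rule Cauchy_Schwarz_ineq2)
    also have "\<dots> \<le> \<kappa> * norm h" using d by (intro mult_right_mono) auto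
    finally show "\<bar>W p \<bullet> h - W p0 \<bullet> h\<bar> \<le> \<kappa> * norm h" by (simp add: inner_diff_left)
  qed
  note smv = segment_mean_value[OF S(1) z zc W]
  have P00: "P 0 0 = p0" by (simp add: P_def)
  have 1: "\<bar>z (P 0 (-1))\<bar> \<le> s * (c / 8)"
  proof -
    have eq: "p0 + \<theta> *\<^sub>R (- (s * \<delta>) *\<^sub>R n) = P 0 (- \<theta>)" for \<theta> by (simp add: P_def algebra_simps)
    obtain \<theta> where \<theta>: "0 < \<theta>" "\<theta> < 1" "z (p0 + (- (s * \<delta>) *\<^sub>R n)) - z p0 = W (p0 + \<theta> *\<^sub>R (- (s * \<delta>) *\<^sub>R n)) \<bullet> (- (s * \<delta>) *\<^sub>R n)"
    proof (rule smv[of p0 "- (s * \<delta>) *\<^sub>R n"])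
      show "p0 + \<theta> *\<^sub>R (- (s * \<delta>) *\<^sub>R n) \<in> S" if "0 < \<theta>" "\<theta> < 1" for \<theta>
        unfolding eq using PS[of 0 "- \<theta>"] that by simp
      show "p0 + (- (s * \<delta>) *\<^sub>R n) \<in> closure S"
        using eq[of 1] PS[of 0 "-1"] closure_subset[of S] by auto
    qed (use p0 in auto)
    have "norm (W (P 0 (-\<theta>))) \<le> M" using Wle(1)[of "P 0 (-\<theta>)"] PS[of 0 "-\<theta>"] PV[of 0 "-\<theta>"] \<theta> by simp
    then have "norm (W (P 0 (-\<theta>))) * norm (- (s * \<delta>) *\<^sub>R n) \<le> M * norm (- (s * \<delta>) *\<^sub>R n)" by (intro mult_right_mono) auto
    also have "\<dots> = s * (\<delta> * M * norm n)" using s \<delta> by (simp add: abs_mult)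
    also have "\<dots> = s * (c / 8)" by (simp add: \<delta>M)
    finally show ?thesis
      using \<theta>(3) eq[of 1] eq[of \<theta>] z0[OF V(2) S(2)] Cauchy_Schwarz_ineq2[of "W (P 0 (-\<theta>))" "- (s * \<delta>) *\<^sub>R n"]
      by simp
  qed
  have 2: "\<bar>z (P 1 (-1)) - z (P 0 (-1)) - s * (W p0 \<bullet> h)\<bar> \<le> s * (c / 4)"
  proof -
    have eq: "P 0 (-1) + \<theta> *\<^sub>R (s *\<^sub>R h) = P \<theta> (- 1)" for \<theta> by (simp add: P_def algebra_simps)
    obtain \<theta> where \<theta>: "0 < \<theta>" "\<theta> < 1" "z (P 0 (-1) + s *\<^sub>R h) - z (P 0 (-1)) = W (P 0 (-1) + \<theta> *\<^sub>R (s *\<^sub>R h)) \<bullet> (s *\<^sub>R h)"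
    proof (rule smv[of "P 0 (-1)" "s *\<^sub>R h"])
      show "P 0 (-1) + \<theta> *\<^sub>R (s *\<^sub>R h) \<in> S" if "0 < \<theta>" "\<theta> < 1" for \<theta>
        unfolding eq using PS[of \<theta> "- 1"] that by simp
      show "P 0 (-1) + s *\<^sub>R h \<in> closure S"
        using eq[of 1] PS[of 1 "-1"] closure_subset[of S] by auto
      show "P 0 (-1) \<in> closure S" using PS[of 0 "-1"] closure_subset[of S] by auto
    qed
    have "\<bar>W (P \<theta> (-1)) \<bullet> h - W p0 \<bullet> h\<bar> \<le> c / 4"
      using Wle(2)[of "P \<theta> (-1)"] PS[of \<theta> "-1"] PV[of \<theta> "-1"] \<theta> \<kappa>h by simp
    then have "s * \<bar>W (P \<theta> (-1)) \<bullet> h - W p0 \<bullet> h\<bar> \<le> s * (c / 4)" using s by (intro mult_left_mono) auto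
    moreover have "z (P 1 (-1)) - z (P 0 (-1)) - s * (W p0 \<bullet> h) = s * (W (P \<theta> (-1)) \<bullet> h - W p0 \<bullet> h)"
      using \<theta>(3) eq[of 1] eq[of \<theta>] by (simp add: algebra_simps)
    ultimately show ?thesis using s by (simp add: abs_mult)
  qed
  have 3: "\<bar>z (P 1 (-1))\<bar> \<le> s * (c / 4)"
  proof -
    define w where "w = (2 * s * \<delta>) *\<^sub>R n"
    have eq: "P 1 (-1) + \<theta> *\<^sub>R w = P 1 (2 * \<theta> - 1)" for \<theta> by (simp add: P_def w_def algebra_simps)
    define T where "T = {\<theta>\<in>{0..1}. P 1 (-1) + \<theta> *\<^sub>R w \<notin> S}"
    have "closed ({0..1} \<inter> (\<lambda>\<theta>. P 1 (-1) + \<theta> *\<^sub>R w) -` (- S))"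
      by (intro continuous_closed_preimage continuous_intros) (use S(1) in auto)
    moreover have "T = {0..1} \<inter> (\<lambda>\<theta>. P 1 (-1) + \<theta> *\<^sub>R w) -` (- S)" by (auto simp: T_def)
    ultimately have "closed T" by simp
    then have Tc: "compact T" 
    proof -
      have "T = {0..1} \<inter> T" by (auto simp: T_def)
      then show ?thesis using compact_Int_closed[OF compact_Icc \<open>closed T\<close>, of 0 1] by metis
    qed
    have "1 \<in> T" using Pout eq[of 1] by (simp add: T_def)
    \<comment> \<open>First exit from S on the way outwards. It exists because \<open>P 1 1\<close>
      lies outside; being minimal it is a boundary point in V, and z vanishes there.\<close>
    then obtain \<theta>0 where \<theta>0: "\<theta>0 \<in> T" "\<And>\<theta>. \<theta> \<in> T \<Longrightarrow> \<theta>0 \<le> \<theta>" using compact_attains_inf[OF Tc] by blast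
    have inS: "P 1 (-1) + \<theta> *\<^sub>R w \<in> S" if "0 \<le> \<theta>" "\<theta> < \<theta>0" for \<theta>
      using \<theta>0 that by (force simp: T_def)
    have t01: "0 \<le> \<theta>0" "\<theta>0 \<le> 1" using \<theta>0(1) by (auto simp: T_def)
    have "\<theta>0 \<noteq> 0" using \<theta>0(1) eq[of 0] PS[of 1 "-1"] by (auto simp: T_def)
    then have t0: "0 < \<theta>0" using t01 by simp
    define y where "y = P 1 (-1) + \<theta>0 *\<^sub>R w"
    have ycl: "y \<in> closure S"
    proof -
      have "((\<lambda>\<theta>. P 1 (-1) + \<theta> *\<^sub>R w) \<longlongrightarrow> y) (at_left \<theta>0)"
        unfolding y_def by (intro tendsto_intros)
      moreover have "\<forall>\<^sub>F \<theta> in at_left \<theta>0. P 1 (-1) + \<theta> *\<^sub>R w \<in> S"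
        using eventually_at_left_real[OF t0] by eventually_elim (use inS in auto)
      then have "\<forall>\<^sub>F \<theta> in at_left \<theta>0. P 1 (-1) + \<theta> *\<^sub>R w \<in> closure S"
        by (rule eventually_mono) (use closure_subset in auto)
      ultimately show ?thesis
        by (intro Lim_in_closed_set[OF closed_closure, of _ _ "at_left \<theta>0"]) auto
    qed
    have yS: "y \<notin> S" using \<theta>0(1) by (simp add: T_def y_def)
    have yfr: "y \<in> frontier S" using ycl yS S(1) by (simp add: frontier_def interior_open)
    have yV: "y \<in> V" unfolding y_def eq using t01 by (intro PV) auto
    have zy: "z y = 0" using z0[OF yV yfr] .
    obtain \<theta> where \<theta>: "0 < \<theta>" "\<theta> < 1" "z (P 1 (-1) + \<theta>0 *\<^sub>R w) - z (P 1 (-1)) = W (P 1 (-1) + \<theta> *\<^sub>R (\<theta>0 *\<^sub>R w)) \<bullet> (\<theta>0 *\<^sub>R w)"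
    proof (rule smv[of "P 1 (-1)" "\<theta>0 *\<^sub>R w"])
      show "P 1 (-1) + \<theta> *\<^sub>R (\<theta>0 *\<^sub>R w) \<in> S" if "0 < \<theta>" "\<theta> < 1" for \<theta>
        using inS[of "\<theta> * \<theta>0"] that t0 by simp
      show "P 1 (-1) + \<theta>0 *\<^sub>R w \<in> closure S" using ycl by (simp add: y_def)
      show "P 1 (-1) \<in> closure S" using PS[of 1 "-1"] closure_subset[of S] by auto
    qed
    define q where "q = P 1 (-1) + (\<theta> * \<theta>0) *\<^sub>R w"
    have tt: "0 < \<theta> * \<theta>0" "\<theta> * \<theta>0 < \<theta>0" "\<theta> * \<theta>0 \<le> 1"
      using \<theta> t0 t01 by (auto simp: mult_le_one)
    have qS: "q \<in> S" unfolding q_def using inS tt by auto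
    have "dist q p0 < e2" unfolding q_def eq using tt by (intro PV) auto
    then have "norm (W q) \<le> M" using Wle(1) qS by blast
    moreover have "norm (\<theta>0 *\<^sub>R w) \<le> norm w" using t01 by (simp add: mult_left_le_one_le)
    ultimately have "norm (W q) * norm (\<theta>0 *\<^sub>R w) \<le> M * norm w" using M by (intro mult_mono) auto
    also have "\<dots> = 2 * s * (\<delta> * M * norm n)" using s \<delta> by (simp add: w_def abs_mult)
    also have "\<dots> = s * (c / 4)" by (simp add: \<delta>M)
    finally show ?thesis
      using \<theta>(3) zy Cauchy_Schwarz_ineq2[of "W q" "\<theta>0 *\<^sub>R w"] by (simp add: y_def q_def)
  qed
  have "\<bar>s * (W p0 \<bullet> h)\<bar> = s * c" using s by (simp add: abs_mult c_def)
  moreover have "\<bar>s * (W p0 \<bullet> h)\<bar> \<le> s * (c / 8) + s * (c / 4) + s * (c / 4)" using 1 2 3 by linarith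
  moreover have "s * (c / 8) + s * (c / 4) + s * (c / 4) < s * c" using s c by (simp add: field_simps)
  ultimately show False by linarith
qed

lemma normal_direction:
  fixes w n :: "'a::real_inner"
  assumes "n \<noteq> 0" "\<And>h. n \<bullet> h = 0 \<Longrightarrow> w \<bullet> h = 0"
  shows "\<exists>l. w = l *\<^sub>R n"
proof -
  define l where "l = (w \<bullet> n) / (n \<bullet> n)"
  have "n \<bullet> (w - l *\<^sub>R n) = 0" using assms(1) by (simp add: l_def inner_diff_right inner_commute)
  then have "w \<bullet> (w - l *\<^sub>R n) = 0" "n \<bullet> (w - l *\<^sub>R n) = 0" using assms(2) by auto
  then have "(w - l *\<^sub>R n) \<bullet> (w - l *\<^sub>R n) = 0" by (simp add: inner_diff_left)
  then show ?thesis by auto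
qed

text \<open>\<open>outward_normal\<close> is a choice made with some defining function \<psi>,
  whereas \<phi> is arbitrary. If x had a positive product with the gradient of \<phi> but not with
  that of \<psi>, some direction h would lead from x to points that \<phi> places inside and \<psi>
  outside \<Omega>. Only first order expansions at x are used.\<close>

lemma outside_Gamma_plus:
  assumes "local_defining \<Omega> x V \<phi>" "x \<in> frontier \<Omega>" "open \<Omega>" "x \<notin> Gamma_plus \<Omega>"
  shows "x \<bullet> grad \<phi> x \<le> 0"
proof -
  define \<nu> where "\<nu> = outward_normal \<Omega> x"
  have "\<exists>U \<phi>. local_defining \<Omega> x U \<phi> \<and> \<nu> = sgn (grad \<phi> x)"
    unfolding \<nu>_def outward_normal_def by (rule someI_ex) (use assms(1) in blast)
  then obtain V' \<psi> where \<psi>: "local_defining \<Omega> x V' \<psi>" "\<nu> = sgn (grad \<psi> x)" by blast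
  have "x \<bullet> \<nu> \<le> 0" using assms(2,4) by (simp add: Gamma_plus_def \<nu>_def)
  then have le: "x \<bullet> grad \<psi> x \<le> 0"
    using \<psi> by (auto simp: sgn_div_norm local_defining_def divide_le_0_iff inverse_eq_divide mult_le_0_iff)
  have line: "\<exists>d>0. \<forall>s. 0 < s \<and> s < d \<longrightarrow> x + s *\<^sub>R h \<in> V \<and> \<bar>\<phi> (x + s *\<^sub>R h) - s * (grad \<phi> x \<bullet> h)\<bar> < s * k"
    if ld: "local_defining \<Omega> x V \<phi>" and k: "k > 0" for V \<phi> h k
  proof -
    have V: "open V" "x \<in> V" "Ck 1 V \<phi>" using ld by (auto simp: local_defining_def smooth_on_def)
    have 0: "\<phi> x = 0" using local_defining_frontier_zero[OF ld assms(3,2) V(2)] .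
    have "grad \<phi> x = egrad \<phi> x" using V by (intro grad_eq_egrad) (auto simp: One_nat_def)
    then have "((\<lambda>s. \<phi> (x + s *\<^sub>R h)) has_real_derivative grad \<phi> x \<bullet> h) (at 0)"
      using C1_deriv_line_real[OF Ck_1_C1_deriv[OF V(3)], of x 0 h] V(2) by simp
    then have "((\<lambda>s. \<phi> (x + s *\<^sub>R h) / s) \<longlongrightarrow> grad \<phi> x \<bullet> h) (at 0)" by (simp add: DERIV_def 0)
    then have "\<forall>\<^sub>F s in at 0. dist (\<phi> (x + s *\<^sub>R h) / s) (grad \<phi> x \<bullet> h) < k" using k by (rule tendstoD)
    then obtain d1 where d1: "d1 > 0" "\<And>s. s \<noteq> 0 \<Longrightarrow> \<bar>s\<bar> < d1 \<Longrightarrow> \<bar>\<phi> (x + s *\<^sub>R h) / s - grad \<phi> x \<bullet> h\<bar> < k"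
      by (auto simp: eventually_at dist_real_def)
    obtain e where e: "e > 0" "ball x e \<subseteq> V" using V openE by blast
    define d where "d = min d1 (e / (norm h + 1))"
    have h1: "norm h + 1 > 0" by (simp add: add_nonneg_pos)
    have "d > 0" using d1 e h1 by (simp add: d_def)
    moreover have "x + s *\<^sub>R h \<in> V \<and> \<bar>\<phi> (x + s *\<^sub>R h) - s * (grad \<phi> x \<bullet> h)\<bar> < s * k" if s: "0 < s" "s < d" for s
    proof
      have "s * norm h \<le> s * (norm h + 1)" using s by simp
      also have "\<dots> < e" using s h1 by (simp add: d_def field_simps)
      finally show "x + s *\<^sub>R h \<in> V" using e(2) s by (auto simp: dist_norm)
      have "s * \<bar>\<phi> (x + s *\<^sub>R h) / s - grad \<phi> x \<bullet> h\<bar> < s * k"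
        using d1(2)[of s] s by (intro mult_strict_left_mono) (auto simp: d_def)
      moreover have "\<phi> (x + s *\<^sub>R h) - s * (grad \<phi> x \<bullet> h) = s * (\<phi> (x + s *\<^sub>R h) / s - grad \<phi> x \<bullet> h)"
        using s by (simp add: field_simps)
      ultimately show "\<bar>\<phi> (x + s *\<^sub>R h) - s * (grad \<phi> x \<bullet> h)\<bar> < s * k" using s by (simp only: abs_mult abs_of_pos)
    qed
    ultimately show ?thesis by blast
  qed
  show ?thesis
  proof (rule ccontr)
    assume "\<not> x \<bullet> grad \<phi> x \<le> 0"
    then have pos: "x \<bullet> grad \<phi> x > 0" by simp
    define g where "g = grad \<psi> x"
    have g0: "g \<bullet> g > 0" using \<psi>(1) by (auto simp: g_def local_defining_def)
    define \<eta> where "\<eta> = (x \<bullet> grad \<phi> x) / (2 * (\<bar>g \<bullet> grad \<phi> x\<bar> + 1))"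
    have \<eta>: "\<eta> > 0" using pos by (simp add: \<eta>_def)
    \<comment> \<open>The direction - x decreases \<phi> to first order and does not decrease
      \<psi>. A small multiple of the gradient of \<psi> makes the increase of \<psi> strict without
      spoiling the decrease of \<phi>.\<close>
    define h where "h = \<eta> *\<^sub>R g - x"
    have 1: "grad \<phi> x \<bullet> h < 0"
    proof -
      have "\<eta> * (g \<bullet> grad \<phi> x) \<le> \<eta> * (\<bar>g \<bullet> grad \<phi> x\<bar> + 1)" using \<eta> by (intro mult_left_mono) auto
      also have "\<dots> = (x \<bullet> grad \<phi> x) / 2"
      proof -
        define y where "y = \<bar>g \<bullet> grad \<phi> x\<bar> + 1"
        have "y \<noteq> 0" unfolding y_def by linarith
        then show ?thesis unfolding \<eta>_def y_def[symmetric] by simp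
      qed
      finally have "\<eta> * (g \<bullet> grad \<phi> x) \<le> (x \<bullet> grad \<phi> x) / 2" .
      moreover have "grad \<phi> x \<bullet> h = \<eta> * (g \<bullet> grad \<phi> x) - x \<bullet> grad \<phi> x"
        by (simp add: h_def inner_diff_right inner_commute)
      ultimately show ?thesis using pos by linarith
    qed
    have 2: "g \<bullet> h > 0"
    proof -
      have "0 < \<eta> * (g \<bullet> g)" using \<eta> g0 by simp
      moreover have "g \<bullet> h = \<eta> * (g \<bullet> g) - x \<bullet> grad \<psi> x"
        by (simp add: h_def inner_diff_right g_def inner_commute)
      ultimately show ?thesis using le by linarith
    qed
    obtain d1 where d1: "d1 > 0" "\<And>s. 0 < s \<Longrightarrow> s < d1 \<Longrightarrow> x + s *\<^sub>R h \<in> V \<and> \<bar>\<phi> (x + s *\<^sub>R h) - s * (grad \<phi> x \<bullet> h)\<bar> < s * (- (grad \<phi> x \<bullet> h))"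
      using line[OF assms(1), of "- (grad \<phi> x \<bullet> h)" h] 1 by auto
    obtain d2 where d2: "d2 > 0" "\<And>s. 0 < s \<Longrightarrow> s < d2 \<Longrightarrow> x + s *\<^sub>R h \<in> V' \<and> \<bar>\<psi> (x + s *\<^sub>R h) - s * (g \<bullet> h)\<bar> < s * (g \<bullet> h)"
      using line[OF \<psi>(1), of "g \<bullet> h" h] 2 by (auto simp: g_def)
    define s where "s = min d1 d2 / 2"
    have s: "0 < s" "s < d1" "s < d2" using d1 d2 by (auto simp: s_def min_def)
    have "\<phi> (x + s *\<^sub>R h) < 0" "x + s *\<^sub>R h \<in> V" using d1(2)[OF s(1,2)] by auto
    then have "x + s *\<^sub>R h \<in> \<Omega>" using assms(1) by (auto simp: local_defining_def)
    moreover have "\<psi> (x + s *\<^sub>R h) > 0" "x + s *\<^sub>R h \<in> V'" using d2(2)[OF s(1,3)] by auto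
    ultimately show False using \<psi>(1) by (force simp: local_defining_def)
  qed
qed

text \<open>Both functions come from products of 1 - \<open>bump\<close> over a finite cover of the
  closure of A by balls of radius s. Radius s gives \<psi> and radius 2 s gives 1 - e. Where \<psi>
  is not locally trivial, some centre is closer than 2 s, and there e = 1; e itself lives within 4 s
  of the centres.\<close>

lemma localizing_cutoffs:
  fixes A :: "'a::euclidean_space set"
  assumes A: "bounded A" and \<sigma>: "\<sigma> > 0"
  obtains \<psi> \<psi>' e e' where "C1_deriv UNIV \<psi> \<psi>'" "C1_deriv UNIV e e'"
    "\<And>x. 0 \<le> \<psi> x \<and> \<psi> x \<le> (1::real)" "\<And>x. 0 \<le> e x \<and> e x \<le> (1::real)"
    "\<And>x. x \<in> A \<Longrightarrow> \<psi> x = 0"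
    "\<And>x. \<psi> x \<noteq> 1 \<Longrightarrow> e x = 1" "\<And>x v. \<psi>' x v \<noteq> 0 \<Longrightarrow> e x = 1"
    "\<And>x. e x \<noteq> 0 \<Longrightarrow> \<exists>y\<in>A. dist x y < \<sigma>" "\<And>x v. e' x v \<noteq> 0 \<Longrightarrow> \<exists>y\<in>A. dist x y < \<sigma>"
proof -
  \<comment> \<open>The support of e reaches 4 s = \<sigma> / 2 from the centres, and these are
    taken in A rather than in its closure.\<close>
  define s where "s = \<sigma> / 8"
  have s: "s > 0" using \<sigma> by (simp add: s_def)
  have "closure A \<subseteq> (\<Union>c\<in>A. ball c s)"
  proof
    fix x assume "x \<in> closure A"
    then obtain c where "c \<in> A" "dist c x < s" using s closure_approachable by blast
    then show "x \<in> (\<Union>c\<in>A. ball c s)" by auto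
  qed
  moreover have "compact (closure A)" using A by simp
  ultimately obtain I where I: "I \<subseteq> A" "finite I" "closure A \<subseteq> (\<Union>c\<in>I. ball c s)"
    using compactE_image[of "closure A" A "\<lambda>c. ball c s"] open_ball by metis
  define X where "X \<rho> x = (\<Prod>c\<in>I. 1 - bump c \<rho> x)" for \<rho> x
  define X' where "X' \<rho> x v = (\<Sum>c\<in>I. (0 - bump' c \<rho> x v) * (\<Prod>d\<in>I - {c}. 1 - bump d \<rho> x))" for \<rho> x v
  have XC: "C1_deriv UNIV (X \<rho>) (X' \<rho>)" for \<rho>
    unfolding X_def[abs_def] X'_def[abs_def]
    by (intro C1_deriv_prod C1_deriv_diff C1_deriv_const C1_deriv_bump)
  have X01: "0 \<le> X \<rho> x" "X \<rho> x \<le> 1" for \<rho> x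
    unfolding X_def by (auto intro!: prod_nonneg prod_le_1 simp: bump_nonneg bump_le_1)
  have far: "X \<rho> x = 1 \<and> X' \<rho> x v = 0" if "\<rho> > 0" "\<And>c. c \<in> I \<Longrightarrow> 2 * \<rho> \<le> dist x c" for \<rho> x v
    using that by (simp add: X_def X'_def bump_eq_0 bump'_eq_0)
  have far': "\<exists>c\<in>I. dist x c < 2 * \<rho>" if "\<rho> > 0" "\<not> (X \<rho> x = 1 \<and> X' \<rho> x v = 0)" for \<rho> x v
  proof (rule ccontr)
    assume "\<not> (\<exists>c\<in>I. dist x c < 2 * \<rho>)"
    then have "X \<rho> x = 1 \<and> X' \<rho> x v = 0" by (intro far that(1)) (auto simp: not_less)
    then show False using that(2) by blast
  qed
  have near: "X \<rho> x = 0" if "\<rho> > 0" "c \<in> I" "dist x c \<le> \<rho>" for \<rho> x c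
  proof -
    have "1 - bump c \<rho> x = 0" using bump_eq_1[OF that(1,3)] by simp
    then show ?thesis unfolding X_def using I(2) that(2) by (metis prod_zero_iff)
  qed
  define e where "e x = 1 - X (2 * s) x" for x
  define e' where "e' x v = 0 - X' (2 * s) x v" for x v
  have eC: "C1_deriv UNIV e e'" unfolding e_def[abs_def] e'_def[abs_def]
    by (intro C1_deriv_diff C1_deriv_const XC)
  have e1: "e x = 1" if nt: "\<not> (X s x = 1 \<and> X' s x v = 0)" for x v
  proof -
    obtain c where c: "c \<in> I" "dist x c < 2 * s" using far'[OF s nt] by blast
    then have "X (2 * s) x = 0" using s by (intro near[of _ c]) auto
    then show ?thesis by (simp add: e_def)
  qed
  have e2: "\<exists>y\<in>A. dist x y < \<sigma>" if nt: "\<not> (X (2 * s) x = 1 \<and> X' (2 * s) x v = 0)" for x v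
  proof -
    obtain c where c: "c \<in> I" "dist x c < 2 * (2 * s)"  using far'[OF _ nt] s by auto
    then have "dist x c < \<sigma>" using \<sigma> by (simp add: s_def)
    then show ?thesis using c I(1) by blast
  qed
  have XA: "X s x = 0" if "x \<in> A" for x
  proof -
    have "x \<in> closure A" using that closure_subset by (rule subsetD[rotated])
    then obtain c where "c \<in> I" "x \<in> ball c s" using I(3) by auto
    then show ?thesis using s by (intro near[of _ c]) (auto simp: dist_commute)
  qed
  show ?thesis
  proof (rule that[of "X s" "X' s" e e', OF XC eC])
    show "0 \<le> X s x \<and> X s x \<le> 1" "0 \<le> e x \<and> e x \<le> 1" for x using X01 by (auto simp: e_def)
    show "X s x = 0" if "x \<in> A" for x by (rule XA[OF that])
    show "e x = 1" if "X s x \<noteq> 1" for x using e1[of x undefined] that by blast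
    show "e x = 1" if "X' s x v \<noteq> 0" for x v using e1[of x v] that by blast
    show "\<exists>y\<in>A. dist x y < \<sigma>" if "e x \<noteq> 0" for x using e2[of x undefined] that by (auto simp: e_def)
    show "\<exists>y\<in>A. dist x y < \<sigma>" if "e' x v \<noteq> 0" for x v using e2[of x v] that by (auto simp: e'_def)
  qed
qed

lemma C1_deriv_snd:
  fixes \<psi> :: "'b::real_normed_vector \<Rightarrow> 'c::real_normed_vector" and S :: "('a::real_normed_vector \<times> 'b) set"
  assumes "C1_deriv UNIV \<psi> \<psi>'"
  shows "C1_deriv S (\<lambda>p. \<psi> (snd p)) (\<lambda>p v. \<psi>' (snd p) (snd v))"
proof (rule C1_derivI)
  fix p :: "'a \<times> 'b"
  have "(snd has_derivative snd) (at p)" by (rule bounded_linear_imp_has_derivative[OF bounded_linear_snd])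
  from has_derivative_compose[OF this C1_deriv_has_derivative[OF assms UNIV_I]]
  show "((\<lambda>p. \<psi> (snd p)) has_derivative (\<lambda>v. \<psi>' (snd p) (snd v))) (at p)" by simp
next
  fix v :: "'a \<times> 'b"
  show "continuous_on S (\<lambda>p. \<psi>' (snd p) (snd v))"
    by (rule continuous_on_compose2[OF C1_deriv_continuous_deriv[OF assms]]) (auto intro!: continuous_intros)
qed

text \<open>\<open>Ck\<close> speaks of iterated directional derivatives. Their continuity yields a
  C1 gradient, whose derivative H is the Hessian of z written in the standard basis.\<close>

lemma Ck_2_derivatives:
  assumes "Ck 2 S z"
  defines "H \<equiv> \<lambda>p v. \<Sum>b\<in>Basis. dder (dder z b) v p *\<^sub>R b"
  shows "C1_deriv S z (\<lambda>p v. egrad z p \<bullet> v)" "C1_deriv S (egrad z) H"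
    "\<And>p v. p \<in> S \<Longrightarrow> dder z v p = egrad z p \<bullet> v"
proof -
  have 1: "\<And>p. p \<in> S \<Longrightarrow> z differentiable (at p)" and 2: "\<And>h. Ck 1 S (dder z h)"
    using assms(1) by (auto simp: numeral_2_eq_2)
  have c: "C1_deriv S (dder z b) (\<lambda>p v. egrad (dder z b) p \<bullet> v)" for b using Ck_1_C1_deriv[OF 2] .
  have "Ck 1 S z" using 1 C1_deriv_continuous_on[OF c] by (simp add: One_nat_def)
  then show "C1_deriv S z (\<lambda>p v. egrad z p \<bullet> v)" by (rule Ck_1_C1_deriv)
  show "\<And>p v. p \<in> S \<Longrightarrow> dder z v p = egrad z p \<bullet> v" using egrad_inner(2) 1 by blast
  have d: "dder (dder z b) v p = egrad (dder z b) p \<bullet> v" if "p \<in> S" for b v p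
    using egrad_inner(2) 2[of b] that by (auto simp: One_nat_def)
  show "C1_deriv S (egrad z) H"
  proof (rule C1_derivI)
    fix p assume p: "p \<in> S"
    have 3: "((\<lambda>p. \<Sum>b\<in>Basis. dder z b p *\<^sub>R b) has_derivative (\<lambda>v. \<Sum>b\<in>Basis. (egrad (dder z b) p \<bullet> v) *\<^sub>R b)) (at p)"
      by (intro has_derivative_sum has_derivative_scaleR_left C1_deriv_has_derivative[OF c p])
    have 4: "H p = (\<lambda>v. \<Sum>b\<in>Basis. (egrad (dder z b) p \<bullet> v) *\<^sub>R b)" unfolding H_def using d[OF p] by simp
    have 5: "egrad z = (\<lambda>p. \<Sum>b\<in>Basis. dder z b p *\<^sub>R b)" by (rule ext) (rule egrad_def)
    show "(egrad z has_derivative H p) (at p)" unfolding 4 5 by (rule 3)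
  next
    fix v
    have "continuous_on S (\<lambda>p. \<Sum>b\<in>Basis. (egrad (dder z b) p \<bullet> v) *\<^sub>R b)"
      by (intro continuous_intros C1_deriv_continuous_deriv[OF c])
    then show "continuous_on S (\<lambda>p. H p v)"
      by (rule continuous_on_eq) (simp add: H_def d)
  qed
qed

lemma C1_closure_gradient:
  fixes z :: "'a::euclidean_space \<Rightarrow> real"
  assumes "C1_closure S z"
  obtains W where "continuous_on (closure S) W" "\<And>p. p \<in> S \<Longrightarrow> W p = egrad z p"
proof -
  obtain g where g: "\<And>h. continuous_on (closure S) (g h)" "\<And>h p. p \<in> S \<Longrightarrow> g h p = dder z h p"
    using assms unfolding C1_closure_def by metis
  show ?thesis
    by (rule that[of "\<lambda>p. \<Sum>b\<in>Basis. g b p *\<^sub>R b"]) (auto intro!: continuous_intros g simp: egrad_def g(2))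
qed

section \<open>The multiplier field and the weight\<close>

lemma linear_mink: "linear mink"
  using bounded_linear_mink by (rule bounded_linear.linear)

lemmas mink_simps = linear_add[OF linear_mink] linear_cmul[OF linear_mink] linear_diff[OF linear_mink]

text \<open>Only the divergence is recorded and the full derivative is hidden under the existential
  quantifier, so that sums and products of long currents remain manageable.\<close>

definition C1_div :: "'a::euclidean_space set \<Rightarrow> ('a \<Rightarrow> 'a) \<Rightarrow> ('a \<Rightarrow> real) \<Rightarrow> bool" where
  "C1_div S J \<delta> \<longleftrightarrow> (\<exists>J'. C1_deriv S J J' \<and> (\<forall>p\<in>S. trace_of (J' p) = \<delta> p))"

lemma C1_divI: "C1_deriv S J J' \<Longrightarrow> (\<And>p. p \<in> S \<Longrightarrow> trace_of (J' p) = \<delta> p) \<Longrightarrow> C1_div S J \<delta>"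
  by (auto simp: C1_div_def)

lemma C1_div_eq: "C1_div S J \<delta> \<Longrightarrow> (\<And>p. p \<in> S \<Longrightarrow> \<delta> p = \<gamma> p) \<Longrightarrow> C1_div S J \<gamma>"
  by (auto simp: C1_div_def)

lemma C1_div_add: "C1_div S J \<delta> \<Longrightarrow> C1_div S K \<gamma> \<Longrightarrow> C1_div S (\<lambda>p. J p + K p) (\<lambda>p. \<delta> p + \<gamma> p)"
  unfolding C1_div_def using C1_deriv_add by (fastforce simp: trace_of_add)

lemma C1_div_diff: "C1_div S J \<delta> \<Longrightarrow> C1_div S K \<gamma> \<Longrightarrow> C1_div S (\<lambda>p. J p - K p) (\<lambda>p. \<delta> p - \<gamma> p)"
  unfolding C1_div_def using C1_deriv_diff by (fastforce simp: trace_of_diff)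

lemma C1_div_scaleR:
  assumes s: "C1_deriv S s s'" and J: "C1_div S J \<delta>"
  shows "C1_div S (\<lambda>p. s p *\<^sub>R J p) (\<lambda>p. s p * \<delta> p + s' p (J p))"
proof -
  obtain J' where J': "C1_deriv S J J'" "\<And>p. p \<in> S \<Longrightarrow> trace_of (J' p) = \<delta> p" using J by (auto simp: C1_div_def)
  show ?thesis
    by (rule C1_divI[OF C1_deriv_scaleR[OF s J'(1)]])
      (simp add: trace_of_add trace_of_scaleR J'(2) trace_of_rank_one[OF C1_deriv_linear[OF s]])
qed

section \<open>Radial and angular directions outside the cone\<close>

definition rad :: "(real^'m) \<times> (real^'n) \<Rightarrow> (real^'m) \<times> (real^'n)" where
  "rad p = (0, snd p /\<^sub>R rr p)"

text \<open>Projection to the tangent space of the spatial sphere through p, and at the same time r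
  times the derivative of \<open>rad\<close>.\<close>

definition ang_proj :: "(real^'m) \<times> (real^'n) \<Rightarrow> (real^'m) \<times> (real^'n) \<Rightarrow> (real^'m) \<times> (real^'n)" where
  "ang_proj p v = (0, snd v) - (rad p \<bullet> v) *\<^sub>R rad p"

lemma rr_pos: "p \<in> DD \<Longrightarrow> rr p > 0"
  using ff_pos_norm_less[of p] norm_ge_zero[of "fst p"] by (auto simp: DD_def rr_def simp del: norm_ge_zero)

lemma rr_sq_ge: "p \<in> DD \<Longrightarrow> 4 * ff p \<le> (rr p)\<^sup>2"
  by (simp add: ff_eq mink_def inner_prod_def rr_def power2_norm_eq_inner)

lemma mink_rad [simp]: "mink (rad p) = rad p"
  by (simp add: mink_def rad_def)

lemma mink_ang_proj [simp]: "mink (ang_proj p v) = ang_proj p v"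
  by (simp add: mink_def ang_proj_def rad_def)

lemma ang_proj_mink [simp]: "ang_proj p (mink v) = ang_proj p v"
  by (simp add: mink_def ang_proj_def rad_def inner_prod_def)

lemma rad_inner_rad: "p \<in> DD \<Longrightarrow> rad p \<bullet> rad p = 1"
  using rr_pos[of p] by (simp add: rad_def inner_prod_def rr_def power2_norm_eq_inner[symmetric] power2_eq_square)

lemma rad_inner_self: "p \<in> DD \<Longrightarrow> rad p \<bullet> p = rr p"
  using rr_pos[of p] by (simp add: rad_def inner_prod_def rr_def power2_norm_eq_inner[symmetric] power2_eq_square)

lemma rad_inner_mink: "rad p \<bullet> mink v = rad p \<bullet> v"
  by (simp add: inner_mink[symmetric])

lemma self_inner_mink: "p \<bullet> mink p = 4 * ff p"
  by (simp add: ff_eq)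

lemma bounded_linear_snd_embed: "bounded_linear (\<lambda>v. (0, snd v))"
  by (intro bounded_linear_Pair bounded_linear_zero bounded_linear_snd)

lemma trace_of_snd_embed: "trace_of (\<lambda>v::(real^'m) \<times> (real^'n). (0, snd v)) = real CARD('n)"
proof -
  have "trace_of (\<lambda>v::(real^'m) \<times> (real^'n). (0, snd v)) = (\<Sum>b\<in>(Basis::(real^'n) set). b \<bullet> b)"
    unfolding trace_of_def Basis_prod_def
    by (subst sum.union_disjoint) (auto simp: inner_prod_def sum.reindex inj_on_def)
  also have "\<dots> = real CARD('n)" by (simp add: inner_Basis)
  finally show ?thesis .
qed

lemma trace_of_ang_proj:
  fixes p :: "(real^'m) \<times> (real^'n)"
  assumes "p \<in> DD" shows "trace_of (ang_proj p) = real CARD('n) - 1"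
  unfolding ang_proj_def[abs_def]
  by (simp add: trace_of_diff trace_of_snd_embed trace_of_inner rad_inner_rad[OF assms])

lemma C1_deriv_rr: "C1_deriv DD rr (\<lambda>p v. rad p \<bullet> v)"
proof (rule C1_derivI)
  fix p :: "(real^'a) \<times> (real^'b)" assume p: "p \<in> DD"
  have "(snd has_derivative snd) (at p)" by (rule bounded_linear_imp_has_derivative[OF bounded_linear_snd])
  moreover have "(norm has_derivative (\<lambda>v. sgn (snd p) \<bullet> v)) (at (snd p))"
    using has_derivative_norm[of "snd p"] rr_pos[OF p] by (simp add: rr_def inner_commute)
  ultimately have "((\<lambda>p. norm (snd p)) has_derivative (\<lambda>v. sgn (snd p) \<bullet> snd v)) (at p)"
    by (rule has_derivative_compose)
  then show "(rr has_derivative (\<lambda>v. rad p \<bullet> v)) (at p)"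
    by (simp add: rr_def[abs_def] rad_def inner_prod_def sgn_div_norm rr_def)
next
  fix v :: "(real^'a) \<times> (real^'b)"
  show "continuous_on DD (\<lambda>p. rad p \<bullet> v)"
    unfolding rad_def rr_def by (intro continuous_intros) (use rr_pos in \<open>auto simp: rr_def\<close>)
qed

lemma C1_deriv_rad: "C1_deriv (DD :: ((real^'a) \<times> (real^'b)) set) rad (\<lambda>p v. (1 / rr p) *\<^sub>R ang_proj p v)"
proof -
  have 1: "C1_deriv DD (\<lambda>p::(real^'a) \<times> (real^'b). (1 / rr p) *\<^sub>R (0, snd p))
      (\<lambda>p v. (1 / rr p) *\<^sub>R (0, snd v) + (- (rad p \<bullet> v) / (rr p)\<^sup>2) *\<^sub>R (0, snd p))"
    by (intro C1_deriv_scaleR C1_deriv_inverse C1_deriv_rr C1_deriv_bounded_linear bounded_linear_snd_embed)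
      (use rr_pos in force)
  show ?thesis
  proof (rule C1_deriv_cong[OF 1 open_DD])
    show "(1 / rr p) *\<^sub>R (0, snd p) = rad p" for p :: "(real^'a) \<times> (real^'b)"
      by (simp add: rad_def divide_inverse)
    fix p v :: "(real^'a) \<times> (real^'b)" assume p: "p \<in> DD"
    have "(0, snd p) = rr p *\<^sub>R rad p" using rr_pos[OF p] by (simp add: rad_def)
    then show "(1 / rr p) *\<^sub>R (0, snd v) + (- (rad p \<bullet> v) / (rr p)\<^sup>2) *\<^sub>R (0, snd p) = (1 / rr p) *\<^sub>R ang_proj p v"
      using rr_pos[OF p] by (simp add: ang_proj_def scaleR_diff_right power2_eq_square)
  qed
qed

section \<open>The multiplier field, its divergence and the zeroth order coefficient\<close>

definition kk :: "real \<Rightarrow> (real^'m) \<times> (real^'n) \<Rightarrow> real" where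
  "kk e p = 1 - e * rr p"

definition cone :: "real \<Rightarrow> ((real^'m) \<times> (real^'n)) set" where
  "cone e = {p\<in>DD. kk e p > 0}"

lemma coneD: "p \<in> cone e \<Longrightarrow> p \<in> DD" "p \<in> cone e \<Longrightarrow> ff p > 0" "p \<in> cone e \<Longrightarrow> kk e p > 0" "p \<in> cone e \<Longrightarrow> rr p > 0"
  using rr_pos[of p] by (auto simp: cone_def DD_def)

lemma C1_deriv_on_cone: "C1_deriv DD s s' \<Longrightarrow> C1_deriv (cone e) s s'"
  by (erule C1_deriv_subset) (auto simp: cone_def)

lemma C1_deriv_kk: "C1_deriv DD (kk e) (\<lambda>p v. - e * (rad p \<bullet> v))"
proof -
  have "C1_deriv DD (\<lambda>p. 1 - e * rr p) (\<lambda>p v. 0 - (e * (rad p \<bullet> v) + 0 * rr p))"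
    by (intro C1_deriv_diff C1_deriv_mult C1_deriv_const C1_deriv_rr)
  then show ?thesis unfolding kk_def[abs_def] by simp
qed

text \<open>The metric gradients of f and k are p / 2 and - e \<open>rad p\<close>, and the field
  equals k^2 times the metric gradient of f / k.\<close>

definition YY :: "real \<Rightarrow> (real^'m) \<times> (real^'n) \<Rightarrow> (real^'m) \<times> (real^'n)" where
  "YY e p = (kk e p / 2) *\<^sub>R p + (e * ff p) *\<^sub>R rad p"

text \<open>The two rank-one terms with factor e / 2 form the antisymmetric part with respect to the
  metric; the other two are the deformation tensor.\<close>

definition DY :: "real \<Rightarrow> (real^'m) \<times> (real^'n) \<Rightarrow> (real^'m) \<times> (real^'n) \<Rightarrow> (real^'m) \<times> (real^'n)" where
  "DY e p v = (- (e / 2) * (rad p \<bullet> v)) *\<^sub>R p + (kk e p / 2) *\<^sub>R v + (e / 2 * (mink p \<bullet> v)) *\<^sub>R rad p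
     + (e * ff p / rr p) *\<^sub>R ang_proj p v"

lemma C1_deriv_YY: "C1_deriv DD (YY e) (DY e)"
proof -
  have "C1_deriv DD (\<lambda>p. ((1 / 2) * kk e p) *\<^sub>R p + (e * ff p) *\<^sub>R rad p)
    (\<lambda>p v. (((1 / 2) * kk e p) *\<^sub>R v + ((1 / 2) * (- e * (rad p \<bullet> v)) + 0 * kk e p) *\<^sub>R p)
      + ((e * ff p) *\<^sub>R ((1 / rr p) *\<^sub>R ang_proj p v) + (e * ((mink p \<bullet> v) / 2) + 0 * ff p) *\<^sub>R rad p))"
    by (intro C1_deriv_add C1_deriv_scaleR C1_deriv_mult C1_deriv_const C1_deriv_kk C1_deriv_ff C1_deriv_rad
        C1_deriv_bounded_linear bounded_linear_ident)
  then have "C1_deriv DD (YY e) (\<lambda>p v. (((1 / 2) * kk e p) *\<^sub>R v + ((1 / 2) * (- e * (rad p \<bullet> v)) + 0 * kk e p) *\<^sub>R p)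
      + ((e * ff p) *\<^sub>R ((1 / rr p) *\<^sub>R ang_proj p v) + (e * ((mink p \<bullet> v) / 2) + 0 * ff p) *\<^sub>R rad p))"
    by (simp add: YY_def[abs_def])
  then show ?thesis by (rule C1_deriv_eq) (simp add: DY_def algebra_simps)
qed

definition divY :: "real \<Rightarrow> (real^'m) \<times> (real^'n) \<Rightarrow> real" where
  "divY e p = real (CARD('m) + CARD('n)) * kk e p / 2 + e * ff p / rr p * (real CARD('n) - 1)"

lemma trace_of_DY:
  fixes p :: "(real^'m) \<times> (real^'n)"
  assumes p: "p \<in> DD" shows "trace_of (DY e p) = divY e p"
proof -
  have l: "linear (\<lambda>v. c * (q \<bullet> v))" for c and q :: "(real^'m) \<times> (real^'n)"
    by (simp add: linear_iff inner_add_right algebra_simps)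
  have "rad p \<bullet> p = rr p" "mink p \<bullet> rad p = rr p"
    using rad_inner_self[OF p] by (simp_all add: inner_mink inner_commute)
  then show ?thesis
    unfolding DY_def[abs_def]
    by (simp only: trace_of_add trace_of_scaleR trace_of_id trace_of_ang_proj[OF p] trace_of_rank_one[OF l])
      (simp add: divY_def field_simps)
qed

text \<open>The coefficients of q are forced by the identity div Y = 2 q + k + e f / r. With it, all
  multiples of the Lorentzian square of the gradient cancel in the divergence of the current, except
  for - e f / (2 r).\<close>

definition q0 :: "nat \<Rightarrow> nat \<Rightarrow> real" where "q0 m n = (real (m + n) - 2) / 4"
definition q1 :: "nat \<Rightarrow> real" where "q1 n = (real n - 2) / 2"

definition qq :: "real \<Rightarrow> (real^'m) \<times> (real^'n) \<Rightarrow> real" where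
  "qq e p = q0 CARD('m) CARD('n) * kk e p + e * q1 CARD('n) * (ff p * (1 / rr p))"

definition Gq :: "real \<Rightarrow> (real^'m) \<times> (real^'n) \<Rightarrow> (real^'m) \<times> (real^'n)" where
  "Gq e p = (- e * q0 CARD('m) CARD('n) - e * q1 CARD('n) * (ff p / (rr p)\<^sup>2)) *\<^sub>R rad p
      + (e * q1 CARD('n) / 2 * (1 / rr p)) *\<^sub>R mink p"

text \<open>The wave operator applied to \<open>qq e\<close>. Since f <= r^2 / 4 it is of order e /
  r, so its contribution can be absorbed for small e.\<close>

definition boxq :: "real \<Rightarrow> (real^'m) \<times> (real^'n) \<Rightarrow> real" where
  "boxq e p = - e * q0 CARD('m) CARD('n) * (real CARD('n) - 1) / rr p
     + e * q1 CARD('n) * ((real (CARD('m) + CARD('n)) / 2 - 1) / rr p - (real CARD('n) - 3) * ff p / (rr p) ^ 3)"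

lemma C1_deriv_inverse_rr: "C1_deriv DD (\<lambda>p. 1 / rr p) (\<lambda>p v. - (rad p \<bullet> v) / (rr p)\<^sup>2)"
  by (intro C1_deriv_inverse C1_deriv_rr) (use rr_pos in force)

lemma C1_deriv_qq: "C1_deriv DD (qq e) (\<lambda>p v. Gq e p \<bullet> v)"
proof -
  have "C1_deriv DD (qq e :: (real^'m) \<times> (real^'n) \<Rightarrow> real)
    (\<lambda>p v. (q0 CARD('m) CARD('n) * (- e * (rad p \<bullet> v)) + 0 * kk e p)
     + ((e * q1 CARD('n)) * (ff p * (- (rad p \<bullet> v) / (rr p)\<^sup>2) + ((mink p \<bullet> v) / 2) * (1 / rr p)) + 0 * (ff p * (1 / rr p))))"
    unfolding qq_def[abs_def]
    by (intro C1_deriv_add C1_deriv_mult C1_deriv_const C1_deriv_kk C1_deriv_ff C1_deriv_inverse_rr)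
  then show ?thesis by (rule C1_deriv_eq) (simp add: Gq_def inner_add_left algebra_simps)
qed

lemma C1_div_Gq: "C1_div (DD :: ((real^'m) \<times> (real^'n)) set) (\<lambda>p. mink (Gq e p)) (boxq e)"
proof -
  let ?A = "q0 CARD('m) CARD('n)" and ?E = "q1 CARD('n)"
  have r: "C1_div DD (rad :: (real^'m) \<times> (real^'n) \<Rightarrow> _) (\<lambda>p. (real CARD('n) - 1) / rr p)"
    by (rule C1_divI[OF C1_deriv_rad]) (simp add: trace_of_scaleR trace_of_ang_proj)
  have i: "C1_div DD (\<lambda>p::(real^'m) \<times> (real^'n). p) (\<lambda>p. real (CARD('m) + CARD('n)))"
    by (rule C1_divI[OF C1_deriv_bounded_linear[OF bounded_linear_ident]]) (simp add: trace_of_id)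
  have ir2: "C1_deriv DD (\<lambda>p::(real^'m) \<times> (real^'n). (1 / rr p) * (1 / rr p))
     (\<lambda>p v. (1 / rr p) * (- (rad p \<bullet> v) / (rr p)\<^sup>2) + (- (rad p \<bullet> v) / (rr p)\<^sup>2) * (1 / rr p))"
    by (intro C1_deriv_mult C1_deriv_inverse_rr)
  have s1: "C1_deriv DD (\<lambda>p::(real^'m) \<times> (real^'n). - e * ?A - e * ?E * (ff p * ((1 / rr p) * (1 / rr p))))
    (\<lambda>p v. 0 - ((e * ?E) * (ff p * ((1 / rr p) * (- (rad p \<bullet> v) / (rr p)\<^sup>2) + (- (rad p \<bullet> v) / (rr p)\<^sup>2) * (1 / rr p))
        + ((mink p \<bullet> v) / 2) * ((1 / rr p) * (1 / rr p))) + 0 * (ff p * ((1 / rr p) * (1 / rr p)))))"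
    by (intro C1_deriv_diff C1_deriv_mult C1_deriv_const C1_deriv_ff C1_deriv_inverse_rr)
  have s2: "C1_deriv DD (\<lambda>p::(real^'m) \<times> (real^'n). e * ?E / 2 * (1 / rr p))
      (\<lambda>p v. e * ?E / 2 * (- (rad p \<bullet> v) / (rr p)\<^sup>2) + 0 * (1 / rr p))"
    by (intro C1_deriv_mult C1_deriv_const C1_deriv_inverse_rr)
  have "C1_div DD (\<lambda>p::(real^'m) \<times> (real^'n). (- e * ?A - e * ?E * (ff p * ((1 / rr p) * (1 / rr p)))) *\<^sub>R rad p
      + (e * ?E / 2 * (1 / rr p)) *\<^sub>R p) (boxq e)"
  proof (rule C1_div_eq[OF C1_div_add[OF C1_div_scaleR[OF s1 r] C1_div_scaleR[OF s2 i]]])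
    fix p :: "(real^'m) \<times> (real^'n)" assume p: "p \<in> DD"
    have "mink p \<bullet> rad p = rr p" using rad_inner_self[OF p] by (simp add: inner_mink inner_commute)
    then show "((- e * ?A - e * ?E * (ff p * ((1 / rr p) * (1 / rr p)))) * ((real CARD('n) - 1) / rr p)
       + (0 - ((e * ?E) * (ff p * ((1 / rr p) * (- (rad p \<bullet> rad p) / (rr p)\<^sup>2) + (- (rad p \<bullet> rad p) / (rr p)\<^sup>2) * (1 / rr p))
        + ((mink p \<bullet> rad p) / 2) * ((1 / rr p) * (1 / rr p))) + 0 * (ff p * ((1 / rr p) * (1 / rr p))))))
       + (e * ?E / 2 * (1 / rr p) * real (CARD('m) + CARD('n)) + (e * ?E / 2 * (- (rad p \<bullet> p) / (rr p)\<^sup>2) + 0 * (1 / rr p))) = boxq e p"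
      using rr_pos[OF p]
      by (simp add: rad_inner_rad[OF p] rad_inner_self[OF p] boxq_def field_simps power2_eq_square power3_eq_cube)
  qed
  moreover have "(\<lambda>p::(real^'m) \<times> (real^'n). mink (Gq e p)) = (\<lambda>p. (- e * ?A - e * ?E * (ff p * ((1 / rr p) * (1 / rr p)))) *\<^sub>R rad p
      + (e * ?E / 2 * (1 / rr p)) *\<^sub>R p)"
    unfolding Gq_def mink_simps mink_mink mink_rad by (simp add: power2_eq_square)
  ultimately show ?thesis by simp
qed

text \<open>Euclidean gradient of the logarithm of the weight. Raised by \<open>mink\<close> it is a
  / (k f) times \<open>YY e\<close>, so conjugation with the weight produces a derivative along the
  multiplier itself.\<close>

definition lam :: "real \<Rightarrow> real \<Rightarrow> (real^'m) \<times> (real^'n) \<Rightarrow> (real^'m) \<times> (real^'n)" where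
  "lam a e p = (a / 2 * (1 / ff p)) *\<^sub>R mink p + (a * e * (1 / kk e p)) *\<^sub>R rad p"

definition wt :: "real \<Rightarrow> real \<Rightarrow> (real^'m) \<times> (real^'n) \<Rightarrow> real" where
  "wt a e p = (ff p * (1 / kk e p)) powr a"

lemma C1_deriv_inverse_ff: "C1_deriv (cone e) (\<lambda>p. 1 / ff p) (\<lambda>p v. - ((mink p \<bullet> v) / 2) / (ff p)\<^sup>2)"
  by (intro C1_deriv_inverse C1_deriv_ff) (use coneD(2) in force)

lemma C1_deriv_inverse_kk: "C1_deriv (cone e) (\<lambda>p. 1 / kk e p) (\<lambda>p v. - (- e * (rad p \<bullet> v)) / (kk e p)\<^sup>2)"
  by (intro C1_deriv_inverse C1_deriv_on_cone C1_deriv_kk) (use coneD(3) in force)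

lemma C1_deriv_wt: "C1_deriv (cone e :: ((real^'a) \<times> (real^'b)) set) (wt a e) (\<lambda>p v. wt a e p * (lam a e p \<bullet> v))"
proof -
  have 1: "C1_deriv (cone e) (\<lambda>p::(real^'a) \<times> (real^'b). ff p * (1 / kk e p))
     (\<lambda>p v. ff p * (- (- e * (rad p \<bullet> v)) / (kk e p)\<^sup>2) + ((mink p \<bullet> v) / 2) * (1 / kk e p))"
    by (intro C1_deriv_mult C1_deriv_inverse_kk C1_deriv_ff)
  have pos: "ff p * (1 / kk e p) > 0" if "p \<in> cone e" for p :: "(real^'a) \<times> (real^'b)"
    using coneD[OF that] by simp
  have "C1_deriv (cone e) (\<lambda>p::(real^'a) \<times> (real^'b). (\<lambda>x. x powr a) (ff p * (1 / kk e p)))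
     (\<lambda>p v. (\<lambda>x. a * x powr (a - 1)) (ff p * (1 / kk e p)) *
        (ff p * (- (- e * (rad p \<bullet> v)) / (kk e p)\<^sup>2) + ((mink p \<bullet> v) / 2) * (1 / kk e p)))"
  proof (rule C1_deriv_compose_real[OF 1, where h="\<lambda>x. x powr a" and h'="\<lambda>x. a * x powr (a - 1)"])
    show "((\<lambda>x. x powr a) has_real_derivative a * (ff p * (1 / kk e p)) powr (a - 1)) (at (ff p * (1 / kk e p)))"
      if "p \<in> cone e" for p :: "(real^'a) \<times> (real^'b)"
      using has_real_derivative_powr[OF pos[OF that], of a] by (simp add: mult.commute)
    show "continuous_on ((\<lambda>p::(real^'a) \<times> (real^'b). ff p * (1 / kk e p)) ` cone e) (\<lambda>x. a * x powr (a - 1))"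
      by (intro continuous_intros) (use pos in force)
  qed
  then have 2: "C1_deriv (cone e) (wt a e :: (real^'a) \<times> (real^'b) \<Rightarrow> real) (\<lambda>p v. a * (ff p * (1 / kk e p)) powr (a - 1) *
        (ff p * (- (- e * (rad p \<bullet> v)) / (kk e p)\<^sup>2) + ((mink p \<bullet> v) / 2) * (1 / kk e p)))"
    by (simp add: wt_def[abs_def])
  show ?thesis
  proof (rule C1_deriv_eq[OF 2])
    fix p v :: "(real^'a) \<times> (real^'b)" assume p: "p \<in> cone e"
    have pw: "(ff p * (1 / kk e p)) powr (a - 1) = wt a e p / (ff p * (1 / kk e p))"
      unfolding wt_def using pos[OF p] coneD[OF p] by (simp add: powr_diff)
    show "a * (ff p * (1 / kk e p)) powr (a - 1) *
        (ff p * (- (- e * (rad p \<bullet> v)) / (kk e p)\<^sup>2) + ((mink p \<bullet> v) / 2) * (1 / kk e p)) = wt a e p * (lam a e p \<bullet> v)"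
      unfolding pw using coneD[OF p] by (simp add: lam_def inner_add_left field_simps power2_eq_square)
  qed
qed

definition Dlam :: "real \<Rightarrow> real \<Rightarrow> (real^'m) \<times> (real^'n) \<Rightarrow> (real^'m) \<times> (real^'n) \<Rightarrow> (real^'m) \<times> (real^'n)" where
  "Dlam a e p v = ((a / 2 * (1 / ff p)) *\<^sub>R mink v + (a / 2 * (- ((mink p \<bullet> v) / 2) / (ff p)\<^sup>2)) *\<^sub>R mink p)
     + ((a * e * (1 / kk e p)) *\<^sub>R ((1 / rr p) *\<^sub>R ang_proj p v) + (a * e * (- (- e * (rad p \<bullet> v)) / (kk e p)\<^sup>2)) *\<^sub>R rad p)"

lemma C1_deriv_lam: "C1_deriv (cone e) (lam a e) (Dlam a e)"
proof -
  have "C1_deriv (cone e) (lam a e) (\<lambda>p v. ((a / 2 * (1 / ff p)) *\<^sub>R mink v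
       + (a / 2 * (- ((mink p \<bullet> v) / 2) / (ff p)\<^sup>2) + 0 * (1 / ff p)) *\<^sub>R mink p)
     + ((a * e * (1 / kk e p)) *\<^sub>R ((1 / rr p) *\<^sub>R ang_proj p v)
       + (a * e * (- (- e * (rad p \<bullet> v)) / (kk e p)\<^sup>2) + 0 * (1 / kk e p)) *\<^sub>R rad p))"
    unfolding lam_def[abs_def]
    by (intro C1_deriv_add C1_deriv_scaleR C1_deriv_mult C1_deriv_const C1_deriv_inverse_ff C1_deriv_inverse_kk
        C1_deriv_on_cone[OF C1_deriv_rad] C1_deriv_bounded_linear bounded_linear_mink)
  then show ?thesis by (rule C1_deriv_eq) (simp add: Dlam_def)
qed

text \<open>This is the wave operator applied to the logarithm of the weight. It is the part of the
  conjugated potential linear in a; the quadratic part is the Lorentzian square of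
  \<open>lam\<close>.\<close>

lemma trace_of_mink_Dlam:
  fixes p :: "(real^'m) \<times> (real^'n)"
  assumes p: "p \<in> cone e"
  shows "trace_of (\<lambda>v. mink (Dlam a e p v)) = a * ((real (CARD('m) + CARD('n)) / 2 - 1) / ff p
     + e * (real CARD('n) - 1) / (rr p * kk e p) + e\<^sup>2 / (kk e p)\<^sup>2)"
proof -
  have l: "linear (\<lambda>v. c * (- ((q \<bullet> v) / 2) / b))" "linear (\<lambda>v. c * (- (- e * (q \<bullet> v)) / b))" for c b and q :: "(real^'m) \<times> (real^'n)"
    by (simp_all add: linear_iff inner_add_right algebra_simps add_divide_distrib diff_divide_distrib)
  have "mink p \<bullet> p = 4 * ff p" "rad p \<bullet> rad p = 1" using rad_inner_rad[OF coneD(1)[OF p]] self_inner_mink[of p]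
    by (simp_all add: inner_mink)
  then show ?thesis
    using coneD[OF p]
    unfolding Dlam_def
    by (simp only: mink_simps mink_mink mink_rad mink_ang_proj trace_of_add trace_of_scaleR trace_of_id
        trace_of_ang_proj trace_of_rank_one[OF l(1)] trace_of_rank_one[OF l(2)])
      (simp add: field_simps power2_eq_square)
qed

section \<open>The current and its divergence\<close>

text \<open>The gradient at p of \<psi> = \<open>wt\<close> z, when z and its gradient have the
  values s and g there.\<close>

definition xi :: "real \<Rightarrow> real \<Rightarrow> (real^'m) \<times> (real^'n) \<Rightarrow> real \<Rightarrow> (real^'m) \<times> (real^'n) \<Rightarrow> (real^'m) \<times> (real^'n)" where
  "xi a e p s g = wt a e p *\<^sub>R g + (wt a e p * s) *\<^sub>R lam a e p"

text \<open>Coefficient of the Hardy field. The first summand cancels the singular potential a^2 /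
  (k f) of the conjugated equation; the second leaves a positive multiple of d r / f in front of
  \<psi>^2.\<close>

definition Th :: "real \<Rightarrow> real \<Rightarrow> real \<Rightarrow> (real^'m) \<times> (real^'n) \<Rightarrow> real" where
  "Th a e d p = a\<^sup>2 / 2 * ((1 / kk e p) * (1 / ff p)) + d * (rr p * (1 / ff p))"

text \<open>The current of the multiplier method for the conjugated function \<open>wt * z\<close>, as a function of the point,
  the value and the gradient of \<open>z\<close>; in this form it also makes sense on the boundary.\<close>

definition cfield :: "real \<Rightarrow> real \<Rightarrow> real \<Rightarrow> (real^'m) \<times> (real^'n) \<Rightarrow> real \<Rightarrow> (real^'m) \<times> (real^'n) \<Rightarrow> (real^'m) \<times> (real^'n)" where
  "cfield a e d p s g =
     (YY e p \<bullet> xi a e p s g) *\<^sub>R mink (xi a e p s g)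
     - (1 / 2 * (xi a e p s g \<bullet> mink (xi a e p s g))) *\<^sub>R YY e p
     + (qq e p * (wt a e p * s)) *\<^sub>R mink (xi a e p s g)
     - (1 / 2 * ((wt a e p * s) * (wt a e p * s))) *\<^sub>R mink (Gq e p)
     + (Th a e d p * ((wt a e p * s) * (wt a e p * s))) *\<^sub>R YY e p"

text \<open>Arranged around x = Y \<psi> + q \<psi>: the source, the square gained from conjugation,
  a cross term from which a^2 / (k f) has disappeared, the angular form, and the zeroth order term.
  The argument b stands for the value of the wave operator on z.\<close>

definition cdiv :: "real \<Rightarrow> real \<Rightarrow> real \<Rightarrow> (real^'m) \<times> (real^'n) \<Rightarrow> real \<Rightarrow> (real^'m) \<times> (real^'n) \<Rightarrow> real \<Rightarrow> real" where
  "cdiv a e d p s g b = (let \<xi> = xi a e p s g; \<psi> = wt a e p * s; x = YY e p \<bullet> \<xi> + qq e p * \<psi>;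
       f = ff p; k = kk e p; r = rr p in
     wt a e p * b * x + 2 * (a / (k * f)) * x\<^sup>2
     + (a * e / (k * r) - (a\<^sup>2 - a) * e\<^sup>2 / k\<^sup>2 + 2 * d * (r / f)) * \<psi> * x
     + e * f / r * (snd \<xi> \<bullet> snd \<xi> - (rad p \<bullet> \<xi>)\<^sup>2 - (\<xi> \<bullet> mink \<xi>) / 2)
     + \<psi>\<^sup>2 * (a\<^sup>2 / 2 * (e\<^sup>2 / k\<^sup>2 + e / (k * r)) + d * (r / (2 * f) * (1 - 2 * e * r) + 2 * e) - boxq e p / 2))"

lemma mink_lam:
  assumes "p \<in> cone e" shows "mink (lam a e p) = (a / (kk e p * ff p)) *\<^sub>R YY e p"
  using coneD[OF assms] by (simp add: lam_def YY_def mink_simps scaleR_add_right)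

lemma
  assumes p: "p \<in> DD"
  shows rad_inner_YY: "rad p \<bullet> YY e p = kk e p * rr p / 2 + e * ff p"
    and ff_along_YY: "(mink p \<bullet> YY e p) / 2 = kk e p * ff p + e * ff p * rr p / 2"
    and YY_inner_mink: "YY e p \<bullet> mink (YY e p) = ff p * (kk e p + e\<^sup>2 * ff p)"
proof -
  have 1: "rad p \<bullet> p = rr p" "p \<bullet> rad p = rr p" "rad p \<bullet> rad p = 1" "mink p \<bullet> p = 4 * ff p" "mink p \<bullet> rad p = rr p"
    "p \<bullet> mink p = 4 * ff p" "rad p \<bullet> mink p = rr p"
    using rad_inner_self[OF p] rad_inner_rad[OF p] self_inner_mink[of p] by (simp_all add: inner_mink inner_commute rad_inner_mink)
  show "rad p \<bullet> YY e p = kk e p * rr p / 2 + e * ff p" by (simp add: YY_def inner_add_right 1)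
  show "(mink p \<bullet> YY e p) / 2 = kk e p * ff p + e * ff p * rr p / 2" by (simp add: YY_def inner_add_right 1)
  have k: "kk e p + e * rr p = 1" by (simp add: kk_def)
  have "YY e p \<bullet> mink (YY e p) = ff p * (kk e p * (kk e p + e * rr p) + e\<^sup>2 * ff p)"
    by (simp add: YY_def mink_simps inner_add_left inner_add_right 1 algebra_simps power2_eq_square)
  then show "YY e p \<bullet> mink (YY e p) = ff p * (kk e p + e\<^sup>2 * ff p)" by (simp add: k)
qed

text \<open>The deformation tensor of Y contracted twice with \<xi>: the terms pairing
  \<open>rad p\<close> with p cancel, and only the metric and the spatial angular part
  remain.\<close>

lemma DY_mink_inner:
  assumes p: "p \<in> DD"
  shows "DY e p (mink \<xi>) \<bullet> \<xi> = kk e p / 2 * (\<xi> \<bullet> mink \<xi>) + e * ff p / rr p * (snd \<xi> \<bullet> snd \<xi> - (rad p \<bullet> \<xi>)\<^sup>2)"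
proof -
  have 1: "mink p \<bullet> mink \<xi> = p \<bullet> \<xi>" by (simp add: inner_mink)
  have 2: "ang_proj p \<xi> \<bullet> \<xi> = snd \<xi> \<bullet> snd \<xi> - (rad p \<bullet> \<xi>)\<^sup>2"
    by (simp add: ang_proj_def inner_diff_left power2_eq_square) (simp add: inner_prod_def)
  show ?thesis
    unfolding DY_def inner_add_left inner_scaleR_left rad_inner_mink ang_proj_mink inner_mink[of \<xi>] 1 2
    by (simp add: algebra_simps)
qed

lemma C1_deriv_Th: "C1_deriv (cone e) (Th a e d) (\<lambda>p v. a\<^sup>2 / 2 * ((1 / kk e p) * (- ((mink p \<bullet> v) / 2) / (ff p)\<^sup>2)
      + (- (- e * (rad p \<bullet> v)) / (kk e p)\<^sup>2) * (1 / ff p))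
      + d * (rr p * (- ((mink p \<bullet> v) / 2) / (ff p)\<^sup>2) + (rad p \<bullet> v) * (1 / ff p)))"
proof -
  have "C1_deriv (cone e) (Th a e d) (\<lambda>p v. (a\<^sup>2 / 2 * ((1 / kk e p) * (- ((mink p \<bullet> v) / 2) / (ff p)\<^sup>2)
      + (- (- e * (rad p \<bullet> v)) / (kk e p)\<^sup>2) * (1 / ff p)) + 0 * ((1 / kk e p) * (1 / ff p)))
      + (d * (rr p * (- ((mink p \<bullet> v) / 2) / (ff p)\<^sup>2) + (rad p \<bullet> v) * (1 / ff p)) + 0 * (rr p * (1 / ff p))))"
    unfolding Th_def[abs_def]
    by (intro C1_deriv_add C1_deriv_mult C1_deriv_const C1_deriv_inverse_ff C1_deriv_inverse_kk C1_deriv_on_cone[OF C1_deriv_rr])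
  then show ?thesis by (rule C1_deriv_eq) simp
qed

text \<open>Symmetry of the second derivatives of \<psi> turns the divergence of the energy current
  into the wave operator on \<psi> times Y \<psi> plus the deformation term. The conjugated equation
  replaces the wave operator on \<psi> by that on z. The choices of q and \<open>Th\<close> then
  remove the metric multiples and the potential a^2 / (k f).\<close>

lemma C1_div_cfield:
  fixes z :: "(real^'m) \<times> (real^'n) \<Rightarrow> real"
  assumes S: "open S" "S \<subseteq> cone e" and z: "C1_deriv S z (\<lambda>p v. G p \<bullet> v)" and G: "C1_deriv S G H"
  shows "C1_div S (\<lambda>p. cfield a e d p (z p) (G p)) (\<lambda>p. cdiv a e d p (z p) (G p) (trace_of (\<lambda>v. mink (H p v))))"
proof -
  define \<psi> where "\<psi> p = wt a e p * z p" for p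
  define \<xi> where "\<xi> p = xi a e p (z p) (G p)" for p
  have SD: "S \<subseteq> DD" using S(2) by (auto simp: cone_def)
  have w: "C1_deriv S (wt a e) (\<lambda>p v. wt a e p * (lam a e p \<bullet> v))" by (rule C1_deriv_subset[OF C1_deriv_wt S(2)])
  have l: "C1_deriv S (lam a e) (Dlam a e)" by (rule C1_deriv_subset[OF C1_deriv_lam S(2)])
  have \<psi>C: "C1_deriv S \<psi> (\<lambda>p v. \<xi> p \<bullet> v)"
  proof -
    have "C1_deriv S \<psi> (\<lambda>p v. wt a e p * (G p \<bullet> v) + wt a e p * (lam a e p \<bullet> v) * z p)"
      unfolding \<psi>_def[abs_def] by (rule C1_deriv_mult[OF w z])
    then show ?thesis by (rule C1_deriv_eq) (simp add: \<xi>_def xi_def inner_add_left)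
  qed
  define D\<xi> where "D\<xi> p v = (wt a e p *\<^sub>R H p v + (wt a e p * (lam a e p \<bullet> v)) *\<^sub>R G p)
      + (\<psi> p *\<^sub>R Dlam a e p v + (\<xi> p \<bullet> v) *\<^sub>R lam a e p)" for p v
  have \<xi>C: "C1_deriv S \<xi> D\<xi>"
  proof -
    have "\<xi> = (\<lambda>p. wt a e p *\<^sub>R G p + \<psi> p *\<^sub>R lam a e p)" by (simp add: \<xi>_def xi_def \<psi>_def fun_eq_iff)
    then show ?thesis
      unfolding D\<xi>_def[abs_def] by (simp only:) (intro C1_deriv_add C1_deriv_scaleR w G \<psi>C[unfolded \<open>\<xi> = _\<close>] l)
  qed
  \<comment> \<open>This makes the Hessian terms from the two quadratic parts of the energy current
    cancel.\<close>
  have sym: "D\<xi> p u \<bullet> v = D\<xi> p v \<bullet> u" if "p \<in> S" for p u v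
    by (rule second_derivative_symmetric[OF S(1) that \<psi>C \<xi>C])
  \<comment> \<open>The wave operator on \<psi>, as the divergence of its metric gradient.\<close>
  define B where "B p = trace_of (\<lambda>v. mink (D\<xi> p v))" for p
  have Beq: "B p = wt a e p * trace_of (\<lambda>v. mink (H p v)) + 2 * (lam a e p \<bullet> mink (\<xi> p))
      + \<psi> p * (trace_of (\<lambda>v. mink (Dlam a e p v)) - lam a e p \<bullet> mink (lam a e p))" if "p \<in> S" for p
  proof -
    have lin: "linear (\<lambda>v. c * (q \<bullet> v))" for c and q :: "(real^'m) \<times> (real^'n)"
      by (simp add: linear_iff inner_add_right algebra_simps)
    have "B p = wt a e p * trace_of (\<lambda>v. mink (H p v)) + wt a e p * (lam a e p \<bullet> mink (G p))
       + (\<psi> p * trace_of (\<lambda>v. mink (Dlam a e p v)) + \<xi> p \<bullet> mink (lam a e p))"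
      unfolding B_def D\<xi>_def mink_simps
      by (simp only: trace_of_add trace_of_scaleR trace_of_rank_one[OF lin] trace_of_inner)
    moreover have "\<xi> p \<bullet> mink (lam a e p) = lam a e p \<bullet> mink (\<xi> p)" by (metis inner_commute inner_mink)
    moreover have "wt a e p * (lam a e p \<bullet> mink (G p)) = lam a e p \<bullet> mink (\<xi> p) - \<psi> p * (lam a e p \<bullet> mink (lam a e p))"
      by (simp add: \<xi>_def xi_def \<psi>_def mink_simps inner_add_right)
    ultimately show ?thesis by (simp add: algebra_simps)
  qed
  have mC: "C1_div S (\<lambda>p. mink (\<xi> p)) B"
    by (rule C1_divI[OF C1_deriv_linear_compose[OF bounded_linear_mink \<xi>C]]) (simp add: B_def)
  have Y: "C1_deriv S (YY e) (DY e)" by (rule C1_deriv_subset[OF C1_deriv_YY SD])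
  have Yd: "C1_div S (YY e) (divY e)"
    by (rule C1_divI[OF Y]) (use SD trace_of_DY in blast)
  have Qd: "C1_div S (\<lambda>p. mink (Gq e p)) (boxq e)"
  proof -
    obtain J' where "C1_deriv DD (\<lambda>p::(real^'m) \<times> (real^'n). mink (Gq e p)) J'" "\<forall>p\<in>DD. trace_of (J' p) = boxq e p"
      using C1_div_Gq[of e] unfolding C1_div_def by blast
    then show ?thesis using SD by (intro C1_divI[OF C1_deriv_subset]) auto
  qed
  have Q: "C1_deriv S (qq e) (\<lambda>p v. Gq e p \<bullet> v)" by (rule C1_deriv_subset[OF C1_deriv_qq SD])
  define Th' where "Th' p v = a\<^sup>2 / 2 * ((1 / kk e p) * (- ((mink p \<bullet> v) / 2) / (ff p)\<^sup>2)
      + (- (- e * (rad p \<bullet> v)) / (kk e p)\<^sup>2) * (1 / ff p))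
      + d * (rr p * (- ((mink p \<bullet> v) / 2) / (ff p)\<^sup>2) + (rad p \<bullet> v) * (1 / ff p))" for p v :: "(real^'m) \<times> (real^'n)"
  have T: "C1_deriv S (Th a e d) Th'" unfolding Th'_def[abs_def] by (rule C1_deriv_subset[OF C1_deriv_Th S(2)])
  note m\<xi> = C1_deriv_linear_compose[OF bounded_linear_mink \<xi>C]
  note \<psi>2 = C1_deriv_mult[OF \<psi>C \<psi>C]
  have raw: "C1_div S (\<lambda>p. cfield a e d p (z p) (G p)) (\<lambda>p.
      ((((YY e p \<bullet> \<xi> p) * B p + (YY e p \<bullet> D\<xi> p (mink (\<xi> p)) + DY e p (mink (\<xi> p)) \<bullet> \<xi> p))
      - ((1 / 2 * (\<xi> p \<bullet> mink (\<xi> p))) * divY e p + (1 / 2 * (\<xi> p \<bullet> mink (D\<xi> p (YY e p)) + D\<xi> p (YY e p) \<bullet> mink (\<xi> p)) + 0 * (\<xi> p \<bullet> mink (\<xi> p)))))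
      + ((qq e p * \<psi> p) * B p + (qq e p * (\<xi> p \<bullet> mink (\<xi> p)) + (Gq e p \<bullet> mink (\<xi> p)) * \<psi> p)))
      - ((1 / 2 * (\<psi> p * \<psi> p)) * boxq e p + (1 / 2 * (\<psi> p * (\<xi> p \<bullet> mink (Gq e p)) + (\<xi> p \<bullet> mink (Gq e p)) * \<psi> p) + 0 * (\<psi> p * \<psi> p)))
      + ((Th a e d p * (\<psi> p * \<psi> p)) * divY e p + (Th a e d p * (\<psi> p * (\<xi> p \<bullet> YY e p) + (\<xi> p \<bullet> YY e p) * \<psi> p) + Th' p (YY e p) * (\<psi> p * \<psi> p))))"
    unfolding cfield_def \<xi>_def[symmetric] \<psi>_def[symmetric]
    by (intro C1_div_add C1_div_diff
        C1_div_scaleR[OF C1_deriv_inner[OF Y \<xi>C] mC]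
        C1_div_scaleR[OF C1_deriv_mult[OF C1_deriv_const C1_deriv_inner[OF \<xi>C m\<xi>]] Yd]
        C1_div_scaleR[OF C1_deriv_mult[OF Q \<psi>C] mC]
        C1_div_scaleR[OF C1_deriv_mult[OF C1_deriv_const \<psi>2] Qd]
        C1_div_scaleR[OF C1_deriv_mult[OF T \<psi>2] Yd])
  show ?thesis
  proof (rule C1_div_eq[OF raw])
    fix p assume p: "p \<in> S"
    then have pc: "p \<in> cone e" and pD: "p \<in> DD" using S(2) SD by auto
    define f where "f = ff p" define k where "k = kk e p" define r where "r = rr p"
    have pos: "f > 0" "k > 0" "r > 0" using coneD[OF pc] by (auto simp: f_def k_def r_def)
    have ker: "k = 1 - e * r" by (simp add: k_def r_def kk_def)
    define y where "y = YY e p \<bullet> \<xi> p"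
    define q where "q = qq e p"
    define X where "X = \<xi> p \<bullet> mink (\<xi> p)"
    define ang where "ang = snd (\<xi> p) \<bullet> snd (\<xi> p) - (rad p \<bullet> \<xi> p)\<^sup>2"
    have 1: "YY e p \<bullet> D\<xi> p (mink (\<xi> p)) = D\<xi> p (YY e p) \<bullet> mink (\<xi> p)"
      using sym[OF p, of "mink (\<xi> p)" "YY e p"] by (simp add: inner_commute)
    have 2: "\<xi> p \<bullet> mink (D\<xi> p (YY e p)) = D\<xi> p (YY e p) \<bullet> mink (\<xi> p)" by (metis inner_commute inner_mink)
    have 3: "DY e p (mink (\<xi> p)) \<bullet> \<xi> p = k / 2 * X + e * f / r * ang"
      unfolding DY_mink_inner[OF pD] by (simp add: k_def f_def r_def X_def ang_def)
    have 4: "Gq e p \<bullet> mink (\<xi> p) = \<xi> p \<bullet> mink (Gq e p)" by (metis inner_commute inner_mink)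
    have 5: "divY e p = 2 * q + k + e * f / r"
      using pos by (simp add: divY_def q_def qq_def q0_def q1_def k_def[symmetric] f_def[symmetric] r_def[symmetric] field_simps)
    define b where "b = trace_of (\<lambda>v. mink (H p v))"
    have lx: "lam a e p \<bullet> mink (\<xi> p) = a / (k * f) * y"
      using mink_lam[OF pc, of a] by (metis f_def inner_mink inner_scaleR_left k_def y_def)
    have ll: "lam a e p \<bullet> mink (lam a e p) = a\<^sup>2 * (k + e\<^sup>2 * f) / (k\<^sup>2 * f)"
    proof -
      have "lam a e p = (a / (k * f)) *\<^sub>R mink (YY e p)"
        using arg_cong[OF mink_lam[OF pc, of a], of mink] by (simp add: mink_simps k_def f_def)
      then have "lam a e p \<bullet> mink (lam a e p) = (a / (k * f)) * ((a / (k * f)) * (YY e p \<bullet> mink (YY e p)))"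
        by (simp add: mink_simps inner_commute)
      also have "\<dots> = a\<^sup>2 * (k + e\<^sup>2 * f) / (k\<^sup>2 * f)"
        unfolding YY_inner_mink[OF pD] using pos by (simp add: k_def[symmetric] f_def[symmetric] field_simps power2_eq_square)
      finally show ?thesis .
    qed
    define \<mu> where "\<mu> = a / (k * f)"
    define \<kappa> where "\<kappa> = a\<^sup>2 / (k * f) + (a\<^sup>2 - a) * e\<^sup>2 / k\<^sup>2 - a * e / (k * r)"
    \<comment> \<open>The conjugated equation. The zeroth order term 2 \<mu> q needed to complete y
      to y + q \<psi> is supplied by the wave operator on the logarithm of the weight; the rest of
      the potential is \<kappa>.\<close>
    have 6: "B p = wt a e p * b + 2 * \<mu> * (y + q * \<psi> p) - \<kappa> * \<psi> p"
    proof -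
      have "2 * (a / (k * f)) * q = (a / 2) * (real (CARD('m) + CARD('n)) - 2) / f + a * e * (real CARD('n) - 2) / (k * r)"
        using pos by (simp add: q_def qq_def q0_def q1_def k_def[symmetric] f_def[symmetric] r_def[symmetric] field_simps)
      moreover have "a * ((real (CARD('m) + CARD('n)) / 2 - 1) / f + e * (real CARD('n) - 1) / (r * k) + e\<^sup>2 / k\<^sup>2)
          - a\<^sup>2 * (k + e\<^sup>2 * f) / (k\<^sup>2 * f)
         = (a / 2) * (real (CARD('m) + CARD('n)) - 2) / f + a * e * (real CARD('n) - 2) / (k * r) - \<kappa>"
        unfolding \<kappa>_def using pos by (simp add: field_simps power2_eq_square)
      ultimately have "a * ((real (CARD('m) + CARD('n)) / 2 - 1) / f + e * (real CARD('n) - 1) / (r * k) + e\<^sup>2 / k\<^sup>2)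
          - a\<^sup>2 * (k + e\<^sup>2 * f) / (k\<^sup>2 * f) = 2 * \<mu> * q - \<kappa>" by (simp add: \<mu>_def)
      then have tl: "trace_of (\<lambda>v. mink (Dlam a e p v)) - lam a e p \<bullet> mink (lam a e p) = 2 * \<mu> * q - \<kappa>"
        unfolding ll trace_of_mink_Dlam[OF pc] by (simp add: f_def[symmetric] k_def[symmetric] r_def[symmetric])
      show ?thesis
        unfolding Beq[OF p] lx tl b_def \<mu>_def[symmetric] by (simp add: algebra_simps)
    qed
    \<comment> \<open>Twice \<open>Th\<close>. The difference t - \<kappa>, which multiplies \<psi>
      x, contains no term a^2 / (k f).\<close>
    define t where "t = a\<^sup>2 / (k * f) + 2 * d * (r / f)"
    have 7: "Th a e d p = t / 2" by (simp add: Th_def t_def k_def f_def r_def)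
    \<comment> \<open>The zeroth order coefficient left by the Hardy field: the derivative of
      \<open>Th\<close> along Y plus \<open>Th\<close> times the part of div Y that is not 2 q. The
      part 2 q has been used to complete y to x.\<close>
    have 8: "Th' p (YY e p) + t / 2 * (k + e * f / r)
       = a\<^sup>2 / 2 * (e\<^sup>2 / k\<^sup>2 + e / (k * r)) + d * (r / (2 * f) * (1 - 2 * e * r) + 2 * e)"
    proof -
      have "Th' p (YY e p) = a\<^sup>2 / 2 * ((1 / k) * (- (k * f + e * f * r / 2) / f\<^sup>2)
        + (e * (k * r / 2 + e * f) / k\<^sup>2) * (1 / f)) + d * (r * (- (k * f + e * f * r / 2) / f\<^sup>2) + (k * r / 2 + e * f) * (1 / f))"
        unfolding Th'_def ff_along_YY[OF pD] rad_inner_YY[OF pD] by (simp add: f_def k_def r_def)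
      then have "Th' p (YY e p) + t / 2 * (k + e * f / r) = a\<^sup>2 / 2 * ((1 / k) * (- (k * f + e * f * r / 2) / f\<^sup>2)
        + (e * (k * r / 2 + e * f) / k\<^sup>2) * (1 / f) + (k + e * f / r) / (k * f))
        + d * (r * (- (k * f + e * f * r / 2) / f\<^sup>2) + (k * r / 2 + e * f) * (1 / f) + (r / f) * (k + e * f / r))"
        by (simp add: t_def algebra_simps add_divide_distrib)
      moreover have "(1 / k) * (- (k * f + e * f * r / 2) / f\<^sup>2)
        + (e * (k * r / 2 + e * f) / k\<^sup>2) * (1 / f) + (k + e * f / r) / (k * f) = e\<^sup>2 / k\<^sup>2 + e / (k * r)"
        using pos by (simp add: field_simps power2_eq_square)
      moreover have "r * (- (k * f + e * f * r / 2) / f\<^sup>2) + (k * r / 2 + e * f) * (1 / f) + (r / f) * (k + e * f / r)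
         = r / (2 * f) * (1 - 2 * e * r) + 2 * e"
        unfolding ker using pos by (simp add: field_simps power2_eq_square)
      ultimately show ?thesis by simp
    qed
    define P where "P = a\<^sup>2 / 2 * (e\<^sup>2 / k\<^sup>2 + e / (k * r)) + d * (r / (2 * f) * (1 - 2 * e * r) + 2 * e)"
    define cc where "cc = a * e / (k * r) - (a\<^sup>2 - a) * e\<^sup>2 / k\<^sup>2 + 2 * d * (r / f)"
    have ct: "cc = t - \<kappa>" by (simp add: cc_def t_def \<kappa>_def)
    have 8: "Th' p (YY e p) = P - t / 2 * (k + e * f / r)" using 8 by (simp add: P_def)
    have yc: "\<xi> p \<bullet> YY e p = y" by (simp add: y_def inner_commute)
    define c2 where "c2 = e * f / r"
    have "cdiv a e d p (z p) (G p) b = wt a e p * b * (y + q * \<psi> p) + 2 * \<mu> * (y + q * \<psi> p)\<^sup>2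
       + cc * \<psi> p * (y + q * \<psi> p) + c2 * (ang - X / 2) + (\<psi> p)\<^sup>2 * (P - boxq e p / 2)"
      unfolding cdiv_def Let_def \<xi>_def[symmetric] \<psi>_def[symmetric] c2_def cc_def P_def \<mu>_def ang_def X_def y_def q_def f_def k_def r_def by simp
    then show "((((YY e p \<bullet> \<xi> p) * B p + (YY e p \<bullet> D\<xi> p (mink (\<xi> p)) + DY e p (mink (\<xi> p)) \<bullet> \<xi> p))
      - ((1 / 2 * (\<xi> p \<bullet> mink (\<xi> p))) * divY e p + (1 / 2 * (\<xi> p \<bullet> mink (D\<xi> p (YY e p)) + D\<xi> p (YY e p) \<bullet> mink (\<xi> p)) + 0 * (\<xi> p \<bullet> mink (\<xi> p)))))
      + ((qq e p * \<psi> p) * B p + (qq e p * (\<xi> p \<bullet> mink (\<xi> p)) + (Gq e p \<bullet> mink (\<xi> p)) * \<psi> p)))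
      - ((1 / 2 * (\<psi> p * \<psi> p)) * boxq e p + (1 / 2 * (\<psi> p * (\<xi> p \<bullet> mink (Gq e p)) + (\<xi> p \<bullet> mink (Gq e p)) * \<psi> p) + 0 * (\<psi> p * \<psi> p)))
      + ((Th a e d p * (\<psi> p * \<psi> p)) * divY e p + (Th a e d p * (\<psi> p * (\<xi> p \<bullet> YY e p) + (\<xi> p \<bullet> YY e p) * \<psi> p) + Th' p (YY e p) * (\<psi> p * \<psi> p)))
      = cdiv a e d p (z p) (G p) (trace_of (\<lambda>v. mink (H p v)))"
      unfolding b_def[symmetric] 1 2 3 4 5 6 7 8 yc y_def[symmetric] q_def[symmetric] X_def[symmetric] c2_def[symmetric] ct
      by (simp add: algebra_simps power2_eq_square add_divide_distrib)
  qed
qed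

section \<open>The pointwise Carleman inequality\<close>

text \<open>A balance of Young inequalities. The term 2 a / (k f) x^2 contains four portions a / (2
  f) x^2: one pays for the source, one for the cross term with d, one for all errors with factor e,
  and one is kept. In units of d r / f the Hardy term yields 1/4 of s^2, of which 1/8 goes to the
  cross term, 1/16 to the errors, and 1/16 is kept.\<close>

lemma carleman_scalar:
  fixes f r k e d a R x s S0 y q B AX AT bq Q Cb :: real
  assumes f: "f > 0" and r: "0 < r" "r \<le> R" "4 * f \<le> r\<^sup>2" and e: "e > 0" "e * R \<le> 1 / 4" and a: "a > 0"
    and k: "k = 1 - e * r" and d: "d = a / (16 * R)"
    and q: "\<bar>q\<bar> \<le> Q" and bq: "\<bar>bq\<bar> \<le> Cb * (e / r)"
    and e1: "((2 * a\<^sup>2 + 2 * a) / 2 + 2) * (e * R) \<le> 2 * a"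
    and e2: "4 * (e * ((2 * a\<^sup>2 + 2 * a) / 2 + 2 * Q\<^sup>2 + Cb / 2)) \<le> d" and Cb: "Cb \<ge> 0"
    and y: "y = x - q * s" and A: "AX \<ge> 0" "AT \<ge> 0"
  shows "a / (2 * f) * x\<^sup>2 + e / (2 * r) * (AX + AT + B\<^sup>2) + d * (r / (16 * f)) * s\<^sup>2
    \<le> S0 * x + 2 * (a / (k * f)) * x\<^sup>2 + (a * e / (k * r) - (a\<^sup>2 - a) * e\<^sup>2 / k\<^sup>2 + 2 * d * (r / f)) * s * x
     + e / (2 * r) * (AX + AT + (B\<^sup>2 - y\<^sup>2) / (k + e\<^sup>2 * f))
     + s\<^sup>2 * (a\<^sup>2 / 2 * (e\<^sup>2 / k\<^sup>2 + e / (k * r)) + d * (r / (2 * f) * (1 - 2 * e * r) + 2 * e) - bq / 2)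
     + f / (2 * a) * S0\<^sup>2"
proof -
  have R: "R > 0" using r by linarith
  have d0: "d > 0" using d a R by simp
  have "e * r \<le> e * R" using e r by (intro mult_left_mono) auto
  then have er: "0 < e * r" "e * r \<le> 1 / 4" using e r by (simp, linarith)
  have k34: "3 / 4 \<le> k" "k \<le> 1" "k > 0" using k er by auto
  \<comment> \<open>The errors carry the factor e / r. By 4 f <= r^2 it is at most e r / (4 f),
    hence comparable with the Hardy weight, and at most e R / (4 f), hence comparable with the
    coefficient of x^2.\<close>
  define E where "E = e / r"
  have E: "E > 0" using e r by (simp add: E_def)
  define \<rho> where "\<rho> = r / f"
  have \<rho>: "\<rho> > 0" using f r by (simp add: \<rho>_def)
  have rinv: "1 / r \<le> \<rho> / 4" unfolding \<rho>_def using f r by (simp add: field_simps power2_eq_square)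
  have E\<rho>: "E \<le> e * (\<rho> / 4)"
    using mult_left_mono[OF rinv, of e] e by (simp add: E_def)
  have \<rho>R: "\<rho> \<le> R / f" unfolding \<rho>_def using f r by (simp add: divide_right_mono)
  define C1 where "C1 = 2 * a\<^sup>2 + 2 * a"
  have C1: "C1 \<ge> 0" using a by (simp add: C1_def)
  have t1: "S0 * x + f / (2 * a) * S0\<^sup>2 \<ge> - (a / (2 * f)) * x\<^sup>2"
  proof -
    have "0 \<le> (f * S0 + a * x)\<^sup>2 / (2 * a * f)" using a f by simp
    also have "\<dots> = S0 * x + f / (2 * a) * S0\<^sup>2 + (a / (2 * f)) * x\<^sup>2"
      using a f by (simp add: field_simps power2_eq_square)
    finally show ?thesis by simp
  qed
  have t2: "2 * (a / (k * f)) * x\<^sup>2 \<ge> 2 * (a / f) * x\<^sup>2"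
  proof -
    have "a / f \<le> a / (k * f)" using a f k34 by (intro divide_left_mono) (auto simp: mult_le_cancel_right1)
    then show ?thesis by (intro mult_right_mono) auto
  qed
  have c1: "\<bar>a * e / (k * r) - (a\<^sup>2 - a) * e\<^sup>2 / k\<^sup>2\<bar> \<le> C1 * E"
  proof -
    have "\<bar>a * e / (k * r)\<bar> = (a * E) * (1 / k)" using a e k34 r by (simp add: E_def abs_mult)
    also have "\<dots> \<le> (a * E) * (4 / 3)" using k34 a E by (intro mult_left_mono) (auto simp: field_simps)
    finally have 1: "\<bar>a * e / (k * r)\<bar> \<le> 4 / 3 * (a * E)" by simp
    have "\<bar>(a\<^sup>2 - a) * e\<^sup>2 / k\<^sup>2\<bar> = \<bar>a\<^sup>2 - a\<bar> * E * (e * r) * (1 / k\<^sup>2)"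
      using r by (simp add: E_def abs_mult power2_eq_square)
    also have "\<dots> \<le> (a\<^sup>2 + a) * E * (1 / 4) * (16 / 9)"
    proof (intro mult_mono)
      have "(3 / 4)\<^sup>2 \<le> k\<^sup>2" using k34 by (intro power_mono) auto
      then show "1 / k\<^sup>2 \<le> 16 / 9" using k34 by (simp add: field_simps)
      show "\<bar>a\<^sup>2 - a\<bar> \<le> a\<^sup>2 + a" using a by (simp add: abs_if)
    qed (use a E er in auto)
    finally have 2: "\<bar>(a\<^sup>2 - a) * e\<^sup>2 / k\<^sup>2\<bar> \<le> 4 / 9 * (a\<^sup>2 * E) + 4 / 9 * (a * E)" by (simp add: algebra_simps)
    have "C1 * E = 2 * (a\<^sup>2 * E) + 2 * (a * E)" by (simp add: C1_def algebra_simps)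
    moreover have "0 \<le> a\<^sup>2 * E" "0 \<le> a * E" using a E by auto
    ultimately show ?thesis using 1 2 by linarith
  qed
  have t3a: "(a * e / (k * r) - (a\<^sup>2 - a) * e\<^sup>2 / k\<^sup>2) * (s * x) \<ge> - (C1 * E * (s\<^sup>2 / 2) + C1 * E * (x\<^sup>2 / 2))"
  proof -
    have "\<bar>(a * e / (k * r) - (a\<^sup>2 - a) * e\<^sup>2 / k\<^sup>2) * (s * x)\<bar> \<le> (C1 * E) * \<bar>s * x\<bar>"
      unfolding abs_mult[of "_ - _"] using c1 by (intro mult_right_mono) auto
    also have "\<dots> \<le> (C1 * E) * ((s\<^sup>2 + x\<^sup>2) / 2)"
    proof (intro mult_left_mono)
      have "0 \<le> (\<bar>s\<bar> - \<bar>x\<bar>)\<^sup>2" by simp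
      then show "\<bar>s * x\<bar> \<le> (s\<^sup>2 + x\<^sup>2) / 2" by (simp add: power2_diff abs_mult)
    qed (use C1 E in auto)
    finally show ?thesis by (simp add: algebra_simps add_divide_distrib)
  qed
  have t3b: "2 * d * \<rho> * (s * x) \<ge> - (d * \<rho> * (s\<^sup>2 / 8) + 8 * (d * \<rho> * x\<^sup>2))"
  proof -
    have "0 \<le> (s + 8 * x)\<^sup>2 / 8" by simp
    also have "\<dots> = s\<^sup>2 / 8 + 2 * (s * x) + 8 * x\<^sup>2" by (simp add: power2_sum power_mult_distrib field_simps)
    finally have "0 \<le> s\<^sup>2 / 8 + 2 * (s * x) + 8 * x\<^sup>2" .
    then have "0 \<le> (d * \<rho>) * (s\<^sup>2 / 8 + 2 * (s * x) + 8 * x\<^sup>2)" using d0 \<rho> by simp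
    then show ?thesis by (simp add: algebra_simps)
  qed
  \<comment> \<open>f D is the Lorentzian square of Y. The bounds 3/4 <= D <= 1 allow B^2 / D to be
    replaced by B^2 and y^2 / D by 2 y^2.\<close>
  define D where "D = k + e\<^sup>2 * f"
  have D: "3 / 4 \<le> D" "D \<le> 1"
  proof -
    have "0 \<le> e\<^sup>2 * f" using f by simp
    then show "3 / 4 \<le> D" using k34 by (simp add: D_def)
    have "e\<^sup>2 * f \<le> e\<^sup>2 * (r\<^sup>2 / 4)" using r by (intro mult_left_mono) auto
    also have "\<dots> = (e * r) * (e * r / 4)" by (simp add: power2_eq_square)
    also have "\<dots> \<le> (e * r) * 1" using er by (intro mult_left_mono) auto
    finally show "D \<le> 1" by (simp add: D_def k)
  qed
  have t4: "e / (2 * r) * (AX + AT + (B\<^sup>2 - y\<^sup>2) / D) \<ge> e / (2 * r) * (AX + AT + B\<^sup>2) - (2 * (E * x\<^sup>2) + 2 * Q\<^sup>2 * (E * s\<^sup>2))"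
  proof -
    have b: "B\<^sup>2 \<le> B\<^sup>2 / D" using D by (simp add: le_divide_eq mult_left_le)
    have "y\<^sup>2 / D \<le> y\<^sup>2 / (3 / 4)" using D by (intro divide_left_mono) auto
    also have "\<dots> \<le> 2 * y\<^sup>2" by simp
    finally have yd: "y\<^sup>2 / D \<le> 2 * y\<^sup>2" .
    have "q\<^sup>2 \<le> Q\<^sup>2" using q by (metis abs_ge_zero power2_abs power_mono)
    then have "(q * s)\<^sup>2 \<le> Q\<^sup>2 * s\<^sup>2" by (simp add: power_mult_distrib mult_right_mono)
    moreover have "y\<^sup>2 \<le> 2 * x\<^sup>2 + 2 * (q * s)\<^sup>2"
    proof -
      have "0 \<le> (x + q * s)\<^sup>2" by simp
      then show ?thesis unfolding y by (simp add: power2_sum power2_diff)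
    qed
    ultimately have "y\<^sup>2 / D \<le> 4 * x\<^sup>2 + 4 * (Q\<^sup>2 * s\<^sup>2)" using yd by linarith
    then have "AX + AT + B\<^sup>2 - (4 * x\<^sup>2 + 4 * (Q\<^sup>2 * s\<^sup>2)) \<le> AX + AT + (B\<^sup>2 - y\<^sup>2) / D"
      using b by (simp add: diff_divide_distrib)
    then have "E / 2 * (AX + AT + B\<^sup>2 - (4 * x\<^sup>2 + 4 * (Q\<^sup>2 * s\<^sup>2))) \<le> E / 2 * (AX + AT + (B\<^sup>2 - y\<^sup>2) / D)"
      using E by (intro mult_left_mono) auto
    then show ?thesis by (simp add: E_def algebra_simps)
  qed
  have t5: "s\<^sup>2 * (a\<^sup>2 / 2 * (e\<^sup>2 / k\<^sup>2 + e / (k * r)) + d * (r / (2 * f) * (1 - 2 * e * r) + 2 * e) - bq / 2)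
     \<ge> d * \<rho> * (s\<^sup>2 / 4) - Cb / 2 * (E * s\<^sup>2)"
  proof -
    have 1: "0 \<le> a\<^sup>2 / 2 * (e\<^sup>2 / k\<^sup>2 + e / (k * r))" using e r k34 by simp
    have "\<rho> / 2 * (1 / 2) \<le> \<rho> / 2 * (1 - 2 * e * r)" using er \<rho> by (intro mult_left_mono) auto
    then have "\<rho> / 4 \<le> r / (2 * f) * (1 - 2 * e * r) + 2 * e" using e by (simp add: \<rho>_def)
    then have 2: "d * (\<rho> / 4) \<le> d * (r / (2 * f) * (1 - 2 * e * r) + 2 * e)" using d0 by (intro mult_left_mono) auto
    have 3: "bq \<le> Cb * E" using bq by (simp add: E_def)
    have "s\<^sup>2 * (d * (\<rho> / 4) - Cb * E / 2) \<le> s\<^sup>2 * (a\<^sup>2 / 2 * (e\<^sup>2 / k\<^sup>2 + e / (k * r)) + d * (r / (2 * f) * (1 - 2 * e * r) + 2 * e) - bq / 2)"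
    proof (rule mult_left_mono)
      show "d * (\<rho> / 4) - Cb * E / 2 \<le> a\<^sup>2 / 2 * (e\<^sup>2 / k\<^sup>2 + e / (k * r)) + d * (r / (2 * f) * (1 - 2 * e * r) + 2 * e) - bq / 2"
        using 1 2 3 by linarith
    qed simp
    then show ?thesis by (simp add: algebra_simps)
  qed
  have xc: "(C1 / 2 + 2) * (E * x\<^sup>2) \<le> a / (2 * f) * x\<^sup>2"
  proof -
    have "(C1 / 2 + 2) * E \<le> (C1 / 2 + 2) * (e * ((R / f) / 4))"
    proof (rule mult_left_mono)
      have "e * (\<rho> / 4) \<le> e * ((R / f) / 4)" using \<rho>R e by (intro mult_left_mono) auto
      then show "E \<le> e * ((R / f) / 4)" using E\<rho> by linarith
    qed (use C1 in auto)
    also have "\<dots> = ((C1 / 2 + 2) * (e * R)) / (4 * f)" by simp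
    also have "\<dots> \<le> (2 * a) / (4 * f)" using e1 f by (intro divide_right_mono) (auto simp: C1_def)
    finally have "(C1 / 2 + 2) * E \<le> a / (2 * f)" by simp
    then have "(C1 / 2 + 2) * E * x\<^sup>2 \<le> a / (2 * f) * x\<^sup>2" by (intro mult_right_mono) auto
    then show ?thesis by (simp add: mult.assoc)
  qed
  \<comment> \<open>The choice d = a / (16 R) is made for this step: 8 d r / f is at most a / (2
    f).\<close>
  have xd: "8 * (d * \<rho> * x\<^sup>2) \<le> a / (2 * f) * x\<^sup>2"
  proof -
    have "8 * (d * \<rho>) \<le> 8 * (d * (R / f))" using \<rho>R d0 by (intro mult_left_mono) auto
    also have "\<dots> = a / (2 * f)" using R f by (simp add: d)
    finally have "8 * (d * \<rho>) * x\<^sup>2 \<le> a / (2 * f) * x\<^sup>2" by (intro mult_right_mono) auto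
    then show ?thesis by (simp add: mult.assoc)
  qed
  define C3 where "C3 = C1 / 2 + 2 * Q\<^sup>2 + Cb / 2"
  have sc: "C3 * (E * s\<^sup>2) \<le> d * \<rho> * (s\<^sup>2 / 16)"
  proof -
    have C3: "C3 \<ge> 0" using C1 Cb by (simp add: C3_def)
    have "C3 * E \<le> C3 * (e * (\<rho> / 4))" using E\<rho> C3 by (intro mult_left_mono) auto
    also have "\<dots> = (4 * (e * C3)) * (\<rho> / 16)" by simp
    also have "\<dots> \<le> d * (\<rho> / 16)" using e2 \<rho> by (intro mult_right_mono) (auto simp: C3_def C1_def)
    finally have "C3 * E * s\<^sup>2 \<le> d * (\<rho> / 16) * s\<^sup>2" by (intro mult_right_mono) auto
    then show ?thesis by (simp add: mult.assoc)
  qed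
  have sc': "C1 * E * (s\<^sup>2 / 2) + 2 * Q\<^sup>2 * (E * s\<^sup>2) + Cb / 2 * (E * s\<^sup>2) \<le> d * \<rho> * (s\<^sup>2 / 16)"
    using sc by (simp add: C3_def algebra_simps)
  have xc': "C1 * E * (x\<^sup>2 / 2) + 2 * (E * x\<^sup>2) \<le> a / (2 * f) * x\<^sup>2"
    using xc by (simp add: algebra_simps)
  have split3: "(a * e / (k * r) - (a\<^sup>2 - a) * e\<^sup>2 / k\<^sup>2 + 2 * d * (r / f)) * s * x
     = (a * e / (k * r) - (a\<^sup>2 - a) * e\<^sup>2 / k\<^sup>2) * (s * x) + 2 * d * \<rho> * (s * x)"
    by (simp add: \<rho>_def algebra_simps)
  have xa: "2 * (a / f) * x\<^sup>2 = a / (2 * f) * x\<^sup>2 + a / (2 * f) * x\<^sup>2 + a / (2 * f) * x\<^sup>2 + a / (2 * f) * x\<^sup>2" by simp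
  have ds: "d * \<rho> * (s\<^sup>2 / 4) - d * \<rho> * (s\<^sup>2 / 8) - d * \<rho> * (s\<^sup>2 / 16) = d * (r / (16 * f)) * s\<^sup>2"
    by (simp add: \<rho>_def)
  have neg: "- (a / (2 * f)) * x\<^sup>2 = - (a / (2 * f) * x\<^sup>2)" by simp
  show ?thesis
    using t1 t2 t3a t3b t4 t5 sc' xc' xd unfolding split3 D_def[symmetric] ds[symmetric] xa neg by linarith
qed

lemma norm_scaleR_sgn: "v = norm v *\<^sub>R sgn v" for v :: "'a::real_normed_vector"
  by (cases "v = 0") (simp_all add: sgn_div_norm)

text \<open>The first-order density on the left of the estimate, without weight and without 1 / r,
  as a function of the point and of the Euclidean gradient g of z.\<close>

definition dens :: "(real^'m) \<times> (real^'n) \<Rightarrow> (real^'m) \<times> (real^'n) \<Rightarrow> real" where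
  "dens p g = (uu p * (fst g \<bullet> sgn (fst p) - snd g \<bullet> sgn (snd p)))\<^sup>2 + (vv p * (fst g \<bullet> sgn (fst p) + snd g \<bullet> sgn (snd p)))\<^sup>2
     + ff p * (snd g \<bullet> snd g - (snd g \<bullet> sgn (snd p))\<^sup>2) + ff p * (fst g \<bullet> fst g - (fst g \<bullet> sgn (fst p))\<^sup>2)"

lemma sgn_inner_sq_le: "(v \<bullet> sgn w)\<^sup>2 \<le> v \<bullet> v" for v w :: "'a::real_inner"
proof -
  have "\<bar>v \<bullet> sgn w\<bar> \<le> norm v * norm (sgn w)" by (rule Cauchy_Schwarz_ineq2)
  also have "\<dots> \<le> norm v" by (simp add: norm_sgn mult_left_le)
  finally have "\<bar>v \<bullet> sgn w\<bar>\<^sup>2 \<le> (norm v)\<^sup>2" by (intro power_mono) auto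
  then show ?thesis by (simp add: power2_norm_eq_inner)
qed

text \<open>In the (\<tau>, r) plane \<xi> is split into its product y with Y and its product B with
  the field orthogonal to Y for the metric. The gradient of the log-weight is parallel to Y, so B
  has no zeroth order part. The null derivatives of z in the statement are then the sum and the
  difference of the same two components of the gradient of z.\<close>

lemma carleman_pointwise:
  fixes a R :: real
  assumes a: "a > 0" and R: "R > 0"
  obtains e d C where "e > 0" "d \<ge> 0" "C > 0" "e * R \<le> 1 / 4"
    "\<And>p s g b. \<lbrakk>p \<in> (DD :: ((real^'m) \<times> (real^'n)) set); rr p < R\<rbrakk> \<Longrightarrow>
       (wt a e p)\<^sup>2 * (1 / rr p * dens p g + 1 / sqrt (ff p) * s\<^sup>2)
        \<le> C * (cdiv a e d p s g b + ff p / (2 * a) * (wt a e p * b)\<^sup>2)"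
proof -
  let ?q0 = "\<bar>q0 CARD('m) CARD('n)\<bar>" and ?q1 = "\<bar>q1 CARD('n)\<bar>"
  define Q where "Q = ?q0 + ?q1"
  define Cb where "Cb = ?q0 * \<bar>real CARD('n) - 1\<bar> + ?q1 * (\<bar>real (CARD('m) + CARD('n)) / 2 - 1\<bar> + \<bar>real CARD('n) - 3\<bar>)"
  have Q0: "Q \<ge> 0" and Cb0: "Cb \<ge> 0" by (auto simp: Q_def Cb_def)
  define d where "d = a / (16 * R)"
  have d: "d > 0" using a R by (simp add: d_def)
  define c1 where "c1 = (2 * a\<^sup>2 + 2 * a) / 2 + 2"
  define c3 where "c3 = (2 * a\<^sup>2 + 2 * a) / 2 + 2 * Q\<^sup>2 + Cb / 2 + 1"
  have c1: "c1 > 0" and c3: "c3 > 0" using a Cb0 by (auto simp: c1_def c3_def intro!: add_nonneg_pos)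
  \<comment> \<open>The three bounds serve, in this order, k >= 3/4, the absorption of errors into
    x^2, and their absorption into the Hardy term.\<close>
  define e where "e = min (1 / (4 * R)) (min (2 * a / (c1 * R)) (d / (4 * c3)))"
  have e: "e > 0" using a R c1 c3 d by (simp add: e_def)
  have eR: "e * R \<le> 1 / 4"
  proof -
    have "e * R \<le> 1 / (4 * R) * R" using R by (intro mult_right_mono) (auto simp: e_def)
    then show ?thesis using R by simp
  qed
  have e1: "c1 * (e * R) \<le> 2 * a"
  proof -
    have "c1 * (e * R) \<le> c1 * (2 * a / (c1 * R) * R)" using R c1 by (intro mult_left_mono mult_right_mono) (auto simp: e_def)
    then show ?thesis using R c1 by simp
  qed
  have e2: "4 * (e * ((2 * a\<^sup>2 + 2 * a) / 2 + 2 * Q\<^sup>2 + Cb / 2)) \<le> d"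
  proof -
    have "e * ((2 * a\<^sup>2 + 2 * a) / 2 + 2 * Q\<^sup>2 + Cb / 2) \<le> e * c3" using e by (intro mult_left_mono) (auto simp: c3_def)
    also have "\<dots> \<le> d / (4 * c3) * c3" using c3 by (intro mult_right_mono) (auto simp: e_def)
    finally show ?thesis using c3 by simp
  qed
  define Q2 where "Q2 = Q + 2 * a"
  \<comment> \<open>The summands account, in this order, for x^2 / r, \<psi>^2 / r, \<psi>^2 / sqrt
    f, and the sum of the angular squares and B^2 over r, each measured against L.\<close>
  define C where "C = 8 * R / a + 64 * Q2\<^sup>2 / d + 8 / d + 16 / e"
  have C: "C > 0" unfolding C_def using a R d e by (intro add_nonneg_pos) auto
  have main: "(wt a e p)\<^sup>2 * (1 / rr p * dens p g + 1 / sqrt (ff p) * s\<^sup>2)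
        \<le> C * (cdiv a e d p s g b + ff p / (2 * a) * (wt a e p * b)\<^sup>2)"
    if pD: "p \<in> DD" and pR: "rr p < R" for p :: "(real^'m) \<times> (real^'n)" and s g b
  proof -
    define f where "f = ff p" define r where "r = rr p" define k where "k = kk e p" define \<tau> where "\<tau> = tau p"
    define w where "w = wt a e p"
    have f: "f > 0" using pD by (simp add: f_def DD_def)
    have r: "0 < r" "r \<le> R" "4 * f \<le> r\<^sup>2" using rr_pos[OF pD] pR rr_sq_ge[OF pD] by (auto simp: r_def f_def)
    have ker: "k = 1 - e * r" by (simp add: k_def kk_def r_def)
    have "e * r \<le> e * R" using e r by (intro mult_left_mono) auto
    then have er: "0 < e * r" "e * r \<le> 1 / 4" using e r eR by (simp, linarith)
    have k: "3 / 4 \<le> k" "k \<le> 1" using ker er by auto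
    have pc: "p \<in> cone e" using pD k by (simp add: cone_def k_def)
    have \<tau>: "\<tau>\<^sup>2 = r\<^sup>2 - 4 * f"
      by (simp add: \<tau>_def r_def f_def ff_eq mink_def inner_prod_def tau_def rr_def power2_norm_eq_inner diff_divide_distrib)
    have fr: "f / r \<le> r / 4" using r f by (simp add: field_simps power2_eq_square)
    define \<xi> where "\<xi> = xi a e p s g"
    define \<psi> where "\<psi> = w * s"
    define pz where "pz = fst g \<bullet> sgn (fst p)"
    define sz where "sz = snd g \<bullet> sgn (snd p)"
    define px where "px = fst \<xi> \<bullet> sgn (fst p)"
    define sx where "sx = snd \<xi> \<bullet> sgn (snd p)"
    have rad_in: "rad p \<bullet> v = snd v \<bullet> sgn (snd p)" for v
      by (simp add: rad_def inner_prod_def sgn_div_norm rr_def inner_commute)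
    have fstp: "fst p = \<tau> *\<^sub>R sgn (fst p)" and sndp: "snd p = r *\<^sub>R sgn (snd p)"
      using norm_scaleR_sgn by (simp_all add: \<tau>_def tau_def r_def rr_def)
    have tt: "fst p \<bullet> sgn (fst p) = \<tau>" 
      by (cases "fst p = 0") (simp_all add: \<tau>_def tau_def sgn_div_norm power2_norm_eq_inner[symmetric] power2_eq_square)
    have ss: "sgn (snd p) \<bullet> sgn (snd p) = 1"
      using rad_inner_rad[OF pD] by (simp add: rad_in) (simp add: rad_def sgn_div_norm rr_def)
    define lt0 where "lt0 = a / (2 * f)"
    define lx0 where "lx0 = a * r / (2 * f) + a * e / k"
    have fst_xi: "fst \<xi> = w *\<^sub>R fst g - (\<psi> * lt0) *\<^sub>R fst p"
      by (simp add: \<xi>_def xi_def lam_def mink_def rad_def \<psi>_def lt0_def w_def f_def algebra_simps)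
    have snd_xi: "snd \<xi> = w *\<^sub>R snd g + (\<psi> * lx0) *\<^sub>R sgn (snd p)"
    proof -
      have "snd (lam a e p) = lx0 *\<^sub>R sgn (snd p)"
        unfolding lam_def mink_def rad_def lx0_def
        by (subst (1 2) sndp) (use r in \<open>simp add: f_def[symmetric] k_def[symmetric] r_def[symmetric] algebra_simps\<close>)
      then show ?thesis by (simp add: \<xi>_def xi_def \<psi>_def w_def)
    qed
    have px: "px = w * pz - \<psi> * lt0 * \<tau>" by (simp add: px_def fst_xi inner_diff_left tt pz_def)
    have sx: "sx = w * sz + \<psi> * lx0" by (simp add: sx_def snd_xi inner_add_left ss sz_def)
    define Yr where "Yr = k * r / 2 + e * f"
    define Yt where "Yt = k * \<tau> / 2"
    have y: "YY e p \<bullet> \<xi> = Yt * px + Yr * sx"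
    proof -
      have "p \<bullet> \<xi> = \<tau> * px + r * sx"
        unfolding inner_prod_def px_def sx_def by (subst fstp, subst sndp) (simp add: inner_commute)
      then show ?thesis
        by (simp add: YY_def inner_add_left rad_in sx_def[symmetric] k_def[symmetric] f_def[symmetric] Yt_def Yr_def algebra_simps add_divide_distrib)
    qed
    define D where "D = k + e\<^sup>2 * f"
    have YD: "Yr\<^sup>2 - Yt\<^sup>2 = f * D"
    proof -
      have "Yr\<^sup>2 - Yt\<^sup>2 = k\<^sup>2 * (r\<^sup>2 - \<tau>\<^sup>2) / 4 + k * r * e * f + e\<^sup>2 * f\<^sup>2"
        by (simp add: Yr_def Yt_def power2_eq_square field_simps)
      also have "\<dots> = f * (k * (k + e * r) + e\<^sup>2 * f)" 
        unfolding \<tau> by (simp add: power2_eq_square algebra_simps)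
      also have "k + e * r = 1" by (simp add: ker)
      finally show ?thesis by (simp add: D_def)
    qed
    have D: "3 / 4 \<le> D" "D \<le> 1"
    proof -
      have "0 \<le> e\<^sup>2 * f" using f by simp
      then show "3 / 4 \<le> D" using k by (simp add: D_def)
      have "e\<^sup>2 * f \<le> e\<^sup>2 * (r\<^sup>2 / 4)" using r by (intro mult_left_mono) auto
      also have "\<dots> = (e * r) * (e * r / 4)" by (simp add: power2_eq_square)
      also have "\<dots> \<le> (e * r) * 1" using er by (intro mult_left_mono) auto
      finally show "D \<le> 1" by (simp add: D_def ker)
    qed
    define B where "B = Yr * px + Yt * sx"
    define y where "y = Yt * px + Yr * sx"
    \<comment> \<open>The Lorentzian form in the (\<tau>, r) plane in the frame of Y and its
      orthogonal field. It isolates - y^2 as the only negative square, and y is controlled by x and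
      \<psi>.\<close>
    have By: "f * (px\<^sup>2 - sx\<^sup>2) = (B\<^sup>2 - y\<^sup>2) / D"
    proof -
      have "B\<^sup>2 - y\<^sup>2 = (Yr\<^sup>2 - Yt\<^sup>2) * (px\<^sup>2 - sx\<^sup>2)" by (simp add: B_def y_def power2_eq_square algebra_simps)
      then show ?thesis unfolding YD using D by (simp add: field_simps)
    qed
    define q where "q = qq e p"
    define x where "x = y + q * \<psi>"
    have qQ: "\<bar>q\<bar> \<le> Q"
    proof -
      have "\<bar>e * q1 CARD('n) * (f * (1 / r))\<bar> = ?q1 * (e * (f / r))" using e f r by (simp add: abs_mult)
      also have "\<dots> \<le> ?q1 * 1"
      proof (intro mult_left_mono)
        have "e * (f / r) \<le> e * (r / 4)" using fr e by (intro mult_left_mono) auto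
        then show "e * (f / r) \<le> 1" using er by simp
      qed simp
      finally have 1: "\<bar>e * q1 CARD('n) * (f * (1 / r))\<bar> \<le> ?q1" by simp
      have "\<bar>q0 CARD('m) CARD('n) * k\<bar> \<le> ?q0 * 1" unfolding abs_mult using k by (intro mult_left_mono) auto
      then show ?thesis using 1 unfolding q_def qq_def Q_def k_def[symmetric] f_def[symmetric] r_def[symmetric] by linarith
    qed
    define bq where "bq = boxq e p"
    have bqC: "\<bar>bq\<bar> \<le> Cb * (e / r)"
    proof -
      define X where "X = (real (CARD('m) + CARD('n)) / 2 - 1)"
      have fr3: "f / r ^ 3 \<le> 1 / r"
      proof -
        have "f / r ^ 3 = (f / r) / r\<^sup>2" by (simp add: power3_eq_cube power2_eq_square)
        also have "\<dots> \<le> (r / 4) / r\<^sup>2" using fr by (intro divide_right_mono) auto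
        also have "\<dots> \<le> 1 / r" using r by (simp add: power2_eq_square field_simps)
        finally show ?thesis .
      qed
      have "\<bar>bq\<bar> \<le> \<bar>e * q0 CARD('m) CARD('n) * (real CARD('n) - 1) / r\<bar> + \<bar>e * q1 CARD('n) * (X / r - (real CARD('n) - 3) * f / r ^ 3)\<bar>"
        unfolding bq_def boxq_def f_def[symmetric] r_def[symmetric] X_def[symmetric]
        using abs_triangle_ineq[of "- e * q0 CARD('m) CARD('n) * (real CARD('n) - 1) / r"] by simp
      moreover have "\<bar>e * q0 CARD('m) CARD('n) * (real CARD('n) - 1) / r\<bar> = ?q0 * \<bar>real CARD('n) - 1\<bar> * (e / r)"
        using e r by (simp add: abs_mult)
      moreover have "\<bar>e * q1 CARD('n) * (X / r - (real CARD('n) - 3) * f / r ^ 3)\<bar> \<le> ?q1 * (\<bar>X\<bar> + \<bar>real CARD('n) - 3\<bar>) * (e / r)"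
      proof -
        have "\<bar>X / r - (real CARD('n) - 3) * f / r ^ 3\<bar> \<le> \<bar>X / r\<bar> + \<bar>(real CARD('n) - 3) * f / r ^ 3\<bar>" by (rule abs_triangle_ineq4)
        also have "\<bar>(real CARD('n) - 3) * f / r ^ 3\<bar> = \<bar>real CARD('n) - 3\<bar> * (f / r ^ 3)" using f r by (simp add: abs_mult)
        also have "\<dots> \<le> \<bar>real CARD('n) - 3\<bar> * (1 / r)" using fr3 by (intro mult_left_mono) auto
        also have "\<bar>X / r\<bar> = \<bar>X\<bar> * (1 / r)" using r by simp
        finally have "\<bar>X / r - (real CARD('n) - 3) * f / r ^ 3\<bar> \<le> (\<bar>X\<bar> + \<bar>real CARD('n) - 3\<bar>) * (1 / r)"
          by (simp add: algebra_simps)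
        then have "(e * ?q1) * \<bar>X / r - (real CARD('n) - 3) * f / r ^ 3\<bar> \<le> (e * ?q1) * ((\<bar>X\<bar> + \<bar>real CARD('n) - 3\<bar>) * (1 / r))"
          using e by (intro mult_left_mono) auto
        moreover have "\<bar>e * q1 CARD('n) * (X / r - (real CARD('n) - 3) * f / r ^ 3)\<bar> = (e * ?q1) * \<bar>X / r - (real CARD('n) - 3) * f / r ^ 3\<bar>"
          using e by (simp add: abs_mult)
        moreover have "(e * ?q1) * ((\<bar>X\<bar> + \<bar>real CARD('n) - 3\<bar>) * (1 / r)) = ?q1 * (\<bar>X\<bar> + \<bar>real CARD('n) - 3\<bar>) * (e / r)"
          by simp
        ultimately show ?thesis by linarith
      qed
      ultimately have "\<bar>bq\<bar> \<le> ?q0 * \<bar>real CARD('n) - 1\<bar> * (e / r) + ?q1 * (\<bar>X\<bar> + \<bar>real CARD('n) - 3\<bar>) * (e / r)" by linarith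
      then show ?thesis unfolding Cb_def X_def by (simp only: distrib_right)
    qed
    define AX where "AX = f * (snd \<xi> \<bullet> snd \<xi> - sx\<^sup>2)"
    define AT where "AT = f * (fst \<xi> \<bullet> fst \<xi> - px\<^sup>2)"
    have A0: "AX \<ge> 0" "AT \<ge> 0"
      unfolding AX_def AT_def px_def sx_def using f sgn_inner_sq_le by (auto intro!: mult_nonneg_nonneg)
    define L where "L = a / (2 * f) * x\<^sup>2 + e / (2 * r) * (AX + AT + B\<^sup>2) + d * (r / (16 * f)) * \<psi>\<^sup>2"
    have L_le: "L \<le> cdiv a e d p s g b + f / (2 * a) * (w * b)\<^sup>2"
    proof -
      have "L \<le> (w * b) * x + 2 * (a / (k * f)) * x\<^sup>2 + (a * e / (k * r) - (a\<^sup>2 - a) * e\<^sup>2 / k\<^sup>2 + 2 * d * (r / f)) * \<psi> * x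
        + e / (2 * r) * (AX + AT + (B\<^sup>2 - y\<^sup>2) / (k + e\<^sup>2 * f))
        + \<psi>\<^sup>2 * (a\<^sup>2 / 2 * (e\<^sup>2 / k\<^sup>2 + e / (k * r)) + d * (r / (2 * f) * (1 - 2 * e * r) + 2 * e) - bq / 2)
        + f / (2 * a) * (w * b)\<^sup>2"
        unfolding L_def
        by (rule carleman_scalar[OF f r e eR a ker d_def qQ bqC e1[unfolded c1_def] e2 Cb0 _ A0]) (simp add: x_def)
      moreover have "e / (2 * r) * (AX + AT + (B\<^sup>2 - y\<^sup>2) / (k + e\<^sup>2 * f))
         = e * f / r * (snd \<xi> \<bullet> snd \<xi> - (rad p \<bullet> \<xi>)\<^sup>2 - (\<xi> \<bullet> mink \<xi>) / 2)"
      proof -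
        have "\<xi> \<bullet> mink \<xi> = snd \<xi> \<bullet> snd \<xi> - fst \<xi> \<bullet> fst \<xi>" by (simp add: mink_def inner_prod_def)
        show ?thesis
          unfolding D_def[symmetric] By[symmetric] AX_def AT_def rad_in sx_def[symmetric] \<open>\<xi> \<bullet> mink \<xi> = _\<close>
          using r by (simp add: field_simps)
      qed
      moreover have "cdiv a e d p s g b = w * b * x + 2 * (a / (k * f)) * x\<^sup>2
        + (a * e / (k * r) - (a\<^sup>2 - a) * e\<^sup>2 / k\<^sup>2 + 2 * d * (r / f)) * \<psi> * x
        + e * f / r * (snd \<xi> \<bullet> snd \<xi> - (rad p \<bullet> \<xi>)\<^sup>2 - (\<xi> \<bullet> mink \<xi>) / 2)
        + \<psi>\<^sup>2 * (a\<^sup>2 / 2 * (e\<^sup>2 / k\<^sup>2 + e / (k * r)) + d * (r / (2 * f) * (1 - 2 * e * r) + 2 * e) - bq / 2)"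
        unfolding cdiv_def Let_def x_def y_def \<open>YY e p \<bullet> \<xi> = _\<close>[symmetric] q_def bq_def \<xi>_def \<psi>_def w_def f_def k_def r_def by simp
      ultimately show ?thesis by linarith
    qed
    define y1 where "y1 = w * (Yt * pz + Yr * sz)"
    have y1: "y1 = x - (q + a * D / k) * \<psi>"
    proof -
      have lx: "lx0 = a / (k * f) * Yr" unfolding lx0_def Yr_def using f k by (simp add: field_simps)
      have lt: "lt0 * \<tau> = a / (k * f) * Yt" unfolding lt0_def Yt_def using f k by (simp add: field_simps)
      have "y = y1 + \<psi> * (Yr * lx0 - Yt * (lt0 * \<tau>))" unfolding y_def px sx y1_def by (simp add: algebra_simps)
      also have "Yr * lx0 - Yt * (lt0 * \<tau>) = a / (k * f) * (Yr\<^sup>2 - Yt\<^sup>2)" unfolding lx lt by (simp add: power2_eq_square algebra_simps)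
      also have "\<dots> = a * D / k" unfolding YD using f by simp
      finally show ?thesis by (simp add: x_def algebra_simps)
    qed
    \<comment> \<open>The \<psi> terms cancel because \<open>lx0\<close> and
      \<open>lt0 * \<tau>\<close> are proportional to Yr and Yt with the same factor.\<close>
    have Bz: "B = w * (Yr * pz + Yt * sz)"
    proof -
      have lx: "lx0 = a / (k * f) * Yr" unfolding lx0_def Yr_def using f k by (simp add: field_simps)
      have lt: "lt0 * \<tau> = a / (k * f) * Yt" unfolding lt0_def Yt_def using f k by (simp add: field_simps)
      have "B = w * (Yr * pz + Yt * sz) + \<psi> * (Yt * lx0 - Yr * (lt0 * \<tau>))" unfolding B_def px sx by (simp add: algebra_simps)
      then show ?thesis unfolding lx lt by simp
    qed
    define u where "u = uu p" define v where "v = vv p"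
    have uv: "\<tau> = u + v" "r = v - u" "f = - u * v" by (simp_all add: u_def v_def \<tau>_def r_def f_def uu_def vv_def ff_def field_simps)
    have u: "- r / 2 \<le> u" "0 \<le> v" "v \<le> r"
    proof -
      have "\<tau> < r" using ff_pos_norm_less[of p] pD by (simp add: DD_def \<tau>_def r_def tau_def rr_def)
      moreover have "0 \<le> \<tau>" by (simp add: \<tau>_def tau_def)
      ultimately show "- r / 2 \<le> u" "0 \<le> v" "v \<le> r" by (simp_all add: u_def v_def uu_def vv_def \<tau>_def r_def)
    qed
    \<comment> \<open>The coefficients of Y factor along the null directions: Yt - Yr = u (1 + e u)
      and, for the next fact, Yt + Yr = v (1 - e v). Both brackets are at least 3/4.\<close>
    have wu: "w * (u * (pz - sz)) * (1 + e * u) = y1 - B"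
      unfolding y1_def Bz Yr_def Yt_def ker uv by (simp add: algebra_simps) (simp add: field_simps)
    have wv: "w * (v * (pz + sz)) * (1 - e * v) = y1 + B"
      unfolding y1_def Bz Yr_def Yt_def ker uv by (simp add: algebra_simps) (simp add: field_simps)
    have pu: "1 + e * u \<ge> 3 / 4"
    proof -
      have "e * (- r / 2) \<le> e * u" using u e by (intro mult_left_mono) auto
      then show ?thesis using er by simp
    qed
    have pv: "1 - e * v \<ge> 3 / 4"
    proof -
      have "e * v \<le> e * r" using u e by (intro mult_left_mono) auto
      then show ?thesis using er by simp
    qed
    have half: "X\<^sup>2 \<le> 2 * Z\<^sup>2" if "X * c = Z" "c \<ge> 3 / 4" for X Z c :: real
    proof -
      have "(3 / 4)\<^sup>2 \<le> c\<^sup>2" using that by (intro power_mono) auto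
      then have "X\<^sup>2 * (1 / 2) \<le> X\<^sup>2 * c\<^sup>2" by (intro mult_left_mono) (auto simp: power_divide)
      then show ?thesis using that(1) by (simp add: power_mult_distrib[symmetric])
    qed
    have du: "(w * (u * (pz - sz)))\<^sup>2 + (w * (v * (pz + sz)))\<^sup>2 \<le> 4 * (y1\<^sup>2 + B\<^sup>2)"
      using half[OF wu pu] half[OF wv pv] by (simp add: power2_sum power2_diff)
    have AXz: "w\<^sup>2 * (f * (snd g \<bullet> snd g - sz\<^sup>2)) = AX"
    proof -
      have "snd \<xi> \<bullet> snd \<xi> - sx\<^sup>2 = w\<^sup>2 * (snd g \<bullet> snd g - sz\<^sup>2)"
        unfolding sx snd_xi by (simp add: inner_add_left inner_add_right ss sz_def inner_commute power2_eq_square algebra_simps)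
      then show ?thesis by (simp add: AX_def)
    qed
    have ATz: "w\<^sup>2 * (f * (fst g \<bullet> fst g - pz\<^sup>2)) = AT"
    proof -
      have ff1: "fst g \<bullet> fst p = \<tau> * pz" unfolding pz_def by (subst fstp) simp
      have ff2: "fst p \<bullet> fst p = \<tau>\<^sup>2" by (simp add: \<tau>_def tau_def power2_norm_eq_inner)
      have "fst \<xi> \<bullet> fst \<xi> - px\<^sup>2 = w\<^sup>2 * (fst g \<bullet> fst g - pz\<^sup>2)"
        unfolding px fst_xi
        by (simp add: inner_diff_left inner_diff_right inner_commute[of "fst p" "fst g"] ff1 ff2 power2_eq_square algebra_simps)
      then show ?thesis by (simp add: AT_def)
    qed
    have "w\<^sup>2 * dens p g = (w * (u * (pz - sz)))\<^sup>2 + (w * (v * (pz + sz)))\<^sup>2 + AX + AT"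
      unfolding dens_def AXz[symmetric] ATz[symmetric] pz_def[symmetric] sz_def[symmetric] u_def v_def f_def
        power_mult_distrib[of w] by (simp only: distrib_left)
    also have "\<dots> \<le> 4 * (y1\<^sup>2 + B\<^sup>2) + AX + AT" using du by simp
    also have "\<dots> \<le> 8 * x\<^sup>2 + 8 * Q2\<^sup>2 * \<psi>\<^sup>2 + 8 * (AX + AT + B\<^sup>2)"
    proof -
      have "\<bar>q + a * D / k\<bar> \<le> Q2"
      proof -
        have "D / k \<le> 2" using D k by (simp add: field_simps)
        then have "a * (D / k) \<le> a * 2" using a by (intro mult_left_mono) auto
        moreover have "0 \<le> a * (D / k)" using a D k by simp
        ultimately show ?thesis using qQ unfolding Q2_def by (simp add: abs_le_iff)
      qed
      then have "(q + a * D / k)\<^sup>2 \<le> Q2\<^sup>2" by (metis abs_ge_zero power2_abs power_mono)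
      then have "((q + a * D / k) * \<psi>)\<^sup>2 \<le> Q2\<^sup>2 * \<psi>\<^sup>2" by (simp add: power_mult_distrib mult_right_mono)
      moreover have "y1\<^sup>2 \<le> 2 * x\<^sup>2 + 2 * ((q + a * D / k) * \<psi>)\<^sup>2"
      proof -
        have "0 \<le> (x + (q + a * D / k) * \<psi>)\<^sup>2" by simp
        then show ?thesis unfolding y1 by (simp add: power2_sum power2_diff)
      qed
      ultimately have "y1\<^sup>2 \<le> 2 * x\<^sup>2 + 2 * (Q2\<^sup>2 * \<psi>\<^sup>2)" by linarith
      then have "4 * (y1\<^sup>2 + B\<^sup>2) + AX + AT \<le> 8 * x\<^sup>2 + 8 * (Q2\<^sup>2 * \<psi>\<^sup>2) + 8 * (AX + AT + B\<^sup>2)"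
        using A0 zero_le_power2[of B] unfolding distrib_left by linarith
      then show ?thesis by (simp only: mult.assoc)
    qed
    finally have dl: "w\<^sup>2 * dens p g \<le> 8 * x\<^sup>2 + 8 * Q2\<^sup>2 * \<psi>\<^sup>2 + 8 * (AX + AT + B\<^sup>2)" .
    have rinv: "1 / r \<le> r / (4 * f)" using r f by (simp add: field_simps power2_eq_square)
    have "1 / r * (w\<^sup>2 * dens p g) \<le> 1 / r * (8 * x\<^sup>2 + 8 * Q2\<^sup>2 * \<psi>\<^sup>2 + 8 * (AX + AT + B\<^sup>2))"
      using dl r by (intro mult_left_mono) auto
    also have "\<dots> = 8 * (1 / r * x\<^sup>2) + 8 * Q2\<^sup>2 * (1 / r * \<psi>\<^sup>2) + 8 * (1 / r * (AX + AT + B\<^sup>2))"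
      by (simp add: algebra_simps add_divide_distrib)
    also have "\<dots> \<le> 8 * R / a * L + 64 * Q2\<^sup>2 / d * L + 16 / e * L"
    proof (intro add_mono)
      define l1 where "l1 = a / (2 * f) * x\<^sup>2"
      define l2 where "l2 = e / (2 * r) * (AX + AT + B\<^sup>2)"
      define l3 where "l3 = d * (r / (16 * f)) * \<psi>\<^sup>2"
      have l0: "l1 \<ge> 0" "l2 \<ge> 0" "l3 \<ge> 0" unfolding l1_def l2_def l3_def using a f e r d A0 by auto
      have Ll: "L = l1 + l2 + l3" by (simp add: L_def l1_def l2_def l3_def)
      have "1 / r * x\<^sup>2 \<le> R / (4 * f) * x\<^sup>2"
      proof (intro mult_right_mono order_trans[OF rinv])
        show "r / (4 * f) \<le> R / (4 * f)" using r f by (intro divide_right_mono) auto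
      qed simp
      also have "\<dots> = R / (2 * a) * l1" using a by (simp add: l1_def)
      also have "\<dots> \<le> R / (2 * a) * L" using l0 R a by (intro mult_left_mono) (auto simp: Ll)
      also have "\<dots> \<le> R / a * L" using l0 R a by (intro mult_right_mono) (auto simp: Ll field_simps)
      finally show "8 * (1 / r * x\<^sup>2) \<le> 8 * R / a * L" by simp
      have "1 / r * \<psi>\<^sup>2 \<le> r / (4 * f) * \<psi>\<^sup>2" using rinv by (intro mult_right_mono) auto
      also have "\<dots> = 4 / d * l3" using d by (simp add: l3_def)
      also have "\<dots> \<le> 4 / d * L" using l0 d by (intro mult_left_mono) (auto simp: Ll)
      also have "\<dots> \<le> 8 / d * L" using l0 d by (intro mult_right_mono) (auto simp: Ll divide_right_mono)
      finally have "8 * Q2\<^sup>2 * (1 / r * \<psi>\<^sup>2) \<le> 8 * Q2\<^sup>2 * (8 / d * L)" by (intro mult_left_mono) auto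
      then show "8 * Q2\<^sup>2 * (1 / r * \<psi>\<^sup>2) \<le> 64 * Q2\<^sup>2 / d * L" by simp
      define ab where "ab = AX + AT + B\<^sup>2"
      have "1 / r * ab = 2 / e * l2" using e by (simp add: l2_def ab_def[symmetric])
      also have "\<dots> \<le> 2 / e * L" using l0 e by (intro mult_left_mono) (auto simp: Ll)
      finally have "8 * (1 / r * ab) \<le> 16 / e * L" by simp
      then show "8 * (1 / r * (AX + AT + B\<^sup>2)) \<le> 16 / e * L" by (simp only: ab_def)
    qed
    finally have 1: "1 / r * (w\<^sup>2 * dens p g) \<le> 8 * R / a * L + 64 * Q2\<^sup>2 / d * L + 16 / e * L" .
    have 2: "1 / sqrt f * \<psi>\<^sup>2 \<le> 8 / d * L"
    proof -
      have "(2 * sqrt f)\<^sup>2 \<le> r\<^sup>2" using r f by (simp add: power_mult_distrib)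
      then have "2 * sqrt f \<le> r" by (rule power2_le_imp_le) (use r(1) in linarith)
      then have "2 * sqrt f / (2 * f) \<le> r / (2 * f)" using f by (intro divide_right_mono) auto
      moreover have "2 * sqrt f / (2 * f) = 1 / sqrt f" using f by (simp add: field_simps)
      ultimately have "1 / sqrt f \<le> r / (2 * f)" by simp
      then have "1 / sqrt f * \<psi>\<^sup>2 \<le> r / (2 * f) * \<psi>\<^sup>2" by (intro mult_right_mono) auto
      also have "\<dots> = 8 / d * (d * (r / (16 * f)) * \<psi>\<^sup>2)" using d by simp
      also have "\<dots> \<le> 8 / d * L"
        unfolding L_def using a f e r d A0 by (intro mult_left_mono) auto
      finally show ?thesis .
    qed
    have "(wt a e p)\<^sup>2 * (1 / rr p * dens p g + 1 / sqrt (ff p) * s\<^sup>2) = 1 / r * (w\<^sup>2 * dens p g) + 1 / sqrt f * \<psi>\<^sup>2"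
      by (simp add: w_def[symmetric] r_def[symmetric] f_def[symmetric] \<psi>_def power_mult_distrib algebra_simps)
    also have "\<dots> \<le> C * L" using 1 2 by (simp add: C_def algebra_simps)
    also have "\<dots> \<le> C * (cdiv a e d p s g b + f / (2 * a) * (w * b)\<^sup>2)" using L_le C by (intro mult_left_mono) auto
    finally show ?thesis by (simp add: f_def w_def)
  qed
  show ?thesis by (rule that[of e d C, OF e _ C eR main]) (use d in auto)
qed

section \<open>Bounds for the current\<close>

lemma cone_of_bounded:
  assumes "p \<in> DD" "rr p \<le> R" "e > 0" "e * R \<le> 1 / 4"
  shows "p \<in> cone e" "3 / 4 \<le> kk e p" "kk e p \<le> 1"
proof -
  have "0 \<le> e * rr p" "e * rr p \<le> e * R" using assms by (auto simp: rr_def intro!: mult_left_mono)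
  then show "3 / 4 \<le> kk e p" "kk e p \<le> 1" using assms(4) by (auto simp: kk_def)
  then show "p \<in> cone e" using assms(1) by (simp add: cone_def)
qed

lemma ff_le:
  assumes "p \<in> DD" "rr p \<le> R" shows "ff p \<le> R\<^sup>2"
proof -
  have "(rr p)\<^sup>2 \<le> R\<^sup>2" using assms by (intro power_mono) (auto simp: rr_def)
  then show ?thesis using rr_sq_ge[OF assms(1)] assms(1) by (simp add: DD_def)
qed

text \<open>The factor 1 / k costs at most 2 to the power 2 a, so only the power of f matters when
  weights are compared.\<close>

lemma wt_sq_bounds:
  assumes p: "p \<in> DD" and k: "3 / 4 \<le> kk e p" "kk e p \<le> 1" and a: "a > 0"
  shows "ff p powr (2 * a) \<le> (wt a e p)\<^sup>2" "(wt a e p)\<^sup>2 \<le> 2 powr (2 * a) * ff p powr (2 * a)"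
proof -
  have f: "ff p > 0" using p by (simp add: DD_def)
  have w: "(wt a e p)\<^sup>2 = (ff p / kk e p) powr (2 * a)"
  proof -
    have "(wt a e p)\<^sup>2 = (ff p / kk e p) powr a * (ff p / kk e p) powr a" by (simp add: wt_def power2_eq_square)
    also have "\<dots> = (ff p / kk e p) powr (2 * a)" by (simp add: powr_add[symmetric])
    finally show ?thesis .
  qed
  have "ff p \<le> ff p / kk e p" using f k by (simp add: le_divide_eq mult_left_le)
  then show "ff p powr (2 * a) \<le> (wt a e p)\<^sup>2" unfolding w using f a by (intro powr_mono2) auto
  have "ff p / kk e p \<le> 2 * ff p" using f k by (simp add: divide_le_eq)
  then have "(ff p / kk e p) powr (2 * a) \<le> (2 * ff p) powr (2 * a)" using f k a by (intro powr_mono2) auto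
  then show "(wt a e p)\<^sup>2 \<le> 2 powr (2 * a) * ff p powr (2 * a)" unfolding w using f by (simp add: powr_mult)
qed

text \<open>The size of the current: as \<open>lam\<close> is O(1 / f), the value of z enters with
  two powers of f fewer than its gradient.\<close>

definition en2 :: "real \<Rightarrow> (real^'m) \<times> (real^'n) \<Rightarrow> real \<Rightarrow> (real^'m) \<times> (real^'n) \<Rightarrow> real" where
  "en2 a p s g = ff p powr (2 * a) * (g \<bullet> g) + ff p powr (2 * a - 2) * s\<^sup>2"

lemma powr_shift: "f > 0 \<Longrightarrow> f powr (c + real n) = f ^ n * f powr c" for f c :: real
  by (simp add: powr_add powr_realpow mult.commute)

lemma norm_rad: "p \<in> DD \<Longrightarrow> norm (rad p) = 1"
  using rad_inner_rad[of p] by (simp add: norm_eq_sqrt_inner)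

text \<open>The coefficients without a bound near the cone are \<open>lam\<close> and
  \<open>Th\<close>, both O(1 / f). They are compensated because \<psi>^2 is at most a constant
  times f^2 times the second summand of \<open>en2\<close>.\<close>

lemma cfield_bound:
  fixes a R e d :: real
  assumes a: "a > 0" and R: "R > 0" and e: "e > 0" "e * R \<le> 1 / 4" and d: "d \<ge> 0"
  obtains C where "C > 0" "\<And>p s g. \<lbrakk>p \<in> (DD :: ((real^'m) \<times> (real^'n)) set); rr p \<le> R\<rbrakk> \<Longrightarrow>
     norm (cfield a e d p s g) \<le> C * en2 a p s g"
proof -
  let ?q0 = "\<bar>q0 CARD('m) CARD('n)\<bar>" and ?q1 = "\<bar>q1 CARD('n)\<bar>"
  define Q where "Q = ?q0 + ?q1"
  define G where "G = e * (?q0 + ?q1) + e * ?q1"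
  have Q0: "Q \<ge> 0" and G0: "G \<ge> 0" using e by (auto simp: Q_def G_def)
  define Kw where "Kw = 2 powr (2 * a)"
  have Kw: "Kw > 0" by (simp add: Kw_def)
  define Cl where "Cl = 4 * a * R"
  define Cx where "Cx = Kw * (2 + 2 * Cl\<^sup>2)"
  have Cx: "Cx > 0" using Kw by (simp add: Cx_def add_pos_nonneg)
  define Ct where "Ct = a\<^sup>2 + d * R"
  have Ct: "Ct \<ge> 0" using R d by (simp add: Ct_def)
  define C where "C = (4 * R + Q) * Cx + (Q + G) * (Kw * R ^ 4) + 2 * R * Ct * (Kw * R\<^sup>2)"
  have C: "C > 0" unfolding C_def using R Q0 G0 Kw Ct Cx by (intro add_pos_nonneg mult_pos_pos) auto
  have "norm (cfield a e d p s g) \<le> C * en2 a p s g"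
    if p: "p \<in> DD" and pR: "rr p \<le> R" for p :: "(real^'m) \<times> (real^'n)" and s g
  proof -
    note pc = cone_of_bounded[OF p pR e]
    define f where "f = ff p" define r where "r = rr p" define k where "k = kk e p" define w where "w = wt a e p"
    have f: "f > 0" using p by (simp add: f_def DD_def)
    have fR: "f \<le> R\<^sup>2" using ff_le[OF p pR] by (simp add: f_def)
    have r: "0 < r" "r \<le> R" "4 * f \<le> r\<^sup>2" using rr_pos[OF p] pR rr_sq_ge[OF p] by (auto simp: r_def f_def)
    have k: "3 / 4 \<le> k" "k \<le> 1" using pc by (auto simp: k_def)
    have fr: "f / r \<le> r / 4" using r f by (simp add: field_simps power2_eq_square)
    have er: "e * r \<le> 1 / 4" using mult_left_mono[OF r(2), of e] e by linarith
    have np: "norm p \<le> 2 * r" using norm_le_of_ff_pos[of p] f by (simp add: f_def r_def rr_def)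
    have w2: "w\<^sup>2 \<le> Kw * f powr (2 * a)"
      using wt_sq_bounds(2)[OF p pc(2,3) a] by (simp add: w_def Kw_def f_def)
    have f2a: "f powr (2 * a) = f\<^sup>2 * f powr (2 * a - 2)"
      using powr_shift[OF f, of "2 * a - 2" 2] by simp
    define X where "X = f powr (2 * a) * (g \<bullet> g)"
    define Z where "Z = f powr (2 * a - 2) * s\<^sup>2"
    have XZ: "X \<ge> 0" "Z \<ge> 0" "en2 a p s g = X + Z" by (auto simp: X_def Z_def en2_def f_def)
    have Y: "norm (YY e p) \<le> 2 * R"
    proof -
      have "norm (YY e p) \<le> norm ((k / 2) *\<^sub>R p) + norm ((e * f) *\<^sub>R rad p)"
        unfolding YY_def k_def f_def by (rule norm_triangle_ineq)
      also have "\<dots> = k / 2 * norm p + e * f" using k e f by (simp add: norm_rad[OF p])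
      also have "\<dots> \<le> 1 / 2 * (2 * r) + R"
      proof (intro add_mono mult_mono)
        have "e * f = (e * r) * (f / r)" using r by simp
        also have "\<dots> \<le> 1 * (r / 4)" using er fr e f r by (intro mult_mono) auto
        finally show "e * f \<le> R" using r by simp
      qed (use k np in auto)
      finally show ?thesis using r by simp
    qed
    have l: "norm (lam a e p) \<le> Cl / f"
    proof -
      have "norm (lam a e p) = norm (mink (lam a e p))" by simp
      also have "\<dots> = a / (k * f) * norm (YY e p)"
        unfolding mink_lam[OF pc(1)] using a k f by (simp add: k_def f_def)
      also have "\<dots> \<le> (2 * a / f) * (2 * R)"
      proof (intro mult_mono Y)
        show "a / (k * f) \<le> 2 * a / f" using a k f by (simp add: field_simps)
      qed (use a f in auto)
      finally show ?thesis by (simp add: Cl_def)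
    qed
    define \<xi> where "\<xi> = xi a e p s g"
    define \<psi> where "\<psi> = w * s"
    have \<psi>2: "\<psi>\<^sup>2 \<le> Kw * f\<^sup>2 * Z"
    proof -
      have "\<psi>\<^sup>2 = w\<^sup>2 * s\<^sup>2" by (simp add: \<psi>_def power_mult_distrib)
      also have "\<dots> \<le> (Kw * f powr (2 * a)) * s\<^sup>2" using w2 by (intro mult_right_mono) auto
      finally show ?thesis by (simp add: f2a Z_def mult.assoc)
    qed
    have \<xi>2: "(norm \<xi>)\<^sup>2 \<le> Cx * (X + Z)"
    proof -
      have "norm \<xi> \<le> norm (w *\<^sub>R g) + norm (\<psi> *\<^sub>R lam a e p)"
        unfolding \<xi>_def xi_def w_def \<psi>_def by (rule norm_triangle_ineq)
      also have "\<dots> \<le> \<bar>w\<bar> * norm g + \<bar>\<psi>\<bar> * (Cl / f)" 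
        using mult_left_mono[OF l, of "\<bar>\<psi>\<bar>"] by simp
      finally have "(norm \<xi>)\<^sup>2 \<le> (\<bar>w\<bar> * norm g + \<bar>\<psi>\<bar> * (Cl / f))\<^sup>2" by (intro power_mono) auto
      also have "\<dots> \<le> 2 * (\<bar>w\<bar> * norm g)\<^sup>2 + 2 * (\<bar>\<psi>\<bar> * (Cl / f))\<^sup>2"
      proof -
        have "0 \<le> (\<bar>w\<bar> * norm g - \<bar>\<psi>\<bar> * (Cl / f))\<^sup>2" by simp
        then show ?thesis by (simp add: power2_sum power2_diff)
      qed
      also have "\<dots> = 2 * (w\<^sup>2 * (g \<bullet> g)) + 2 * (Cl\<^sup>2 * (\<psi>\<^sup>2 / f\<^sup>2))"
        by (simp add: power_mult_distrib power_divide power2_norm_eq_inner)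
      also have "\<dots> \<le> 2 * (Kw * X) + 2 * (Cl\<^sup>2 * (Kw * Z))"
      proof (intro add_mono mult_left_mono)
        show "w\<^sup>2 * (g \<bullet> g) \<le> Kw * X" using mult_right_mono[OF w2, of "g \<bullet> g"] by (simp add: X_def mult.assoc)
        show "\<psi>\<^sup>2 / f\<^sup>2 \<le> Kw * Z" using \<psi>2 f by (simp add: divide_le_eq mult.commute mult.left_commute)
      qed auto
      also have "\<dots> \<le> Cx * (X + Z)"
      proof -
        have "0 \<le> Kw * Z" "0 \<le> Cl\<^sup>2 * (Kw * X)" using Kw XZ by auto
        then show ?thesis by (simp add: Cx_def algebra_simps)
      qed
      finally show ?thesis .
    qed
    have f4: "f\<^sup>2 \<le> R ^ 4"
    proof -
      have "f\<^sup>2 \<le> (R\<^sup>2)\<^sup>2" using fR f by (intro power_mono) auto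
      then show ?thesis by simp
    qed
    have \<psi>3: "\<psi>\<^sup>2 \<le> Kw * R ^ 4 * (X + Z)"
    proof -
      have "Kw * f\<^sup>2 * Z \<le> Kw * R ^ 4 * (X + Z)" using f4 Kw XZ by (intro mult_mono) auto
      then show ?thesis using \<psi>2 by linarith
    qed
    have \<psi>4: "\<psi>\<^sup>2 / f \<le> Kw * R\<^sup>2 * (X + Z)"
    proof -
      have "\<psi>\<^sup>2 / f \<le> Kw * f\<^sup>2 * Z / f" using \<psi>2 f by (intro divide_right_mono) auto
      also have "\<dots> = Kw * f * Z" using f by (simp add: power2_eq_square)
      also have "\<dots> \<le> Kw * R\<^sup>2 * (X + Z)" using fR Kw XZ f by (intro mult_mono) auto
      finally show ?thesis .
    qed
    define q where "q = qq e p"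
    have qQ: "\<bar>q\<bar> \<le> Q"
    proof -
      have "\<bar>e * q1 CARD('n) * (f * (1 / r))\<bar> = ?q1 * (e * (f / r))" using e f r by (simp add: abs_mult)
      also have "\<dots> \<le> ?q1 * 1"
      proof (intro mult_left_mono)
        have "e * (f / r) \<le> e * (r / 4)" using fr e by (intro mult_left_mono) auto
        then show "e * (f / r) \<le> 1" using er by simp
      qed simp
      finally have 1: "\<bar>e * q1 CARD('n) * (f * (1 / r))\<bar> \<le> ?q1" by simp
      have "\<bar>q0 CARD('m) CARD('n) * k\<bar> \<le> ?q0 * 1" unfolding abs_mult using k by (intro mult_left_mono) auto
      then show ?thesis using 1 unfolding q_def qq_def Q_def k_def[symmetric] f_def[symmetric] r_def[symmetric] by linarith
    qed
    have GG: "norm (Gq e p) \<le> G"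
    proof -
      have "norm (Gq e p) \<le> \<bar>- e * q0 CARD('m) CARD('n) - e * q1 CARD('n) * (f / r\<^sup>2)\<bar> * 1 + \<bar>e * q1 CARD('n) / 2 * (1 / r)\<bar> * norm p"
        unfolding Gq_def f_def[symmetric] r_def[symmetric]
        by (rule order_trans[OF norm_triangle_ineq]) (simp add: norm_rad[OF p])
      also have "\<dots> \<le> e * (?q0 + ?q1) + e * ?q1"
      proof (intro add_mono)
        have "f / r\<^sup>2 \<le> 1" using r f by (simp add: divide_le_eq)
        then have "(e * ?q1) * (f / r\<^sup>2) \<le> (e * ?q1) * 1" using e by (intro mult_left_mono) auto
        moreover have "\<bar>- e * q0 CARD('m) CARD('n) - e * q1 CARD('n) * (f / r\<^sup>2)\<bar> \<le> e * ?q0 + (e * ?q1) * (f / r\<^sup>2)"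
          using abs_triangle_ineq4[of "- e * q0 CARD('m) CARD('n)" "e * q1 CARD('n) * (f / r\<^sup>2)"] e f r by (simp add: abs_mult)
        ultimately show "\<bar>- e * q0 CARD('m) CARD('n) - e * q1 CARD('n) * (f / r\<^sup>2)\<bar> * 1 \<le> e * (?q0 + ?q1)" by (simp add: algebra_simps)
        have "\<bar>e * q1 CARD('n) / 2 * (1 / r)\<bar> * norm p \<le> \<bar>e * q1 CARD('n) / 2 * (1 / r)\<bar> * (2 * r)"
          using np by (intro mult_left_mono) auto
        also have "\<dots> = e * ?q1" using e r by (simp add: abs_mult)
        finally show "\<bar>e * q1 CARD('n) / 2 * (1 / r)\<bar> * norm p \<le> e * ?q1" .
      qed
      finally show ?thesis by (simp add: G_def)
    qed
    have T: "\<bar>Th a e d p\<bar> \<le> Ct / f"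
    proof -
      have "0 \<le> Th a e d p" unfolding Th_def using pc(2) p d rr_pos[OF p] by (simp add: DD_def)
      moreover have "Th a e d p = (a\<^sup>2 / 2 * (1 / k) + d * r) / f"
        unfolding Th_def k_def f_def r_def by (simp add: add_divide_distrib)
      moreover have "(a\<^sup>2 / 2 * (1 / k) + d * r) / f \<le> Ct / f"
      proof (intro divide_right_mono)
        have "a\<^sup>2 / 2 * (1 / k) \<le> a\<^sup>2 / 2 * 2" using k by (intro mult_left_mono) (auto simp: field_simps)
        moreover have "d * r \<le> d * R" using r d by (intro mult_left_mono) auto
        ultimately show "a\<^sup>2 / 2 * (1 / k) + d * r \<le> Ct" by (simp add: Ct_def)
      qed (use f in auto)
      ultimately show ?thesis by simp
    qed
    define n where "n = norm \<xi>"
    have "norm (cfield a e d p s g) \<le> \<bar>YY e p \<bullet> \<xi>\<bar> * n + \<bar>1 / 2 * (\<xi> \<bullet> mink \<xi>)\<bar> * norm (YY e p) + \<bar>q * \<psi>\<bar> * n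
       + \<bar>1 / 2 * (\<psi> * \<psi>)\<bar> * norm (Gq e p) + \<bar>Th a e d p * (\<psi> * \<psi>)\<bar> * norm (YY e p)"
      unfolding cfield_def \<xi>_def[symmetric] \<psi>_def[symmetric] w_def[symmetric] q_def[symmetric] n_def
      by (intro order_trans[OF norm_triangle_ineq] order_trans[OF norm_triangle_ineq4] add_mono) simp_all
    also have "\<dots> \<le> (2 * R * n) * n + (n * n) * (2 * R) + (Q * \<bar>\<psi>\<bar>) * n + \<psi>\<^sup>2 * G + (Ct / f * \<psi>\<^sup>2) * (2 * R)"
    proof (intro add_mono mult_mono)
      have "\<bar>YY e p \<bullet> \<xi>\<bar> \<le> norm (YY e p) * n" unfolding n_def by (rule Cauchy_Schwarz_ineq2)
      also have "\<dots> \<le> 2 * R * n" using Y by (intro mult_right_mono) (auto simp: n_def)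
      finally show "\<bar>YY e p \<bullet> \<xi>\<bar> \<le> 2 * R * n" .
      have "\<bar>\<xi> \<bullet> mink \<xi>\<bar> \<le> n * n" using Cauchy_Schwarz_ineq2[of \<xi> "mink \<xi>"] by (simp add: n_def)
      moreover have "0 \<le> n * n" by simp
      ultimately show "\<bar>1 / 2 * (\<xi> \<bullet> mink \<xi>)\<bar> \<le> n * n" by simp
      show "\<bar>q * \<psi>\<bar> \<le> Q * \<bar>\<psi>\<bar>" unfolding abs_mult using qQ by (intro mult_right_mono) auto
      show "\<bar>1 / 2 * (\<psi> * \<psi>)\<bar> \<le> \<psi>\<^sup>2" by (simp add: power2_eq_square)
      show "\<bar>Th a e d p * (\<psi> * \<psi>)\<bar> \<le> Ct / f * \<psi>\<^sup>2"
        using mult_right_mono[OF T, of "\<psi>\<^sup>2"] by (simp add: abs_mult power2_eq_square)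
    qed (use R GG Y Ct f Q0 G0 in \<open>auto simp: n_def\<close>)
    also have "\<dots> \<le> 4 * R * n\<^sup>2 + Q * (\<psi>\<^sup>2 + n\<^sup>2) + \<psi>\<^sup>2 * G + 2 * R * Ct * (\<psi>\<^sup>2 / f)"
    proof -
      have "0 \<le> (\<bar>\<psi>\<bar> - n)\<^sup>2" by simp
      then have "\<bar>\<psi>\<bar> * n \<le> (\<psi>\<^sup>2 + n\<^sup>2) / 2" by (simp add: power2_diff)
      also have "\<dots> \<le> \<psi>\<^sup>2 + n\<^sup>2" by simp
      finally have "Q * (\<bar>\<psi>\<bar> * n) \<le> Q * (\<psi>\<^sup>2 + n\<^sup>2)" using Q0 by (intro mult_left_mono) auto
      then show ?thesis by (simp add: power2_eq_square mult.commute mult.left_commute)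
    qed
    also have "\<dots> = (4 * R + Q) * n\<^sup>2 + (Q + G) * \<psi>\<^sup>2 + 2 * R * Ct * (\<psi>\<^sup>2 / f)" by (simp add: algebra_simps)
    also have "\<dots> \<le> (4 * R + Q) * (Cx * (X + Z)) + (Q + G) * (Kw * R ^ 4 * (X + Z)) + 2 * R * Ct * (Kw * R\<^sup>2 * (X + Z))"
      using \<xi>2 \<psi>3 \<psi>4 R Q0 G0 Ct unfolding n_def by (intro add_mono mult_left_mono) auto
    also have "\<dots> = C * en2 a p s g" unfolding C_def XZ(3) by (simp add: algebra_simps)
    finally show ?thesis .
  qed
  then show ?thesis using that C by blast
qed

text \<open>For z = 0 and a normal gradient, \<xi> is a multiple of the purely spatial vector (0,
  n). The two terms of the energy current combine to half of |\<xi>|^2 times the normal component of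
  Y, and the spatial part of Y is a nonnegative multiple of x.\<close>

lemma cfield_boundary_sign:
  assumes p: "p \<in> cone e" and e: "e > 0" and n: "snd p \<bullet> n \<le> 0"
  shows "snd (cfield a e d p 0 (0, l *\<^sub>R n)) \<bullet> n \<le> 0"
proof -
  define w where "w = wt a e p"
  define \<beta> where "\<beta> = kk e p / 2 + e * ff p / rr p"
  have \<beta>: "\<beta> \<ge> 0" unfolding \<beta>_def using coneD[OF p] e by simp
  have Y: "snd (YY e p) = \<beta> *\<^sub>R snd p"
  proof -
    have "snd (YY e p) = (kk e p / 2) *\<^sub>R snd p + (e * ff p * inverse (rr p)) *\<^sub>R snd p"
      by (simp add: YY_def rad_def)
    then show ?thesis unfolding \<beta>_def scaleR_add_left by (simp only: divide_inverse)
  qed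
  have x: "xi a e p 0 (0, l *\<^sub>R n) = (0, (w * l) *\<^sub>R n)" by (simp add: xi_def w_def)
  have "snd (cfield a e d p 0 (0, l *\<^sub>R n)) \<bullet> n = ((\<beta> * (w * l) * (snd p \<bullet> n)) * (w * l) * (n \<bullet> n)
      - 1 / 2 * ((w * l) * (w * l) * (n \<bullet> n)) * (\<beta> * (snd p \<bullet> n)))"
    unfolding cfield_def x by (simp add: mink_def inner_prod_def Y inner_diff_left)
  also have "\<dots> = (1 / 2 * (w * l)\<^sup>2 * (n \<bullet> n) * \<beta>) * (snd p \<bullet> n)" by (simp add: power2_eq_square algebra_simps)
  also have "\<dots> \<le> 0" using \<beta> n by (intro mult_nonneg_nonpos) auto
  finally show ?thesis .
qed

lemma continuous_on_cfield:
  assumes T: "T \<subseteq> cone e" and z: "continuous_on T z" and W: "continuous_on T W"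
  shows "continuous_on T (\<lambda>p. cfield a e d p (z p) (W p))"
proof -
  have TD: "T \<subseteq> DD" using T by (auto simp: cone_def)
  have c: "continuous_on T (wt a e)" "continuous_on T (lam a e)" "continuous_on T (Th a e d)"
    using C1_deriv_continuous_on[OF C1_deriv_wt] C1_deriv_continuous_on[OF C1_deriv_lam] C1_deriv_continuous_on[OF C1_deriv_Th]
      continuous_on_subset T by blast+
  have y: "continuous_on T (YY e)" "continuous_on T (qq e)"
    using C1_deriv_continuous_on[OF C1_deriv_YY] C1_deriv_continuous_on[OF C1_deriv_qq] continuous_on_subset TD by blast+
  have g: "continuous_on T (\<lambda>p. mink (Gq e p))"
    using C1_div_Gq[of e] C1_deriv_continuous_on continuous_on_subset TD unfolding C1_div_def by blast
  have x: "continuous_on T (\<lambda>p. xi a e p (z p) (W p))" unfolding xi_def by (intro continuous_intros c z W)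
  have m: "continuous_on T (\<lambda>p. mink (xi a e p (z p) (W p)))"
    by (rule bounded_linear.continuous_on[OF bounded_linear_mink x])
  show ?thesis unfolding cfield_def by (intro continuous_intros c y g x m z)
qed

text \<open>The coordinate definition is the trace of the Hessian against the metric, that is, the
  divergence of \<open>mink (egrad z p)\<close>. This connects the statement with
  \<open>C1_div\<close>.\<close>

lemma box_eq_trace:
  fixes z :: "(real^'m) \<times> (real^'n) \<Rightarrow> real"
  shows "box z p = trace_of (\<lambda>v. mink (\<Sum>b\<in>Basis. dder (dder z b) v p *\<^sub>R b))"
proof -
  define H where "H v = (\<Sum>b\<in>Basis. dder (dder z b) v p *\<^sub>R b)" for v
  have Hb: "H v \<bullet> b = dder (dder z b) v p" if "b \<in> Basis" for v b
    unfolding H_def inner_sum_left using that by (simp add: inner_Basis if_distrib cong: if_cong)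
  have "trace_of (\<lambda>v. mink (H v)) = (\<Sum>b\<in>Basis. H b \<bullet> mink b)" by (simp add: trace_of_def inner_mink)
  also have "\<dots> = (\<Sum>u\<in>Basis. H (u, 0) \<bullet> mink (u, 0)) + (\<Sum>v\<in>Basis. H (0, v) \<bullet> mink (0, v))"
    unfolding Basis_prod_def by (subst sum.union_disjoint) (auto simp: sum.reindex inj_on_def)
  also have "(\<Sum>u\<in>Basis. H (u, 0) \<bullet> mink (u, 0)) = - (\<Sum>u\<in>Basis. dder (dder z (u, 0)) (u, 0) p)"
  proof -
    have "H (u, 0) \<bullet> mink (u, 0) = - dder (dder z (u, 0)) (u, 0) p" if "u \<in> Basis" for u :: "real^'m"
    proof -
      have "H (u, 0) \<bullet> mink (u, 0) = - (H (u, 0) \<bullet> (u, 0))" by (simp add: mink_def inner_prod_def)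
      also have "\<dots> = - dder (dder z (u, 0)) (u, 0) p" using that by (subst Hb) (auto simp: Basis_prod_def)
      finally show ?thesis .
    qed
    then show ?thesis by (simp add: sum_negf)
  qed
  also have "\<dots> = - (\<Sum>i\<in>UNIV. dder (dt z i) (axis i 1, 0) p)"
    unfolding Basis_vec_def dt_def[abs_def]
    by (simp add: UNION_singleton_eq_range sum.reindex axis_eq_axis inj_on_def)
  also have "(\<Sum>v\<in>Basis. H (0, v) \<bullet> mink (0, v)) = (\<Sum>v\<in>Basis. dder (dder z (0, v)) (0, v) p)"
    by (simp add: mink_def Hb Basis_prod_def)
  also have "\<dots> = (\<Sum>j\<in>UNIV. dder (dx z j) (0, axis j 1) p)"
    unfolding Basis_vec_def dx_def[abs_def]
    by (simp add: UNION_singleton_eq_range sum.reindex axis_eq_axis inj_on_def)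
  finally show ?thesis by (simp add: box_def H_def)
qed

lemma gradt_sq_eq:
  assumes "z differentiable (at p)"
  shows "gradt_sq z p = fst (egrad z p) \<bullet> fst (egrad z p)" "gradx_sq z p = snd (egrad z p) \<bullet> snd (egrad z p)"
    "dtau z p = fst (egrad z p) \<bullet> sgn (fst p)" "dr z p = snd (egrad z p) \<bullet> sgn (snd p)"
  by (simp_all add: gradt_sq_def gradx_sq_def dt_def dx_def dtau_def dr_def egrad_inner(2)[OF assms] inner_prod_def inner_axis)
    (simp_all add: inner_vec_def power2_eq_square)

section \<open>A Caccioppoli inequality\<close>

lemma C1_div_cong:
  assumes "C1_div S J \<delta>" "open S" "\<And>p. p \<in> S \<Longrightarrow> J p = K p"
  shows "C1_div S K \<delta>"
proof -
  obtain J' where J': "C1_deriv S J J'" "\<forall>p\<in>S. trace_of (J' p) = \<delta> p" using assms(1) by (auto simp: C1_div_def)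
  show ?thesis by (rule C1_divI[OF C1_deriv_cong[OF J'(1) assms(2,3)]]) (use J'(2) in auto)
qed

lemma slab_open: "open \<Omega> \<Longrightarrow> open ((UNIV \<times> \<Omega>) \<inter> (DD :: ((real^'m) \<times> (real^'n)) set))"
  using open_DD by (intro open_Int open_Times) auto

lemma slab_bounds:
  assumes "\<forall>x\<in>\<Omega>. norm x < R" "p \<in> (UNIV \<times> \<Omega>) \<inter> DD"
  shows "p \<in> DD" "ff p > 0" "rr p < R" "norm p \<le> 2 * R" "ff p \<le> R\<^sup>2" "rr p > 0"
proof -
  show 1: "p \<in> DD" "ff p > 0" "rr p < R" using assms by (auto simp: DD_def rr_def)
  show "norm p \<le> 2 * R" using norm_le_of_ff_pos[OF 1(2)] 1(3) by (simp add: rr_def)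
  show "ff p \<le> R\<^sup>2" using ff_le[OF 1(1)] 1(3) by simp
  show "rr p > 0" by (rule rr_pos[OF 1(1)])
qed

text \<open>The cylinder is unbounded, but its part in \<open>DD\<close> lies in the ball of radius
  2 R, so continuity up to the lateral boundary gives a bound on a compact set.\<close>

lemma bounded_on_slab:
  fixes h :: "(real^'m) \<times> (real^'n) \<Rightarrow> 'b::real_normed_vector"
  assumes R: "\<forall>x\<in>\<Omega>. norm x < R" and h: "continuous_on (closure (UNIV \<times> \<Omega>)) h"
  obtains M where "M > 0" "\<And>p. p \<in> (UNIV \<times> \<Omega>) \<inter> DD \<Longrightarrow> norm (h p) \<le> M"
proof -
  define K where "K = cball 0 (2 * R) \<inter> closure (UNIV \<times> \<Omega> :: ((real^'m) \<times> (real^'n)) set)"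
  have "compact K" unfolding K_def by (intro compact_Int_closed) auto
  moreover have "continuous_on K h" by (rule continuous_on_subset[OF h]) (auto simp: K_def)
  ultimately obtain M where M: "\<forall>p\<in>K. norm (h p) \<le> M"
    using compact_imp_bounded[OF compact_continuous_image] by (metis bounded_iff imageI)
  have "norm (h p) \<le> max M 1" if p: "p \<in> (UNIV \<times> \<Omega>) \<inter> DD" for p
  proof -
    have "p \<in> K" unfolding K_def using slab_bounds(4)[OF R p] p closure_subset[of "UNIV \<times> \<Omega>"] by auto
    then show ?thesis using M by (simp add: le_max_iff_disj)
  qed
  then show ?thesis using that[of "max M 1"] by simp
qed

text \<open>This is where a >= 2 enters: f^(2 a - 2) = f^2 f^(2 a - 4) with nonnegative remaining
  exponent, so the currents decay like f^2 at the null cone.\<close>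

lemma en2_le_ff_sq:
  assumes f: "0 < ff p" "ff p \<le> R\<^sup>2" and a: "a \<ge> 2" and R: "R > 0" and s: "\<bar>s\<bar> \<le> M" and g: "norm g \<le> M"
  shows "en2 a p s g \<le> ((R\<^sup>2) powr (2 * a - 2) + (R\<^sup>2) powr (2 * a - 4)) * M\<^sup>2 * (ff p)\<^sup>2"
proof -
  have 1: "ff p powr (2 * a) = (ff p)\<^sup>2 * ff p powr (2 * a - 2)" using powr_shift[OF f(1), of "2 * a - 2" 2] by simp
  have 2: "ff p powr (2 * a - 2) = (ff p)\<^sup>2 * ff p powr (2 * a - 4)" using powr_shift[OF f(1), of "2 * a - 4" 2] by simp
  have 3: "ff p powr (2 * a - 2) \<le> (R\<^sup>2) powr (2 * a - 2)" "ff p powr (2 * a - 4) \<le> (R\<^sup>2) powr (2 * a - 4)"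
    using f a by (intro powr_mono2; simp)+
  have 4: "g \<bullet> g \<le> M\<^sup>2" using g by (metis norm_ge_zero power2_norm_eq_inner power_mono)
  have 5: "s\<^sup>2 \<le> M\<^sup>2" using s by (metis abs_ge_zero power2_abs power_mono)
  have "ff p powr (2 * a - 2) * (g \<bullet> g) + ff p powr (2 * a - 4) * s\<^sup>2
      \<le> (R\<^sup>2) powr (2 * a - 2) * M\<^sup>2 + (R\<^sup>2) powr (2 * a - 4) * M\<^sup>2"
    using 3 4 5 by (intro add_mono mult_mono) auto
  then have "(ff p)\<^sup>2 * (ff p powr (2 * a - 2) * (g \<bullet> g) + ff p powr (2 * a - 4) * s\<^sup>2)
      \<le> (ff p)\<^sup>2 * ((R\<^sup>2) powr (2 * a - 2) * M\<^sup>2 + (R\<^sup>2) powr (2 * a - 4) * M\<^sup>2)" by (intro mult_left_mono) auto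
  moreover have "en2 a p s g = (ff p)\<^sup>2 * (ff p powr (2 * a - 2) * (g \<bullet> g) + ff p powr (2 * a - 4) * s\<^sup>2)"
    unfolding en2_def 1 by (subst (2) 2) (simp add: algebra_simps)
  ultimately show ?thesis by (simp add: algebra_simps)
qed

text \<open>z vanishes on the lateral boundary outside the cone, so all its tangential derivatives
  vanish there, those in time included. The normal of the cylinder has no time component.\<close>

lemma boundary_gradient_normal:
  fixes z :: "(real^'m) \<times> (real^'n) \<Rightarrow> real"
  assumes \<Omega>: "open \<Omega>" and z: "Ck 2 (UNIV \<times> \<Omega>) z" and zc: "continuous_on (closure (UNIV \<times> \<Omega>)) z"
    and W: "continuous_on (closure (UNIV \<times> \<Omega>)) W" "\<And>p. p \<in> UNIV \<times> \<Omega> \<Longrightarrow> W p = egrad z p"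
    and z0: "\<forall>p\<in>frontier (UNIV \<times> \<Omega>) \<inter> DD. z p = 0"
    and p: "p \<in> frontier (UNIV \<times> \<Omega>)" "p \<in> DD" and V: "local_defining \<Omega> (snd p) V \<phi>"
  obtains l where "W p = (0, l *\<^sub>R grad \<phi> (snd p))"
proof -
  have V': "open V" "snd p \<in> V" "grad \<phi> (snd p) \<noteq> 0" "\<Omega> \<inter> V = {y\<in>V. \<phi> y < 0}" "Ck 1 V \<phi>"
    using V by (auto simp: local_defining_def smooth_on_def)
  have xfr: "snd p \<in> frontier \<Omega>" using p(1) by (simp add: frontier_cylinder mem_Times_iff)
  define n :: "(real^'m) \<times> (real^'n)" where "n = (0, grad \<phi> (snd p))"
  define V1 where "V1 = (UNIV \<times> V) \<inter> (DD :: ((real^'m) \<times> (real^'n)) set)"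
  have Vo: "open V1" unfolding V1_def by (rule slab_open[OF V'(1)])
  have pV: "p \<in> V1" using p(2) V'(2) by (simp add: V1_def mem_Times_iff)
  have "grad \<phi> (snd p) = egrad \<phi> (snd p)" using V'(2,5) by (intro grad_eq_egrad) (auto simp: One_nat_def)
  then have d1: "(\<phi> has_derivative (\<lambda>v. grad \<phi> (snd p) \<bullet> v)) (at (snd p))"
    using C1_deriv_has_derivative[OF Ck_1_C1_deriv[OF V'(5)] V'(2)] by simp
  have "(snd has_derivative snd) (at p)" by (rule bounded_linear_imp_has_derivative[OF bounded_linear_snd])
  from has_derivative_compose[OF this d1]
  have "((\<lambda>p. \<phi> (snd p)) has_derivative (\<lambda>v. grad \<phi> (snd p) \<bullet> snd v)) (at p)" .
  then have d: "((\<lambda>p. \<phi> (snd p)) has_derivative (\<lambda>v. n \<bullet> v)) (at p)" by (simp add: n_def inner_prod_def)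
  have n0: "n \<noteq> 0" using V'(3) by (simp add: n_def zero_prod_def)
  have SV: "(UNIV \<times> \<Omega>) \<inter> V1 = {p\<in>V1. \<phi> (snd p) < 0}"
  proof -
    have "y \<in> \<Omega> \<longleftrightarrow> \<phi> y < 0" if "y \<in> V" for y using V'(4) that by blast
    then show ?thesis by (auto simp: V1_def)
  qed
  have Uo: "open (UNIV \<times> \<Omega> :: ((real^'m) \<times> (real^'n)) set)" using \<Omega> by (intro open_Times) auto
  have "\<exists>l. W p = l *\<^sub>R n"
  proof (rule normal_direction[OF n0])
    fix h assume "n \<bullet> h = 0"
    then show "W p \<bullet> h = 0"
      using tangential_derivative_zero[OF Uo p(1) Vo pV d local_defining_frontier_zero[OF V \<Omega> xfr V'(2)] n0 SV
          Ck_2_derivatives(1)[OF z] zc W(2) W(1)] z0 by (auto simp: V1_def)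
  qed
  then show ?thesis using that by (auto simp: n_def)
qed

lemma C1_deriv_ff_powr: "C1_deriv DD (\<lambda>p. ff p powr c) (\<lambda>p v. c * ff p powr (c - 1) * ((mink p \<bullet> v) / 2))"
proof (rule C1_deriv_compose_real[OF C1_deriv_ff, where h="\<lambda>x. x powr c" and h'="\<lambda>x. c * x powr (c - 1)"])
  show "((\<lambda>x. x powr c) has_real_derivative c * ff p powr (c - 1)) (at (ff p))"
    if "p \<in> DD" for p :: "(real^'a) \<times> (real^'b)"
    using has_real_derivative_powr[of "ff p" c] that by (simp add: mult.commute DD_def)
  show "continuous_on (ff ` (DD :: ((real^'a) \<times> (real^'b)) set)) (\<lambda>x. c * x powr (c - 1))"
    by (intro continuous_intros) (auto simp: DD_def)
qed

text \<open>Recovers the spatial gradient near the boundary piece from the time derivatives, \<open>box z\<close> and \<open>z\<close>.\<close>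

lemma caccioppoli:
  fixes z :: "(real^'m) \<times> (real^'n) \<Rightarrow> real" and \<eta> :: "real^'n \<Rightarrow> real"
  assumes \<Omega>: "open \<Omega>" "smooth_boundary \<Omega>" and R: "R > 0" "\<forall>x\<in>\<Omega>. norm x < R" and a: "a \<ge> 2"
    and \<eta>: "C1_deriv UNIV \<eta> (\<lambda>x v. N x \<bullet> v)" "\<And>x. 0 \<le> \<eta> x \<and> \<eta> x \<le> 1" and Nc: "continuous_on UNIV N"
    and z: "Ck 2 (UNIV \<times> \<Omega>) z" and zC: "C1_closure (UNIV \<times> \<Omega>) z"
    and z0: "\<forall>p\<in>frontier (UNIV \<times> \<Omega>) \<inter> DD. z p = 0"
  shows "(\<integral>\<^sup>+p\<in>(UNIV \<times> \<Omega>) \<inter> DD. ennreal ((\<eta> (snd p))\<^sup>2 * ff p powr (2 * a) * (snd (egrad z p) \<bullet> snd (egrad z p)) / 2) \<partial>lborel)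
    \<le> (\<integral>\<^sup>+p\<in>(UNIV \<times> \<Omega>) \<inter> DD. ennreal (2 * ((\<eta> (snd p))\<^sup>2 * ff p powr (2 * a) * (fst (egrad z p) \<bullet> fst (egrad z p)))
        + (\<eta> (snd p))\<^sup>2 * (ff p powr (2 * a + 1) * (box z p)\<^sup>2)
        + (R\<^sup>2 + 4 * a\<^sup>2 * R\<^sup>2) * ((\<eta> (snd p))\<^sup>2 * ff p powr (2 * a - 2) * (z p)\<^sup>2)
        + 4 * ((N (snd p) \<bullet> N (snd p)) * ff p powr (2 * a) * (z p)\<^sup>2)) \<partial>lborel)"
    (is "(\<integral>\<^sup>+p\<in>_. ennreal (?L p) \<partial>_) \<le> (\<integral>\<^sup>+p\<in>_. ennreal (?F p) \<partial>_)")
proof -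
  define S where "S = (UNIV \<times> \<Omega>) \<inter> (DD :: ((real^'m) \<times> (real^'n)) set)"
  have So: "open S" unfolding S_def by (rule slab_open[OF \<Omega>(1)])
  have SU: "S \<subseteq> UNIV \<times> \<Omega>" "S \<subseteq> DD" by (auto simp: S_def)
  have Sb: "p \<in> DD" "ff p > 0" "rr p < R" "norm p \<le> 2 * R" "ff p \<le> R\<^sup>2" "rr p > 0" if "p \<in> S" for p
    using slab_bounds[OF R(2) that[unfolded S_def]] by auto
  define G where "G = egrad z"
  define H where "H = (\<lambda>p v. \<Sum>b\<in>Basis. dder (dder z b) v p *\<^sub>R b)"
  have zC1: "C1_deriv S z (\<lambda>p v. G p \<bullet> v)" and GC: "C1_deriv S G H"
    using Ck_2_derivatives[OF z] SU(1) C1_deriv_subset unfolding G_def H_def by blast+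
  have box: "box z p = trace_of (\<lambda>v. mink (H p v))" for p unfolding H_def by (rule box_eq_trace)
  obtain W where W: "continuous_on (closure (UNIV \<times> \<Omega>)) W" "\<And>p. p \<in> UNIV \<times> \<Omega> \<Longrightarrow> W p = egrad z p"
    using C1_closure_gradient[OF zC] by blast
  have zc: "continuous_on (closure (UNIV \<times> \<Omega>)) z" using zC by (simp add: C1_closure_def)
  have WG: "W p = G p" if "p \<in> S" for p using W(2) SU that by (auto simp: G_def)
  \<comment> \<open>The test function \<eta>^2 f^(2 a) z. The current s times the metric gradient of
    z vanishes on the lateral boundary, so the sign condition there is trivial.\<close>
  define s where "s p = (\<eta> (snd p) * \<eta> (snd p)) * (ff p powr (2 * a) * z p)" for p
  define s' where "s' p v = (\<eta> (snd p) * \<eta> (snd p)) * (ff p powr (2 * a) * (G p \<bullet> v) + (2 * a * ff p powr (2 * a - 1) * ((mink p \<bullet> v) / 2)) * z p)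
      + (\<eta> (snd p) * (N (snd p) \<bullet> snd v) + (N (snd p) \<bullet> snd v) * \<eta> (snd p)) * (ff p powr (2 * a) * z p)" for p v
  have sC: "C1_deriv S s s'"
    unfolding s_def[abs_def] s'_def[abs_def]
    by (intro C1_deriv_mult C1_deriv_snd[OF \<eta>(1)] zC1 C1_deriv_subset[OF C1_deriv_ff_powr SU(2)])
  have mG: "C1_div S (\<lambda>p. mink (G p)) (box z)"
    by (rule C1_divI[OF C1_deriv_linear_compose[OF bounded_linear_mink GC]]) (simp add: box)
  define J where "J p = s p *\<^sub>R mink (W p)" for p
  have "C1_div S J (\<lambda>p. s p * box z p + s' p (mink (G p)))"
    by (rule C1_div_cong[OF C1_div_scaleR[OF sC mG] So]) (simp add: J_def WG)
  then obtain J' where J': "C1_deriv S J J'" "\<And>p. p \<in> S \<Longrightarrow> trace_of (J' p) = s p * box z p + s' p (mink (G p))"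
    by (auto simp: C1_div_def)
  have \<eta>c: "continuous_on T (\<lambda>p. \<eta> (snd p))" for T :: "((real^'m) \<times> (real^'n)) set"
    using C1_deriv_continuous_on[OF C1_deriv_snd[OF \<eta>(1)]] by blast
  have Nc': "continuous_on T (\<lambda>p. N (snd p))" for T :: "((real^'m) \<times> (real^'n)) set"
    by (rule continuous_on_compose2[OF Nc]) (auto intro!: continuous_intros)
  have fc: "continuous_on T (\<lambda>p. ff p powr c)" if "T \<subseteq> DD" for c and T :: "((real^'m) \<times> (real^'n)) set"
    using C1_deriv_continuous_on[OF C1_deriv_ff_powr] continuous_on_subset that by blast
  have Jc: "continuous_on (closure (UNIV \<times> \<Omega>) \<inter> DD) J"
    unfolding J_def s_def
    by (intro continuous_intros \<eta>c fc continuous_on_subset[OF zc] bounded_linear.continuous_on[OF bounded_linear_mink]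
        continuous_on_subset[OF W(1)]) auto
  obtain M1 where M1: "M1 > 0" "\<And>p. p \<in> S \<Longrightarrow> norm (z p) \<le> M1" using bounded_on_slab[OF R(2) zc, folded S_def] by blast
  obtain M2 where M2: "M2 > 0" "\<And>p. p \<in> S \<Longrightarrow> norm (W p) \<le> M2" using bounded_on_slab[OF R(2) W(1), folded S_def] by blast
  define CJ where "CJ = (R\<^sup>2) powr (2 * a - 2) * M1 * M2"
  have JB: "norm (J p) \<le> CJ * (ff p)\<^sup>2" if p: "p \<in> S" for p
  proof -
    have f: "ff p > 0" "ff p \<le> R\<^sup>2" using Sb[OF p] by auto
    have 1: "ff p powr (2 * a) = (ff p)\<^sup>2 * ff p powr (2 * a - 2)" using powr_shift[OF f(1), of "2 * a - 2" 2] by simp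
    have "norm (J p) = (\<eta> (snd p) * \<eta> (snd p)) * (ff p powr (2 * a) * \<bar>z p\<bar> * norm (W p))"
      unfolding J_def s_def using \<eta>(2)[of "snd p"] by (simp add: abs_mult)
    also have "\<dots> \<le> 1 * (ff p powr (2 * a) * M1 * M2)"
      using \<eta>(2)[of "snd p"] M1(1) M1(2)[OF p] M2(1) M2(2)[OF p] by (intro mult_mono mult_le_one) auto
    also have "\<dots> \<le> (ff p)\<^sup>2 * (R\<^sup>2) powr (2 * a - 2) * M1 * M2"
    proof -
      have "ff p powr (2 * a - 2) \<le> (R\<^sup>2) powr (2 * a - 2)" using f a by (intro powr_mono2) auto
      then show ?thesis unfolding 1 using M1(1) M2(1) by (simp add: mult_left_mono mult_right_mono)
    qed
    finally show ?thesis by (simp add: CJ_def mult.commute mult.left_commute)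
  qed
  have bd: "snd (J p) \<bullet> grad \<phi> (snd p) \<le> 0" if "p \<in> frontier (UNIV \<times> \<Omega>)" "p \<in> DD" for p V \<phi>
    using z0 that by (simp add: J_def s_def)
  have Gc: "continuous_on S G" by (rule C1_deriv_continuous_on[OF GC])
  have bc: "continuous_on S (box z)"
  proof -
    have "continuous_on S (\<lambda>p. trace_of (\<lambda>v. mink (H p v)))"
      by (rule C1_deriv_continuous_trace[OF C1_deriv_linear_compose[OF bounded_linear_mink GC]])
    then show ?thesis by (simp add: box)
  qed
  have Fc: "continuous_on S ?F"
    unfolding G_def[symmetric]
    by (intro continuous_on_add continuous_on_mult continuous_on_const continuous_on_power continuous_on_inner
        continuous_on_fst continuous_on_snd \<eta>c Nc' fc[OF SU(2)] bc Gc C1_deriv_continuous_on[OF zC1])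
  have F0: "0 \<le> ?F p" for p using R by (auto intro!: add_nonneg_nonneg mult_nonneg_nonneg)
  have key: "?L p \<le> ?F p + trace_of (J' p)" if p: "p \<in> S" for p
  proof -
    define f where "f = ff p"
    have f: "f > 0" "f \<le> R\<^sup>2" using Sb[OF p] by (auto simp: f_def)
    define h where "h = \<eta> (snd p)"
    define P where "P = f powr (2 * a - 2)"
    have P: "P > 0" using f by (simp add: P_def)
    have P0: "f powr (2 * a) = f\<^sup>2 * P" using powr_shift[OF f(1), of "2 * a - 2" 2] by (simp add: P_def)
    have P1: "f powr (2 * a - 1) = f * P" using powr_shift[OF f(1), of "2 * a - 2" 1] by (simp add: P_def)
    have P3: "f powr (2 * a + 1) = f ^ 3 * P" using powr_shift[OF f(1), of "2 * a - 2" 3] by (simp add: P_def add.commute)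
    define X where "X = snd (G p) \<bullet> snd (G p)"
    define T where "T = fst (G p) \<bullet> fst (G p)"
    define m where "m = N (snd p) \<bullet> snd (G p)"
    define n where "n = N (snd p) \<bullet> N (snd p)"
    define c where "c = p \<bullet> G p"
    define b where "b = box z p"
    define s0 where "s0 = z p"
    have G1: "G p \<bullet> mink (G p) = X - T" by (simp add: X_def T_def mink_def inner_prod_def)
    have G2: "mink p \<bullet> mink (G p) = c" by (simp add: c_def inner_mink)
    have G3: "snd (mink (G p)) = snd (G p)" by (simp add: mink_def)
    have tr: "trace_of (J' p) = h\<^sup>2 * P * (f\<^sup>2 * (s0 * b) + f\<^sup>2 * (X - T) + a * f * (s0 * c)) + P * f\<^sup>2 * (2 * h * (s0 * m))"
      unfolding J'(2)[OF p] s_def s'_def G1 G2 G3 f_def[symmetric] P0 P1 h_def[symmetric] b_def[symmetric] s0_def[symmetric] m_def[symmetric]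
      by (simp add: power2_eq_square algebra_simps)
    have X0: "X \<ge> 0" "T \<ge> 0" "n \<ge> 0" by (simp_all add: X_def T_def n_def)
    \<comment> \<open>The source: f^3 b^2 and f / 4 times s0^2 complete the square, and f <=
      R^2.\<close>
    have i1: "0 \<le> f ^ 3 * b\<^sup>2 + f\<^sup>2 * (s0 * b) + R\<^sup>2 * s0\<^sup>2"
    proof -
      have "0 \<le> f * (f * b + s0 / 2)\<^sup>2" using f by simp
      also have "\<dots> = f ^ 3 * b\<^sup>2 + f\<^sup>2 * (s0 * b) + f / 4 * s0\<^sup>2" by (simp add: power2_eq_square power3_eq_cube algebra_simps)
      also have "\<dots> \<le> f ^ 3 * b\<^sup>2 + f\<^sup>2 * (s0 * b) + R\<^sup>2 * s0\<^sup>2" using f by (intro add_left_mono mult_right_mono) auto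
      finally show ?thesis .
    qed
    \<comment> \<open>The derivative of the power of f. It is paid by a quarter of the full gradient
      and uses |p| <= 2 R.\<close>
    have i2: "0 \<le> f\<^sup>2 * (X + T) / 4 + a * f * (s0 * c) + 4 * a\<^sup>2 * R\<^sup>2 * s0\<^sup>2"
    proof -
      have XT: "X + T = (norm (G p))\<^sup>2" by (simp add: X_def T_def power2_norm_eq_inner inner_prod_def)
      have "\<bar>c\<bar> \<le> norm p * norm (G p)" unfolding c_def by (rule Cauchy_Schwarz_ineq2)
      also have "\<dots> \<le> 2 * R * norm (G p)" using Sb(4)[OF p] by (intro mult_right_mono) auto
      finally have sc: "\<bar>s0\<bar> * \<bar>c\<bar> \<le> \<bar>s0\<bar> * (2 * R * norm (G p))" by (intro mult_left_mono) auto
      have "(a * f) * \<bar>s0 * c\<bar> \<le> (a * f) * (\<bar>s0\<bar> * (2 * R * norm (G p)))"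
        unfolding abs_mult by (rule mult_left_mono[OF sc]) (use a f in auto)
      moreover have "- ((a * f) * \<bar>s0 * c\<bar>) \<le> a * f * (s0 * c)"
      proof -
        have "(a * f) * (- \<bar>s0 * c\<bar>) \<le> (a * f) * (s0 * c)" using a f by (intro mult_left_mono) auto
        then show ?thesis by simp
      qed
      moreover have "0 \<le> (f * norm (G p) / 2 - 2 * a * R * \<bar>s0\<bar>)\<^sup>2" by simp
      moreover have "(f * norm (G p) / 2 - 2 * a * R * \<bar>s0\<bar>)\<^sup>2 = f\<^sup>2 * (X + T) / 4 - (a * f) * (\<bar>s0\<bar> * (2 * R * norm (G p))) + 4 * a\<^sup>2 * R\<^sup>2 * s0\<^sup>2"
        unfolding XT by (simp add: power2_diff power_mult_distrib power_divide)
      ultimately show ?thesis by linarith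
    qed
    \<comment> \<open>The derivative of \<eta>, paid by another quarter of the spatial gradient.
      Together with the half on the left and the quarter in the previous fact this uses up the
      single copy of X in the divergence.\<close>
    have i3: "0 \<le> h\<^sup>2 * X / 4 + 2 * h * (s0 * m) + 4 * n * s0\<^sup>2"
    proof -
      define x1 where "x1 = norm (snd (G p))" define n1 where "n1 = norm (N (snd p))"
      have e: "X = x1\<^sup>2" "n = n1\<^sup>2" by (simp_all add: X_def n_def x1_def n1_def power2_norm_eq_inner)
      have "\<bar>m\<bar> \<le> n1 * x1" unfolding m_def n1_def x1_def by (rule Cauchy_Schwarz_ineq2)
      then have "(2 * \<bar>h\<bar> * \<bar>s0\<bar>) * \<bar>m\<bar> \<le> (2 * \<bar>h\<bar> * \<bar>s0\<bar>) * (n1 * x1)" by (intro mult_left_mono) auto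
      moreover have "- ((2 * \<bar>h\<bar> * \<bar>s0\<bar>) * \<bar>m\<bar>) \<le> 2 * h * (s0 * m)"
        using abs_ge_minus_self[of "2 * h * (s0 * m)"] by (simp add: abs_mult)
      moreover have "0 \<le> (\<bar>h\<bar> * x1 / 2 - 2 * n1 * \<bar>s0\<bar>)\<^sup>2" by simp
      moreover have "(\<bar>h\<bar> * x1 / 2 - 2 * n1 * \<bar>s0\<bar>)\<^sup>2 = h\<^sup>2 * X / 4 - (2 * \<bar>h\<bar> * \<bar>s0\<bar>) * (n1 * x1) + 4 * n * s0\<^sup>2"
        unfolding e by (simp add: power2_diff power_mult_distrib power_divide)
      ultimately show ?thesis by linarith
    qed
    have "?F p + trace_of (J' p) - ?L p
       = h\<^sup>2 * P * (f ^ 3 * b\<^sup>2 + f\<^sup>2 * (s0 * b) + R\<^sup>2 * s0\<^sup>2)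
         + h\<^sup>2 * P * (f\<^sup>2 * (X + T) / 4 + a * f * (s0 * c) + 4 * a\<^sup>2 * R\<^sup>2 * s0\<^sup>2)
         + P * f\<^sup>2 * (h\<^sup>2 * X / 4 + 2 * h * (s0 * m) + 4 * n * s0\<^sup>2) + 3 / 4 * (h\<^sup>2 * P * f\<^sup>2 * T)"
      unfolding tr G_def[symmetric] f_def[symmetric] P0 P3 P_def[symmetric] h_def[symmetric] b_def[symmetric] s0_def[symmetric]
        X_def[symmetric] T_def[symmetric] n_def[symmetric]
      by (simp add: algebra_simps add_divide_distrib)
    moreover have "0 \<le> \<dots>"
    proof -
      have c1: "0 \<le> h\<^sup>2 * P" and c2: "0 \<le> P * f\<^sup>2" and c3: "0 \<le> 3 / 4 * (h\<^sup>2 * P * f\<^sup>2 * T)" using P X0 by simp_all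
      show ?thesis
        by (rule add_nonneg_nonneg[OF add_nonneg_nonneg[OF add_nonneg_nonneg[OF mult_nonneg_nonneg[OF c1 i1]
                mult_nonneg_nonneg[OF c1 i2]] mult_nonneg_nonneg[OF c2 i3]] c3])
    qed
    ultimately show ?thesis by linarith
  qed
  have L0: "0 \<le> ?L p" for p by simp
  have nn: "0 \<le> ?F p + trace_of (J' p)" if "p \<in> S" for p using key[OF that] L0[of p] by linarith
  have "(\<integral>\<^sup>+p\<in>S. ennreal (?L p) \<partial>lborel) \<le> (\<integral>\<^sup>+p\<in>S. ennreal (?F p + trace_of (J' p)) \<partial>lborel)"
    by (intro nn_integral_mono) (auto simp: indicator_def intro!: ennreal_leI key)
  also have "\<dots> \<le> (\<integral>\<^sup>+p\<in>S. ennreal (?F p) \<partial>lborel)"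
    by (rule divergence_inequality_cone[OF \<Omega> R S_def J'(1) Jc JB bd Fc F0 nn])
  finally show ?thesis by (simp only: S_def)
qed

section \<open>The Carleman estimate\<close>

text \<open>After multiplication by \<theta> the current on the lateral boundary either vanishes or
  is taken off \<open>Gamma_plus \<Omega>\<close>, where its normal component has the right sign. F
  consists of the source and the absolute value of the term with the gradient of \<theta>; adding it
  makes D = F + div J nonnegative, as the divergence inequality requires.\<close>

lemma carleman_localized:
  fixes z :: "(real^'m) \<times> (real^'n) \<Rightarrow> real" and \<theta> :: "real^'n \<Rightarrow> real"
  assumes \<Omega>: "open \<Omega>" "smooth_boundary \<Omega>" and R: "R > 0" "\<forall>x\<in>\<Omega>. norm x < R" and a: "a \<ge> 2"
    and e: "e > 0" "e * R \<le> 1 / 4" and d: "d \<ge> 0"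
    and \<theta>: "C1_deriv UNIV \<theta> (\<lambda>x v. N x \<bullet> v)" "\<And>x. 0 \<le> \<theta> x \<and> \<theta> x \<le> 1" and Nc: "continuous_on UNIV N"
    and \<theta>\<Gamma>: "\<And>x. x \<in> Gamma_plus \<Omega> \<Longrightarrow> \<theta> x = 0"
    and z: "Ck 2 (UNIV \<times> \<Omega>) z" and zC: "C1_closure (UNIV \<times> \<Omega>) z"
    and z0: "\<forall>p\<in>frontier (UNIV \<times> \<Omega>) \<inter> DD. z p = 0"
    and pos: "\<And>p. \<lbrakk>p \<in> (UNIV \<times> \<Omega>) \<inter> DD\<rbrakk> \<Longrightarrow> 0 \<le> cdiv a e d p (z p) (egrad z p) (box z p) + ff p / (2 * a) * (wt a e p * box z p)\<^sup>2"
  defines "F \<equiv> \<lambda>p. \<theta> (snd p) * (ff p / (2 * a) * (wt a e p * box z p)\<^sup>2) + \<bar>N (snd p) \<bullet> snd (cfield a e d p (z p) (egrad z p))\<bar>"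
    and "D \<equiv> \<lambda>p. \<theta> (snd p) * (ff p / (2 * a) * (wt a e p * box z p)\<^sup>2) + \<bar>N (snd p) \<bullet> snd (cfield a e d p (z p) (egrad z p))\<bar>
        + (\<theta> (snd p) * cdiv a e d p (z p) (egrad z p) (box z p) + N (snd p) \<bullet> snd (cfield a e d p (z p) (egrad z p)))"
  shows "continuous_on ((UNIV \<times> \<Omega>) \<inter> DD) F" "continuous_on ((UNIV \<times> \<Omega>) \<inter> DD) D"
    "\<And>p. p \<in> (UNIV \<times> \<Omega>) \<inter> DD \<Longrightarrow> \<theta> (snd p) * (cdiv a e d p (z p) (egrad z p) (box z p) + ff p / (2 * a) * (wt a e p * box z p)\<^sup>2) \<le> D p"
    "(\<integral>\<^sup>+p\<in>(UNIV \<times> \<Omega>) \<inter> DD. ennreal (D p) \<partial>lborel) \<le> (\<integral>\<^sup>+p\<in>(UNIV \<times> \<Omega>) \<inter> DD. ennreal (F p) \<partial>lborel)"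
proof -
  define S where "S = (UNIV \<times> \<Omega>) \<inter> (DD :: ((real^'m) \<times> (real^'n)) set)"
  have So: "open S" unfolding S_def by (rule slab_open[OF \<Omega>(1)])
  have SU: "S \<subseteq> UNIV \<times> \<Omega>" "S \<subseteq> DD" by (auto simp: S_def)
  have Sb: "p \<in> DD" "ff p > 0" "rr p < R" "norm p \<le> 2 * R" "ff p \<le> R\<^sup>2" "rr p > 0" if "p \<in> S" for p
    using slab_bounds[OF R(2) that[unfolded S_def]] by auto
  have Sc: "S \<subseteq> cone e"
  proof
    fix p assume "p \<in> S"
    then show "p \<in> cone e" using cone_of_bounded(1)[of p R e] Sb[of p] e by simp
  qed
  have cl: "closure (UNIV \<times> \<Omega>) \<inter> DD \<subseteq> (cone e :: ((real^'m) \<times> (real^'n)) set)"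
  proof
    fix p :: "(real^'m) \<times> (real^'n)" assume p: "p \<in> closure (UNIV \<times> \<Omega>) \<inter> DD"
    have "closure \<Omega> \<subseteq> cball 0 R" using R by (intro closure_minimal) auto
    then have "rr p \<le> R" using p by (auto simp: closure_Times rr_def)
    then show "p \<in> cone e" using cone_of_bounded(1)[of p R e] p e by simp
  qed
  define G where "G = egrad z"
  define H where "H = (\<lambda>p v. \<Sum>b\<in>Basis. dder (dder z b) v p *\<^sub>R b)"
  have zC1: "C1_deriv S z (\<lambda>p v. G p \<bullet> v)" and GC: "C1_deriv S G H"
    using Ck_2_derivatives[OF z] SU(1) C1_deriv_subset unfolding G_def H_def by blast+
  have box: "trace_of (\<lambda>v. mink (H p v)) = box z p" for p unfolding H_def by (rule box_eq_trace[symmetric])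
  obtain W where W: "continuous_on (closure (UNIV \<times> \<Omega>)) W" "\<And>p. p \<in> UNIV \<times> \<Omega> \<Longrightarrow> W p = egrad z p"
    using C1_closure_gradient[OF zC] by blast
  have zc: "continuous_on (closure (UNIV \<times> \<Omega>)) z" using zC by (simp add: C1_closure_def)
  have WG: "W p = G p" if "p \<in> S" for p using W(2) SU that by (auto simp: G_def)
  define c where "c p = cfield a e d p (z p) (G p)" for p
  define cd where "cd p = cdiv a e d p (z p) (G p) (box z p)" for p
  have cD: "C1_div S c cd"
    unfolding c_def[abs_def] cd_def[abs_def] using C1_div_cfield[OF So Sc zC1 GC, of a d] by (simp add: box)
  \<comment> \<open>Built with the continuous extension W of the gradient, so that it is defined and
    continuous up to the lateral boundary, where its sign is examined.\<close>
  define J where "J p = \<theta> (snd p) *\<^sub>R cfield a e d p (z p) (W p)" for p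
  have "C1_div S J (\<lambda>p. \<theta> (snd p) * cd p + N (snd p) \<bullet> snd (c p))"
    by (rule C1_div_cong[OF C1_div_scaleR[OF C1_deriv_snd[OF \<theta>(1)] cD] So]) (simp add: J_def c_def WG)
  then obtain J' where J': "C1_deriv S J J'" "\<And>p. p \<in> S \<Longrightarrow> trace_of (J' p) = \<theta> (snd p) * cd p + N (snd p) \<bullet> snd (c p)"
    by (auto simp: C1_div_def)
  have \<theta>c: "continuous_on T (\<lambda>p. \<theta> (snd p))" for T :: "((real^'m) \<times> (real^'n)) set"
    using C1_deriv_continuous_on[OF C1_deriv_snd[OF \<theta>(1)]] by blast
  have Nc': "continuous_on T (\<lambda>p. N (snd p))" for T :: "((real^'m) \<times> (real^'n)) set"
    by (rule continuous_on_compose2[OF Nc]) (auto intro!: continuous_intros)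
  have Jc: "continuous_on (closure (UNIV \<times> \<Omega>) \<inter> DD) J"
    unfolding J_def
    by (intro continuous_on_scaleR \<theta>c continuous_on_cfield[OF cl] continuous_on_subset[OF zc] continuous_on_subset[OF W(1)]) auto
  obtain M1 where M1: "M1 > 0" "\<And>p. p \<in> S \<Longrightarrow> norm (z p) \<le> M1" using bounded_on_slab[OF R(2) zc, folded S_def] by blast
  obtain M2 where M2: "M2 > 0" "\<And>p. p \<in> S \<Longrightarrow> norm (W p) \<le> M2" using bounded_on_slab[OF R(2) W(1), folded S_def] by blast
  obtain Cf where Cf: "Cf > 0" "\<And>p s g. \<lbrakk>p \<in> (DD :: ((real^'m) \<times> (real^'n)) set); rr p \<le> R\<rbrakk> \<Longrightarrow> norm (cfield a e d p s g) \<le> Cf * en2 a p s g"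
    using cfield_bound[of a R e d] a R e d by (metis less_le_trans zero_less_numeral)
  define M where "M = max M1 M2"
  define CJ where "CJ = Cf * (((R\<^sup>2) powr (2 * a - 2) + (R\<^sup>2) powr (2 * a - 4)) * M\<^sup>2)"
  have JB: "norm (J p) \<le> CJ * (ff p)\<^sup>2" if p: "p \<in> S" for p
  proof -
    have "norm (J p) = \<theta> (snd p) * norm (cfield a e d p (z p) (W p))" unfolding J_def using \<theta>(2)[of "snd p"] by simp
    also have "\<dots> \<le> 1 * norm (cfield a e d p (z p) (W p))" using \<theta>(2)[of "snd p"] by (intro mult_right_mono) auto
    also have "\<dots> \<le> Cf * en2 a p (z p) (W p)" using Cf(2)[of p "z p" "W p"] Sb[OF p] by simp
    also have "\<dots> \<le> Cf * ((((R\<^sup>2) powr (2 * a - 2) + (R\<^sup>2) powr (2 * a - 4)) * M\<^sup>2) * (ff p)\<^sup>2)"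
      using en2_le_ff_sq[OF Sb(2)[OF p] Sb(5)[OF p] a R(1), of "z p" M "W p"] M1(2)[OF p] M2(2)[OF p] Cf(1)
      by (intro mult_left_mono) (auto simp: M_def le_max_iff_disj)
    finally show ?thesis by (simp add: CJ_def mult.assoc)
  qed
  have bd: "snd (J p) \<bullet> grad \<phi> (snd p) \<le> 0"
    if p: "p \<in> frontier (UNIV \<times> \<Omega>)" "p \<in> DD" and V: "local_defining \<Omega> (snd p) V \<phi>" for p V \<phi>
  proof (cases "\<theta> (snd p) = 0")
    case True
    then show ?thesis by (simp add: J_def)
  next
    case False
    then have "snd p \<notin> Gamma_plus \<Omega>" using \<theta>\<Gamma> by blast
    moreover have "snd p \<in> frontier \<Omega>" using p(1) by (simp add: frontier_cylinder mem_Times_iff)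
    ultimately have out: "snd p \<bullet> grad \<phi> (snd p) \<le> 0" using outside_Gamma_plus[OF V] \<Omega>(1) by blast
    obtain l where l: "W p = (0, l *\<^sub>R grad \<phi> (snd p))"
      using boundary_gradient_normal[OF \<Omega>(1) z zc W z0 p V] by blast
    have zp: "z p = 0" using z0 p by blast
    have "p \<in> closure (UNIV \<times> \<Omega>) \<inter> DD" using p by (simp add: frontier_def)
    then have pc: "p \<in> cone e" using cl by blast
    have "snd (cfield a e d p 0 (0, l *\<^sub>R grad \<phi> (snd p))) \<bullet> grad \<phi> (snd p) \<le> 0"
      by (rule cfield_boundary_sign[OF pc e(1) out])
    then show ?thesis using \<theta>(2)[of "snd p"] by (simp add: J_def l zp mult_nonneg_nonpos)
  qed
  have Gc: "continuous_on S G" by (rule C1_deriv_continuous_on[OF GC])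
  have zcS: "continuous_on S z" by (rule C1_deriv_continuous_on[OF zC1])
  have bc: "continuous_on S (box z)"
  proof -
    have "continuous_on S (\<lambda>p. trace_of (\<lambda>v. mink (H p v)))"
      by (rule C1_deriv_continuous_trace[OF C1_deriv_linear_compose[OF bounded_linear_mink GC]])
    then show ?thesis by (simp add: box)
  qed
  have cc: "continuous_on S c" unfolding c_def[abs_def] by (rule continuous_on_cfield[OF Sc zcS Gc])
  have wc: "continuous_on S (wt a e)" by (rule continuous_on_subset[OF C1_deriv_continuous_on[OF C1_deriv_wt] Sc])
  have F_eq: "F = (\<lambda>p. \<theta> (snd p) * ((1 / (2 * a)) * ff p * (wt a e p * box z p)\<^sup>2) + \<bar>N (snd p) \<bullet> snd (c p)\<bar>)"
    by (simp add: F_def c_def G_def)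
  have Fc: "continuous_on S F"
    unfolding F_eq
    by (intro continuous_on_add continuous_on_mult continuous_on_const continuous_on_power continuous_on_rabs continuous_on_inner
        continuous_on_snd \<theta>c Nc' continuous_on_ff wc bc cc)
  have DJ: "D p = F p + trace_of (J' p)" if "p \<in> S" for p
    using J'(2)[OF that] by (simp add: D_def F_def cd_def c_def G_def)
  have F0: "0 \<le> F p" if "p \<in> S" for p
    unfolding F_def using \<theta>(2)[of "snd p"] Sb(2)[OF that] a by simp
  show "continuous_on ((UNIV \<times> \<Omega>) \<inter> DD) F" using Fc by (simp only: S_def)
  have "continuous_on S D"
    by (rule continuous_on_eq[OF continuous_on_add[OF Fc C1_deriv_continuous_trace[OF J'(1)]]]) (simp add: DJ)
  then show "continuous_on ((UNIV \<times> \<Omega>) \<inter> DD) D" by (simp only: S_def)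
  have low: "\<theta> (snd p) * (cdiv a e d p (z p) (egrad z p) (box z p) + ff p / (2 * a) * (wt a e p * box z p)\<^sup>2) \<le> D p" for p
    unfolding D_def by (simp add: distrib_left)
  then show "\<And>p. p \<in> (UNIV \<times> \<Omega>) \<inter> DD \<Longrightarrow> \<theta> (snd p) * (cdiv a e d p (z p) (egrad z p) (box z p) + ff p / (2 * a) * (wt a e p * box z p)\<^sup>2) \<le> D p" .
  have D0: "0 \<le> F p + trace_of (J' p)" if p: "p \<in> S" for p
  proof -
    have "0 \<le> \<theta> (snd p) * (cdiv a e d p (z p) (egrad z p) (box z p) + ff p / (2 * a) * (wt a e p * box z p)\<^sup>2)"
      using pos[of p] p \<theta>(2)[of "snd p"] by (intro mult_nonneg_nonneg) (auto simp: S_def)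
    then show ?thesis using low[of p] DJ[OF p] by linarith
  qed
  have "(\<integral>\<^sup>+p\<in>S. ennreal (D p) \<partial>lborel) = (\<integral>\<^sup>+p\<in>S. ennreal (F p + trace_of (J' p)) \<partial>lborel)"
    by (intro nn_integral_cong) (auto simp: indicator_def DJ)
  also have "\<dots> \<le> (\<integral>\<^sup>+p\<in>S. ennreal (F p) \<partial>lborel)"
    by (rule divergence_inequality_cone[OF \<Omega> R S_def J'(1) Jc JB bd Fc F0 D0])
  finally show "(\<integral>\<^sup>+p\<in>(UNIV \<times> \<Omega>) \<inter> DD. ennreal (D p) \<partial>lborel) \<le> (\<integral>\<^sup>+p\<in>(UNIV \<times> \<Omega>) \<inter> DD. ennreal (F p) \<partial>lborel)"
    by (simp only: S_def)
qed

text \<open>Measurability is asked of the two majorants only. This suits densities containing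
  \<open>sgn (fst p)\<close>, which is discontinuous at t = 0.\<close>

lemma nn_integral_le_lincomb:
  assumes m: "(\<lambda>p. ennreal (h1 p) * indicator S p) \<in> borel_measurable M" "(\<lambda>p. ennreal (h2 p) * indicator S p) \<in> borel_measurable M"
    and c: "c1 \<ge> 0" "c2 \<ge> 0" and h: "\<And>p. p \<in> S \<Longrightarrow> 0 \<le> h1 p" "\<And>p. p \<in> S \<Longrightarrow> 0 \<le> h2 p"
    and le: "\<And>p. p \<in> S \<Longrightarrow> g p \<le> c1 * h1 p + c2 * h2 p"
  shows "(\<integral>\<^sup>+p\<in>S. ennreal (g p) \<partial>M) \<le> ennreal c1 * (\<integral>\<^sup>+p\<in>S. ennreal (h1 p) \<partial>M) + ennreal c2 * (\<integral>\<^sup>+p\<in>S. ennreal (h2 p) \<partial>M)"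
proof -
  have "(\<integral>\<^sup>+p\<in>S. ennreal (g p) \<partial>M) \<le> (\<integral>\<^sup>+p. ennreal c1 * (ennreal (h1 p) * indicator S p) + ennreal c2 * (ennreal (h2 p) * indicator S p) \<partial>M)"
  proof (rule nn_integral_mono)
    fix p
    show "ennreal (g p) * indicator S p \<le> ennreal c1 * (ennreal (h1 p) * indicator S p) + ennreal c2 * (ennreal (h2 p) * indicator S p)"
    proof (cases "p \<in> S")
      case True
      have "ennreal (g p) \<le> ennreal (c1 * h1 p + c2 * h2 p)" using le[OF True] by (rule ennreal_leI)
      also have "\<dots> = ennreal c1 * ennreal (h1 p) + ennreal c2 * ennreal (h2 p)"
        using c h[OF True] by (simp add: ennreal_mult)
      finally show ?thesis using True by simp
    qed simp
  qed
  also have "\<dots> = ennreal c1 * (\<integral>\<^sup>+p\<in>S. ennreal (h1 p) \<partial>M) + ennreal c2 * (\<integral>\<^sup>+p\<in>S. ennreal (h2 p) \<partial>M)"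
    using m by (simp add: nn_integral_add nn_integral_cmult)
  finally show ?thesis .
qed

text \<open>In \<open>DD\<close> both |u| and |v| are at most r and f is at most r^2; each radial
  derivative is dominated by the full gradient.\<close>

lemma dens_bound:
  assumes p: "p \<in> DD" and R: "rr p < R"
  shows "0 \<le> dens p g" "1 / rr p * dens p g \<le> 5 * R * (g \<bullet> g)"
proof -
  define r where "r = rr p"
  have r: "r > 0" "r \<le> R" using rr_pos[OF p] R by (auto simp: r_def)
  have f: "ff p > 0" "ff p \<le> r\<^sup>2" using rr_sq_ge[OF p] p by (auto simp: r_def DD_def)
  define x where "x = fst g \<bullet> sgn (fst p)" define y where "y = snd g \<bullet> sgn (snd p)"
  have gg: "g \<bullet> g = fst g \<bullet> fst g + snd g \<bullet> snd g" by (simp add: inner_prod_def)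
  have x: "x\<^sup>2 \<le> fst g \<bullet> fst g" and y: "y\<^sup>2 \<le> snd g \<bullet> snd g" unfolding x_def y_def by (rule sgn_inner_sq_le)+
  have dn: "dens p g = (uu p)\<^sup>2 * (x - y)\<^sup>2 + (vv p)\<^sup>2 * (x + y)\<^sup>2 + ff p * (snd g \<bullet> snd g - y\<^sup>2) + ff p * (fst g \<bullet> fst g - x\<^sup>2)"
    by (simp add: dens_def x_def y_def power_mult_distrib)
  show "0 \<le> dens p g" unfolding dn using x y f by (intro add_nonneg_nonneg mult_nonneg_nonneg) auto
  have tr: "tau p < r" "0 \<le> tau p" using ff_pos_norm_less[OF f(1)] by (auto simp: r_def tau_def rr_def)
  have u: "(uu p)\<^sup>2 \<le> r\<^sup>2" and v: "(vv p)\<^sup>2 \<le> r\<^sup>2"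
    using tr by (auto simp: abs_le_square_iff[symmetric] uu_def vv_def r_def[symmetric])
  have "0 \<le> (x + y)\<^sup>2" "0 \<le> (x - y)\<^sup>2" by simp_all
  then have xy: "(x - y)\<^sup>2 \<le> 2 * (x\<^sup>2 + y\<^sup>2)" "(x + y)\<^sup>2 \<le> 2 * (x\<^sup>2 + y\<^sup>2)" by (simp_all add: power2_sum power2_diff)
  have xyg: "2 * (x\<^sup>2 + y\<^sup>2) \<le> 2 * (g \<bullet> g)" using x y gg by simp
  have "dens p g \<le> r\<^sup>2 * (2 * (g \<bullet> g)) + r\<^sup>2 * (2 * (g \<bullet> g)) + r\<^sup>2 * (snd g \<bullet> snd g) + r\<^sup>2 * (fst g \<bullet> fst g)"
    unfolding dn using u v xy xyg f x y by (intro add_mono mult_mono) auto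
  also have "\<dots> = 5 * r\<^sup>2 * (g \<bullet> g)" by (simp add: gg algebra_simps)
  finally have "1 / r * dens p g \<le> 1 / r * (5 * r\<^sup>2 * (g \<bullet> g))" using r by (intro mult_left_mono) auto
  also have "\<dots> = 5 * r * (g \<bullet> g)" using r by (simp add: power2_eq_square)
  also have "\<dots> \<le> 5 * R * (g \<bullet> g)" using r by (intro mult_right_mono) auto
  finally show "1 / rr p * dens p g \<le> 5 * R * (g \<bullet> g)" by (simp add: r_def)
qed

lemma C1_deriv_gradient:
  fixes s :: "'a::euclidean_space \<Rightarrow> real"
  assumes "C1_deriv UNIV s s'"
  obtains N where "C1_deriv UNIV s (\<lambda>x v. N x \<bullet> v)" "continuous_on UNIV N" "\<And>x v. s' x v = N x \<bullet> v"
proof -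
  define N where "N x = (\<Sum>b\<in>Basis. s' x b *\<^sub>R b)" for x
  have N: "s' x v = N x \<bullet> v" for x v
  proof -
    have "s' x v = s' x (\<Sum>b\<in>Basis. (v \<bullet> b) *\<^sub>R b)" by (simp add: euclidean_representation)
    also have "\<dots> = (\<Sum>b\<in>Basis. (v \<bullet> b) * s' x b)"
      using C1_deriv_linear[OF assms, of x] by (simp add: linear_sum linear_cmul)
    finally show ?thesis by (simp add: N_def inner_sum_left mult.commute inner_commute[of v])
  qed
  show ?thesis
  proof (rule that[of N])
    show "C1_deriv UNIV s (\<lambda>x v. N x \<bullet> v)" by (rule C1_deriv_eq[OF assms N])
    show "continuous_on UNIV N" unfolding N_def by (intro continuous_intros C1_deriv_continuous_deriv[OF assms])
  qed (rule N)
qed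

lemma bounded_on_closure:
  fixes N :: "real^'n \<Rightarrow> 'b::real_normed_vector"
  assumes "continuous_on UNIV N" "bounded \<Omega>"
  obtains B where "B > 0" "\<And>x. x \<in> \<Omega> \<Longrightarrow> norm (N x) \<le> B"
proof -
  have "compact (closure \<Omega>)" using assms(2) by simp
  from compact_imp_bounded[OF compact_continuous_image[OF continuous_on_subset[OF assms(1)] this]]
  obtain M where M: "\<forall>x\<in>closure \<Omega>. norm (N x) \<le> M" by (auto simp: bounded_iff)
  then have "norm (N x) \<le> max M 1" if "x \<in> \<Omega>" for x using closure_subset[of \<Omega>] that by (auto simp: le_max_iff_disj)
  then show ?thesis using that[of "max M 1"] by simp
qed

lemma open_nbhd: "open (nbhd \<sigma> A)"
proof -
  have "nbhd \<sigma> A = (\<Union>x\<in>A. ball x \<sigma>)" by (auto simp: nbhd_def dist_commute)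
  then show ?thesis by (simp add: open_UN)
qed

text \<open>The estimate with the bare weight f^(2 a). Where \<theta> = 1 the pointwise inequality
  applies; elsewhere \<eta> = 1 and the density is bounded by the energy E cut off to \<omega>,
  which the Caccioppoli inequality controls. A continuous majorant \<Phi> is returned, so that the
  integrals of the statement can be bounded through a measurable function.\<close>

lemma carleman_core:
  fixes \<Omega> :: "(real^'n) set"
  assumes \<Omega>: "open \<Omega>" "bounded \<Omega>" "smooth_boundary \<Omega>" and R: "R > 0" "\<forall>x\<in>\<Omega>. norm x < R" and a: "a \<ge> 2" and \<sigma>: "\<sigma> > 0"
  defines "S \<equiv> (UNIV \<times> \<Omega>) \<inter> (DD :: ((real^'m) \<times> (real^'n)) set)"
    and "S\<omega> \<equiv> (UNIV \<times> (nbhd \<sigma> (Gamma_plus \<Omega>) \<inter> \<Omega>)) \<inter> (DD :: ((real^'m) \<times> (real^'n)) set)"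
  obtains C where "C > 0"
    "\<And>z. \<lbrakk>Ck 2 (UNIV \<times> \<Omega>) z; C1_closure (UNIV \<times> \<Omega>) z; \<forall>p\<in>frontier (UNIV \<times> \<Omega>) \<inter> DD. z p = 0\<rbrakk> \<Longrightarrow>
      \<exists>\<Phi>. continuous_on S \<Phi> \<and> (\<forall>p\<in>S. ff p powr (2 * a) * (1 / rr p * dens p (egrad z p) + 1 / sqrt (ff p) * (z p)\<^sup>2) \<le> \<Phi> p) \<and>
        (\<integral>\<^sup>+p\<in>S. ennreal (\<Phi> p) \<partial>lborel) \<le> ennreal C *
          ((\<integral>\<^sup>+p\<in>S. ennreal (ff p powr (2 * a + 1) * (box z p)\<^sup>2) \<partial>lborel)
           + (\<integral>\<^sup>+p\<in>S\<omega>. ennreal (ff p powr (2 * a - 2) * gradt_sq z p) \<partial>lborel)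
           + (\<integral>\<^sup>+p\<in>S\<omega>. ennreal (ff p powr (2 * a - 3) * (z p)\<^sup>2) \<partial>lborel))"
proof -
  have a0: "a > 0" using a by simp
  obtain e d C where e: "e > 0" "e * R \<le> 1 / 4" and d: "d \<ge> 0" and C: "C > 0"
    and cp: "\<And>p s g b. \<lbrakk>p \<in> (DD :: ((real^'m) \<times> (real^'n)) set); rr p < R\<rbrakk> \<Longrightarrow>
       (wt a e p)\<^sup>2 * (1 / rr p * dens p g + 1 / sqrt (ff p) * s\<^sup>2)
        \<le> C * (cdiv a e d p s g b + ff p / (2 * a) * (wt a e p * b)\<^sup>2)"
    using carleman_pointwise[OF a0 R(1)] by metis
  obtain Cf where Cf: "Cf > 0" "\<And>p s g. \<lbrakk>p \<in> (DD :: ((real^'m) \<times> (real^'n)) set); rr p \<le> R\<rbrakk> \<Longrightarrow> norm (cfield a e d p s g) \<le> Cf * en2 a p s g"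
    using cfield_bound[OF a0 R(1) e d] by metis
  have bG: "bounded (Gamma_plus \<Omega>)"
  proof (rule bounded_subset)
    show "bounded (closure \<Omega>)" by (rule bounded_closure[OF \<Omega>(2)])
    show "Gamma_plus \<Omega> \<subseteq> closure \<Omega>" by (auto simp: Gamma_plus_def frontier_def)
  qed
  obtain \<theta> \<theta>' \<eta> \<eta>' where ct: "C1_deriv UNIV \<theta> \<theta>'" "C1_deriv UNIV \<eta> \<eta>'"
    "\<And>x. 0 \<le> \<theta> x \<and> \<theta> x \<le> (1::real)" "\<And>x. 0 \<le> \<eta> x \<and> \<eta> x \<le> (1::real)"
    "\<And>x. x \<in> Gamma_plus \<Omega> \<Longrightarrow> \<theta> x = 0"
    "\<And>x. \<theta> x \<noteq> 1 \<Longrightarrow> \<eta> x = 1" "\<And>x v. \<theta>' x v \<noteq> 0 \<Longrightarrow> \<eta> x = 1"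
    "\<And>x. \<eta> x \<noteq> 0 \<Longrightarrow> \<exists>y\<in>Gamma_plus \<Omega>. dist x y < \<sigma>" "\<And>x v. \<eta>' x v \<noteq> 0 \<Longrightarrow> \<exists>y\<in>Gamma_plus \<Omega>. dist x y < \<sigma>"
    by (rule localizing_cutoffs[OF bG \<sigma>]) (rule that)
  obtain N1 where N1: "C1_deriv UNIV \<theta> (\<lambda>x v. N1 x \<bullet> v)" "continuous_on UNIV N1" "\<And>x v. \<theta>' x v = N1 x \<bullet> v"
    using C1_deriv_gradient[OF ct(1)] by blast
  obtain N2 where N2: "C1_deriv UNIV \<eta> (\<lambda>x v. N2 x \<bullet> v)" "continuous_on UNIV N2" "\<And>x v. \<eta>' x v = N2 x \<bullet> v"
    using C1_deriv_gradient[OF ct(2)] by blast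
  obtain B1 where B1: "B1 > 0" "\<And>x. x \<in> \<Omega> \<Longrightarrow> norm (N1 x) \<le> B1" using bounded_on_closure[OF N1(2) \<Omega>(2)] by blast
  obtain B2 where B2: "B2 > 0" "\<And>x. x \<in> \<Omega> \<Longrightarrow> norm (N2 x) \<le> B2" using bounded_on_closure[OF N2(2) \<Omega>(2)] by blast
  have \<omega>\<eta>: "x \<in> nbhd \<sigma> (Gamma_plus \<Omega>)" if "\<eta> x \<noteq> 0" for x using ct(8)[OF that] by (simp add: nbhd_def)
  have \<omega>N: "x \<in> nbhd \<sigma> (Gamma_plus \<Omega>)" if "N2 x \<noteq> 0" for x
  proof -
    have "\<eta>' x (N2 x) \<noteq> 0" using that by (simp add: N2(3))
    then show ?thesis using ct(9) by (simp add: nbhd_def)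
  qed
  have \<eta>N: "\<eta> x = 1" if "N1 x \<noteq> 0" for x
  proof -
    have "\<theta>' x (N1 x) \<noteq> 0" using that by (simp add: N1(3))
    then show ?thesis using ct(7) by blast
  qed
  define Kw where "Kw = 2 powr (2 * a)"
  define C2 where "C2 = 5 * R + R ^ 3"
  define C3 where "C3 = Kw + B1 * Cf"
  define C4 where "C4 = R\<^sup>2 + 4 * a\<^sup>2 * R\<^sup>2"
  define C7 where "C7 = R ^ 4 + R\<^sup>2"
  define C8 where "C8 = 2 * R ^ 4 + 1 + C4 * R\<^sup>2 + 4 * B2\<^sup>2 * R ^ 6"
  have cpos: "Kw > 0" "C2 \<ge> 0" "C3 \<ge> 0" "C4 \<ge> 0" "C7 \<ge> 0" "C8 \<ge> 0"
    using R(1) B1(1) Cf(1) by (auto simp: Kw_def C2_def C3_def C4_def C7_def C8_def)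
  \<comment> \<open>k1 bounds the integral of the cut-off energy by the right-hand side V; k2
    combines this with the bound for the Carleman part.\<close>
  define k1 where "k1 = 2 * C8 + C7"
  define k2 where "k2 = C * (C3 + C3 * k1) + C2 * k1"
  have k0: "k1 \<ge> 0" "k2 \<ge> 0" using cpos C by (auto simp: k1_def k2_def)
  have So: "open S" unfolding S_def by (rule slab_open[OF \<Omega>(1)])
  have S\<omega>o: "open S\<omega>" unfolding S\<omega>_def by (rule slab_open) (simp add: open_Int open_nbhd \<Omega>(1))
  have SS: "S\<omega> \<subseteq> S" by (auto simp: S_def S\<omega>_def)
  have Sb: "p \<in> DD" "ff p > 0" "rr p < R" "norm p \<le> 2 * R" "ff p \<le> R\<^sup>2" "rr p > 0" if "p \<in> S" for p
    using slab_bounds[OF R(2) that[unfolded S_def]] by auto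
  have S\<Omega>: "snd p \<in> \<Omega>" if "p \<in> S" for p using that by (auto simp: S_def)
  have S\<omega>: "p \<in> S\<omega>" if "p \<in> S" "snd p \<in> nbhd \<sigma> (Gamma_plus \<Omega>)" for p
    using that by (cases p) (auto simp: S_def S\<omega>_def)
  have powr_le: "ff p powr (c + real n) \<le> R ^ (2 * n) * ff p powr c" if "p \<in> S" for p c n
  proof -
    have "ff p ^ n \<le> (R\<^sup>2) ^ n" using Sb[OF that] by (intro power_mono) auto
    then show ?thesis unfolding powr_shift[OF Sb(2)[OF that]] by (intro mult_right_mono) (auto simp: power_mult)
  qed
  have main: "\<exists>\<Phi>. continuous_on S \<Phi> \<and> (\<forall>p\<in>S. ff p powr (2 * a) * (1 / rr p * dens p (egrad z p) + 1 / sqrt (ff p) * (z p)\<^sup>2) \<le> \<Phi> p) \<and>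
        (\<integral>\<^sup>+p\<in>S. ennreal (\<Phi> p) \<partial>lborel) \<le> ennreal (k2 + 1) *
          ((\<integral>\<^sup>+p\<in>S. ennreal (ff p powr (2 * a + 1) * (box z p)\<^sup>2) \<partial>lborel)
           + (\<integral>\<^sup>+p\<in>S\<omega>. ennreal (ff p powr (2 * a - 2) * gradt_sq z p) \<partial>lborel)
           + (\<integral>\<^sup>+p\<in>S\<omega>. ennreal (ff p powr (2 * a - 3) * (z p)\<^sup>2) \<partial>lborel))"
    if z: "Ck 2 (UNIV \<times> \<Omega>) z" "C1_closure (UNIV \<times> \<Omega>) z" "\<forall>p\<in>frontier (UNIV \<times> \<Omega>) \<inter> DD. z p = 0"
    for z :: "(real^'m) \<times> (real^'n) \<Rightarrow> real"
  proof -
    define G where "G = egrad z"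
    define b where "b = (box z :: (real^'m) \<times> (real^'n) \<Rightarrow> real)"
    have diff: "z differentiable (at p)" if "p \<in> S" for p using z(1) that by (auto simp: S_def numeral_2_eq_2)
    have gt: "gradt_sq z p = fst (G p) \<bullet> fst (G p)" if "p \<in> S" for p using gradt_sq_eq(1)[OF diff[OF that]] by (simp add: G_def)
    have SU: "S \<subseteq> UNIV \<times> \<Omega>" "S \<subseteq> DD" by (auto simp: S_def)
    have zc: "continuous_on S z" and Gc: "continuous_on S G"
      using Ck_2_derivatives[OF z(1)] SU(1) C1_deriv_continuous_on continuous_on_subset unfolding G_def by blast+
    have bc: "continuous_on S b"
    proof -
      have "continuous_on (UNIV \<times> \<Omega>) (\<lambda>p. trace_of (\<lambda>v. mink (\<Sum>b\<in>Basis. dder (dder z b) v p *\<^sub>R b)))"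
        by (rule C1_deriv_continuous_trace[OF C1_deriv_linear_compose[OF bounded_linear_mink Ck_2_derivatives(2)[OF z(1)]]])
      then show ?thesis unfolding b_def box_eq_trace[abs_def] using continuous_on_subset SU(1) by blast
    qed
    have fc: "continuous_on S (\<lambda>p. ff p powr c)" for c
      using C1_deriv_continuous_on[OF C1_deriv_ff_powr] continuous_on_subset SU(2) by blast
    have \<eta>c: "continuous_on S (\<lambda>p. \<eta> (snd p))" using C1_deriv_continuous_on[OF C1_deriv_snd[OF ct(2)]] by blast
    define w where "w p = cdiv a e d p (z p) (G p) (b p) + ff p / (2 * a) * (wt a e p * b p)\<^sup>2" for p
    define l0 where "l0 p = ff p powr (2 * a) * (1 / rr p * dens p (G p) + 1 / sqrt (ff p) * (z p)\<^sup>2)" for p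
    have l00: "0 \<le> 1 / rr p * dens p (G p) + 1 / sqrt (ff p) * (z p)\<^sup>2" if "p \<in> S" for p
      using dens_bound(1)[OF Sb(1,3)[OF that], of "G p"] Sb[OF that] by simp
    have lw: "l0 p \<le> C * w p" if p: "p \<in> S" for p
    proof -
      note c = cone_of_bounded[OF Sb(1)[OF p] less_imp_le[OF Sb(3)[OF p]] e]
      have "l0 p \<le> (wt a e p)\<^sup>2 * (1 / rr p * dens p (G p) + 1 / sqrt (ff p) * (z p)\<^sup>2)"
        unfolding l0_def using wt_sq_bounds(1)[OF Sb(1)[OF p] c(2,3) a0] l00[OF p] by (intro mult_right_mono)
      also have "\<dots> \<le> C * w p" unfolding w_def by (rule cp[OF Sb(1,3)[OF p]])
      finally show ?thesis .
    qed
    have l0nn: "0 \<le> l0 p" if "p \<in> S" for p unfolding l0_def using l00[OF that] by simp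
    have w0: "0 \<le> w p" if "p \<in> S" for p 
    proof -
      have "0 \<le> C * w p" using lw[OF that] l0nn[OF that] by linarith
      then show ?thesis using C by (simp add: zero_le_mult_iff)
    qed
    define F where "F p = \<theta> (snd p) * (ff p / (2 * a) * (wt a e p * b p)\<^sup>2) + \<bar>N1 (snd p) \<bullet> snd (cfield a e d p (z p) (G p))\<bar>" for p
    define D where "D p = \<theta> (snd p) * (ff p / (2 * a) * (wt a e p * b p)\<^sup>2) + \<bar>N1 (snd p) \<bullet> snd (cfield a e d p (z p) (G p))\<bar>
        + (\<theta> (snd p) * cdiv a e d p (z p) (G p) (b p) + N1 (snd p) \<bullet> snd (cfield a e d p (z p) (G p)))" for p
    have pos: "0 \<le> cdiv a e d p (z p) (egrad z p) (box z p) + ff p / (2 * a) * (wt a e p * box z p)\<^sup>2"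
      if "p \<in> (UNIV \<times> \<Omega>) \<inter> DD" for p using w0[of p] that by (simp add: w_def G_def b_def S_def)
    note loc = carleman_localized[OF \<Omega>(1,3) R a e d N1(1) ct(3) N1(2) ct(5) z pos, folded G_def b_def, folded S_def]
    have Fc: "continuous_on S F" using loc(1) by (simp add: F_def[abs_def] S_def G_def b_def)
    have Dc: "continuous_on S D" using loc(2) by (simp add: D_def[abs_def] S_def G_def b_def)
    have Dl: "\<theta> (snd p) * w p \<le> D p" if "p \<in> S" for p using loc(3)[of p] that by (simp add: D_def w_def S_def G_def b_def)
    have DF: "(\<integral>\<^sup>+p\<in>S. ennreal (D p) \<partial>lborel) \<le> (\<integral>\<^sup>+p\<in>S. ennreal (F p) \<partial>lborel)"
      using loc(4) by (simp add: D_def F_def S_def G_def b_def)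
    have D0: "0 \<le> D p" if "p \<in> S" for p
      using Dl[OF that] w0[OF that] ct(3)[of "snd p"] by (meson mult_nonneg_nonneg order_trans)
    \<comment> \<open>The energy cut off to \<omega>. It equals \<open>en2\<close> wherever \<theta>
      differs from 1 or has a nonzero gradient.\<close>
    define E where "E p = (\<eta> (snd p))\<^sup>2 * en2 a p (z p) (G p)" for p
    have en0: "0 \<le> en2 a p s g" for p :: "(real^'m) \<times> (real^'n)" and s g by (simp add: en2_def)
    have E0: "0 \<le> E p" for p by (simp add: E_def en0)
    have Ec: "continuous_on S E"
      unfolding E_def en2_def
      by (intro continuous_on_add continuous_on_mult continuous_on_power continuous_on_inner \<eta>c fc Gc zc)
    have l_en: "l0 p \<le> C2 * en2 a p (z p) (G p)" if p: "p \<in> S" for p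
    proof -
      define f where "f = ff p"
      have f: "f > 0" "f \<le> R\<^sup>2" using Sb[OF p] by (auto simp: f_def)
      have P0: "f powr (2 * a) = f\<^sup>2 * f powr (2 * a - 2)" using powr_shift[OF f(1), of "2 * a - 2" 2] by simp
      have sq: "sqrt f \<le> R" using f R by (simp add: real_le_lsqrt)
      have "f\<^sup>2 / sqrt f = f * (f / sqrt f)" by (simp add: power2_eq_square)
      also have "\<dots> = f * sqrt f" using f by (simp add: real_div_sqrt)
      also have "\<dots> \<le> R\<^sup>2 * R" using f sq R by (intro mult_mono) auto
      finally have fs: "f\<^sup>2 / sqrt f \<le> R ^ 3" by (simp add: power2_eq_square power3_eq_cube)
      have 1: "f powr (2 * a) * (1 / rr p * dens p (G p)) \<le> 5 * R * (f powr (2 * a) * (G p \<bullet> G p))"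
        using mult_left_mono[OF dens_bound(2)[OF Sb(1,3)[OF p], of "G p"], of "f powr (2 * a)"]
        by (simp add: mult.left_commute mult.assoc)
      have 2: "f powr (2 * a) * (1 / sqrt f * (z p)\<^sup>2) \<le> R ^ 3 * (f powr (2 * a - 2) * (z p)\<^sup>2)"
      proof -
        have "f powr (2 * a) * (1 / sqrt f * (z p)\<^sup>2) = (f\<^sup>2 / sqrt f) * (f powr (2 * a - 2) * (z p)\<^sup>2)" by (simp add: P0)
        also have "\<dots> \<le> R ^ 3 * (f powr (2 * a - 2) * (z p)\<^sup>2)" using fs by (intro mult_right_mono) auto
        finally show ?thesis .
      qed
      define X where "X = f powr (2 * a) * (G p \<bullet> G p)"
      define Z where "Z = f powr (2 * a - 2) * (z p)\<^sup>2"
      have XZ: "X \<ge> 0" "Z \<ge> 0" by (simp_all add: X_def Z_def)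
      have "l0 p \<le> 5 * R * X + R ^ 3 * Z" using 1 2 by (simp add: l0_def f_def[symmetric] X_def Z_def distrib_left)
      also have "\<dots> \<le> C2 * (X + Z)"
      proof -
        have "0 \<le> R ^ 3 * X" "0 \<le> 5 * R * Z" using XZ R by auto
        then show ?thesis unfolding C2_def by (simp add: algebra_simps)
      qed
      finally show ?thesis by (simp add: en2_def X_def Z_def f_def)
    qed
    have s1: "l0 p \<le> C * D p + C2 * E p" if p: "p \<in> S" for p
    proof (cases "\<theta> (snd p) = 1")
      case True
      have "l0 p \<le> C * w p" by (rule lw[OF p])
      also have "\<dots> \<le> C * D p" using Dl[OF p] True C by (intro mult_left_mono) auto
      finally show ?thesis using cpos E0[of p] by (simp add: add_increasing2)
    next
      case False
      then have "\<eta> (snd p) = 1" by (rule ct(6))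
      then have "l0 p \<le> C2 * E p" using l_en[OF p] by (simp add: E_def)
      then show ?thesis using C D0[OF p] by (simp add: add_increasing)
    qed
    \<comment> \<open>Zero extensions of the three densities on the right, so that their sum V3 is a
      single measurable density on S.\<close>
    define Fb where "Fb p = (if p \<in> S then ff p powr (2 * a + 1) * (b p)\<^sup>2 else 0)" for p
    define T3 where "T3 p = (if p \<in> S\<omega> then ff p powr (2 * a - 2) * (fst (G p) \<bullet> fst (G p)) else 0)" for p
    define Z3 where "Z3 p = (if p \<in> S\<omega> then ff p powr (2 * a - 3) * (z p)\<^sup>2 else 0)" for p
    define V3 where "V3 p = Fb p + T3 p + Z3 p" for p
    have V30: "0 \<le> Fb p" "0 \<le> T3 p" "0 \<le> Z3 p" "0 \<le> V3 p" for p by (auto simp: V3_def Fb_def T3_def Z3_def)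
    have [measurable]: "Fb \<in> borel_measurable borel"
      unfolding Fb_def[abs_def] by (intro borel_measurable_on_open[OF So] continuous_on_mult continuous_on_power fc bc)
    have [measurable]: "T3 \<in> borel_measurable borel"
      unfolding T3_def[abs_def]
      by (intro borel_measurable_on_open[OF S\<omega>o] continuous_on_mult continuous_on_inner continuous_on_fst
          continuous_on_subset[OF fc SS] continuous_on_subset[OF Gc SS])
    have [measurable]: "Z3 \<in> borel_measurable borel"
      unfolding Z3_def[abs_def]
      by (intro borel_measurable_on_open[OF S\<omega>o] continuous_on_mult continuous_on_power
          continuous_on_subset[OF fc SS] continuous_on_subset[OF zc SS])
    have [measurable]: "S \<in> sets borel" using So by simp
    have Vm: "(\<lambda>p. ennreal (V3 p) * indicator S p) \<in> borel_measurable lborel" unfolding V3_def by measurable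
    define V where "V = (\<integral>\<^sup>+p\<in>S. ennreal (V3 p) \<partial>lborel)"
    have V_eq: "V = (\<integral>\<^sup>+p\<in>S. ennreal (ff p powr (2 * a + 1) * (box z p)\<^sup>2) \<partial>lborel)
           + (\<integral>\<^sup>+p\<in>S\<omega>. ennreal (ff p powr (2 * a - 2) * gradt_sq z p) \<partial>lborel)
           + (\<integral>\<^sup>+p\<in>S\<omega>. ennreal (ff p powr (2 * a - 3) * (z p)\<^sup>2) \<partial>lborel)"
    proof -
      have "V = (\<integral>\<^sup>+p. (ennreal (Fb p) + ennreal (T3 p)) + ennreal (Z3 p) \<partial>lborel)"
        unfolding V_def
      proof (rule nn_integral_cong)
        fix p
        show "ennreal (V3 p) * indicator S p = ennreal (Fb p) + ennreal (T3 p) + ennreal (Z3 p)"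
        proof (cases "p \<in> S")
          case True
          then show ?thesis using V30[of p] by (simp add: V3_def)
        next
          case False
          then show ?thesis using SS by (auto simp: Fb_def T3_def Z3_def)
        qed
      qed
      also have "\<dots> = (\<integral>\<^sup>+p. ennreal (Fb p) \<partial>lborel) + (\<integral>\<^sup>+p. ennreal (T3 p) \<partial>lborel) + (\<integral>\<^sup>+p. ennreal (Z3 p) \<partial>lborel)"
        by (simp add: nn_integral_add)
      also have "(\<integral>\<^sup>+p. ennreal (Fb p) \<partial>lborel) = (\<integral>\<^sup>+p\<in>S. ennreal (ff p powr (2 * a + 1) * (box z p)\<^sup>2) \<partial>lborel)"
        by (intro nn_integral_cong) (auto simp: Fb_def b_def indicator_def)
      also have "(\<integral>\<^sup>+p. ennreal (T3 p) \<partial>lborel) = (\<integral>\<^sup>+p\<in>S\<omega>. ennreal (ff p powr (2 * a - 2) * gradt_sq z p) \<partial>lborel)"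
        using SS by (intro nn_integral_cong) (auto simp: T3_def indicator_def gt)
      also have "(\<integral>\<^sup>+p. ennreal (Z3 p) \<partial>lborel) = (\<integral>\<^sup>+p\<in>S\<omega>. ennreal (ff p powr (2 * a - 3) * (z p)\<^sup>2) \<partial>lborel)"
        by (intro nn_integral_cong) (auto simp: Z3_def indicator_def)
      finally show ?thesis .
    qed
    have t3: "\<eta> (snd p) \<noteq> 0 \<Longrightarrow> T3 p = ff p powr (2 * a - 2) * (fst (G p) \<bullet> fst (G p))"
      "\<eta> (snd p) \<noteq> 0 \<or> N2 (snd p) \<noteq> 0 \<Longrightarrow> Z3 p = ff p powr (2 * a - 3) * (z p)\<^sup>2" if "p \<in> S" for p
      using S\<omega>[OF that] \<omega>\<eta> \<omega>N by (auto simp: T3_def Z3_def)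
    have \<eta>2: "(\<eta> x)\<^sup>2 \<le> 1" for x using ct(4)[of x] by (simp add: power_le_one)
    \<comment> \<open>Powers of f are lowered to the exponents 2 a - 2 and 2 a - 3 of the statement
      at the cost of powers of R.\<close>
    have p1: "ff p powr (2 * a) \<le> R ^ 4 * ff p powr (2 * a - 2)" "ff p powr (2 * a - 2) \<le> R\<^sup>2 * ff p powr (2 * a - 3)"
      "ff p powr (2 * a) \<le> R ^ 6 * ff p powr (2 * a - 3)" if "p \<in> S" for p
      using powr_le[OF that, of "2 * a - 2" 2] powr_le[OF that, of "2 * a - 3" 1] powr_le[OF that, of "2 * a - 3" 3] by simp_all
    have tE: "(\<eta> (snd p))\<^sup>2 * ff p powr (2 * a) * (fst (G p) \<bullet> fst (G p)) \<le> R ^ 4 * T3 p" if p: "p \<in> S" for p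
    proof (cases "\<eta> (snd p) = 0")
      case False
      have "(\<eta> (snd p))\<^sup>2 * (ff p powr (2 * a) * (fst (G p) \<bullet> fst (G p))) \<le> 1 * (R ^ 4 * ff p powr (2 * a - 2) * (fst (G p) \<bullet> fst (G p)))"
        using \<eta>2 p1[OF p] by (intro mult_mono) auto
      then show ?thesis using t3[OF p] False by (simp add: mult.assoc)
    qed (use V30 R in auto)
    have zE: "(\<eta> (snd p))\<^sup>2 * ff p powr (2 * a - 2) * (z p)\<^sup>2 \<le> R\<^sup>2 * Z3 p" if p: "p \<in> S" for p
    proof (cases "\<eta> (snd p) = 0")
      case False
      have "(\<eta> (snd p))\<^sup>2 * (ff p powr (2 * a - 2) * (z p)\<^sup>2) \<le> 1 * (R\<^sup>2 * ff p powr (2 * a - 3) * (z p)\<^sup>2)"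
        using \<eta>2 p1[OF p] by (intro mult_mono) auto
      then show ?thesis using t3[OF p] False by (simp add: mult.assoc)
    qed (use V30 R in auto)
    have nE: "(N2 (snd p) \<bullet> N2 (snd p)) * ff p powr (2 * a) * (z p)\<^sup>2 \<le> B2\<^sup>2 * R ^ 6 * Z3 p" if p: "p \<in> S" for p
    proof (cases "N2 (snd p) = 0")
      case False
      have "N2 (snd p) \<bullet> N2 (snd p) \<le> B2\<^sup>2"
        using power_mono[OF B2(2)[OF S\<Omega>[OF p]] norm_ge_zero, of 2] by (simp add: power2_norm_eq_inner)
      then have "(N2 (snd p) \<bullet> N2 (snd p)) * (ff p powr (2 * a) * (z p)\<^sup>2) \<le> B2\<^sup>2 * (R ^ 6 * ff p powr (2 * a - 3) * (z p)\<^sup>2)"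
        using p1[OF p] by (intro mult_mono) auto
      then show ?thesis using t3[OF p] False by (simp add: mult.assoc)
    qed (use V30 R in auto)
    define X2 where "X2 p = (\<eta> (snd p))\<^sup>2 * ff p powr (2 * a) * (snd (G p) \<bullet> snd (G p)) / 2" for p
    have X2c: "continuous_on S X2"
    proof -
      have "continuous_on S (\<lambda>p. (1 / 2) * ((\<eta> (snd p))\<^sup>2 * ff p powr (2 * a) * (snd (G p) \<bullet> snd (G p))))"
        by (intro continuous_on_mult continuous_on_const continuous_on_power continuous_on_inner continuous_on_snd \<eta>c fc Gc)
      then show ?thesis by (simp add: X2_def[abs_def])
    qed
    have X20: "0 \<le> X2 p" for p by (simp add: X2_def)
    define F2 where "F2 p = 2 * ((\<eta> (snd p))\<^sup>2 * ff p powr (2 * a) * (fst (G p) \<bullet> fst (G p)))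
        + (\<eta> (snd p))\<^sup>2 * (ff p powr (2 * a + 1) * (b p)\<^sup>2) + C4 * ((\<eta> (snd p))\<^sup>2 * ff p powr (2 * a - 2) * (z p)\<^sup>2)
        + 4 * ((N2 (snd p) \<bullet> N2 (snd p)) * ff p powr (2 * a) * (z p)\<^sup>2)" for p
    have cac: "(\<integral>\<^sup>+p\<in>S. ennreal (X2 p) \<partial>lborel) \<le> (\<integral>\<^sup>+p\<in>S. ennreal (F2 p) \<partial>lborel)"
      using caccioppoli[OF \<Omega>(1,3) R a N2(1) ct(4) N2(2) z] by (simp add: X2_def F2_def S_def G_def b_def C4_def)
    have F2V: "F2 p \<le> C8 * V3 p" if p: "p \<in> S" for p
    proof -
      have fb: "(\<eta> (snd p))\<^sup>2 * (ff p powr (2 * a + 1) * (b p)\<^sup>2) \<le> 1 * Fb p"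
        using \<eta>2[of "snd p"] p by (simp add: Fb_def mult_left_le_one_le)
      have z4: "C4 * ((\<eta> (snd p))\<^sup>2 * ff p powr (2 * a - 2) * (z p)\<^sup>2) \<le> C4 * (R\<^sup>2 * Z3 p)"
        using zE[OF p] cpos by (intro mult_left_mono)
      have "F2 p \<le> 2 * (R ^ 4 * T3 p) + 1 * Fb p + C4 * (R\<^sup>2 * Z3 p) + 4 * (B2\<^sup>2 * R ^ 6 * Z3 p)"
        unfolding F2_def using tE[OF p] fb z4 nE[OF p] by linarith
      also have "\<dots> = (2 * R ^ 4) * T3 p + 1 * Fb p + (C4 * R\<^sup>2 + 4 * B2\<^sup>2 * R ^ 6) * Z3 p" by (simp add: algebra_simps)
      also have "\<dots> \<le> C8 * T3 p + C8 * Fb p + C8 * Z3 p"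
        using V30[of p] R cpos(4) by (intro add_mono mult_right_mono) (auto simp: C8_def add_nonneg_nonneg)
      finally show ?thesis by (simp add: V3_def algebra_simps)
    qed
    have E_le: "E p \<le> 2 * X2 p + C7 * V3 p" if p: "p \<in> S" for p
    proof -
      have "E p = 2 * X2 p + (\<eta> (snd p))\<^sup>2 * ff p powr (2 * a) * (fst (G p) \<bullet> fst (G p)) + (\<eta> (snd p))\<^sup>2 * ff p powr (2 * a - 2) * (z p)\<^sup>2"
        by (simp add: E_def en2_def X2_def inner_prod_def algebra_simps)
      also have "\<dots> \<le> 2 * X2 p + (R ^ 4 * T3 p + R\<^sup>2 * Z3 p)" using tE[OF p] zE[OF p] by linarith
      also have "R ^ 4 * T3 p + R\<^sup>2 * Z3 p \<le> C7 * T3 p + C7 * Z3 p"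
        using V30[of p] by (intro add_mono mult_right_mono) (auto simp: C7_def)
      also have "\<dots> \<le> C7 * V3 p" using V30[of p] cpos by (simp add: V3_def distrib_left)
      finally show ?thesis by simp
    qed
    have F_le: "F p \<le> C3 * V3 p + C3 * E p" if p: "p \<in> S" for p
    proof -
      note c = cone_of_bounded[OF Sb(1)[OF p] less_imp_le[OF Sb(3)[OF p]] e]
      have 1: "\<theta> (snd p) * (ff p / (2 * a) * (wt a e p * b p)\<^sup>2) \<le> Kw * V3 p"
      proof -
        have "ff p / (2 * a) \<le> ff p / 1" using Sb(2)[OF p] a by (intro divide_left_mono) auto
        then have "ff p / (2 * a) * (wt a e p * b p)\<^sup>2 \<le> ff p * ((Kw * ff p powr (2 * a)) * (b p)\<^sup>2)"
          unfolding power_mult_distrib using wt_sq_bounds(2)[OF Sb(1)[OF p] c(2,3) a0] Sb(2)[OF p]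
          by (intro mult_mono) (auto simp: Kw_def)
        also have "\<dots> = Kw * Fb p"
          using p powr_shift[OF Sb(2)[OF p], of "2 * a" 1] by (simp add: Fb_def)
        also have "\<dots> \<le> Kw * V3 p" using V30[of p] cpos by (intro mult_left_mono) (auto simp: V3_def)
        finally have "ff p / (2 * a) * (wt a e p * b p)\<^sup>2 \<le> Kw * V3 p" .
        moreover have "\<theta> (snd p) * (ff p / (2 * a) * (wt a e p * b p)\<^sup>2) \<le> 1 * (ff p / (2 * a) * (wt a e p * b p)\<^sup>2)"
          using ct(3)[of "snd p"] Sb(2)[OF p] a by (intro mult_right_mono) auto
        ultimately show ?thesis by linarith
      qed
      \<comment> \<open>The gradient of \<theta> is nonzero only where \<eta> = 1, so the cutoff
        error is bounded by E rather than by the energy on all of S.\<close>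
      have 2: "\<bar>N1 (snd p) \<bullet> snd (cfield a e d p (z p) (G p))\<bar> \<le> (B1 * Cf) * E p"
      proof (cases "N1 (snd p) = 0")
        case True
        then show ?thesis using B1 Cf E0[of p] by simp
      next
        case False
        then have "E p = en2 a p (z p) (G p)" using \<eta>N by (simp add: E_def)
        moreover have "\<bar>N1 (snd p) \<bullet> snd (cfield a e d p (z p) (G p))\<bar> \<le> norm (N1 (snd p)) * norm (snd (cfield a e d p (z p) (G p)))"
          by (rule Cauchy_Schwarz_ineq2)
        moreover have "\<dots> \<le> B1 * (Cf * en2 a p (z p) (G p))"
        proof (intro mult_mono B1(2) S\<Omega> p)
          have "norm (snd (cfield a e d p (z p) (G p))) \<le> norm (cfield a e d p (z p) (G p))" 
            by (simp add: norm_prod_def real_le_rsqrt)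
          also have "\<dots> \<le> Cf * en2 a p (z p) (G p)" using Cf(2)[OF Sb(1)[OF p]] Sb(3)[OF p] by simp
          finally show "norm (snd (cfield a e d p (z p) (G p))) \<le> Cf * en2 a p (z p) (G p)" .
        qed (use B1 in auto)
        ultimately show ?thesis by (simp add: mult.assoc)
      qed
      have "F p \<le> Kw * V3 p + (B1 * Cf) * E p" unfolding F_def using 1 2 by linarith
      also have "\<dots> \<le> C3 * V3 p + C3 * E p"
        using V30[of p] E0[of p] B1(1) Cf(1) cpos(1) by (intro add_mono mult_right_mono) (auto simp: C3_def)
      finally show ?thesis .
    qed
    have mE: "(\<lambda>p. ennreal (E p) * indicator S p) \<in> borel_measurable lborel" by (rule borel_measurable_indicator_on_open[OF So Ec])
    have mX: "(\<lambda>p. ennreal (X2 p) * indicator S p) \<in> borel_measurable lborel" by (rule borel_measurable_indicator_on_open[OF So X2c])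
    have mD: "(\<lambda>p. ennreal (D p) * indicator S p) \<in> borel_measurable lborel" by (rule borel_measurable_indicator_on_open[OF So Dc])
    define IE where "IE = (\<integral>\<^sup>+p\<in>S. ennreal (E p) \<partial>lborel)"
    have "(\<integral>\<^sup>+p\<in>S. ennreal (F2 p) \<partial>lborel) \<le> ennreal C8 * V + ennreal 0 * V"
      unfolding V_def by (rule nn_integral_le_lincomb[OF Vm Vm]) (use cpos V30 F2V in auto)
    then have IX: "(\<integral>\<^sup>+p\<in>S. ennreal (X2 p) \<partial>lborel) \<le> ennreal C8 * V" using cac by simp
    have "IE \<le> ennreal 2 * (\<integral>\<^sup>+p\<in>S. ennreal (X2 p) \<partial>lborel) + ennreal C7 * V"
      unfolding IE_def V_def by (rule nn_integral_le_lincomb[OF mX Vm]) (use cpos V30 X20 E_le in auto)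
    also have "\<dots> \<le> ennreal 2 * (ennreal C8 * V) + ennreal C7 * V" by (intro add_right_mono mult_left_mono IX) simp
    also have "\<dots> = ennreal k1 * V"
      unfolding k1_def using cpos by (simp add: ennreal_mult distrib_right mult.assoc)
    finally have IE: "IE \<le> ennreal k1 * V" .
    have "(\<integral>\<^sup>+p\<in>S. ennreal (F p) \<partial>lborel) \<le> ennreal C3 * V + ennreal C3 * IE"
      unfolding V_def IE_def by (rule nn_integral_le_lincomb[OF Vm mE]) (use cpos V30 E0 F_le in auto)
    also have "\<dots> \<le> ennreal C3 * V + ennreal C3 * (ennreal k1 * V)" by (intro add_left_mono mult_left_mono IE) simp
    also have "\<dots> = ennreal (C3 + C3 * k1) * V"
      using cpos k0 by (simp add: ennreal_mult distrib_right mult.assoc)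
    finally have ID: "(\<integral>\<^sup>+p\<in>S. ennreal (D p) \<partial>lborel) \<le> ennreal (C3 + C3 * k1) * V" using DF by (rule order_trans[rotated])
    have "(\<integral>\<^sup>+p\<in>S. ennreal (C * D p + C2 * E p) \<partial>lborel) \<le> ennreal C * (\<integral>\<^sup>+p\<in>S. ennreal (D p) \<partial>lborel) + ennreal C2 * IE"
      unfolding IE_def by (rule nn_integral_le_lincomb[OF mD mE]) (use cpos C D0 E0 in auto)
    also have "\<dots> \<le> ennreal C * (ennreal (C3 + C3 * k1) * V) + ennreal C2 * (ennreal k1 * V)"
      by (intro add_mono mult_left_mono ID IE) simp_all
    also have "\<dots> = ennreal k2 * V"
      unfolding k2_def using cpos k0 C by (simp add: ennreal_mult distrib_right mult.assoc)
    also have "\<dots> \<le> ennreal (k2 + 1) * V" using k0 by (intro mult_right_mono ennreal_leI) auto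
    finally have fin: "(\<integral>\<^sup>+p\<in>S. ennreal (C * D p + C2 * E p) \<partial>lborel) \<le> ennreal (k2 + 1) * V" .
    show ?thesis
    proof (intro exI[of _ "\<lambda>p. C * D p + C2 * E p"] conjI ballI)
      show "continuous_on S (\<lambda>p. C * D p + C2 * E p)" by (intro continuous_on_add continuous_on_mult continuous_on_const Dc Ec)
      show "ff p powr (2 * a) * (1 / rr p * dens p (egrad z p) + 1 / sqrt (ff p) * (z p)\<^sup>2) \<le> C * D p + C2 * E p" if "p \<in> S" for p
        using s1[OF that] by (simp add: l0_def G_def)
    qed (use fin in \<open>simp add: V_eq\<close>)
  qed
  show ?thesis by (rule that[of "k2 + 1"]) (use k0 main in auto)
qed

text \<open>On r < R one has - R <= u <= 0 <= v <= R. With \<epsilon> R <= 1/2 the two factors of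
  the denominator lie between 1/2 and 1, those under the square roots are at least 1, and the
  exponent is between 0 and 2 b R.\<close>

lemma zeta_bounds:
  assumes p: "p \<in> DD" "rr p < R" and \<epsilon>: "\<epsilon> > 0" "\<epsilon> * R \<le> 1 / 2" and b: "b > 0" and a: "a > 0"
  shows "ff p powr (2 * a) \<le> zeta a b \<epsilon> p" "zeta a b \<epsilon> p \<le> (4 * exp (2 * b * R)) powr (2 * a) * ff p powr (2 * a)"
proof -
  define f where "f = ff p" define u where "u = uu p" define v where "v = vv p" define r where "r = rr p"
  have f: "f > 0" using p by (simp add: f_def DD_def)
  have R: "R > 0" using rr_pos[OF p(1)] p(2) by linarith
  have fR: "sqrt f \<le> R" using ff_le[OF p(1), of R] p(2) R by (simp add: f_def real_le_lsqrt)
  have tr: "tau p < r" "0 \<le> tau p" using ff_pos_norm_less[of p] f by (auto simp: r_def f_def tau_def rr_def)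
  have u: "- R \<le> u" "u \<le> 0" and v: "0 \<le> v" "v \<le> R"
    using tr p(2) by (auto simp: u_def v_def uu_def vv_def r_def)
  have "\<epsilon> * (- R) \<le> \<epsilon> * u" "\<epsilon> * u \<le> 0"
    using mult_left_mono[OF u(1), of \<epsilon>] mult_left_mono[OF u(2), of \<epsilon>] \<epsilon>(1) by simp_all
  then have pu: "1 / 2 \<le> 1 + \<epsilon> * u" "1 + \<epsilon> * u \<le> 1" "1 \<le> 1 - \<epsilon> * u" using \<epsilon>(2) by auto
  have "\<epsilon> * v \<le> \<epsilon> * R" "0 \<le> \<epsilon> * v" using v \<epsilon> by (auto intro: mult_left_mono)
  then have pv: "1 / 2 \<le> 1 - \<epsilon> * v" "1 - \<epsilon> * v \<le> 1" "1 \<le> 1 + \<epsilon> * v" using \<epsilon>(2) by auto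
  define q where "q = (1 + \<epsilon> * u) * (1 - \<epsilon> * v)"
  have q: "1 / 4 \<le> q" "q \<le> 1"
    using mult_mono[of "1 / 2" "1 + \<epsilon> * u" "1 / 2" "1 - \<epsilon> * v"] mult_le_one[of "1 + \<epsilon> * u" "1 - \<epsilon> * v"] pu pv by (auto simp: q_def)
  define g where "g = 2 * b * sqrt f / (sqrt (1 - \<epsilon> * u) * sqrt (1 + \<epsilon> * v))"
  have g: "0 \<le> g" "g \<le> 2 * b * R"
  proof -
    have s: "1 \<le> sqrt (1 - \<epsilon> * u) * sqrt (1 + \<epsilon> * v)"
      using mult_mono[of 1 "sqrt (1 - \<epsilon> * u)" 1 "sqrt (1 + \<epsilon> * v)"] pu pv by simp
    show "0 \<le> g" unfolding g_def using b f s by simp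
    have "g \<le> 2 * b * sqrt f / 1" unfolding g_def using b f s by (intro divide_left_mono) auto
    also have "\<dots> \<le> 2 * b * R" using fR b by simp
    finally show "g \<le> 2 * b * R" .
  qed
  have z: "zeta a b \<epsilon> p = (f / q * exp g) powr (2 * a)"
    by (simp add: zeta_def f_def q_def g_def u_def v_def)
  have "f * 1 \<le> f / q * exp g"
  proof (intro mult_mono)
    show "f \<le> f / q" using f q by (simp add: le_divide_eq mult_left_le)
  qed (use f q g in auto)
  then show "ff p powr (2 * a) \<le> zeta a b \<epsilon> p" unfolding z f_def[symmetric] using f a by (intro powr_mono2) auto
  have "f / q * exp g \<le> (4 * f) * exp (2 * b * R)"
  proof (intro mult_mono)
    show "f / q \<le> 4 * f" using f q by (simp add: divide_le_eq)
  qed (use f q g in auto)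
  also have "\<dots> = (4 * exp (2 * b * R)) * f" by simp
  finally have "(f / q * exp g) powr (2 * a) \<le> ((4 * exp (2 * b * R)) * f) powr (2 * a)"
    using f q a by (intro powr_mono2) auto
  then show "zeta a b \<epsilon> p \<le> (4 * exp (2 * b * R)) powr (2 * a) * ff p powr (2 * a)"
    unfolding z f_def[symmetric] using f by (simp add: powr_mult)
qed

text \<open>K, c1 and c2 express the comparison signs of the hypotheses and may depend only on m and
  n, whereas C is chosen after all data except z. All work is in \<open>carleman_core\<close>; what
  remains is to exchange the weights and to fit the constants.\<close>

theorem theorem3p13:
  shows "\<exists>K c1 c2. K > 0 \<and> c1 > 0 \<and> c2 > 0 \<and>
    (\<forall>(\<Omega>::(real^'n) set) R a b \<epsilon> \<sigma>.
       open \<Omega> \<and> bounded \<Omega> \<and> smooth_boundary \<Omega> \<and>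
       R > 0 \<and> (\<forall>x\<in>\<Omega>. norm x < R) \<and>
       \<epsilon> > 0 \<and> a > 0 \<and> b > 0 \<and>
       a \<ge> (real (CARD('m) + CARD('n)))\<^sup>2 \<and> a \<ge> K * R \<and>
       \<epsilon> \<le> c1 * b \<and> b \<le> c2 / R \<and> \<sigma> > 0
     \<longrightarrow> (\<exists>C>0. \<forall>z :: (real^'m) \<times> (real^'n) \<Rightarrow> real.
          Ck 2 (UNIV \<times> \<Omega>) z \<and> C1_closure (UNIV \<times> \<Omega>) z \<and>
          (\<forall>p \<in> frontier (UNIV \<times> \<Omega>) \<inter> DD. z p = 0)
          \<longrightarrow>
          ennreal (C * \<epsilon>) *
            set_nn_integral lborel ((UNIV \<times> \<Omega>) \<inter> DD)
              (\<lambda>p. ennreal (zeta a b \<epsilon> p * (1 / rr p) *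
                 ((uu p * du z p)\<^sup>2 + (vv p * dv z p)\<^sup>2 + ff p * ang_x z p - ff p * ang_t z p)))
          + ennreal (C * b * a\<^sup>2) *
            set_nn_integral lborel ((UNIV \<times> \<Omega>) \<inter> DD)
              (\<lambda>p. ennreal (zeta a b \<epsilon> p * ff p powr (-1/2) * (z p)\<^sup>2))
          \<le> ennreal (1 / a) *
            set_nn_integral lborel ((UNIV \<times> \<Omega>) \<inter> DD)
              (\<lambda>p. ennreal (zeta a b \<epsilon> p * ff p * (box z p)\<^sup>2))
          + ennreal (a\<^sup>2 * R ^ 3) *
            set_nn_integral lborel ((UNIV \<times> (nbhd \<sigma> (Gamma_plus \<Omega>) \<inter> \<Omega>)) \<inter> DD)
              (\<lambda>p. ennreal (zeta a b \<epsilon> p * ff p powr (-2) * gradt_sq z p))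
          + ennreal (a ^ 4 * R ^ 4) *
            set_nn_integral lborel ((UNIV \<times> (nbhd \<sigma> (Gamma_plus \<Omega>) \<inter> \<Omega>)) \<inter> DD)
              (\<lambda>p. ennreal (zeta a b \<epsilon> p * ff p powr (-3) * (z p)\<^sup>2))))"
\<comment> \<open>With c1 = 1 and c2 = 1/2 the hypotheses give \<epsilon> <= b <= 1 / (2 R), hence
  \<epsilon> R <= 1/2, as the comparison of the weights requires.\<close>
proof (rule exI[of _ "1::real"], rule exI[of _ "1::real"], rule exI[of _ "1 / 2 :: real"], intro conjI allI impI)
  fix \<Omega> :: "(real^'n) set" and R a b \<epsilon> \<sigma> :: real
  assume A: "open \<Omega> \<and> bounded \<Omega> \<and> smooth_boundary \<Omega> \<and>
       R > 0 \<and> (\<forall>x\<in>\<Omega>. norm x < R) \<and>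
       \<epsilon> > 0 \<and> a > 0 \<and> b > 0 \<and>
       a \<ge> (real (CARD('m) + CARD('n)))\<^sup>2 \<and> a \<ge> 1 * R \<and>
       \<epsilon> \<le> 1 * b \<and> b \<le> 1 / 2 / R \<and> \<sigma> > 0"
  then have \<Omega>: "open \<Omega>" "bounded \<Omega>" "smooth_boundary \<Omega>" and R: "R > 0" "\<forall>x\<in>\<Omega>. norm x < R"
    and \<epsilon>: "\<epsilon> > 0" and a0: "a > 0" and b: "b > 0" and \<sigma>: "\<sigma> > 0" by auto
  define S where "S = (UNIV \<times> \<Omega>) \<inter> (DD :: ((real^'m) \<times> (real^'n)) set)"
  define S\<omega> where "S\<omega> = (UNIV \<times> (nbhd \<sigma> (Gamma_plus \<Omega>) \<inter> \<Omega>)) \<inter> (DD :: ((real^'m) \<times> (real^'n)) set)"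
  have SS: "S\<omega> \<subseteq> S" by (auto simp: S_def S\<omega>_def)
  have \<epsilon>R: "\<epsilon> * R \<le> 1 / 2"
  proof -
    have "\<epsilon> \<le> 1 / 2 / R" using A by linarith
    then show ?thesis using R(1) by (simp add: field_simps)
  qed
  \<comment> \<open>Both index types are nonempty, so m + n >= 2 and the lower bound on a gives a >=
    4.\<close>
  have a2: "a \<ge> 2"
  proof -
    have "CARD('m) \<ge> 1" "CARD('n) \<ge> 1" by (simp_all add: Suc_leI)
    then have "(2::real) \<le> real (CARD('m) + CARD('n))" by linarith
    then have "(2::real)\<^sup>2 \<le> (real (CARD('m) + CARD('n)))\<^sup>2" by (intro power_mono) auto
    then show ?thesis using A by simp
  qed
  obtain Cc where Cc: "Cc > 0"
    "\<And>z. \<lbrakk>Ck 2 (UNIV \<times> \<Omega>) z; C1_closure (UNIV \<times> \<Omega>) z; \<forall>p\<in>frontier (UNIV \<times> \<Omega>) \<inter> DD. z p = 0\<rbrakk> \<Longrightarrow>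
      \<exists>\<Phi>. continuous_on S \<Phi> \<and> (\<forall>p\<in>S. ff p powr (2 * a) * (1 / rr p * dens p (egrad z p) + 1 / sqrt (ff p) * (z p)\<^sup>2) \<le> \<Phi> p) \<and>
        (\<integral>\<^sup>+p\<in>S. ennreal (\<Phi> p) \<partial>lborel) \<le> ennreal Cc *
          ((\<integral>\<^sup>+p\<in>S. ennreal (ff p powr (2 * a + 1) * (box z p)\<^sup>2) \<partial>lborel)
           + (\<integral>\<^sup>+p\<in>S\<omega>. ennreal (ff p powr (2 * a - 2) * gradt_sq z p) \<partial>lborel)
           + (\<integral>\<^sup>+p\<in>S\<omega>. ennreal (ff p powr (2 * a - 3) * (z p)\<^sup>2) \<partial>lborel))"
    using carleman_core[OF \<Omega> R a2 \<sigma>, where 'm='m] unfolding S_def S\<omega>_def by blast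
  define Kz where "Kz = (4 * exp (2 * b * R)) powr (2 * a)"
  have Kz: "Kz > 0" by (simp add: Kz_def)
  \<comment> \<open>The smallest of the three coefficients on the right. Dividing it by the total
    constant c5 of the left-hand side, which contains \<epsilon> and b, gives an admissible
    C.\<close>
  define m0 where "m0 = min (1 / a) (min (a\<^sup>2 * R ^ 3) (a ^ 4 * R ^ 4))"
  have m0: "m0 > 0" "m0 \<le> 1 / a" "m0 \<le> a\<^sup>2 * R ^ 3" "m0 \<le> a ^ 4 * R ^ 4"
    using a0 R(1) by (auto simp: m0_def)
  define c5 where "c5 = (\<epsilon> + b * a\<^sup>2) * Kz * Cc"
  have c5: "c5 > 0" unfolding c5_def using \<epsilon> b a0 Kz Cc(1) by (intro mult_pos_pos add_pos_pos) auto
  define C where "C = m0 / c5"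
  have C: "C > 0" using m0 c5 by (simp add: C_def)
  have So: "open S" unfolding S_def by (rule slab_open[OF \<Omega>(1)])
  have Sb: "p \<in> DD" "ff p > 0" "rr p < R" "rr p > 0" if "p \<in> S" for p
    using slab_bounds[OF R(2) that[unfolded S_def]] by auto
  have zl: "ff p powr (2 * a) \<le> zeta a b \<epsilon> p" and zu: "zeta a b \<epsilon> p \<le> Kz * ff p powr (2 * a)" if "p \<in> S" for p
    using zeta_bounds[OF Sb(1,3)[OF that] \<epsilon> \<epsilon>R b a0] by (auto simp: Kz_def)
  show "\<exists>C>0. \<forall>z :: (real^'m) \<times> (real^'n) \<Rightarrow> real.
          Ck 2 (UNIV \<times> \<Omega>) z \<and> C1_closure (UNIV \<times> \<Omega>) z \<and>
          (\<forall>p \<in> frontier (UNIV \<times> \<Omega>) \<inter> DD. z p = 0)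
          \<longrightarrow>
          ennreal (C * \<epsilon>) *
            set_nn_integral lborel ((UNIV \<times> \<Omega>) \<inter> DD)
              (\<lambda>p. ennreal (zeta a b \<epsilon> p * (1 / rr p) *
                 ((uu p * du z p)\<^sup>2 + (vv p * dv z p)\<^sup>2 + ff p * ang_x z p - ff p * ang_t z p)))
          + ennreal (C * b * a\<^sup>2) *
            set_nn_integral lborel ((UNIV \<times> \<Omega>) \<inter> DD)
              (\<lambda>p. ennreal (zeta a b \<epsilon> p * ff p powr (-1/2) * (z p)\<^sup>2))
          \<le> ennreal (1 / a) *
            set_nn_integral lborel ((UNIV \<times> \<Omega>) \<inter> DD)
              (\<lambda>p. ennreal (zeta a b \<epsilon> p * ff p * (box z p)\<^sup>2))
          + ennreal (a\<^sup>2 * R ^ 3) *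
            set_nn_integral lborel ((UNIV \<times> (nbhd \<sigma> (Gamma_plus \<Omega>) \<inter> \<Omega>)) \<inter> DD)
              (\<lambda>p. ennreal (zeta a b \<epsilon> p * ff p powr (-2) * gradt_sq z p))
          + ennreal (a ^ 4 * R ^ 4) *
            set_nn_integral lborel ((UNIV \<times> (nbhd \<sigma> (Gamma_plus \<Omega>) \<inter> \<Omega>)) \<inter> DD)
              (\<lambda>p. ennreal (zeta a b \<epsilon> p * ff p powr (-3) * (z p)\<^sup>2))"
    unfolding S_def[symmetric] S\<omega>_def[symmetric]
  proof (intro exI[of _ C] conjI C allI impI)
    fix z :: "(real^'m) \<times> (real^'n) \<Rightarrow> real"
    assume z: "Ck 2 (UNIV \<times> \<Omega>) z \<and> C1_closure (UNIV \<times> \<Omega>) z \<and> (\<forall>p \<in> frontier (UNIV \<times> \<Omega>) \<inter> DD. z p = 0)"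
    then obtain \<Phi> where \<Phi>: "continuous_on S \<Phi>"
      "\<And>p. p \<in> S \<Longrightarrow> ff p powr (2 * a) * (1 / rr p * dens p (egrad z p) + 1 / sqrt (ff p) * (z p)\<^sup>2) \<le> \<Phi> p"
      "(\<integral>\<^sup>+p\<in>S. ennreal (\<Phi> p) \<partial>lborel) \<le> ennreal Cc *
          ((\<integral>\<^sup>+p\<in>S. ennreal (ff p powr (2 * a + 1) * (box z p)\<^sup>2) \<partial>lborel)
           + (\<integral>\<^sup>+p\<in>S\<omega>. ennreal (ff p powr (2 * a - 2) * gradt_sq z p) \<partial>lborel)
           + (\<integral>\<^sup>+p\<in>S\<omega>. ennreal (ff p powr (2 * a - 3) * (z p)\<^sup>2) \<partial>lborel))"
      using Cc(2)[of z] by blast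
    have diff: "z differentiable (at p)" if "p \<in> S" for p using z that by (auto simp: S_def numeral_2_eq_2)
    have dn: "(uu p * du z p)\<^sup>2 + (vv p * dv z p)\<^sup>2 + ff p * ang_x z p - ff p * ang_t z p = dens p (egrad z p)" if "p \<in> S" for p
      unfolding dens_def du_def dv_def ang_x_def ang_t_def gradt_sq_eq[OF diff[OF that]] by (simp add: algebra_simps)
    have d0: "0 \<le> dens p (egrad z p)" if "p \<in> S" for p by (rule dens_bound(1)[OF Sb(1,3)[OF that]])
    define I where "I = (\<integral>\<^sup>+p\<in>S. ennreal (\<Phi> p) \<partial>lborel)"
    have m: "(\<lambda>p. ennreal (\<Phi> p) * indicator S p) \<in> borel_measurable lborel"
      by (rule borel_measurable_indicator_on_open[OF So \<Phi>(1)])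
    have sp: "ff p powr (-1/2) = 1 / sqrt (ff p)" if "p \<in> S" for p
      using Sb(2)[OF that] by (simp add: powr_minus_divide powr_half_sqrt)
    define x1 where "x1 p = 1 / rr p * dens p (egrad z p)" for p
    define x2 where "x2 p = 1 / sqrt (ff p) * (z p)\<^sup>2" for p
    have x0: "0 \<le> x1 p" "0 \<le> x2 p" if "p \<in> S" for p using d0[OF that] Sb[OF that] by (simp_all add: x1_def x2_def)
    have \<Phi>0: "0 \<le> \<Phi> p" if "p \<in> S" for p
      using \<Phi>(2)[OF that] x0[OF that] unfolding x1_def[symmetric] x2_def[symmetric]
      by (meson add_nonneg_nonneg mult_nonneg_nonneg order_trans powr_ge_zero)
    have le: "zeta a b \<epsilon> p * x1 p \<le> Kz * \<Phi> p" "zeta a b \<epsilon> p * x2 p \<le> Kz * \<Phi> p" if p: "p \<in> S" for p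
    proof -
      have "zeta a b \<epsilon> p * y \<le> Kz * \<Phi> p" if y: "0 \<le> y" "y \<le> x1 p + x2 p" for y
      proof -
        have "zeta a b \<epsilon> p * y \<le> (Kz * ff p powr (2 * a)) * (x1 p + x2 p)"
          using zu[OF p] y Kz by (intro mult_mono) auto
        also have "\<dots> = Kz * (ff p powr (2 * a) * (x1 p + x2 p))" by simp
        also have "\<dots> \<le> Kz * \<Phi> p" using \<Phi>(2)[OF p] Kz unfolding x1_def x2_def by (intro mult_left_mono) auto
        finally show ?thesis .
      qed
      then show "zeta a b \<epsilon> p * x1 p \<le> Kz * \<Phi> p" "zeta a b \<epsilon> p * x2 p \<le> Kz * \<Phi> p" using x0[OF p] by auto
    qed
    have "(\<integral>\<^sup>+p\<in>S. ennreal (zeta a b \<epsilon> p * (1 / rr p) *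
        ((uu p * du z p)\<^sup>2 + (vv p * dv z p)\<^sup>2 + ff p * ang_x z p - ff p * ang_t z p)) \<partial>lborel) \<le> ennreal Kz * I + ennreal 0 * I"
      unfolding I_def
    proof (rule nn_integral_le_lincomb[OF m m])
      fix p assume p: "p \<in> S"
      show "zeta a b \<epsilon> p * (1 / rr p) * ((uu p * du z p)\<^sup>2 + (vv p * dv z p)\<^sup>2 + ff p * ang_x z p - ff p * ang_t z p)
          \<le> Kz * \<Phi> p + 0 * \<Phi> p"
        unfolding dn[OF p] using le(1)[OF p] by (simp add: x1_def)
    qed (use Kz \<Phi>0 in auto)
    then have I1: "(\<integral>\<^sup>+p\<in>S. ennreal (zeta a b \<epsilon> p * (1 / rr p) *
        ((uu p * du z p)\<^sup>2 + (vv p * dv z p)\<^sup>2 + ff p * ang_x z p - ff p * ang_t z p)) \<partial>lborel) \<le> ennreal Kz * I" by simp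
    have "(\<integral>\<^sup>+p\<in>S. ennreal (zeta a b \<epsilon> p * ff p powr (-1/2) * (z p)\<^sup>2) \<partial>lborel) \<le> ennreal Kz * I + ennreal 0 * I"
      unfolding I_def
    proof (rule nn_integral_le_lincomb[OF m m])
      fix p assume p: "p \<in> S"
      show "zeta a b \<epsilon> p * ff p powr (-1/2) * (z p)\<^sup>2 \<le> Kz * \<Phi> p + 0 * \<Phi> p"
        unfolding sp[OF p] using le(2)[OF p] by (simp add: x2_def)
    qed (use Kz \<Phi>0 in auto)
    then have I2: "(\<integral>\<^sup>+p\<in>S. ennreal (zeta a b \<epsilon> p * ff p powr (-1/2) * (z p)\<^sup>2) \<partial>lborel) \<le> ennreal Kz * I" by simp
    define V1 where "V1 = (\<integral>\<^sup>+p\<in>S. ennreal (ff p powr (2 * a + 1) * (box z p)\<^sup>2) \<partial>lborel)"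
    define V2 where "V2 = (\<integral>\<^sup>+p\<in>S\<omega>. ennreal (ff p powr (2 * a - 2) * gradt_sq z p) \<partial>lborel)"
    define V3 where "V3 = (\<integral>\<^sup>+p\<in>S\<omega>. ennreal (ff p powr (2 * a - 3) * (z p)\<^sup>2) \<partial>lborel)"
    have "ennreal (C * \<epsilon>) * (\<integral>\<^sup>+p\<in>S. ennreal (zeta a b \<epsilon> p * (1 / rr p) *
          ((uu p * du z p)\<^sup>2 + (vv p * dv z p)\<^sup>2 + ff p * ang_x z p - ff p * ang_t z p)) \<partial>lborel)
        + ennreal (C * b * a\<^sup>2) * (\<integral>\<^sup>+p\<in>S. ennreal (zeta a b \<epsilon> p * ff p powr (-1/2) * (z p)\<^sup>2) \<partial>lborel)
       \<le> ennreal (C * \<epsilon>) * (ennreal Kz * I) + ennreal (C * b * a\<^sup>2) * (ennreal Kz * I)"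
      by (intro add_mono mult_left_mono I1 I2) simp_all
    also have "\<dots> = ennreal (C * (\<epsilon> + b * a\<^sup>2) * Kz) * I"
    proof -
      have "ennreal (C * (\<epsilon> + b * a\<^sup>2) * Kz) = ennreal (C * \<epsilon> * Kz) + ennreal (C * b * a\<^sup>2 * Kz)"
        using C \<epsilon> b Kz by (subst ennreal_plus[symmetric]) (auto simp: algebra_simps)
      also have "\<dots> = ennreal (C * \<epsilon>) * ennreal Kz + ennreal (C * b * a\<^sup>2) * ennreal Kz"
        using C \<epsilon> b Kz by (simp add: ennreal_mult)
      finally show ?thesis by (simp add: distrib_right mult.assoc)
    qed
    also have "\<dots> \<le> ennreal (C * (\<epsilon> + b * a\<^sup>2) * Kz) * (ennreal Cc * (V1 + V2 + V3))"
      unfolding V1_def V2_def V3_def I_def by (intro mult_left_mono \<Phi>(3)) simp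
    also have "\<dots> = ennreal m0 * (V1 + V2 + V3)"
    proof -
      have "ennreal (C * (\<epsilon> + b * a\<^sup>2) * Kz) * ennreal Cc = ennreal (C * (\<epsilon> + b * a\<^sup>2) * Kz * Cc)"
        using C \<epsilon> b Kz Cc(1) by (intro ennreal_mult[symmetric]) auto
      also have "C * (\<epsilon> + b * a\<^sup>2) * Kz * Cc = C * c5" by (simp add: c5_def)
      also have "\<dots> = m0" using c5 by (simp add: C_def)
      finally show ?thesis by (simp add: mult.assoc[symmetric])
    qed
    also have "\<dots> = ennreal m0 * V1 + ennreal m0 * V2 + ennreal m0 * V3" by (simp add: distrib_left)
    also have "\<dots> \<le> ennreal (1 / a) * (\<integral>\<^sup>+p\<in>S. ennreal (zeta a b \<epsilon> p * ff p * (box z p)\<^sup>2) \<partial>lborel)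
        + ennreal (a\<^sup>2 * R ^ 3) * (\<integral>\<^sup>+p\<in>S\<omega>. ennreal (zeta a b \<epsilon> p * ff p powr (-2) * gradt_sq z p) \<partial>lborel)
        + ennreal (a ^ 4 * R ^ 4) * (\<integral>\<^sup>+p\<in>S\<omega>. ennreal (zeta a b \<epsilon> p * ff p powr (-3) * (z p)\<^sup>2) \<partial>lborel)"
    proof (intro add_mono mult_mono ennreal_leI m0(2-4))
      have "ff p powr (2 * a + 1) * (box z p)\<^sup>2 \<le> zeta a b \<epsilon> p * ff p * (box z p)\<^sup>2" if "p \<in> S" for p
        using zl[OF that] Sb(2)[OF that] by (intro mult_right_mono) (auto simp: powr_add)
      then show "V1 \<le> (\<integral>\<^sup>+p\<in>S. ennreal (zeta a b \<epsilon> p * ff p * (box z p)\<^sup>2) \<partial>lborel)"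
        unfolding V1_def by (intro nn_integral_mono) (auto simp: indicator_def intro!: ennreal_leI)
      have "ff p powr (2 * a - 2) * gradt_sq z p \<le> zeta a b \<epsilon> p * ff p powr (-2) * gradt_sq z p" if "p \<in> S\<omega>" for p
      proof (intro mult_right_mono)
        have "ff p powr (2 * a - 2) = ff p powr (2 * a) * ff p powr (-2)" by (simp add: powr_add[symmetric])
        then show "ff p powr (2 * a - 2) \<le> zeta a b \<epsilon> p * ff p powr (-2)"
          using zl[of p] that SS by (auto intro!: mult_right_mono)
      qed (simp add: gradt_sq_def sum_nonneg)
      then show "V2 \<le> (\<integral>\<^sup>+p\<in>S\<omega>. ennreal (zeta a b \<epsilon> p * ff p powr (-2) * gradt_sq z p) \<partial>lborel)"
        unfolding V2_def by (intro nn_integral_mono) (auto simp: indicator_def intro!: ennreal_leI)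
      have "ff p powr (2 * a - 3) * (z p)\<^sup>2 \<le> zeta a b \<epsilon> p * ff p powr (-3) * (z p)\<^sup>2" if "p \<in> S\<omega>" for p
      proof (intro mult_right_mono)
        have "ff p powr (2 * a - 3) = ff p powr (2 * a) * ff p powr (-3)" by (simp add: powr_add[symmetric])
        then show "ff p powr (2 * a - 3) \<le> zeta a b \<epsilon> p * ff p powr (-3)"
          using zl[of p] that SS by (auto intro!: mult_right_mono)
      qed simp
      then show "V3 \<le> (\<integral>\<^sup>+p\<in>S\<omega>. ennreal (zeta a b \<epsilon> p * ff p powr (-3) * (z p)\<^sup>2) \<partial>lborel)"
        unfolding V3_def by (intro nn_integral_mono) (auto simp: indicator_def intro!: ennreal_leI)
    qed simp_all
    finally show "ennreal (C * \<epsilon>) * (\<integral>\<^sup>+p\<in>S. ennreal (zeta a b \<epsilon> p * (1 / rr p) *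
          ((uu p * du z p)\<^sup>2 + (vv p * dv z p)\<^sup>2 + ff p * ang_x z p - ff p * ang_t z p)) \<partial>lborel)
        + ennreal (C * b * a\<^sup>2) * (\<integral>\<^sup>+p\<in>S. ennreal (zeta a b \<epsilon> p * ff p powr (-1/2) * (z p)\<^sup>2) \<partial>lborel)
       \<le> ennreal (1 / a) * (\<integral>\<^sup>+p\<in>S. ennreal (zeta a b \<epsilon> p * ff p * (box z p)\<^sup>2) \<partial>lborel)
        + ennreal (a\<^sup>2 * R ^ 3) * (\<integral>\<^sup>+p\<in>S\<omega>. ennreal (zeta a b \<epsilon> p * ff p powr (-2) * gradt_sq z p) \<partial>lborel)
        + ennreal (a ^ 4 * R ^ 4) * (\<integral>\<^sup>+p\<in>S\<omega>. ennreal (zeta a b \<epsilon> p * ff p powr (-3) * (z p)\<^sup>2) \<partial>lborel)" .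
  qed
qed simp_all

end
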